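(* Let $R$ be a commutative Noetherian ring with non-zero identity, let $\mathcal S$ be a Serre subcategory of the category of $R$-modules, and let $M$ be a finite $R$-module of finite projective dimension. Let $N$ be a finite $R$-module, $\mathfrak a$ an ideal of $R$, and $n\geqslant\operatorname{pd} M$ an integer such that $H^{i}_{\mathfrak a}(M,N)$ belongs to $\mathcal S$ for all $i>n$. If $\mathfrak b$ is an ideal of $R$ such that $H^{n}_{\mathfrak a}(M,N/\mathfrak bN)$ belongs to $\mathcal S$, then the module $H^{n}_{\mathfrak a}(M,N)/\mathfrak b H^{n}_{\mathfrak a}(M,N)$ belongs to $\mathcal S$.
   Context: "Finite" module means finitely generated module. For an ideal $\mathfrak a$ of $R$ and $R$-modules $M,N$, the $i$-th generalized local cohomology module is $H^{i}_{\mathfrak a}(M,N)=\varinjlim_{k}\operatorname{Ext}^{i}_{R}(M/\mathfrak a^{k}M,N)$. A Serre subcategory of the category of $R$-modules is a (nonempty) class of modules closed under taking submodules, quotients and extensions. $\operatorname{pd} M$ is the projective dimension of $M$. *)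

theory Defs
  imports "HOL-Algebra.Module" "HOL-Algebra.Ideal_Product" "HOL-Algebra.Ring_Divisibility"
    "HOL-Library.Extended_Nat" "HOL-Library.Equipollence"
begin

text \<open>
  HOL has no type of all \<open>R\<close>-modules. ``The category of \<open>R\<close>-modules'' is therefore rendered as the
  modules whose carrier lies in a type \<open>'u\<close>, where \<open>'u\<close> is infinite and at least as large as the
  carrier of \<open>R\<close>. Up to isomorphism these modules are closed under submodules, quotients,
  extensions and free covers, and they include every finitely generated module. So a Serre
  subcategory of the full category restricts to one of the modules over \<open>'u\<close>, and conversely the
  closure under isomorphism of a Serre subcategory of the modules over \<open>'u\<close> is one of the full
  category; likewise projectivity may be tested on, and projective resolutions may be taken from,
  modules over \<open>'u\<close>. Constants that range over modules on \<open>'u\<close> without having one among their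
  arguments take a parameter of type \<open>'u itself\<close>.

  Records of type \<open>module\<close> carry \<open>mult\<close> and \<open>one\<close> fields, which are irrelevant for modules.
\<close>

section \<open>Modules\<close>

definition module_homs ::
  "('r, 's) ring_scheme \<Rightarrow> ('r, 'a) module \<Rightarrow> ('r, 'b) module \<Rightarrow> ('a \<Rightarrow> 'b) set" where
  "module_homs R A B = {f \<in> carrier A \<rightarrow>\<^sub>E carrier B.
     (\<forall>x \<in> carrier A. \<forall>y \<in> carrier A. f (x \<oplus>\<^bsub>A\<^esub> y) = f x \<oplus>\<^bsub>B\<^esub> f y) \<and>
     (\<forall>r \<in> carrier R. \<forall>x \<in> carrier A. f (r \<odot>\<^bsub>A\<^esub> x) = r \<odot>\<^bsub>B\<^esub> f x)}"

definition module_kernel ::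
  "('r, 'a) module \<Rightarrow> ('r, 'b) module \<Rightarrow> ('a \<Rightarrow> 'b) \<Rightarrow> 'a set" where
  "module_kernel A B f = {x \<in> carrier A. f x = \<zero>\<^bsub>B\<^esub>}"

definition hom_module ::
  "('r, 's) ring_scheme \<Rightarrow> ('r, 'a) module \<Rightarrow> ('r, 'b) module \<Rightarrow> ('r, 'a \<Rightarrow> 'b) module" where
  "hom_module R A B =
    \<lparr>carrier = module_homs R A B, monoid.mult = undefined, one = undefined,
     ring.zero = (\<lambda>x \<in> carrier A. \<zero>\<^bsub>B\<^esub>),
     add = (\<lambda>f g. \<lambda>x \<in> carrier A. f x \<oplus>\<^bsub>B\<^esub> g x),
     smult = (\<lambda>r f. \<lambda>x \<in> carrier A. r \<odot>\<^bsub>B\<^esub> f x)\<rparr>"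

definition quot_module :: "('r, 'a) module \<Rightarrow> 'a set \<Rightarrow> ('r, 'a set) module" where
  "quot_module M H =
    \<lparr>carrier = a_rcosets\<^bsub>M\<^esub> H, monoid.mult = undefined, one = undefined,
     ring.zero = H,
     add = set_add M,
     smult = (\<lambda>r X. \<Union>x \<in> X. H +>\<^bsub>M\<^esub> (r \<odot>\<^bsub>M\<^esub> x))\<rparr>"

definition submodule_span ::
  "('r, 's) ring_scheme \<Rightarrow> ('r, 'a) module \<Rightarrow> 'a set \<Rightarrow> 'a set" where
  "submodule_span R M A = \<Inter>{H. submodule H R M \<and> A \<subseteq> H}"

definition finite_module :: "('r, 's) ring_scheme \<Rightarrow> ('r, 'a) module \<Rightarrow> bool" where
  "finite_module R M \<longleftrightarrow> module R M \<and>
    (\<exists>A. finite A \<and> A \<subseteq> carrier M \<and> submodule_span R M A = carrier M)"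

definition ideal_smult ::
  "('r, 's) ring_scheme \<Rightarrow> 'r set \<Rightarrow> ('r, 'a) module \<Rightarrow> 'a set" where
  "ideal_smult R I M = submodule_span R M {a \<odot>\<^bsub>M\<^esub> x | a x. a \<in> I \<and> x \<in> carrier M}"

abbreviation quot_by_ideal ::
  "('r, 's) ring_scheme \<Rightarrow> ('r, 'a) module \<Rightarrow> 'r set \<Rightarrow> ('r, 'a set) module" where
  "quot_by_ideal R M I \<equiv> quot_module M (ideal_smult R I M)"

section \<open>Serre subcategories\<close>

text \<open>
  Submodules and quotients are taken up to isomorphism, that is, as sources of injective and
  targets of surjective homomorphisms; so a Serre subcategory is closed under isomorphism.
\<close>

definition serre_subcategory :: "('r, 's) ring_scheme \<Rightarrow> ('r, 'u) module set \<Rightarrow> bool" where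
  "serre_subcategory R S \<longleftrightarrow>
    S \<noteq> {} \<and> (\<forall>X \<in> S. module R X) \<and>
    (\<forall>X Y f. X \<in> S \<and> module R Y \<and> f \<in> module_homs R Y X \<and> inj_on f (carrier Y) \<longrightarrow> Y \<in> S) \<and>
    (\<forall>X Y f. X \<in> S \<and> module R Y \<and> f \<in> module_homs R X Y \<and> f ` carrier X = carrier Y \<longrightarrow> Y \<in> S) \<and>
    (\<forall>X Y Z f g. X \<in> S \<and> Z \<in> S \<and> module R Y \<and>
       f \<in> module_homs R X Y \<and> inj_on f (carrier X) \<and>
       g \<in> module_homs R Y Z \<and> g ` carrier Y = carrier Z \<and>
       f ` carrier X = module_kernel Y Z g \<longrightarrow> Y \<in> S)"

text \<open>The module \<open>H\<close> may have its carrier in any type, so membership in \<open>S\<close> means being isomorphic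
  to a member of \<open>S\<close>.\<close>

definition belongs_to ::
  "('r, 's) ring_scheme \<Rightarrow> ('r, 'a) module \<Rightarrow> ('r, 'u) module set \<Rightarrow> bool" where
  "belongs_to R H S \<longleftrightarrow>
    (\<exists>X \<in> S. \<exists>f \<in> module_homs R X H. bij_betw f (carrier X) (carrier H))"

section \<open>Projective resolutions and projective dimension\<close>

definition projective_module :: "('r, 's) ring_scheme \<Rightarrow> ('r, 'u) module \<Rightarrow> bool" where
  "projective_module R P \<longleftrightarrow> module R P \<and>
    (\<forall>(A :: ('r, 'u) module) (B :: ('r, 'u) module) g f.
       module R A \<and> module R B \<and> g \<in> module_homs R A B \<and> g ` carrier A = carrier B \<and>
       f \<in> module_homs R P B \<longrightarrow>
       (\<exists>h \<in> module_homs R P A. \<forall>x \<in> carrier P. g (h x) = f x))"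

text \<open>\<open>\<dots> \<rightarrow> P 2 \<rightarrow> P 1 \<rightarrow> P 0 \<rightarrow> L \<rightarrow> 0\<close>, where \<open>d i : P (i + 1) \<rightarrow> P i\<close> and \<open>e : P 0 \<rightarrow> L\<close>.\<close>

definition projective_resolution ::
  "('r, 's) ring_scheme \<Rightarrow> ('r, 'a) module \<Rightarrow>
    (nat \<Rightarrow> ('r, 'u) module) \<Rightarrow> (nat \<Rightarrow> 'u \<Rightarrow> 'u) \<Rightarrow> ('u \<Rightarrow> 'a) \<Rightarrow> bool" where
  "projective_resolution R L P d e \<longleftrightarrow>
    (\<forall>i. projective_module R (P i)) \<and>
    (\<forall>i. d i \<in> module_homs R (P (Suc i)) (P i)) \<and>
    e \<in> module_homs R (P 0) L \<and>
    e ` carrier (P 0) = carrier L \<and>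
    d 0 ` carrier (P (Suc 0)) = module_kernel (P 0) L e \<and>
    (\<forall>i. d (Suc i) ` carrier (P (Suc (Suc i))) = module_kernel (P (Suc i)) (P i) (d i))"

text \<open>The infimum of the empty set is \<open>\<infinity>\<close>. The zero module gets the value \<open>0\<close>.\<close>

definition projective_dimension ::
  "'u itself \<Rightarrow> ('r, 's) ring_scheme \<Rightarrow> ('r, 'a) module \<Rightarrow> enat" where
  "projective_dimension U R M =
    Inf {enat n | n. \<exists>(P :: nat \<Rightarrow> ('r, 'u) module) d e.
      projective_resolution R M P d e \<and> (\<forall>i > n. carrier (P i) = {\<zero>\<^bsub>P i\<^esub>})}"

section \<open>Ext\<close>

text \<open>\<open>Ext\<close> is computed from a fixed but arbitrary projective resolution of its first argument.\<close>

definition chosen_resolution ::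
  "'u itself \<Rightarrow> ('r, 's) ring_scheme \<Rightarrow> ('r, 'a) module \<Rightarrow>
    (nat \<Rightarrow> ('r, 'u) module) \<times> (nat \<Rightarrow> 'u \<Rightarrow> 'u) \<times> ('u \<Rightarrow> 'a)" where
  "chosen_resolution U R L = (SOME (P, d, e). projective_resolution R L P d e)"

definition res_module ::
  "'u itself \<Rightarrow> ('r, 's) ring_scheme \<Rightarrow> ('r, 'a) module \<Rightarrow> nat \<Rightarrow> ('r, 'u) module" where
  "res_module U R L = fst (chosen_resolution U R L)"

definition res_diff ::
  "'u itself \<Rightarrow> ('r, 's) ring_scheme \<Rightarrow> ('r, 'a) module \<Rightarrow> nat \<Rightarrow> 'u \<Rightarrow> 'u" where
  "res_diff U R L = fst (snd (chosen_resolution U R L))"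

definition res_augmentation ::
  "'u itself \<Rightarrow> ('r, 's) ring_scheme \<Rightarrow> ('r, 'a) module \<Rightarrow> 'u \<Rightarrow> 'a" where
  "res_augmentation U R L = snd (snd (chosen_resolution U R L))"

definition ext_cocycles ::
  "'u itself \<Rightarrow> ('r, 's) ring_scheme \<Rightarrow> nat \<Rightarrow> ('r, 'a) module \<Rightarrow> ('r, 'b) module \<Rightarrow>
    ('r, 'u \<Rightarrow> 'b) module" where
  "ext_cocycles U R i L N = (hom_module R (res_module U R L i) N)
    \<lparr>carrier := {\<phi> \<in> module_homs R (res_module U R L i) N.
       \<forall>x \<in> carrier (res_module U R L (Suc i)). \<phi> (res_diff U R L i x) = \<zero>\<^bsub>N\<^esub>}\<rparr>"

fun ext_coboundaries ::
  "'u itself \<Rightarrow> ('r, 's) ring_scheme \<Rightarrow> nat \<Rightarrow> ('r, 'a) module \<Rightarrow> ('r, 'b) module \<Rightarrow>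
    ('u \<Rightarrow> 'b) set" where
  "ext_coboundaries U R 0 L N = {\<lambda>x \<in> carrier (res_module U R L 0). \<zero>\<^bsub>N\<^esub>}"
| "ext_coboundaries U R (Suc j) L N =
    (\<lambda>\<psi>. compose (carrier (res_module U R L (Suc j))) \<psi> (res_diff U R L j)) `
      module_homs R (res_module U R L j) N"

definition Ext ::
  "'u itself \<Rightarrow> ('r, 's) ring_scheme \<Rightarrow> nat \<Rightarrow> ('r, 'a) module \<Rightarrow> ('r, 'b) module \<Rightarrow>
    ('r, ('u \<Rightarrow> 'b) set) module" where
  "Ext U R i L N = quot_module (ext_cocycles U R i L N) (ext_coboundaries U R i L N)"

definition resolution_lift ::
  "'u itself \<Rightarrow> ('r, 's) ring_scheme \<Rightarrow> ('r, 'a) module \<Rightarrow> ('r, 'c) module \<Rightarrow>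
    ('a \<Rightarrow> 'c) \<Rightarrow> (nat \<Rightarrow> 'u \<Rightarrow> 'u) \<Rightarrow> bool" where
  "resolution_lift U R L L' f F \<longleftrightarrow>
    (\<forall>i. F i \<in> module_homs R (res_module U R L i) (res_module U R L' i)) \<and>
    (\<forall>x \<in> carrier (res_module U R L 0).
       res_augmentation U R L' (F 0 x) = f (res_augmentation U R L x)) \<and>
    (\<forall>i. \<forall>x \<in> carrier (res_module U R L (Suc i)).
       res_diff U R L' i (F (Suc i) x) = F i (res_diff U R L i x))"

text \<open>The map \<open>Ext U R i L' N \<rightarrow> Ext U R i L N\<close> induced by \<open>f : L \<rightarrow> L'\<close>; it does not depend on
  the choice of the lift.\<close>

definition Ext_map ::
  "'u itself \<Rightarrow> ('r, 's) ring_scheme \<Rightarrow> nat \<Rightarrow> ('r, 'a) module \<Rightarrow> ('r, 'c) module \<Rightarrow>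
    ('r, 'b) module \<Rightarrow> ('a \<Rightarrow> 'c) \<Rightarrow> ('u \<Rightarrow> 'b) set \<Rightarrow> ('u \<Rightarrow> 'b) set" where
  "Ext_map U R i L L' N f = (let F = (SOME F. resolution_lift U R L L' f F) in
    (\<lambda>X \<in> carrier (Ext U R i L' N). \<Union>\<phi> \<in> X.
       ext_coboundaries U R i L N +>\<^bsub>ext_cocycles U R i L N\<^esub>
         compose (carrier (res_module U R L i)) \<phi> (F i)))"

section \<open>Generalized local cohomology\<close>

text \<open>Direct limit of a system \<open>t k l : D k \<rightarrow> D l\<close> (\<open>k \<le> l\<close>), as the disjoint union of the
  \<open>D k\<close> modulo eventual equality.\<close>

definition direct_limit_rel ::
  "(nat \<Rightarrow> ('r, 'a) module) \<Rightarrow> (nat \<Rightarrow> nat \<Rightarrow> 'a \<Rightarrow> 'a) \<Rightarrow> ((nat \<times> 'a) \<times> (nat \<times> 'a)) set" where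
  "direct_limit_rel D t = {((k, x), (l, y)) | k x l y.
     x \<in> carrier (D k) \<and> y \<in> carrier (D l) \<and> (\<exists>m \<ge> max k l. t k m x = t l m y)}"

definition direct_limit ::
  "(nat \<Rightarrow> ('r, 'a) module) \<Rightarrow> (nat \<Rightarrow> nat \<Rightarrow> 'a \<Rightarrow> 'a) \<Rightarrow> ('r, (nat \<times> 'a) set) module" where
  "direct_limit D t =
    \<lparr>carrier = (SIGMA k:UNIV. carrier (D k)) // direct_limit_rel D t,
     monoid.mult = undefined, one = undefined,
     ring.zero = direct_limit_rel D t `` {(0, \<zero>\<^bsub>D 0\<^esub>)},
     add = (\<lambda>X Y. \<Union>(k, x) \<in> X. \<Union>(l, y) \<in> Y.
       direct_limit_rel D t `` {(max k l, t k (max k l) x \<oplus>\<^bsub>D (max k l)\<^esub> t l (max k l) y)}),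
     smult = (\<lambda>r X. \<Union>(k, x) \<in> X. direct_limit_rel D t `` {(k, r \<odot>\<^bsub>D k\<^esub> x)})\<rparr>"

definition quot_by_power ::
  "('r, 's) ring_scheme \<Rightarrow> 'r set \<Rightarrow> ('r, 'a) module \<Rightarrow> nat \<Rightarrow> ('r, 'a set) module" where
  "quot_by_power R \<aa> M k = quot_by_ideal R M (\<aa> [^]\<^bsub>ideals_set R\<^esub> k)"

text \<open>The canonical projection from \<open>M / \<aa>\<^sup>l M\<close> to \<open>M / \<aa>\<^sup>k M\<close> for \<open>k \<le> l\<close>.\<close>

definition power_projection ::
  "('r, 's) ring_scheme \<Rightarrow> 'r set \<Rightarrow> ('r, 'a) module \<Rightarrow> nat \<Rightarrow> nat \<Rightarrow> 'a set \<Rightarrow> 'a set" where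
  "power_projection R \<aa> M l k = (\<lambda>X \<in> carrier (quot_by_power R \<aa> M l).
     \<Union>x \<in> X. ideal_smult R (\<aa> [^]\<^bsub>ideals_set R\<^esub> k) M +>\<^bsub>M\<^esub> x)"

definition gen_local_cohomology ::
  "'u itself \<Rightarrow> ('r, 's) ring_scheme \<Rightarrow> 'r set \<Rightarrow> nat \<Rightarrow> ('r, 'a) module \<Rightarrow> ('r, 'b) module \<Rightarrow>
    ('r, (nat \<times> ('u \<Rightarrow> 'b) set) set) module" where
  "gen_local_cohomology U R \<aa> i M N = direct_limit
     (\<lambda>k. Ext U R i (quot_by_power R \<aa> M k) N)
     (\<lambda>k l. Ext_map U R i (quot_by_power R \<aa> M l) (quot_by_power R \<aa> M k) N
        (power_projection R \<aa> M l k))"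

end

theory Submission
  imports Defs
begin

text \<open>
  Write \<open>H\<^sup>i(L)\<close> for the generalized local cohomology of \<open>M\<close> with values in \<open>L\<close>. A class in \<open>H\<^sup>i(L)\<close>
  is represented by a cocycle \<open>P\<^sub>i \<rightarrow> L\<close>, where \<open>P\<close> resolves some \<open>M / \<aa>\<^sup>k M\<close>, and it is zero if and only
  if it becomes a coboundary after pulling back to a resolution of some \<open>M / \<aa>\<^sup>l M\<close> with \<open>l \<ge> k\<close>. Since
  the \<open>P\<^sub>i\<close> are projective, a short exact sequence \<open>0 \<rightarrow> K \<rightarrow> A \<rightarrow> B \<rightarrow> 0\<close> makes
  \<open>H\<^sup>i(K) \<rightarrow> H\<^sup>i(A) \<rightarrow> H\<^sup>i(B) \<rightarrow> H\<^sup>i\<^sup>+\<^sup>1(K)\<close> exact, so two of these memberships in \<open>S\<close> imply a third one: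
  that is \<open>in_S_middle\<close> and \<open>in_S_right\<close>.

  First, there is a degree above which \<open>H\<^sup>i\<close> vanishes on all modules (\<open>vanishing\<close>). For the constant
  system \<open>M\<close> in place of \<open>M / \<aa>\<^sup>k M\<close> this is the finiteness of the projective dimension. If it holds for
  a system \<open>M / W\<^sub>k\<close>, then it holds one degree later for \<open>M / (W\<^sub>k + x\<^sup>k M)\<close>: the cone of \<open>x\<^sup>k\<close> on a resolution
  of \<open>M / W\<^sub>k\<close> differs from a resolution of that quotient only by the homology \<open>{z. x\<^sup>k z = 0}\<close> in degree
  one, and the transition maps between these torsion modules, which multiply by powers of \<open>x\<close>, are
  eventually zero by the Noetherian property (\<open>eventually_null_step\<close>). Applying this to generators
  \<open>x\<^sub>1, \<dots>, x\<^sub>r\<close> of \<open>\<aa>\<close> gives a system that is cofinal with \<open>M / \<aa>\<^sup>k M\<close>.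

  Secondly, \<open>H\<^sup>i(L) \<in> S\<close> for all \<open>i > n\<close> and all finitely generated \<open>L\<close> that are killed by the
  annihilator of \<open>N\<close> (\<open>all_good_above\<close>). This is proved by descending induction on \<open>i\<close>, starting from
  the vanishing. If it holds for \<open>i + 1\<close>, then quotients of \<open>N\<close> are good in degree \<open>i\<close>. A bad module has a bad
  quotient \<open>A\<close> all of whose proper quotients are good, and then every \<open>r \<in> R\<close> acts on \<open>A\<close> as zero or
  injectively, since otherwise \<open>rA\<close> and \<open>A / rA\<close> are good. So \<open>A\<close> is torsion-free over \<open>R / \<pp>\<close> for the
  prime \<open>\<pp> = Ann A\<close>, which contains \<open>Ann N\<close>; hence there is a nonzero map \<open>N \<rightarrow> A\<close>. Its image \<open>I\<close> is
  good as a quotient of \<open>N\<close>, and \<open>A / I\<close> is good, so that \<open>A\<close> is good after all.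

  Finally, let \<open>Q\<close> be a direct sum of copies of \<open>N\<close> and \<open>g : Q \<rightarrow> N\<close> the map given by generators of \<open>\<bb>\<close>,
  with image \<open>\<bb>N\<close> and kernel \<open>K\<close>. The image of \<open>H\<^sup>n(Q)\<close> in \<open>H\<^sup>n(N)\<close> lies in \<open>\<bb> H\<^sup>n(N)\<close>. A class of \<open>H\<^sup>n(N)\<close>
  that vanishes in \<open>H\<^sup>n(N / \<bb>N)\<close> comes from a cocycle with values in \<open>\<bb>N\<close>, and the obstruction to
  lifting that cocycle to \<open>Q\<close> lies in \<open>H\<^sup>n\<^sup>+\<^sup>1(K)\<close>, which belongs to \<open>S\<close>. So \<open>H\<^sup>n(N) / \<bb> H\<^sup>n(N)\<close> is pinched
  between \<open>H\<^sup>n\<^sup>+\<^sup>1(K)\<close> and \<open>H\<^sup>n(N / \<bb>N)\<close> (\<open>in_S_quotient\<close>).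
\<close>

section \<open>Linear maps\<close>

text \<open>The module axioms pass to images. Cosets and transported structures become modules in this way.\<close>

lemma module_of_surj:
  assumes A: "module R A" and im: "f ` carrier A = carrier B"
    and add: "\<And>x y. x \<in> carrier A \<Longrightarrow> y \<in> carrier A \<Longrightarrow> f (x \<oplus>\<^bsub>A\<^esub> y) = f x \<oplus>\<^bsub>B\<^esub> f y"
    and smult: "\<And>r x. r \<in> carrier R \<Longrightarrow> x \<in> carrier A \<Longrightarrow> f (r \<odot>\<^bsub>A\<^esub> x) = r \<odot>\<^bsub>B\<^esub> f x"
    and zero: "f \<zero>\<^bsub>A\<^esub> = \<zero>\<^bsub>B\<^esub>"
  shows "module R B"
proof -
  interpret A: module R A by fact
  have E: "\<exists>x \<in> carrier A. y = f x" if "y \<in> carrier B" for y using that im by blast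
  have cl: "f x \<in> carrier B" if "x \<in> carrier A" for x using that im by blast
  show ?thesis
  proof (rule moduleI)
    show "cring R" by unfold_locales
    show "abelian_group B"
    proof (rule abelian_groupI)
      show "\<zero>\<^bsub>B\<^esub> \<in> carrier B" using cl[of "\<zero>\<^bsub>A\<^esub>"] zero by simp
    next
      fix x y assume "x \<in> carrier B" "y \<in> carrier B"
      with E obtain a b where "a \<in> carrier A" "b \<in> carrier A" "x = f a" "y = f b" by meson
      then show "x \<oplus>\<^bsub>B\<^esub> y \<in> carrier B" "x \<oplus>\<^bsub>B\<^esub> y = y \<oplus>\<^bsub>B\<^esub> x"
        using cl[of "a \<oplus>\<^bsub>A\<^esub> b"] add[of a b] add[of b a] A.a_comm[of a b] by auto
    next
      fix x y z assume "x \<in> carrier B" "y \<in> carrier B" "z \<in> carrier B"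
      with E obtain a b c where abc: "a \<in> carrier A" "b \<in> carrier A" "c \<in> carrier A"
        "x = f a" "y = f b" "z = f c" by meson
      then have "x \<oplus>\<^bsub>B\<^esub> y \<oplus>\<^bsub>B\<^esub> z = f (a \<oplus>\<^bsub>A\<^esub> b \<oplus>\<^bsub>A\<^esub> c)" "x \<oplus>\<^bsub>B\<^esub> (y \<oplus>\<^bsub>B\<^esub> z) = f (a \<oplus>\<^bsub>A\<^esub> (b \<oplus>\<^bsub>A\<^esub> c))"
        by (simp_all add: add)
      then show "x \<oplus>\<^bsub>B\<^esub> y \<oplus>\<^bsub>B\<^esub> z = x \<oplus>\<^bsub>B\<^esub> (y \<oplus>\<^bsub>B\<^esub> z)" using abc by (simp add: A.a_assoc)
    next
      fix x assume "x \<in> carrier B"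
      with E obtain a where a: "a \<in> carrier A" "x = f a" by meson
      then show "\<zero>\<^bsub>B\<^esub> \<oplus>\<^bsub>B\<^esub> x = x" using add[of "\<zero>\<^bsub>A\<^esub>" a] zero by simp
      show "\<exists>y \<in> carrier B. y \<oplus>\<^bsub>B\<^esub> x = \<zero>\<^bsub>B\<^esub>"
        using a add[of "\<ominus>\<^bsub>A\<^esub> a" a] zero cl[of "\<ominus>\<^bsub>A\<^esub> a"] by (auto simp: A.l_neg)
    qed
  next
    fix a x assume "a \<in> carrier R" "x \<in> carrier B"
    then show "a \<odot>\<^bsub>B\<^esub> x \<in> carrier B" using E[of x] cl smult by (metis A.smult_closed)
  next
    fix a b x assume ab: "a \<in> carrier R" "b \<in> carrier R" and "x \<in> carrier B"
    with E obtain c where c: "c \<in> carrier A" "x = f c" by meson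
    show "(a \<oplus>\<^bsub>R\<^esub> b) \<odot>\<^bsub>B\<^esub> x = a \<odot>\<^bsub>B\<^esub> x \<oplus>\<^bsub>B\<^esub> b \<odot>\<^bsub>B\<^esub> x"
      using ab c by (simp flip: add smult add: A.smult_l_distr)
    show "(a \<otimes>\<^bsub>R\<^esub> b) \<odot>\<^bsub>B\<^esub> x = a \<odot>\<^bsub>B\<^esub> (b \<odot>\<^bsub>B\<^esub> x)"
      using ab c by (simp flip: add smult add: A.smult_assoc1)
  next
    fix a x y assume a: "a \<in> carrier R" and "x \<in> carrier B" "y \<in> carrier B"
    with E obtain b c where c: "b \<in> carrier A" "x = f b" "c \<in> carrier A" "y = f c" by meson
    show "a \<odot>\<^bsub>B\<^esub> (x \<oplus>\<^bsub>B\<^esub> y) = a \<odot>\<^bsub>B\<^esub> x \<oplus>\<^bsub>B\<^esub> a \<odot>\<^bsub>B\<^esub> y"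
      using a c by (simp flip: add smult add: A.smult_r_distr)
  next
    fix x assume "x \<in> carrier B"
    with E obtain b where c: "b \<in> carrier A" "x = f b" by meson
    then show "\<one>\<^bsub>R\<^esub> \<odot>\<^bsub>B\<^esub> x = x" by (simp flip: smult)
  qed
qed

lemma (in module) add_smult_closed:
  "x \<in> carrier M \<Longrightarrow> y \<in> carrier M \<Longrightarrow> x \<oplus>\<^bsub>M\<^esub> y \<in> carrier M"
  "\<zero>\<^bsub>M\<^esub> \<in> carrier M"
  "x \<in> carrier M \<Longrightarrow> \<ominus>\<^bsub>M\<^esub> x \<in> carrier M"
  "r \<in> carrier R \<Longrightarrow> x \<in> carrier M \<Longrightarrow> r \<odot>\<^bsub>M\<^esub> x \<in> carrier M"
  by auto

lemma (in module) add_smult_simps: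
  "x \<in> carrier M \<Longrightarrow> \<zero>\<^bsub>M\<^esub> \<oplus>\<^bsub>M\<^esub> x = x"
  "x \<in> carrier M \<Longrightarrow> x \<oplus>\<^bsub>M\<^esub> \<zero>\<^bsub>M\<^esub> = x"
  "x \<in> carrier M \<Longrightarrow> \<ominus>\<^bsub>M\<^esub> x \<oplus>\<^bsub>M\<^esub> x = \<zero>\<^bsub>M\<^esub>"
  "x \<in> carrier M \<Longrightarrow> x \<oplus>\<^bsub>M\<^esub> \<ominus>\<^bsub>M\<^esub> x = \<zero>\<^bsub>M\<^esub>"
  "x \<in> carrier M \<Longrightarrow> y \<in> carrier M \<Longrightarrow> x \<oplus>\<^bsub>M\<^esub> (\<ominus>\<^bsub>M\<^esub> x \<oplus>\<^bsub>M\<^esub> y) = y"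
  "x \<in> carrier M \<Longrightarrow> y \<in> carrier M \<Longrightarrow> \<ominus>\<^bsub>M\<^esub> x \<oplus>\<^bsub>M\<^esub> (x \<oplus>\<^bsub>M\<^esub> y) = y"
  "x \<in> carrier M \<Longrightarrow> y \<in> carrier M \<Longrightarrow> \<ominus>\<^bsub>M\<^esub> (x \<oplus>\<^bsub>M\<^esub> y) = \<ominus>\<^bsub>M\<^esub> x \<oplus>\<^bsub>M\<^esub> \<ominus>\<^bsub>M\<^esub> y"
  "x \<in> carrier M \<Longrightarrow> \<ominus>\<^bsub>M\<^esub> (\<ominus>\<^bsub>M\<^esub> x) = x"
  "\<ominus>\<^bsub>M\<^esub> \<zero>\<^bsub>M\<^esub> = \<zero>\<^bsub>M\<^esub>"
  "x \<in> carrier M \<Longrightarrow> y \<in> carrier M \<Longrightarrow> x \<oplus>\<^bsub>M\<^esub> (y \<oplus>\<^bsub>M\<^esub> \<ominus>\<^bsub>M\<^esub> x) = y"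
  "x \<in> carrier M \<Longrightarrow> y \<in> carrier M \<Longrightarrow> \<ominus>\<^bsub>M\<^esub> x \<oplus>\<^bsub>M\<^esub> (y \<oplus>\<^bsub>M\<^esub> x) = y"
  "r \<in> carrier R \<Longrightarrow> x \<in> carrier M \<Longrightarrow> y \<in> carrier M \<Longrightarrow> r \<odot>\<^bsub>M\<^esub> (x \<oplus>\<^bsub>M\<^esub> y) = r \<odot>\<^bsub>M\<^esub> x \<oplus>\<^bsub>M\<^esub> r \<odot>\<^bsub>M\<^esub> y"
  "r \<in> carrier R \<Longrightarrow> x \<in> carrier M \<Longrightarrow> r \<odot>\<^bsub>M\<^esub> (\<ominus>\<^bsub>M\<^esub> x) = \<ominus>\<^bsub>M\<^esub> (r \<odot>\<^bsub>M\<^esub> x)"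
  "r \<in> carrier R \<Longrightarrow> r \<odot>\<^bsub>M\<^esub> \<zero>\<^bsub>M\<^esub> = \<zero>\<^bsub>M\<^esub>"
  "x \<in> carrier M \<Longrightarrow> \<one> \<odot>\<^bsub>M\<^esub> x = x"
  "x \<in> carrier M \<Longrightarrow> \<zero> \<odot>\<^bsub>M\<^esub> x = \<zero>\<^bsub>M\<^esub>"
  by (simp_all add: l_neg r_neg r_neg1 r_neg2 minus_add smult_r_distr smult_r_minus a_lcomm[of _ y])

lemma (in module) add_ac:
  assumes "x \<in> carrier M" "y \<in> carrier M"
  shows "x \<oplus>\<^bsub>M\<^esub> y = y \<oplus>\<^bsub>M\<^esub> x"
    and "z \<in> carrier M \<Longrightarrow> x \<oplus>\<^bsub>M\<^esub> y \<oplus>\<^bsub>M\<^esub> z = x \<oplus>\<^bsub>M\<^esub> (y \<oplus>\<^bsub>M\<^esub> z)"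
    and "z \<in> carrier M \<Longrightarrow> x \<oplus>\<^bsub>M\<^esub> (y \<oplus>\<^bsub>M\<^esub> z) = y \<oplus>\<^bsub>M\<^esub> (x \<oplus>\<^bsub>M\<^esub> z)"
  using assms by (simp_all add: a_assoc a_comm a_lcomm)

lemmas mod_closed = module.add_smult_closed
lemmas mod_simps = module.add_smult_simps
lemmas mod_ac = module.add_ac

lemma mod_smult_comm:
  assumes "module R A" "r \<in> carrier R" "s \<in> carrier R" "x \<in> carrier A"
  shows "r \<odot>\<^bsub>A\<^esub> (s \<odot>\<^bsub>A\<^esub> x) = s \<odot>\<^bsub>A\<^esub> (r \<odot>\<^bsub>A\<^esub> x)"
proof -
  interpret module R A by fact
  show ?thesis using assms by (metis R.m_comm smult_assoc1)
qed

lemmas mod_smult_assoc = module.smult_assoc1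
lemmas mod_smult_l_distr = module.smult_l_distr

lemma mod_cring: "module R A \<Longrightarrow> cring R"
  by (simp add: module_def)

lemma mod_diff_zero:
  assumes "module R A" "x \<in> carrier A" "y \<in> carrier A"
  shows "x \<oplus>\<^bsub>A\<^esub> \<ominus>\<^bsub>A\<^esub> y = \<zero>\<^bsub>A\<^esub> \<longleftrightarrow> x = y"
proof -
  interpret module R A by fact
  show ?thesis using assms by (metis minus_equality minus_minus a_inv_closed r_neg)
qed

lemma mod_eq_diff:
  assumes "module R A" "x \<in> carrier A" "y \<in> carrier A" "z \<in> carrier A"
  shows "z = x \<oplus>\<^bsub>A\<^esub> \<ominus>\<^bsub>A\<^esub> y \<longleftrightarrow> x = z \<oplus>\<^bsub>A\<^esub> y"
proof -
  interpret module R A by fact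
  show ?thesis
  proof
    assume "z = x \<oplus>\<^bsub>A\<^esub> \<ominus>\<^bsub>A\<^esub> y"
    then show "x = z \<oplus>\<^bsub>A\<^esub> y" using assms by (simp add: a_assoc l_neg)
  next
    assume "x = z \<oplus>\<^bsub>A\<^esub> y"
    then show "z = x \<oplus>\<^bsub>A\<^esub> \<ominus>\<^bsub>A\<^esub> y" using assms by (simp add: a_assoc r_neg)
  qed
qed

text \<open>Unlike the elements of \<open>module_homs\<close>, linear maps in this sense may take any value outside the
  carrier; so they compose and add up as plain functions.\<close>

definition lin :: "('r, 's) ring_scheme \<Rightarrow> ('r, 'a) module \<Rightarrow> ('r, 'b) module \<Rightarrow> ('a \<Rightarrow> 'b) \<Rightarrow> bool" where
  "lin R A B f \<longleftrightarrow> module R A \<and> module R B \<and> f \<in> carrier A \<rightarrow> carrier B \<and>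
     (\<forall>x \<in> carrier A. \<forall>y \<in> carrier A. f (x \<oplus>\<^bsub>A\<^esub> y) = f x \<oplus>\<^bsub>B\<^esub> f y) \<and>
     (\<forall>r \<in> carrier R. \<forall>x \<in> carrier A. f (r \<odot>\<^bsub>A\<^esub> x) = r \<odot>\<^bsub>B\<^esub> f x)"

lemma linI:
  assumes "module R A" "module R B" "\<And>x. x \<in> carrier A \<Longrightarrow> f x \<in> carrier B"
    "\<And>x y. x \<in> carrier A \<Longrightarrow> y \<in> carrier A \<Longrightarrow> f (x \<oplus>\<^bsub>A\<^esub> y) = f x \<oplus>\<^bsub>B\<^esub> f y"
    "\<And>r x. r \<in> carrier R \<Longrightarrow> x \<in> carrier A \<Longrightarrow> f (r \<odot>\<^bsub>A\<^esub> x) = r \<odot>\<^bsub>B\<^esub> f x"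
  shows "lin R A B f"
  using assms unfolding lin_def by auto

lemma lin_module: "lin R A B f \<Longrightarrow> module R A" "lin R A B f \<Longrightarrow> module R B"
  unfolding lin_def by auto

lemma lin_closed: "lin R A B f \<Longrightarrow> x \<in> carrier A \<Longrightarrow> f x \<in> carrier B"
  unfolding lin_def by auto

lemma lin_add: "lin R A B f \<Longrightarrow> x \<in> carrier A \<Longrightarrow> y \<in> carrier A \<Longrightarrow> f (x \<oplus>\<^bsub>A\<^esub> y) = f x \<oplus>\<^bsub>B\<^esub> f y"
  unfolding lin_def by auto

lemma lin_smult: "lin R A B f \<Longrightarrow> r \<in> carrier R \<Longrightarrow> x \<in> carrier A \<Longrightarrow> f (r \<odot>\<^bsub>A\<^esub> x) = r \<odot>\<^bsub>B\<^esub> f x"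
  unfolding lin_def by auto

lemma lin_zero: assumes "lin R A B f" shows "f \<zero>\<^bsub>A\<^esub> = \<zero>\<^bsub>B\<^esub>"
proof -
  interpret A: module R A using assms by (simp add: lin_def)
  interpret B: module R B using assms by (simp add: lin_def)
  show ?thesis using lin_smult[OF assms, of "\<zero>\<^bsub>R\<^esub>" "\<zero>\<^bsub>A\<^esub>"] lin_closed[OF assms, of "\<zero>\<^bsub>A\<^esub>"] by simp
qed

lemma lin_neg: assumes "lin R A B f" "x \<in> carrier A" shows "f (\<ominus>\<^bsub>A\<^esub> x) = \<ominus>\<^bsub>B\<^esub> f x"
proof -
  interpret A: module R A using assms by (simp add: lin_def)
  interpret B: module R B using assms by (simp add: lin_def)
  show ?thesis using lin_add[OF assms(1), of "\<ominus>\<^bsub>A\<^esub> x" x] assms lin_closed[OF assms(1)] lin_zero[OF assms(1)]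
    by (metis A.a_inv_closed A.l_neg B.minus_equality)
qed

lemmas lin_simps = lin_closed lin_add lin_smult lin_zero lin_neg

lemma lin_compose: "lin R A B f \<Longrightarrow> lin R B C g \<Longrightarrow> lin R A C (\<lambda>x. g (f x))"
  unfolding lin_def by (auto simp: Pi_iff)

lemma lin_ident: "module R A \<Longrightarrow> lin R A A (\<lambda>x. x)"
  unfolding lin_def by auto

lemma lin_const_zero: "module R A \<Longrightarrow> module R B \<Longrightarrow> lin R A B (\<lambda>x. \<zero>\<^bsub>B\<^esub>)"
  by (rule linI) (auto simp: mod_closed mod_simps)

lemma lin_sum: assumes "lin R A B f" "lin R A B g" shows "lin R A B (\<lambda>x. f x \<oplus>\<^bsub>B\<^esub> g x)"
proof -
  have m: "module R A" "module R B" using assms by (auto simp: lin_def)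
  show ?thesis
    by (rule linI) (use assms m in \<open>auto simp: lin_simps mod_closed mod_simps mod_ac\<close>)
qed

lemma lin_uminus: assumes "lin R A B f" shows "lin R A B (\<lambda>x. \<ominus>\<^bsub>B\<^esub> f x)"
proof -
  have m: "module R A" "module R B" using assms by (auto simp: lin_def)
  show ?thesis
    by (rule linI) (use assms m in \<open>auto simp: lin_simps mod_closed mod_simps mod_ac\<close>)
qed

lemma lin_scale: assumes "lin R A B f" "r \<in> carrier R" shows "lin R A B (\<lambda>x. r \<odot>\<^bsub>B\<^esub> f x)"
proof -
  have m: "module R A" "module R B" using assms by (auto simp: lin_def)
  show ?thesis
    by (rule linI) (use assms m in \<open>auto simp: lin_simps mod_closed mod_simps mod_smult_comm\<close>)
qed

text \<open>Linear maps matter only on the carrier; this is used to replace a map by its restriction, which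
  is what \<open>module_homs\<close> contains.\<close>

lemma lin_cong: "lin R A B f \<Longrightarrow> (\<And>x. x \<in> carrier A \<Longrightarrow> f x = g x) \<Longrightarrow> lin R A B g"
  unfolding lin_def using mod_closed(1)[of R A] mod_closed(4)[of R A] by (auto simp: Pi_iff)

lemma module_homs_lin: "module R A \<Longrightarrow> module R B \<Longrightarrow> f \<in> module_homs R A B \<Longrightarrow> lin R A B f"
  unfolding lin_def module_homs_def by auto

lemma lin_module_homs: "lin R A B f \<Longrightarrow> restrict f (carrier A) \<in> module_homs R A B"
  unfolding lin_def module_homs_def by (auto simp: mod_closed)

section \<open>Submodules\<close>

abbreviation sub :: "('r, 'a) module \<Rightarrow> 'a set \<Rightarrow> ('r, 'a) module" where
  "sub A H \<equiv> A\<lparr>carrier := H\<rparr>"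

lemma submoduleI':
  assumes "module R A" "H \<subseteq> carrier A" "\<zero>\<^bsub>A\<^esub> \<in> H" "\<And>x y. x \<in> H \<Longrightarrow> y \<in> H \<Longrightarrow> x \<oplus>\<^bsub>A\<^esub> y \<in> H"
    "\<And>r x. r \<in> carrier R \<Longrightarrow> x \<in> H \<Longrightarrow> r \<odot>\<^bsub>A\<^esub> x \<in> H"
  shows "submodule H R A"
proof -
  interpret module R A by fact
  show ?thesis
  proof (rule submoduleI)
    fix a assume a: "a \<in> H"
    have "\<ominus>\<^bsub>A\<^esub> a = (\<ominus>\<^bsub>R\<^esub> \<one>\<^bsub>R\<^esub>) \<odot>\<^bsub>A\<^esub> a" using a assms(2) by (simp add: smult_l_minus subset_iff)
    then show "\<ominus>\<^bsub>A\<^esub> a \<in> H" using assms(5) a by simp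
  qed (use assms in auto)
qed

lemma submodule_simps:
  assumes "module R A" "submodule H R A"
  shows "H \<subseteq> carrier A" "x \<in> H \<Longrightarrow> x \<in> carrier A" "\<zero>\<^bsub>A\<^esub> \<in> H" "x \<in> H \<Longrightarrow> y \<in> H \<Longrightarrow> x \<oplus>\<^bsub>A\<^esub> y \<in> H"
    "r \<in> carrier R \<Longrightarrow> x \<in> H \<Longrightarrow> r \<odot>\<^bsub>A\<^esub> x \<in> H" "x \<in> H \<Longrightarrow> \<ominus>\<^bsub>A\<^esub> x \<in> H"
proof -
  interpret module R A by fact
  note S = submoduleE[OF assms(2)]
  show "H \<subseteq> carrier A" "x \<in> H \<Longrightarrow> x \<in> carrier A" "x \<in> H \<Longrightarrow> y \<in> H \<Longrightarrow> x \<oplus>\<^bsub>A\<^esub> y \<in> H"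
    "r \<in> carrier R \<Longrightarrow> x \<in> H \<Longrightarrow> r \<odot>\<^bsub>A\<^esub> x \<in> H" "x \<in> H \<Longrightarrow> \<ominus>\<^bsub>A\<^esub> x \<in> H"
    using S by auto
  obtain h where "h \<in> H" using S(2) by auto
  then have "\<zero>\<^bsub>R\<^esub> \<odot>\<^bsub>A\<^esub> h \<in> H" using S(4) by blast
  then show "\<zero>\<^bsub>A\<^esub> \<in> H" using \<open>h \<in> H\<close> S(1) by auto
qed

lemma submodule_add_iff:
  assumes "module R A" "submodule H R A" "x \<in> carrier A" "h \<in> H"
  shows "x \<oplus>\<^bsub>A\<^esub> h \<in> H \<longleftrightarrow> x \<in> H"
proof
  assume a: "x \<oplus>\<^bsub>A\<^esub> h \<in> H"
  have "x = (x \<oplus>\<^bsub>A\<^esub> h) \<oplus>\<^bsub>A\<^esub> \<ominus>\<^bsub>A\<^esub> h"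
    using assms submodule_simps[OF assms(1,2)] by (simp add: mod_ac[OF assms(1)] mod_simps[OF assms(1)] mod_closed[OF assms(1)])
  with a assms show "x \<in> H" by (metis submodule_simps(4,6))
qed (use assms submodule_simps(4)[OF assms(1,2)] in simp)

lemma sub_module: "module R A \<Longrightarrow> submodule H R A \<Longrightarrow> module R (sub A H)"
  by (simp add: submodule.submodule_is_module)

lemma lin_sub_incl: "module R A \<Longrightarrow> submodule H R A \<Longrightarrow> lin R (sub A H) A (\<lambda>x. x)"
  by (rule linI) (auto simp: sub_module submodule_simps)

lemma lin_into_sub:
  "lin R A B f \<Longrightarrow> submodule H R B \<Longrightarrow> (\<And>x. x \<in> carrier A \<Longrightarrow> f x \<in> H) \<Longrightarrow> lin R A (sub B H) f"
  by (rule linI) (auto simp: sub_module lin_simps lin_module)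

lemma lin_from_sub: "lin R A B f \<Longrightarrow> submodule H R A \<Longrightarrow> lin R (sub A H) B f"
  using lin_compose[OF lin_sub_incl] lin_module by blast

lemma submodule_image: assumes "lin R A B f" "submodule H R A" shows "submodule (f ` H) R B"
proof -
  have m: "module R A" "module R B" using assms lin_module by auto
  note S = submodule_simps[OF m(1) assms(2)]
  show ?thesis
  proof (rule submoduleI'[OF m(2)])
    show "f ` H \<subseteq> carrier B" using S lin_closed[OF assms(1)] by auto
    show "\<zero>\<^bsub>B\<^esub> \<in> f ` H" using S(3) lin_zero[OF assms(1)] by force
    fix x y assume "x \<in> f ` H" "y \<in> f ` H"
    then obtain a b where ab: "a \<in> H" "b \<in> H" "x = f a" "y = f b" by auto
    then have "x \<oplus>\<^bsub>B\<^esub> y = f (a \<oplus>\<^bsub>A\<^esub> b)" using lin_add[OF assms(1), of a b] S(2) by simp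
    then show "x \<oplus>\<^bsub>B\<^esub> y \<in> f ` H" using S(4)[OF ab(1,2)] by blast
  next
    fix r x assume r: "r \<in> carrier R" and "x \<in> f ` H"
    then obtain a where a: "a \<in> H" "x = f a" by auto
    then have "r \<odot>\<^bsub>B\<^esub> x = f (r \<odot>\<^bsub>A\<^esub> a)" using lin_smult[OF assms(1), of r a] S(2) r by simp
    then show "r \<odot>\<^bsub>B\<^esub> x \<in> f ` H" using S(5)[OF r a(1)] by blast
  qed
qed

lemma submodule_carrier: "module R A \<Longrightarrow> submodule (carrier A) R A"
  by (rule module.carrier_is_submodule)

lemma submodule_zero: "module R A \<Longrightarrow> submodule {\<zero>\<^bsub>A\<^esub>} R A"
  by (rule submoduleI') (auto simp: mod_closed mod_simps)

lemma submodule_vimage: assumes "lin R A B f" "submodule H R B" shows "submodule {x \<in> carrier A. f x \<in> H} R A"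
proof -
  have m: "module R A" "module R B" using assms lin_module by auto
  show ?thesis
    by (rule submoduleI') (use m assms submodule_simps[OF m(2) assms(2)] in \<open>auto simp: lin_simps mod_closed\<close>)
qed

lemma submodule_ker: assumes "lin R A B f" shows "submodule {x \<in> carrier A. f x = \<zero>\<^bsub>B\<^esub>} R A"
  using submodule_vimage[OF assms submodule_zero] lin_module[OF assms] by auto

lemma sub_lin_map: "lin R A (sub B H) f \<Longrightarrow> submodule H R B \<Longrightarrow> module R B \<Longrightarrow> lin R A B f"
  using lin_compose lin_sub_incl by fastforce

subsection \<open>Quotients\<close>

lemma a_coset_mem:
  assumes "module R A" "submodule H R A" "x \<in> carrier A"
  shows "y \<in> H +>\<^bsub>A\<^esub> x \<longleftrightarrow> (\<exists>h \<in> H. y = h \<oplus>\<^bsub>A\<^esub> x)"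
  by (auto simp: a_r_coset_def')

lemma abelian_subgroup_of_submodule: "module R A \<Longrightarrow> submodule H R A \<Longrightarrow> abelian_subgroup H A"
proof -
  assume a: "module R A" "submodule H R A"
  interpret module R A by fact
  show ?thesis by (rule abelian_subgroupI3) (use a M.abelian_group_axioms in \<open>auto simp: additive_subgroup_def submodule_def\<close>)
qed

lemma coset_eq_iff:
  assumes "module R A" "submodule H R A" "x \<in> carrier A" "y \<in> carrier A"
  shows "H +>\<^bsub>A\<^esub> x = H +>\<^bsub>A\<^esub> y \<longleftrightarrow> (\<exists>h \<in> H. x = h \<oplus>\<^bsub>A\<^esub> y)"
proof -
  interpret module R A by fact
  interpret abelian_subgroup H A using abelian_subgroup_of_submodule assms by blast
  show ?thesis
  proof
    assume "H +>\<^bsub>A\<^esub> x = H +>\<^bsub>A\<^esub> y"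
    then have "x \<in> H +>\<^bsub>A\<^esub> y" using a_rcos_self[OF assms(3)] by simp
    then show "\<exists>h \<in> H. x = h \<oplus>\<^bsub>A\<^esub> y" using a_coset_mem[OF assms(1,2,4)] by simp
  next
    assume "\<exists>h \<in> H. x = h \<oplus>\<^bsub>A\<^esub> y"
    then have "x \<in> H +>\<^bsub>A\<^esub> y" using a_coset_mem[OF assms(1,2,4)] by simp
    then show "H +>\<^bsub>A\<^esub> x = H +>\<^bsub>A\<^esub> y" using a_repr_independence[OF _ assms(4) a_subgroup] by simp
  qed
qed

lemma quot_module_props:
  assumes "module R A" "submodule H R A"
  shows quot_carrier: "carrier (quot_module A H) = (\<lambda>x. H +>\<^bsub>A\<^esub> x) ` carrier A"
    and quot_lin: "lin R A (quot_module A H) (\<lambda>x. H +>\<^bsub>A\<^esub> x)"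
    and quot_zero: "x \<in> carrier A \<Longrightarrow> H +>\<^bsub>A\<^esub> x = \<zero>\<^bsub>quot_module A H\<^esub> \<longleftrightarrow> x \<in> H"
proof -
  interpret module R A by fact
  interpret abelian_subgroup H A using abelian_subgroup_of_submodule assms by blast
  note S = submodule_simps[OF assms]
  show C: "carrier (quot_module A H) = (\<lambda>x. H +>\<^bsub>A\<^esub> x) ` carrier A"
    unfolding quot_module_def A_RCOSETS_def' by auto
  have add: "H +>\<^bsub>A\<^esub> (x \<oplus>\<^bsub>A\<^esub> y) = (H +>\<^bsub>A\<^esub> x) \<oplus>\<^bsub>quot_module A H\<^esub> (H +>\<^bsub>A\<^esub> y)"
    if "x \<in> carrier A" "y \<in> carrier A" for x y
    using that by (simp add: quot_module_def a_rcos_sum)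
  have sm: "H +>\<^bsub>A\<^esub> (r \<odot>\<^bsub>A\<^esub> x) = r \<odot>\<^bsub>quot_module A H\<^esub> (H +>\<^bsub>A\<^esub> x)"
    if "x \<in> carrier A" "r \<in> carrier R" for x r
  proof -
    have "H +>\<^bsub>A\<^esub> (r \<odot>\<^bsub>A\<^esub> y) = H +>\<^bsub>A\<^esub> (r \<odot>\<^bsub>A\<^esub> x)" if "y \<in> H +>\<^bsub>A\<^esub> x" for y
    proof -
      obtain h where h: "h \<in> H" "y = h \<oplus>\<^bsub>A\<^esub> x" using a_coset_mem[OF assms \<open>x \<in> carrier A\<close>, of y] \<open>y \<in> H +>\<^bsub>A\<^esub> x\<close> by auto
      then have "r \<odot>\<^bsub>A\<^esub> y = r \<odot>\<^bsub>A\<^esub> h \<oplus>\<^bsub>A\<^esub> r \<odot>\<^bsub>A\<^esub> x" "y \<in> carrier A"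
        using S \<open>x \<in> carrier A\<close> \<open>r \<in> carrier R\<close> by (auto simp: smult_r_distr)
      then show ?thesis using coset_eq_iff[OF assms, of "r \<odot>\<^bsub>A\<^esub> y" "r \<odot>\<^bsub>A\<^esub> x"] S h that \<open>x \<in> carrier A\<close> \<open>r \<in> carrier R\<close>
        by auto
    qed
    moreover have "x \<in> H +>\<^bsub>A\<^esub> x" using that a_rcos_self by blast
    ultimately have "(\<Union>y \<in> H +>\<^bsub>A\<^esub> x. H +>\<^bsub>A\<^esub> (r \<odot>\<^bsub>A\<^esub> y)) = H +>\<^bsub>A\<^esub> (r \<odot>\<^bsub>A\<^esub> x)"
      using SUP_eq_const[of "H +>\<^bsub>A\<^esub> x" "\<lambda>y. H +>\<^bsub>A\<^esub> (r \<odot>\<^bsub>A\<^esub> y)"] by blast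
    then show ?thesis by (simp add: quot_module_def)
  qed
  have H0: "H +>\<^bsub>A\<^esub> \<zero>\<^bsub>A\<^esub> = H" using a_coset_join2[OF M.zero_closed a_subgroup] S(3) by simp
  have z: "H +>\<^bsub>A\<^esub> \<zero>\<^bsub>A\<^esub> = \<zero>\<^bsub>quot_module A H\<^esub>" by (simp add: H0) (simp add: quot_module_def)
  have "module R (quot_module A H)"
    by (rule module_of_surj[OF assms(1) C[symmetric]]) (use add sm z in auto)
  then show "lin R A (quot_module A H) (\<lambda>x. H +>\<^bsub>A\<^esub> x)"
    by (intro linI) (use assms C add sm in auto)
  assume x: "x \<in> carrier A"
  show "H +>\<^bsub>A\<^esub> x = \<zero>\<^bsub>quot_module A H\<^esub> \<longleftrightarrow> x \<in> H"
    unfolding z[symmetric] using coset_eq_iff[OF assms x M.zero_closed] S x by auto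
qed

definition transport :: "('a \<Rightarrow> 'b) \<Rightarrow> ('r, 'a) module \<Rightarrow> ('r, 'b) module" where
  "transport j A = (let v = inv_into (carrier A) j in
    \<lparr>carrier = j ` carrier A, monoid.mult = undefined, one = undefined, ring.zero = j \<zero>\<^bsub>A\<^esub>,
     add = (\<lambda>x y. j (v x \<oplus>\<^bsub>A\<^esub> v y)), smult = (\<lambda>r x. j (r \<odot>\<^bsub>A\<^esub> v x))\<rparr>)"

lemma transport_lin:
  assumes "module R A" "inj_on j (carrier A)"
  shows transport_carrier: "carrier (transport j A) = j ` carrier A"
    and transport_to: "lin R A (transport j A) j"
    and transport_from: "lin R (transport j A) A (inv_into (carrier A) j)"
proof -
  show C: "carrier (transport j A) = j ` carrier A" by (simp add: transport_def Let_def)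
  have m: "module R (transport j A)"
    by (rule module_of_surj[OF assms(1) C[symmetric]]) (use assms in \<open>auto simp: transport_def Let_def mod_closed\<close>)
  then show "lin R A (transport j A) j"
    by (intro linI) (use assms in \<open>auto simp: transport_def Let_def mod_closed\<close>)
  show "lin R (transport j A) A (inv_into (carrier A) j)"
    by (intro linI) (use m assms in \<open>auto simp: transport_def Let_def mod_closed\<close>)
qed

text \<open>A copy of \<open>A / H\<close> on the type of \<open>A\<close>, obtained by choosing an element in each coset.\<close>

definition quot_copy :: "('r, 'a) module \<Rightarrow> 'a set \<Rightarrow> ('r, 'a) module" where
  "quot_copy A H = transport (\<lambda>X. SOME x. x \<in> X) (quot_module A H)"

definition quot_rep :: "('r, 'a) module \<Rightarrow> 'a set \<Rightarrow> 'a \<Rightarrow> 'a" where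
  "quot_rep A H x = (SOME y. y \<in> H +>\<^bsub>A\<^esub> x)"

lemma quot_rep_props:
  assumes "module R A" "submodule H R A"
  shows quot_rep_lin: "lin R A (quot_copy A H) (quot_rep A H)"
    and quot_rep_surj: "quot_rep A H ` carrier A = carrier (quot_copy A H)"
    and quot_rep_zero: "x \<in> carrier A \<Longrightarrow> quot_rep A H x = \<zero>\<^bsub>quot_copy A H\<^esub> \<longleftrightarrow> x \<in> H"
proof -
  interpret module R A by fact
  interpret abelian_subgroup H A using abelian_subgroup_of_submodule assms by blast
  let ?j = "\<lambda>X. SOME x. x \<in> X" and ?Q = "quot_module A H"
  have mem: "?j (H +>\<^bsub>A\<^esub> x) \<in> H +>\<^bsub>A\<^esub> x" if "x \<in> carrier A" for x
    using a_rcos_self[OF that] someI[of "\<lambda>y. y \<in> H +>\<^bsub>A\<^esub> x" x] by simp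
  have inj: "inj_on ?j (carrier ?Q)"
    unfolding quot_carrier[OF assms]
  proof (rule inj_onI, clarify)
    fix x y assume xy: "x \<in> carrier A" "y \<in> carrier A" "?j (H +>\<^bsub>A\<^esub> x) = ?j (H +>\<^bsub>A\<^esub> y)"
    have "H +>\<^bsub>A\<^esub> x = H +>\<^bsub>A\<^esub> ?j (H +>\<^bsub>A\<^esub> x)" by (rule a_repr_independence[OF mem[OF xy(1)] xy(1) a_subgroup])
    also have "\<dots> = H +>\<^bsub>A\<^esub> ?j (H +>\<^bsub>A\<^esub> y)" by (simp only: xy(3))
    also have "\<dots> = H +>\<^bsub>A\<^esub> y" by (rule a_repr_independence[OF mem[OF xy(2)] xy(2) a_subgroup, symmetric])
    finally show "H +>\<^bsub>A\<^esub> x = H +>\<^bsub>A\<^esub> y" .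
  qed
  have mQ: "module R ?Q" using quot_lin[OF assms] lin_module by blast
  note T = transport_lin[OF mQ inj]
  show L: "lin R A (quot_copy A H) (quot_rep A H)"
    using lin_compose[OF quot_lin[OF assms] T(2)] unfolding quot_copy_def quot_rep_def .
  show "quot_rep A H ` carrier A = carrier (quot_copy A H)"
    unfolding quot_copy_def T(1) quot_carrier[OF assms] quot_rep_def by auto
  assume x: "x \<in> carrier A"
  have "quot_rep A H x = \<zero>\<^bsub>quot_copy A H\<^esub> \<longleftrightarrow> H +>\<^bsub>A\<^esub> x = \<zero>\<^bsub>?Q\<^esub>"
    unfolding quot_copy_def quot_rep_def
    using inj_on_eq_iff[OF inj lin_closed[OF quot_lin[OF assms] x] mod_closed(2)[OF mQ]] lin_zero[OF T(2)] by simp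
  then show "quot_rep A H x = \<zero>\<^bsub>quot_copy A H\<^esub> \<longleftrightarrow> x \<in> H" using quot_zero[OF assms x] by simp
qed

subsection \<open>Products\<close>

text \<open>Besides direct sums, these products serve to treat linear relations between modules as
  submodules.\<close>

definition prod_module :: "('r, 'a) module \<Rightarrow> ('r, 'b) module \<Rightarrow> ('r, 'a \<times> 'b) module" where
  "prod_module A B = \<lparr>carrier = carrier A \<times> carrier B, monoid.mult = undefined, one = undefined,
     ring.zero = (\<zero>\<^bsub>A\<^esub>, \<zero>\<^bsub>B\<^esub>), add = (\<lambda>(a, b) (c, d). (a \<oplus>\<^bsub>A\<^esub> c, b \<oplus>\<^bsub>B\<^esub> d)),
     smult = (\<lambda>r (a, b). (r \<odot>\<^bsub>A\<^esub> a, r \<odot>\<^bsub>B\<^esub> b))\<rparr>"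

lemma prod_module_simps [simp]:
  "carrier (prod_module A B) = carrier A \<times> carrier B"
  "\<zero>\<^bsub>prod_module A B\<^esub> = (\<zero>\<^bsub>A\<^esub>, \<zero>\<^bsub>B\<^esub>)"
  "(a, b) \<oplus>\<^bsub>prod_module A B\<^esub> (c, d) = (a \<oplus>\<^bsub>A\<^esub> c, b \<oplus>\<^bsub>B\<^esub> d)"
  "r \<odot>\<^bsub>prod_module A B\<^esub> (a, b) = (r \<odot>\<^bsub>A\<^esub> a, r \<odot>\<^bsub>B\<^esub> b)"
  by (simp_all add: prod_module_def)

lemma prod_module_module: assumes "module R A" "module R B" shows "module R (prod_module A B)"
proof -
  interpret A: module R A by fact
  interpret B: module R B by fact
  show ?thesis
  proof (rule moduleI)
    show "cring R" by unfold_locales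
    show "abelian_group (prod_module A B)"
    proof (rule abelian_groupI)
      fix x assume "x \<in> carrier (prod_module A B)"
      then show "\<exists>y \<in> carrier (prod_module A B). y \<oplus>\<^bsub>prod_module A B\<^esub> x = \<zero>\<^bsub>prod_module A B\<^esub>"
        by (intro bexI[of _ "(\<ominus>\<^bsub>A\<^esub> fst x, \<ominus>\<^bsub>B\<^esub> snd x)"]) (auto simp: A.l_neg B.l_neg)
    qed (auto simp: A.a_ac B.a_ac)
  qed (auto simp: A.smult_l_distr B.smult_l_distr A.smult_r_distr B.smult_r_distr A.smult_assoc1 B.smult_assoc1)
qed

section \<open>Finitely generated modules over a Noetherian ring\<close>

text \<open>Generators are kept in a list, so that proofs about finitely generated modules can go by
  induction on the list, one cyclic factor at a time.\<close>

fun lspan :: "('r, 's) ring_scheme \<Rightarrow> ('r, 'a) module \<Rightarrow> 'a list \<Rightarrow> 'a set" where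
  "lspan R A [] = {\<zero>\<^bsub>A\<^esub>}"
| "lspan R A (x # xs) = {r \<odot>\<^bsub>A\<^esub> x \<oplus>\<^bsub>A\<^esub> y | r y. r \<in> carrier R \<and> y \<in> lspan R A xs}"

definition fin_gen :: "('r, 's) ring_scheme \<Rightarrow> ('r, 'a) module \<Rightarrow> bool" where
  "fin_gen R A \<longleftrightarrow> module R A \<and> (\<exists>xs. set xs \<subseteq> carrier A \<and> carrier A = lspan R A xs)"

definition sub_sum :: "('r, 'a) module \<Rightarrow> 'a set \<Rightarrow> 'a set \<Rightarrow> 'a set" where
  "sub_sum A H K = {h \<oplus>\<^bsub>A\<^esub> k | h k. h \<in> H \<and> k \<in> K}"

lemma submodule_sub_sum:
  assumes m: "module R A" and H: "submodule H R A" and K: "submodule K R A"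
  shows "submodule (sub_sum A H K) R A"
proof -
  note h = submodule_simps[OF m H] and k = submodule_simps[OF m K]
  show ?thesis
  proof (rule submoduleI'[OF m])
    show "sub_sum A H K \<subseteq> carrier A" unfolding sub_sum_def using h(2) k(2) mod_closed[OF m] by auto
    show "\<zero>\<^bsub>A\<^esub> \<in> sub_sum A H K" unfolding sub_sum_def
      using h(3) k(3) mod_simps(1)[OF m mod_closed(2)[OF m]] by force
  next
    fix x y assume "x \<in> sub_sum A H K" "y \<in> sub_sum A H K"
    then obtain a b c d where *: "a \<in> H" "b \<in> K" "c \<in> H" "d \<in> K" "x = a \<oplus>\<^bsub>A\<^esub> b" "y = c \<oplus>\<^bsub>A\<^esub> d"
      unfolding sub_sum_def by blast
    then have "x \<oplus>\<^bsub>A\<^esub> y = (a \<oplus>\<^bsub>A\<^esub> c) \<oplus>\<^bsub>A\<^esub> (b \<oplus>\<^bsub>A\<^esub> d)"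
      using h(2) k(2) by (simp add: mod_ac[OF m] mod_closed[OF m])
    then show "x \<oplus>\<^bsub>A\<^esub> y \<in> sub_sum A H K" unfolding sub_sum_def using h(4)[OF *(1,3)] k(4)[OF *(2,4)] by blast
  next
    fix r x assume r: "r \<in> carrier R" "x \<in> sub_sum A H K"
    then obtain a b where *: "a \<in> H" "b \<in> K" "x = a \<oplus>\<^bsub>A\<^esub> b" unfolding sub_sum_def by blast
    then have "r \<odot>\<^bsub>A\<^esub> x = r \<odot>\<^bsub>A\<^esub> a \<oplus>\<^bsub>A\<^esub> r \<odot>\<^bsub>A\<^esub> b" using h(2) k(2) r by (simp add: mod_simps[OF m])
    then show "r \<odot>\<^bsub>A\<^esub> x \<in> sub_sum A H K" unfolding sub_sum_def using h(5)[OF r(1) *(1)] k(5)[OF r(1) *(2)] by blast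
  qed
qed

lemma sub_sum_upper:
  assumes m: "module R A" and H: "submodule H R A" and K: "submodule K R A"
  shows "H \<subseteq> sub_sum A H K" "K \<subseteq> sub_sum A H K"
proof -
  note h = submodule_simps[OF m H] and k = submodule_simps[OF m K]
  show "H \<subseteq> sub_sum A H K" unfolding sub_sum_def using h(2) k(3) mod_simps(2)[OF m] by force
  show "K \<subseteq> sub_sum A H K" unfolding sub_sum_def using k(2) h(3) mod_simps(1)[OF m] by force
qed

lemma lin_act: assumes "module R A" "r \<in> carrier R" shows "lin R A A (\<lambda>x. r \<odot>\<^bsub>A\<^esub> x)"
  by (rule lin_scale[OF lin_ident]) fact+

lemma submodule_scaled:
  fixes A :: "('r, 'a) module"
  assumes "module R A" "r \<in> carrier R" shows "submodule ((\<lambda>x. r \<odot>\<^bsub>A\<^esub> x) ` carrier A) R A"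
  by (rule submodule_image[OF lin_act[OF assms] submodule_carrier[OF assms(1)]])

definition regular_module :: "('r, 's) ring_scheme \<Rightarrow> ('r, 'r) module" where
  "regular_module R = \<lparr>carrier = carrier R, monoid.mult = undefined, one = undefined,
     ring.zero = \<zero>\<^bsub>R\<^esub>, add = (\<oplus>\<^bsub>R\<^esub>), smult = (\<otimes>\<^bsub>R\<^esub>)\<rparr>"

lemma regular_module_simps [simp]:
  "carrier (regular_module R) = carrier R" "\<zero>\<^bsub>regular_module R\<^esub> = \<zero>\<^bsub>R\<^esub>"
  "x \<oplus>\<^bsub>regular_module R\<^esub> y = x \<oplus>\<^bsub>R\<^esub> y" "r \<odot>\<^bsub>regular_module R\<^esub> x = r \<otimes>\<^bsub>R\<^esub> x"
  by (simp_all add: regular_module_def)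

lemma regular_module: assumes "cring R" shows "module R (regular_module R)"
proof -
  interpret cring R by fact
  show ?thesis
  proof (rule moduleI)
    show "abelian_group (regular_module R)"
    proof (rule abelian_groupI)
      fix x assume "x \<in> carrier (regular_module R)"
      then show "\<exists>y \<in> carrier (regular_module R). y \<oplus>\<^bsub>regular_module R\<^esub> x = \<zero>\<^bsub>regular_module R\<^esub>"
        by (intro bexI[of _ "\<ominus>\<^bsub>R\<^esub> x"]) (auto simp: l_neg)
    qed (auto simp: a_ac)
  qed (auto simp: assms l_distr r_distr m_assoc)
qed

lemma submodule_regular_ideal:
  assumes "cring R" "submodule I R (regular_module R)" shows "ideal I R"
proof -
  interpret cring R by fact
  note m = regular_module[OF assms(1)]
  note S = submodule_simps[OF m assms(2)]
  show ?thesis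
  proof (rule idealI)
    show "ring R" by unfold_locales
    show "subgroup I (add_monoid R)"
    proof (rule add.subgroupI)
      show "I \<subseteq> carrier R" "I \<noteq> {}" using S by auto
      fix a assume a: "a \<in> I"
      have "(\<ominus>\<^bsub>R\<^esub> \<one>\<^bsub>R\<^esub>) \<otimes>\<^bsub>R\<^esub> a = \<ominus>\<^bsub>R\<^esub> a" using S(2)[OF a] by (simp add: l_minus)
      then show "\<ominus>\<^bsub>R\<^esub> a \<in> I" using S(5)[OF _ a, of "\<ominus>\<^bsub>R\<^esub> \<one>\<^bsub>R\<^esub>"] by simp
    qed (use S in auto)
  next
    fix a x assume "a \<in> I" "x \<in> carrier R"
    then show "x \<otimes>\<^bsub>R\<^esub> a \<in> I" "a \<otimes>\<^bsub>R\<^esub> x \<in> I" using S(5)[of x a] S(2)[of a] m_comm[of a x] by auto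
  qed
qed

lemma lin_orbit: assumes "module R A" "x \<in> carrier A" shows "lin R (regular_module R) A (\<lambda>r. r \<odot>\<^bsub>A\<^esub> x)"
  by (rule linI) (use assms regular_module[OF mod_cring[OF assms(1)]] in
    \<open>auto simp: mod_closed[OF assms(1)] mod_smult_l_distr[OF assms(1)] mod_smult_assoc[OF assms(1)]\<close>)

text \<open>For \<open>H = {\<zero>}\<close> this is the annihilator of \<open>x\<close>; in general it allows facts about generators of an
  ideal to be extended to the whole ideal.\<close>

lemma conductor_ideal:
  fixes A :: "('r, 'a) module"
  assumes "module R A" "submodule H R A" "x \<in> carrier A"
  shows "ideal {r \<in> carrier R. r \<odot>\<^bsub>A\<^esub> x \<in> H} R"
  using submodule_vimage[OF lin_orbit[OF assms(1,3)] assms(2)] submodule_regular_ideal mod_cring[OF assms(1)] by auto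

lemma lspan_submodule: assumes m: "module R A" and "set xs \<subseteq> carrier A" shows "submodule (lspan R A xs) R A"
  using assms(2)
proof (induction xs)
  case Nil show ?case using submodule_zero[OF m] by simp
next
  case (Cons x xs)
  have "submodule ((\<lambda>r. r \<odot>\<^bsub>A\<^esub> x) ` carrier R) R A"
    using submodule_image[OF lin_orbit[OF m] submodule_carrier[OF regular_module[OF mod_cring[OF m]]]] Cons.prems by auto
  moreover have "lspan R A (x # xs) = sub_sum A ((\<lambda>r. r \<odot>\<^bsub>A\<^esub> x) ` carrier R) (lspan R A xs)"
    unfolding sub_sum_def by auto
  ultimately show ?case using submodule_sub_sum[OF m] Cons by simp
qed

lemma lspan_mem: assumes m: "module R A" and "set xs \<subseteq> carrier A" shows "set xs \<subseteq> lspan R A xs"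
  using assms(2)
proof (induction xs)
  case (Cons x xs)
  have S: "submodule (lspan R A xs) R A" by (rule lspan_submodule[OF m]) (use Cons.prems in auto)
  have R: "cring R" by (rule mod_cring[OF m])
  have "x = \<one>\<^bsub>R\<^esub> \<odot>\<^bsub>A\<^esub> x \<oplus>\<^bsub>A\<^esub> \<zero>\<^bsub>A\<^esub>" using Cons.prems by (simp add: mod_simps[OF m])
  then have "x \<in> lspan R A (x # xs)" using submodule_simps(3)[OF m S] cring.axioms(1)[OF R]
    by (auto intro!: exI[of _ "\<one>\<^bsub>R\<^esub>"] exI[of _ "\<zero>\<^bsub>A\<^esub>"] simp: ring.ring_simprules)
  moreover have "y \<in> lspan R A (x # xs)" if "y \<in> lspan R A xs" for y
  proof -
    have y: "y \<in> carrier A" using that submodule_simps(2)[OF m S] by auto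
    have "y = \<zero>\<^bsub>R\<^esub> \<odot>\<^bsub>A\<^esub> x \<oplus>\<^bsub>A\<^esub> y" using Cons.prems y by (simp add: mod_simps[OF m])
    moreover have "\<zero>\<^bsub>R\<^esub> \<in> carrier R" using cring.axioms(1)[OF R] by (simp add: ring.ring_simprules)
    ultimately show ?thesis using that by auto
  qed
  ultimately show ?case using Cons by auto
qed auto

lemma lspan_least: assumes m: "module R A" and H: "submodule H R A" and "set xs \<subseteq> H" shows "lspan R A xs \<subseteq> H"
  using assms(3)
proof (induction xs)
  case Nil then show ?case using submodule_simps[OF m H] by simp
next
  case (Cons x xs)
  then show ?case using submodule_simps(4,5)[OF m H] by auto
qed

lemma lspan_sub: "lspan R (sub A H) xs = lspan R A xs"
  by (induction xs) auto

lemma lspan_image: assumes f: "lin R A B f" and "set xs \<subseteq> carrier A" shows "f ` lspan R A xs = lspan R B (map f xs)"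
  using assms(2)
proof (induction xs)
  case Nil then show ?case using lin_zero[OF f] by simp
next
  case (Cons x xs)
  have m: "module R A" using f lin_module by auto
  have S: "submodule (lspan R A xs) R A" by (rule lspan_submodule[OF m]) (use Cons.prems in auto)
  have e: "f (r \<odot>\<^bsub>A\<^esub> x \<oplus>\<^bsub>A\<^esub> y) = r \<odot>\<^bsub>B\<^esub> f x \<oplus>\<^bsub>B\<^esub> f y" if "r \<in> carrier R" "y \<in> lspan R A xs" for r y
    using that submodule_simps(2)[OF m S] Cons.prems by (simp add: lin_simps[OF f] mod_closed[OF m])
  have "f ` lspan R A (x # xs) = {r \<odot>\<^bsub>B\<^esub> f x \<oplus>\<^bsub>B\<^esub> f y | r y. r \<in> carrier R \<and> y \<in> lspan R A xs}"
    using e by (auto simp: image_def) metis+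
  also have "\<dots> = lspan R B (map f (x # xs))" using Cons by (auto simp flip: Cons.IH)
  finally show ?case .
qed

lemma finite_module_fin_gen: assumes "finite_module R A" shows "fin_gen R A"
proof -
  obtain X where X: "module R A" "finite X" "X \<subseteq> carrier A" "submodule_span R A X = carrier A"
    using assms unfolding finite_module_def by blast
  obtain xs where xs: "set xs = X" using finite_list[OF X(2)] by blast
  have "submodule (lspan R A xs) R A" by (rule lspan_submodule) (use X xs in auto)
  moreover have "X \<subseteq> lspan R A xs" using lspan_mem[OF X(1)] xs X by auto
  ultimately have "carrier A \<subseteq> lspan R A xs" using X(4) unfolding submodule_span_def by blast
  moreover have "lspan R A xs \<subseteq> carrier A" by (rule lspan_least) (use X xs submodule_carrier in auto)
  ultimately show ?thesis unfolding fin_gen_def using X xs by blast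
qed

lemma fin_gen_module: "fin_gen R A \<Longrightarrow> module R A"
  by (simp add: fin_gen_def)

text \<open>Generators of the kernel and lifts of generators of the image generate together, because an
  element can be corrected by a combination of the lifts until it lies in the kernel.\<close>

lemma fin_gen_extension:
  assumes f: "lin R A B f" and ys: "set ys \<subseteq> carrier A" "{a \<in> carrier A. f a = \<zero>\<^bsub>B\<^esub>} \<subseteq> lspan R A ys"
    and zs: "set zs \<subseteq> carrier A" "f ` carrier A \<subseteq> lspan R B (map f zs)"
  shows "fin_gen R A"
proof -
  have m: "module R A" "module R B" using lin_module[OF f] by auto
  have c: "set (zs @ ys) \<subseteq> carrier A" using ys zs by simp
  have S: "submodule (lspan R A (zs @ ys)) R A" by (rule lspan_submodule[OF m(1) c])
  note s = submodule_simps[OF m(1) S]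
  have mem: "set zs \<subseteq> lspan R A (zs @ ys)" "set ys \<subseteq> lspan R A (zs @ ys)" using lspan_mem[OF m(1) c] by auto
  have "a \<in> lspan R A (zs @ ys)" if a: "a \<in> carrier A" for a
  proof -
    have "f a \<in> f ` lspan R A zs" using zs a lspan_image[OF f zs(1)] by auto
    then obtain b where b: "b \<in> lspan R A zs" "f a = f b" by auto
    have bG: "b \<in> lspan R A (zs @ ys)" using b(1) lspan_least[OF m(1) S mem(1)] by auto
    have bA: "b \<in> carrier A" using bG s(2) by auto
    have "f (a \<oplus>\<^bsub>A\<^esub> \<ominus>\<^bsub>A\<^esub> b) = \<zero>\<^bsub>B\<^esub>"
      using a bA b(2) by (simp add: lin_simps[OF f] mod_closed[OF m(1)] mod_simps[OF m(2)])
    then have "a \<oplus>\<^bsub>A\<^esub> \<ominus>\<^bsub>A\<^esub> b \<in> lspan R A (zs @ ys)"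
      using ys(2) lspan_least[OF m(1) S mem(2)] mod_closed(1,3)[OF m(1)] a bA by blast
    then show ?thesis using submodule_add_iff[OF m(1) S a, of "\<ominus>\<^bsub>A\<^esub> b"] s(6)[OF bG] by simp
  qed
  then show ?thesis unfolding fin_gen_def using m c s(1) by blast
qed

text \<open>The type \<open>'u\<close> is the universe in which projective modules and resolutions are formed. The
  parameter \<open>U\<close> only makes this type visible to the locale.\<close>

locale noeth_universe = cring R for R :: "('r, 's) ring_scheme" (structure) +
  fixes U :: "'u itself"
  assumes infinite_universe: "infinite (UNIV :: 'u set)"
    and ring_lepoll: "carrier R \<lesssim> (UNIV :: 'u set)"
    and noetherian: "noetherian_ring R"
begin

text \<open>Hilbert's argument: the leading coefficients form an ideal, whose finitely many generators come
  from elements of \<open>H\<close>; subtracting combinations of these elements leads into the span of the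
  remaining generators.\<close>

lemma submodule_fg:
  assumes m: "module R A" and xs: "set xs \<subseteq> carrier A" and H: "submodule H R A" "H \<subseteq> lspan R A xs"
  shows "\<exists>ys. set ys \<subseteq> H \<and> H = lspan R A ys"
  using xs H
proof (induction xs arbitrary: H)
  case Nil
  then have "H = {\<zero>\<^bsub>A\<^esub>}" using submodule_simps[OF m Nil.prems(2)] by auto
  then show ?case by (intro exI[of _ "[]"]) auto
next
  case (Cons x xs)
  note h = submodule_simps[OF m Cons.prems(2)]
  have x: "x \<in> carrier A" and xs: "set xs \<subseteq> carrier A" using Cons.prems by auto
  have S: "submodule (lspan R A xs) R A" by (rule lspan_submodule[OF m xs])
  note s = submodule_simps[OF m S]
  have SH: "submodule (H \<inter> lspan R A xs) R A" by (rule submoduleI'[OF m]) (use h s in auto)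
  obtain ys where ys: "set ys \<subseteq> H \<inter> lspan R A xs" "H \<inter> lspan R A xs = lspan R A ys"
    using Cons.IH[OF xs SH] by blast
  \<comment> \<open>The leading coefficients of elements of \<open>H\<close> form an ideal.\<close>
  define I where "I G = {r \<in> carrier R. r \<odot>\<^bsub>A\<^esub> x \<in> sub_sum A G (lspan R A xs)}" for G
  have I_iff: "r \<in> I G \<longleftrightarrow> r \<in> carrier R \<and> (\<exists>y \<in> lspan R A xs. r \<odot>\<^bsub>A\<^esub> x \<oplus>\<^bsub>A\<^esub> y \<in> G)" if G: "submodule G R A" for r G
  proof -
    note g = submodule_simps[OF m G]
    have "(\<exists>y \<in> lspan R A xs. r \<odot>\<^bsub>A\<^esub> x \<oplus>\<^bsub>A\<^esub> y \<in> G) \<longleftrightarrow> r \<odot>\<^bsub>A\<^esub> x \<in> sub_sum A G (lspan R A xs)" if r: "r \<in> carrier R"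
    proof
      assume "\<exists>y \<in> lspan R A xs. r \<odot>\<^bsub>A\<^esub> x \<oplus>\<^bsub>A\<^esub> y \<in> G"
      then obtain y where y: "y \<in> lspan R A xs" "r \<odot>\<^bsub>A\<^esub> x \<oplus>\<^bsub>A\<^esub> y \<in> G" by auto
      have "r \<odot>\<^bsub>A\<^esub> x = (r \<odot>\<^bsub>A\<^esub> x \<oplus>\<^bsub>A\<^esub> y) \<oplus>\<^bsub>A\<^esub> \<ominus>\<^bsub>A\<^esub> y"
        using r x s(2)[OF y(1)] by (simp add: mod_ac[OF m] mod_closed[OF m] mod_simps[OF m])
      then show "r \<odot>\<^bsub>A\<^esub> x \<in> sub_sum A G (lspan R A xs)" unfolding sub_sum_def using y s(6) by blast
    next
      assume "r \<odot>\<^bsub>A\<^esub> x \<in> sub_sum A G (lspan R A xs)"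
      then obtain g y where gy: "g \<in> G" "y \<in> lspan R A xs" "r \<odot>\<^bsub>A\<^esub> x = g \<oplus>\<^bsub>A\<^esub> y" unfolding sub_sum_def by auto
      then have "r \<odot>\<^bsub>A\<^esub> x \<oplus>\<^bsub>A\<^esub> \<ominus>\<^bsub>A\<^esub> y = g"
        using g(2)[OF gy(1)] s(2)[OF gy(2)] by (simp add: mod_ac[OF m] mod_closed[OF m] mod_simps[OF m])
      then show "\<exists>y \<in> lspan R A xs. r \<odot>\<^bsub>A\<^esub> x \<oplus>\<^bsub>A\<^esub> y \<in> G" using gy s(6) by metis
    qed
    then show ?thesis unfolding I_def by auto
  qed
  have I_ideal: "ideal (I G) R" if "submodule G R A" for G
    unfolding I_def by (rule conductor_ideal[OF m submodule_sub_sum[OF m that S] x])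
  obtain F where F: "F \<subseteq> carrier R" "finite F" "I H = Idl F"
    using noetherian_ring.finetely_gen[OF noetherian I_ideal[OF Cons.prems(2)]] by auto
  have "F \<subseteq> I H" using genideal_self[OF F(1)] F(3) by simp
  then have "\<forall>r \<in> F. \<exists>y. y \<in> lspan R A xs \<and> r \<odot>\<^bsub>A\<^esub> x \<oplus>\<^bsub>A\<^esub> y \<in> H" using I_iff[OF Cons.prems(2)] by blast
  then obtain c where c: "\<And>r. r \<in> F \<Longrightarrow> c r \<in> lspan R A xs \<and> r \<odot>\<^bsub>A\<^esub> x \<oplus>\<^bsub>A\<^esub> c r \<in> H" by metis
  obtain fs where fs: "set fs = F" using finite_list[OF F(2)] by blast
  define zs where "zs = map (\<lambda>r. r \<odot>\<^bsub>A\<^esub> x \<oplus>\<^bsub>A\<^esub> c r) fs @ ys"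
  have zsH: "set zs \<subseteq> H" unfolding zs_def using c fs ys by auto
  then have zsA: "set zs \<subseteq> carrier A" using h(1) by auto
  have G: "submodule (lspan R A zs) R A" by (rule lspan_submodule[OF m zsA])
  note g = submodule_simps[OF m G]
  have zsG: "set zs \<subseteq> lspan R A zs" by (rule lspan_mem[OF m zsA])
  have GH: "lspan R A zs \<subseteq> H" by (rule lspan_least[OF m Cons.prems(2) zsH])
  have ysG: "lspan R A ys \<subseteq> lspan R A zs" by (rule lspan_least[OF m G]) (use zsG in \<open>auto simp: zs_def\<close>)
  have "F \<subseteq> I (lspan R A zs)"
  proof
    fix r assume r: "r \<in> F"
    then have "r \<odot>\<^bsub>A\<^esub> x \<oplus>\<^bsub>A\<^esub> c r \<in> set zs" using fs by (auto simp: zs_def)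
    then show "r \<in> I (lspan R A zs)" unfolding I_iff[OF G] using c[OF r] zsG F(1) r by blast
  qed
  then have IHG: "I H \<subseteq> I (lspan R A zs)" unfolding F(3) by (rule genideal_minimal[OF I_ideal[OF G]])
  have "H \<subseteq> lspan R A zs"
  proof
    fix z assume z: "z \<in> H"
    then obtain r y where ry: "r \<in> carrier R" "y \<in> lspan R A xs" "z = r \<odot>\<^bsub>A\<^esub> x \<oplus>\<^bsub>A\<^esub> y" using Cons.prems(3) by auto
    then have "r \<in> I H" using I_iff[OF Cons.prems(2)] z by auto
    then obtain w where w: "w \<in> lspan R A xs" "r \<odot>\<^bsub>A\<^esub> x \<oplus>\<^bsub>A\<^esub> w \<in> lspan R A zs" using IHG I_iff[OF G] by auto
    let ?g = "r \<odot>\<^bsub>A\<^esub> x \<oplus>\<^bsub>A\<^esub> w"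
    have "z \<oplus>\<^bsub>A\<^esub> \<ominus>\<^bsub>A\<^esub> ?g = y \<oplus>\<^bsub>A\<^esub> \<ominus>\<^bsub>A\<^esub> w"
      using ry x s(2)[OF ry(2)] s(2)[OF w(1)] by (simp add: mod_ac[OF m] mod_closed[OF m] mod_simps[OF m])
    then have "z \<oplus>\<^bsub>A\<^esub> \<ominus>\<^bsub>A\<^esub> ?g \<in> lspan R A xs" using s(4)[OF ry(2) s(6)[OF w(1)]] by simp
    moreover have "z \<oplus>\<^bsub>A\<^esub> \<ominus>\<^bsub>A\<^esub> ?g \<in> H" using h(4)[OF z h(6)] GH w by auto
    ultimately have "z \<oplus>\<^bsub>A\<^esub> \<ominus>\<^bsub>A\<^esub> ?g \<in> lspan R A zs" using ys(2) ysG by auto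
    then show "z \<in> lspan R A zs" using submodule_add_iff[OF m G, of z "\<ominus>\<^bsub>A\<^esub> ?g"] g(6)[OF w(2)] h(2)[OF z] by simp
  qed
  then show ?case using zsH GH by blast
qed

lemma fin_gen_submodule:
  assumes "fin_gen R A" "submodule H R A"
  shows "\<exists>ys. set ys \<subseteq> H \<and> H = lspan R A ys" "fin_gen R (sub A H)"
proof -
  obtain xs where xs: "module R A" "set xs \<subseteq> carrier A" "carrier A = lspan R A xs" using assms unfolding fin_gen_def by auto
  have "H \<subseteq> lspan R A xs" using submodule_simps(1)[OF xs(1) assms(2)] xs(3) by simp
  then show ex: "\<exists>ys. set ys \<subseteq> H \<and> H = lspan R A ys" using submodule_fg[OF xs(1,2) assms(2)] by blast
  then show "fin_gen R (sub A H)" unfolding fin_gen_def using sub_module[OF xs(1) assms(2)] by (auto simp: lspan_sub)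
qed

text \<open>The union of a chain of submodules is finitely generated, hence equal to a member of the chain;
  so Zorn's lemma applies.\<close>

lemma maximal_submodule:
  assumes "fin_gen R A" "C \<noteq> {}" "\<And>H. H \<in> C \<Longrightarrow> submodule H R A"
  shows "\<exists>H \<in> C. \<forall>K \<in> C. H \<subseteq> K \<longrightarrow> K = H"
proof (rule subset_Zorn_nonempty[OF assms(2)])
  fix D assume D: "D \<noteq> {}" "subset.chain C D"
  have m: "module R A" using assms(1) by (rule fin_gen_module)
  have sD: "submodule H R A" if "H \<in> D" for H using D that assms(3) by (auto simp: subset.chain_def)
  have two: "\<exists>H \<in> D. x \<in> H \<and> y \<in> H" if "x \<in> \<Union>D" "y \<in> \<Union>D" for x y
  proof -
    obtain H K where HK: "H \<in> D" "K \<in> D" "x \<in> H" "y \<in> K" using \<open>x \<in> \<Union>D\<close> \<open>y \<in> \<Union>D\<close> by blast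
    then have "H \<subseteq> K \<or> K \<subseteq> H" using D(2) unfolding subset_chain_def by blast
    then show ?thesis using HK by blast
  qed
  have "submodule (\<Union>D) R A"
  proof (rule submoduleI'[OF m])
    show "\<Union>D \<subseteq> carrier A" "\<zero>\<^bsub>A\<^esub> \<in> \<Union>D" using D(1) submodule_simps(1,3)[OF m sD] by auto
    fix x y assume "x \<in> \<Union>D" "y \<in> \<Union>D"
    then show "x \<oplus>\<^bsub>A\<^esub> y \<in> \<Union>D" using two submodule_simps(4)[OF m sD] by blast
  qed (use submodule_simps(5)[OF m sD] in blast)
  then obtain ys where ys: "set ys \<subseteq> \<Union>D" "\<Union>D = lspan R A ys" using fin_gen_submodule(1)[OF assms(1)] by blast
  obtain H where H: "H \<in> D" "set ys \<subseteq> H" using finite_subset_Union_chain[OF _ ys(1) D] by blast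
  then have "\<Union>D \<subseteq> H" using ys(2) lspan_least[OF m sD] by auto
  then have "\<Union>D = H" using H(1) by auto
  then show "\<Union>D \<in> C" using H D by (auto simp: subset.chain_def)
qed

section \<open>Projective modules\<close>

lemma lepoll_copy:
  assumes "module R X" "carrier X \<lesssim> (UNIV :: 'u set)"
  obtains Y :: "('r, 'u) module" and j v where "lin R X Y j" "lin R Y X v" "j ` carrier X = carrier Y"
    "\<And>x. x \<in> carrier X \<Longrightarrow> v (j x) = x" "\<And>y. y \<in> carrier Y \<Longrightarrow> j (v y) = y"
proof -
  obtain j :: "_ \<Rightarrow> 'u" where j: "inj_on j (carrier X)" using assms(2) unfolding lepoll_def by auto
  show ?thesis
    by (rule that[OF transport_to[OF assms(1) j] transport_from[OF assms(1) j]])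
      (auto simp: transport_carrier[OF assms(1) j] j)
qed

text \<open>An infinite universe contains its own square, so direct sums can be formed inside the universe.\<close>

definition dpair :: "'u \<times> 'u \<Rightarrow> 'u" where "dpair = (SOME j. inj j)"

lemma universe_times: "(UNIV :: ('u \<times> 'u) set) \<lesssim> (UNIV :: 'u set)"
proof -
  have "(card_of ((UNIV :: 'u set) \<times> (UNIV :: 'u set)), card_of (UNIV :: 'u set)) \<in> ordLeq"
    using card_of_Times_same_infinite[OF infinite_universe] ordIso_iff_ordLeq by blast
  then have "\<exists>f. inj_on f ((UNIV :: 'u set) \<times> (UNIV :: 'u set)) \<and> f ` (UNIV \<times> UNIV) \<subseteq> (UNIV :: 'u set)"
    by (simp only: card_of_ordLeq)
  then show ?thesis by (auto simp: lepoll_def)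
qed

lemma inj_dpair: "inj dpair"
  unfolding dpair_def using universe_times someI_ex[of "\<lambda>j :: 'u \<times> 'u \<Rightarrow> 'u. inj j"] by (auto simp: lepoll_def)

definition dsum :: "('r, 'u) module \<Rightarrow> ('r, 'u) module \<Rightarrow> ('r, 'u) module" where
  "dsum A B = transport dpair (prod_module A B)"

definition dfst :: "'u \<Rightarrow> 'u" where "dfst z = fst (inv_into UNIV dpair z)"
definition dsnd :: "'u \<Rightarrow> 'u" where "dsnd z = snd (inv_into UNIV dpair z)"

lemma dfst_dpair [simp]: "dfst (dpair (a, b)) = a" and dsnd_dpair [simp]: "dsnd (dpair (a, b)) = b"
  using inj_dpair by (simp_all add: dfst_def dsnd_def)

lemma dsum_carrier: "carrier (dsum A B) = {dpair (a, b) | a b. a \<in> carrier A \<and> b \<in> carrier B}"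
  unfolding dsum_def transport_def Let_def by auto

lemma dsum_lin:
  assumes A: "module R A" and B: "module R B"
  shows dsum_module: "module R (dsum A B)"
    and dfst_lin: "lin R (dsum A B) A dfst"
    and dsnd_lin: "lin R (dsum A B) B dsnd"
    and dsum_pair_lin: "lin R X A f \<Longrightarrow> lin R X B g \<Longrightarrow> lin R X (dsum A B) (\<lambda>x. dpair (f x, g x))"
proof -
  let ?P = "prod_module A B"
  have m: "module R ?P" by (rule prod_module_module) fact+
  have inj: "inj_on dpair (carrier ?P)" using inj_dpair by (rule inj_on_subset) auto
  note T = transport_lin[OF m inj]
  show "module R (dsum A B)" unfolding dsum_def using T(2) lin_module by blast
  have v: "inv_into (carrier ?P) dpair z = inv_into UNIV dpair z" if "z \<in> carrier (dsum A B)" for z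
    using that inj inj_dpair unfolding dsum_carrier by (auto simp: inv_into_f_f)
  have v': "lin R (dsum A B) ?P (inv_into UNIV dpair)"
    using lin_cong[OF T(3)] v unfolding dsum_def by blast
  have "lin R ?P A fst" "lin R ?P B snd" by (rule linI; use A B m in auto)+
  then show "lin R (dsum A B) A dfst" "lin R (dsum A B) B dsnd"
    using lin_compose[OF v'] unfolding dfst_def[abs_def] dsnd_def[abs_def] by auto
  assume f: "lin R X A f" and g: "lin R X B g"
  have "lin R X ?P (\<lambda>x. (f x, g x))"
    by (rule linI) (use lin_module[OF f] m in \<open>auto simp: lin_simps[OF f] lin_simps[OF g]\<close>)
  then show "lin R X (dsum A B) (\<lambda>x. dpair (f x, g x))"
    using lin_compose T(2) unfolding dsum_def by blast
qed

lemma dsum_eq: "z \<in> carrier (dsum A B) \<Longrightarrow> dpair (dfst z, dsnd z) = z"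
  unfolding dsum_carrier by auto

text \<open>Projectivity speaks about surjections between modules on \<open>'u\<close>. Here \<open>B\<close> may have any type:
  \<open>B\<close> is replaced by the quotient of \<open>A\<close> by the kernel of \<open>g\<close>, of which there is a copy on the type of
  \<open>A\<close>.\<close>

lemma projective_lift:
  fixes P A :: "('r, 'u) module"
  assumes P: "projective_module R P" and g: "lin R A B g" and f: "lin R P B f"
    and im: "\<And>x. x \<in> carrier P \<Longrightarrow> f x \<in> g ` carrier A"
  obtains h where "lin R P A h" "\<And>x. x \<in> carrier P \<Longrightarrow> g (h x) = f x"
proof -
  have mA: "module R A" and mB: "module R B" and mP: "module R P" using lin_module[OF g] lin_module[OF f] by auto
  define K where "K = {a \<in> carrier A. g a = \<zero>\<^bsub>B\<^esub>}"
  have K: "submodule K R A" unfolding K_def by (rule submodule_ker[OF g])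
  let ?Q = "quot_copy A K" and ?q = "quot_rep A K"
  note q = quot_rep_lin[OF mA K] and qs = quot_rep_surj[OF mA K] and qz = quot_rep_zero[OF mA K]
  have mQ: "module R ?Q" using lin_module[OF q] by auto
  have eq: "?q a = ?q b \<longleftrightarrow> g a = g b" if ab: "a \<in> carrier A" "b \<in> carrier A" for a b
  proof -
    have "?q a = ?q b \<longleftrightarrow> ?q (a \<oplus>\<^bsub>A\<^esub> \<ominus>\<^bsub>A\<^esub> b) = \<zero>\<^bsub>?Q\<^esub>"
      using ab by (simp add: lin_simps[OF q] mod_closed[OF mA] mod_diff_zero[OF mQ])
    also have "\<dots> \<longleftrightarrow> g (a \<oplus>\<^bsub>A\<^esub> \<ominus>\<^bsub>A\<^esub> b) = \<zero>\<^bsub>B\<^esub>"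
      using ab qz[of "a \<oplus>\<^bsub>A\<^esub> \<ominus>\<^bsub>A\<^esub> b"] by (simp add: K_def mod_closed[OF mA])
    also have "\<dots> \<longleftrightarrow> g a = g b" using ab by (simp add: lin_simps[OF g] mod_closed[OF mA] mod_diff_zero[OF mB])
    finally show ?thesis .
  qed
  define s where "s x = (SOME a. a \<in> carrier A \<and> g a = f x)" for x
  have s: "s x \<in> carrier A" "g (s x) = f x" if "x \<in> carrier P" for x
  proof -
    have "\<exists>a. a \<in> carrier A \<and> g a = f x" using im[OF that] by force
    from someI_ex[OF this] show "s x \<in> carrier A" "g (s x) = f x" unfolding s_def by blast+
  qed
  have l: "lin R P ?Q (\<lambda>x. ?q (s x))"
  proof (rule linI[OF mP mQ])
    fix x y assume xy: "x \<in> carrier P" "y \<in> carrier P"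
    have "?q (s (x \<oplus>\<^bsub>P\<^esub> y)) = ?q (s x \<oplus>\<^bsub>A\<^esub> s y)"
      using xy s by (simp add: eq mod_closed[OF mA] mod_closed[OF mP] lin_simps[OF g] lin_simps[OF f])
    then show "?q (s (x \<oplus>\<^bsub>P\<^esub> y)) = ?q (s x) \<oplus>\<^bsub>?Q\<^esub> ?q (s y)" using xy s by (simp add: lin_simps[OF q])
  next
    fix r x assume xy: "r \<in> carrier R" "x \<in> carrier P"
    have "?q (s (r \<odot>\<^bsub>P\<^esub> x)) = ?q (r \<odot>\<^bsub>A\<^esub> s x)"
      using xy s by (simp add: eq mod_closed[OF mA] mod_closed[OF mP] lin_simps[OF g] lin_simps[OF f])
    then show "?q (s (r \<odot>\<^bsub>P\<^esub> x)) = r \<odot>\<^bsub>?Q\<^esub> ?q (s x)" using xy s by (simp add: lin_simps[OF q])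
  qed (use s lin_closed[OF q] in auto)
  have "\<exists>h \<in> module_homs R P A. \<forall>x \<in> carrier P. restrict ?q (carrier A) (h x) = restrict (\<lambda>x. ?q (s x)) (carrier P) x"
    using P[unfolded projective_module_def, THEN conjunct2, rule_format, OF conjI[OF mA conjI[OF mQ
      conjI[OF lin_module_homs[OF q] conjI[OF _ lin_module_homs[OF l]]]]]] qs
    by (simp only: image_restrict_eq)
  then obtain h where h: "h \<in> module_homs R P A"
    "\<And>x. x \<in> carrier P \<Longrightarrow> restrict ?q (carrier A) (h x) = ?q (s x)" by auto
  have hl: "lin R P A h" by (rule module_homs_lin[OF mP mA h(1)])
  show thesis
  proof (rule that[OF hl])
    fix x assume x: "x \<in> carrier P"
    then have "?q (h x) = ?q (s x)" using h(2) lin_closed[OF hl] by force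
    then show "g (h x) = f x" using eq lin_closed[OF hl x] s[OF x] by auto
  qed
qed

text \<open>Testing with plain linear maps suffices, as the values outside the carriers can be cut off.\<close>

lemma projective_moduleI:
  fixes P :: "('r, 'u) module"
  assumes "module R P"
    and "\<And>(A :: ('r, 'u) module) (B :: ('r, 'u) module) g f. lin R A B g \<Longrightarrow> g ` carrier A = carrier B \<Longrightarrow> lin R P B f \<Longrightarrow>
      \<exists>h. lin R P A h \<and> (\<forall>x \<in> carrier P. g (h x) = f x)"
  shows "projective_module R P"
  unfolding projective_module_def
proof (intro conjI allI impI)
  fix A B :: "('r, 'u) module" and g f
  assume a: "module R A \<and> module R B \<and> g \<in> module_homs R A B \<and> g ` carrier A = carrier B \<and> f \<in> module_homs R P B"
  then obtain h where h: "lin R P A h" "\<forall>x \<in> carrier P. g (h x) = f x"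
    using assms(2)[of A B g f] module_homs_lin assms(1) by blast
  then show "\<exists>h \<in> module_homs R P A. \<forall>x \<in> carrier P. g (h x) = f x"
    using lin_module_homs[OF h(1)] by (intro bexI[of _ "restrict h (carrier P)"]) auto
qed (rule assms(1))

lemma projective_dsum:
  assumes A: "projective_module R A" and B: "projective_module R B"
  shows "projective_module R (dsum A B)"
proof -
  have m: "module R A" "module R B" using assms by (auto simp: projective_module_def)
  show ?thesis
  proof (rule projective_moduleI[OF dsum_module[OF m]])
    fix X Y :: "('r, 'u) module" and g f
    assume g: "lin R X Y g" "g ` carrier X = carrier Y" and f: "lin R (dsum A B) Y f"
    let ?a = "\<lambda>a. dpair (a, \<zero>\<^bsub>B\<^esub>)" and ?b = "\<lambda>b. dpair (\<zero>\<^bsub>A\<^esub>, b)"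
    have ia: "lin R A (dsum A B) ?a" by (rule dsum_pair_lin[OF m lin_ident[OF m(1)] lin_const_zero[OF m(1,2)]])
    have ib: "lin R B (dsum A B) ?b" by (rule dsum_pair_lin[OF m lin_const_zero[OF m(2,1)] lin_ident[OF m(2)]])
    have fa: "lin R A Y (\<lambda>a. f (?a a))" and fb: "lin R B Y (\<lambda>b. f (?b b))"
      by (rule lin_compose[OF ia f], rule lin_compose[OF ib f])
    obtain h where h: "lin R A X h" "\<And>x. x \<in> carrier A \<Longrightarrow> g (h x) = f (?a x)"
      using projective_lift[OF A g(1) fa] lin_closed[OF fa] g(2) by metis
    obtain k where k: "lin R B X k" "\<And>x. x \<in> carrier B \<Longrightarrow> g (k x) = f (?b x)"
      using projective_lift[OF B g(1) fb] lin_closed[OF fb] g(2) by metis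
    let ?h = "\<lambda>z. h (dfst z) \<oplus>\<^bsub>X\<^esub> k (dsnd z)"
    have "lin R (dsum A B) X ?h"
      by (rule lin_sum[OF lin_compose[OF dfst_lin[OF m] h(1)] lin_compose[OF dsnd_lin[OF m] k(1)]])
    moreover have "g (?h z) = f z" if z: "z \<in> carrier (dsum A B)" for z
    proof -
      obtain a b where ab: "a \<in> carrier A" "b \<in> carrier B" "z = dpair (a, b)" using z unfolding dsum_carrier by auto
      have "inj_on dpair (carrier (prod_module A B))" using inj_dpair by (rule inj_on_subset) auto
      note T = transport_to[OF prod_module_module[OF m] this]
      have "z = ?a a \<oplus>\<^bsub>dsum A B\<^esub> ?b b"
        using lin_add[OF T, of "(a, \<zero>\<^bsub>B\<^esub>)" "(\<zero>\<^bsub>A\<^esub>, b)"] ab unfolding dsum_def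
        by (simp add: mod_closed[OF m(1)] mod_closed[OF m(2)] mod_simps[OF m(1)] mod_simps[OF m(2)])
      then have "f z = f (?a a) \<oplus>\<^bsub>Y\<^esub> f (?b b)"
        using lin_add[OF f] lin_closed[OF ia ab(1)] lin_closed[OF ib ab(2)] by simp
      then show ?thesis using ab h k by (simp add: lin_add[OF g(1)] lin_closed[OF h(1)] lin_closed[OF k(1)])
    qed
    ultimately show "\<exists>h. lin R (dsum A B) X h \<and> (\<forall>x \<in> carrier (dsum A B). g (h x) = f x)" by blast
  qed
qed

lemma fin_gen_dsum: assumes A: "fin_gen R A" and B: "fin_gen R B" shows "fin_gen R (dsum A B)"
proof -
  have m: "module R A" "module R B" using assms by (auto simp: fin_gen_def)
  obtain xs ys where xs: "set xs \<subseteq> carrier A" "carrier A = lspan R A xs" and ys: "set ys \<subseteq> carrier B" "carrier B = lspan R B ys"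
    using assms unfolding fin_gen_def by auto
  let ?a = "\<lambda>a. dpair (a, \<zero>\<^bsub>B\<^esub>)" and ?b = "\<lambda>b. dpair (\<zero>\<^bsub>A\<^esub>, b)"
  have ia: "lin R A (dsum A B) ?a" by (rule dsum_pair_lin[OF m lin_ident[OF m(1)] lin_const_zero[OF m(1,2)]])
  have ib: "lin R B (dsum A B) ?b" by (rule dsum_pair_lin[OF m lin_const_zero[OF m(2,1)] lin_ident[OF m(2)]])
  show ?thesis
  proof (rule fin_gen_extension[OF dfst_lin[OF m], of "map ?b ys" "map ?a xs"])
    show "set (map ?b ys) \<subseteq> carrier (dsum A B)" "set (map ?a xs) \<subseteq> carrier (dsum A B)"
      using lin_closed[OF ib] lin_closed[OF ia] xs ys by auto
    show "{a \<in> carrier (dsum A B). dfst a = \<zero>\<^bsub>A\<^esub>} \<subseteq> lspan R (dsum A B) (map ?b ys)"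
      unfolding lspan_image[OF ib ys(1), symmetric] ys(2)[symmetric] dsum_carrier by auto
    have "map dfst (map ?a xs) = xs" by (simp add: comp_def)
    then show "dfst ` carrier (dsum A B) \<subseteq> lspan R A (map dfst (map ?a xs))"
      using xs(2) lin_closed[OF dfst_lin[OF m]] by auto
  qed
qed

text \<open>A copy of \<open>R\<close> in the universe, with its basis element \<open>g\<close>.\<close>

lemma ex_free_cyclic:
  obtains P :: "('r, 'u) module" and g where "projective_module R P" "fin_gen R P" "g \<in> carrier P"
    "\<And>(A :: ('r, 'u) module) a. module R A \<Longrightarrow> a \<in> carrier A \<Longrightarrow> \<exists>f. lin R P A f \<and> (\<forall>r \<in> carrier R. f (r \<odot>\<^bsub>P\<^esub> g) = r \<odot>\<^bsub>A\<^esub> a)"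
proof -
  let ?R = "regular_module R"
  have mR: "module R ?R" by (rule regular_module) (rule is_cring)
  obtain P :: "('r, 'u) module" and j v where P: "lin R ?R P j" "lin R P ?R v" "j ` carrier ?R = carrier P"
    "\<And>x. x \<in> carrier ?R \<Longrightarrow> v (j x) = x" "\<And>y. y \<in> carrier P \<Longrightarrow> j (v y) = y"
    using lepoll_copy[OF mR] ring_lepoll by (metis regular_module_simps(1))
  let ?g = "j \<one>"
  have g: "?g \<in> carrier P" using lin_closed[OF P(1), of \<one>] by simp
  have j: "j r = r \<odot>\<^bsub>P\<^esub> ?g" if "r \<in> carrier R" for r using lin_smult[OF P(1) that, of \<one>] that by simp
  have univ: "\<exists>f. lin R P A f \<and> (\<forall>r \<in> carrier R. f (r \<odot>\<^bsub>P\<^esub> ?g) = r \<odot>\<^bsub>A\<^esub> a)"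
    if "module R A" "a \<in> carrier A" for A :: "('r, 'u) module" and a
  proof (intro exI[of _ "\<lambda>x. v x \<odot>\<^bsub>A\<^esub> a"] conjI ballI)
    show "lin R P A (\<lambda>x. v x \<odot>\<^bsub>A\<^esub> a)" by (rule lin_compose[OF P(2) lin_orbit[OF that]])
    fix r assume r: "r \<in> carrier R"
    have "v (j r) = r" by (rule P(4)) (simp add: r)
    then show "v (r \<odot>\<^bsub>P\<^esub> ?g) \<odot>\<^bsub>A\<^esub> a = r \<odot>\<^bsub>A\<^esub> a" by (simp only: j[OF r, symmetric])
  qed
  have mP: "module R P" using lin_module[OF P(1)] by auto
  have "fin_gen R P"
    unfolding fin_gen_def
  proof (intro conjI exI[of _ "[?g]"] mP)
    show "set [?g] \<subseteq> carrier P" using g by simp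
    have "carrier P = (\<lambda>r. r \<odot>\<^bsub>P\<^esub> ?g) ` carrier R" unfolding P(3)[symmetric] regular_module_simps
      by (rule image_cong[OF refl j])
    also have "\<dots> = (\<lambda>r. r \<odot>\<^bsub>P\<^esub> ?g \<oplus>\<^bsub>P\<^esub> \<zero>\<^bsub>P\<^esub>) ` carrier R"
      by (rule image_cong[OF refl]) (use g in \<open>simp add: mod_simps[OF mP] mod_closed[OF mP]\<close>)
    also have "\<dots> = lspan R P [?g]" by auto
    finally show "carrier P = lspan R P [?g]" .
  qed
  moreover have "projective_module R P"
  proof (rule projective_moduleI[OF mP])
    fix A B :: "('r, 'u) module" and p f assume p: "lin R A B p" "p ` carrier A = carrier B" and f: "lin R P B f"
    obtain a where a: "a \<in> carrier A" "p a = f ?g" using p(2) lin_closed[OF f g] by (metis imageE)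
    obtain h where h: "lin R P A h" "\<forall>r \<in> carrier R. h (r \<odot>\<^bsub>P\<^esub> ?g) = r \<odot>\<^bsub>A\<^esub> a" using univ[OF _ a(1)] lin_module[OF p(1)] by auto
    have "p (h x) = f x" if "x \<in> carrier P" for x
    proof -
      obtain r where r': "r \<in> carrier R" "x = j r" using \<open>x \<in> carrier P\<close> unfolding P(3)[symmetric] by auto
      have r: "r \<in> carrier R" "x = r \<odot>\<^bsub>P\<^esub> ?g" using r'(1) unfolding r'(2) by (simp, rule j)
      then show ?thesis using h a by (simp add: lin_smult[OF p(1)] lin_smult[OF f] g)
    qed
    then show "\<exists>h. lin R P A h \<and> (\<forall>x \<in> carrier P. p (h x) = f x)" using h by blast
  qed
  ultimately show ?thesis using that g univ by blast
qed

lemma projective_cover: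
  fixes A :: "('r, 'u) module"
  assumes "fin_gen R A"
  obtains P :: "('r, 'u) module" and f where "projective_module R P" "fin_gen R P" "lin R P A f" "f ` carrier P = carrier A"
proof -
  have m: "module R A" using assms by (rule fin_gen_module)
  obtain F :: "('r, 'u) module" and g where F: "projective_module R F" "fin_gen R F" "g \<in> carrier F"
    "\<And>(A :: ('r, 'u) module) a. module R A \<Longrightarrow> a \<in> carrier A \<Longrightarrow> \<exists>f. lin R F A f \<and> (\<forall>r \<in> carrier R. f (r \<odot>\<^bsub>F\<^esub> g) = r \<odot>\<^bsub>A\<^esub> a)"
    using ex_free_cyclic by metis
  have mF: "module R F" using F(2) by (rule fin_gen_module)
  have "\<exists>(P :: ('r, 'u) module) f. projective_module R P \<and> fin_gen R P \<and> lin R P A f \<and> lspan R A xs \<subseteq> f ` carrier P"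
    if "set xs \<subseteq> carrier A" for xs using that
  proof (induction xs)
    case Nil
    have "lin R F A (\<lambda>x. \<zero>\<^bsub>A\<^esub>)" by (rule lin_const_zero[OF mF m])
    then show ?case using F(1,2,3) by (intro exI[of _ F] exI[of _ "\<lambda>x. \<zero>\<^bsub>A\<^esub>"]) auto
  next
    case (Cons x xs)
    then obtain P :: "('r, 'u) module" and f where P: "projective_module R P" "fin_gen R P" "lin R P A f" "lspan R A xs \<subseteq> f ` carrier P"
      by auto
    have mP: "module R P" using P(2) by (rule fin_gen_module)
    obtain k where k: "lin R F A k" "\<forall>r \<in> carrier R. k (r \<odot>\<^bsub>F\<^esub> g) = r \<odot>\<^bsub>A\<^esub> x" using F(4)[OF m, of x] Cons.prems by (metis insert_subset list.simps(15))
    let ?f = "\<lambda>z. k (dfst z) \<oplus>\<^bsub>A\<^esub> f (dsnd z)"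
    have "lin R (dsum F P) A ?f"
      by (rule lin_sum[OF lin_compose[OF dfst_lin[OF mF mP] k(1)] lin_compose[OF dsnd_lin[OF mF mP] P(3)]])
    moreover have "lspan R A (x # xs) \<subseteq> ?f ` carrier (dsum F P)"
    proof
      fix z assume "z \<in> lspan R A (x # xs)"
      then obtain r y where ry: "r \<in> carrier R" "y \<in> lspan R A xs" "z = r \<odot>\<^bsub>A\<^esub> x \<oplus>\<^bsub>A\<^esub> y" by auto
      then obtain p where "p \<in> carrier P" "y = f p" using P(4) by auto
      then show "z \<in> ?f ` carrier (dsum F P)" using ry k(2) F(3) mod_closed(4)[OF mF]
        unfolding dsum_carrier by (intro image_eqI[of _ _ "dpair (r \<odot>\<^bsub>F\<^esub> g, p)"]) (simp, blast)
    qed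
    ultimately show ?case using projective_dsum[OF F(1) P(1)] fin_gen_dsum[OF F(2) P(2)] by blast
  qed
  moreover obtain xs where "set xs \<subseteq> carrier A" "carrier A = lspan R A xs" using assms by (auto simp: fin_gen_def)
  ultimately obtain P :: "('r, 'u) module" and f where P: "projective_module R P" "fin_gen R P" "lin R P A f" "carrier A \<subseteq> f ` carrier P"
    by metis
  then have "f ` carrier P = carrier A" using lin_closed[OF P(3)] by auto
  then show ?thesis using that P by blast
qed

end

section \<open>Complexes, cocycles and coboundaries\<close>

text \<open>A complex is a sequence of modules with maps \<open>d i : P (i + 1) \<rightarrow> P i\<close>. Cohomology with values in \<open>N\<close> is
  handled through the representing linear maps \<open>P i \<rightarrow> N\<close>, without forming a quotient. In degree zero
  only the zero map is a coboundary.\<close>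

definition proj_complex where
  "proj_complex R P d \<longleftrightarrow> (\<forall>i::nat. projective_module R (P i)) \<and> (\<forall>i. lin R (P (Suc i)) (P i) (d i)) \<and>
     (\<forall>i. \<forall>x \<in> carrier (P (Suc (Suc i))). d i (d (Suc i) x) = \<zero>\<^bsub>P i\<^esub>)"

definition exact_from where
  "exact_from P d n \<longleftrightarrow> (\<forall>i \<ge> n. \<forall>x \<in> carrier (P (Suc i)). d i x = \<zero>\<^bsub>P i\<^esub> \<longrightarrow> x \<in> d (Suc i) ` carrier (P (Suc (Suc i))))"

definition chain_map where
  "chain_map R P d T \<delta> F \<longleftrightarrow> (\<forall>i::nat. lin R (P i) (T i) (F i)) \<and>
     (\<forall>i. \<forall>x \<in> carrier (P (Suc i)). \<delta> i (F (Suc i) x) = F i (d i x))"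

definition cocycle where
  "cocycle R P d N i \<phi> \<longleftrightarrow> lin R (P i) N \<phi> \<and> (\<forall>x \<in> carrier (P (Suc i)). \<phi> (d i x) = \<zero>\<^bsub>N\<^esub>)"

definition coboundary where
  "coboundary R P d N i f \<longleftrightarrow> (case i of 0 \<Rightarrow> \<forall>x \<in> carrier (P 0). f x = \<zero>\<^bsub>N\<^esub>
     | Suc j \<Rightarrow> \<exists>\<chi>. lin R (P j) N \<chi> \<and> (\<forall>x \<in> carrier (P (Suc j)). f x = \<chi> (d j x)))"

lemma proj_complex_simps:
  assumes "proj_complex R P d"
  shows "projective_module R (P i)" "module R (P i)" "lin R (P (Suc i)) (P i) (d i)"
    "x \<in> carrier (P (Suc (Suc i))) \<Longrightarrow> d i (d (Suc i) x) = \<zero>\<^bsub>P i\<^esub>"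
  using assms by (auto simp: proj_complex_def projective_module_def)

lemma exact_fromD:
  "exact_from P d n \<Longrightarrow> n \<le> i \<Longrightarrow> x \<in> carrier (P (Suc i)) \<Longrightarrow> d i x = \<zero>\<^bsub>P i\<^esub> \<Longrightarrow>
     \<exists>y \<in> carrier (P (Suc (Suc i))). x = d (Suc i) y"
  by (auto simp: exact_from_def)

lemma chain_map_simps:
  assumes "chain_map R P d T \<delta> F"
  shows "lin R (P i) (T i) (F i)" "x \<in> carrier (P (Suc i)) \<Longrightarrow> \<delta> i (F (Suc i) x) = F i (d i x)"
  using assms by (auto simp: chain_map_def)

lemma cocycle_lin: "cocycle R P d N i \<phi> \<Longrightarrow> lin R (P i) N \<phi>"
  by (simp add: cocycle_def)

lemma cocycle_zero: "cocycle R P d N i \<phi> \<Longrightarrow> x \<in> carrier (P (Suc i)) \<Longrightarrow> \<phi> (d i x) = \<zero>\<^bsub>N\<^esub>"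
  by (simp add: cocycle_def)

lemma coboundary_0: "coboundary R P d N 0 f \<longleftrightarrow> (\<forall>x \<in> carrier (P 0). f x = \<zero>\<^bsub>N\<^esub>)"
  by (simp add: coboundary_def)

lemma coboundary_Suc: "coboundary R P d N (Suc j) f \<longleftrightarrow> (\<exists>\<chi>. lin R (P j) N \<chi> \<and> (\<forall>x \<in> carrier (P (Suc j)). f x = \<chi> (d j x)))"
  by (simp add: coboundary_def)

lemma coboundary_cong: "coboundary R P d N i f \<Longrightarrow> (\<And>x. x \<in> carrier (P i) \<Longrightarrow> f x = g x) \<Longrightarrow> coboundary R P d N i g"
  by (cases i) (auto simp: coboundary_0 coboundary_Suc)

lemma cocycle_cong: 
  assumes "cocycle R P d N i \<phi>" "proj_complex R P d" "\<And>x. x \<in> carrier (P i) \<Longrightarrow> \<phi> x = \<psi> x" shows "cocycle R P d N i \<psi>"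
  using assms lin_cong[OF cocycle_lin[OF assms(1)]] lin_closed[OF proj_complex_simps(3)[OF assms(2)]] by (auto simp: cocycle_def)

lemma coboundary_sum:
  assumes "coboundary R P d N i f" "coboundary R P d N i g" "module R N" shows "coboundary R P d N i (\<lambda>x. f x \<oplus>\<^bsub>N\<^esub> g x)"
proof (cases i)
  case 0 then show ?thesis using assms by (auto simp: coboundary_0 mod_simps mod_closed)
next
  case (Suc j)
  then obtain \<chi> \<chi>' where "lin R (P j) N \<chi>" "\<forall>x \<in> carrier (P (Suc j)). f x = \<chi> (d j x)"
    "lin R (P j) N \<chi>'" "\<forall>x \<in> carrier (P (Suc j)). g x = \<chi>' (d j x)" using assms by (auto simp: coboundary_Suc)
  then show ?thesis unfolding Suc coboundary_Suc by (intro exI[of _ "\<lambda>x. \<chi> x \<oplus>\<^bsub>N\<^esub> \<chi>' x"]) (auto intro: lin_sum)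
qed

lemma coboundary_post:
  assumes "coboundary R P d N i f" "lin R N N' v" shows "coboundary R P d N' i (\<lambda>x. v (f x))"
proof (cases i)
  case 0 then show ?thesis using assms by (auto simp: coboundary_0 lin_zero)
next
  case (Suc j)
  then obtain \<chi> where "lin R (P j) N \<chi>" "\<forall>x \<in> carrier (P (Suc j)). f x = \<chi> (d j x)"
    using assms by (auto simp: coboundary_Suc)
  then show ?thesis unfolding Suc coboundary_Suc using lin_compose[OF _ assms(2)] by (intro exI[of _ "\<lambda>x. v (\<chi> x)"]) auto
qed

lemma cocycle_post: assumes "cocycle R P d N i \<phi>" "lin R N N' v" shows "cocycle R P d N' i (\<lambda>x. v (\<phi> x))"
  using assms lin_compose[OF cocycle_lin[OF assms(1)] assms(2)] by (auto simp: cocycle_def lin_zero)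

lemma cocycle_sum: assumes "cocycle R P d N i \<phi>" "cocycle R P d N i \<psi>" shows "cocycle R P d N i (\<lambda>x. \<phi> x \<oplus>\<^bsub>N\<^esub> \<psi> x)"
  using assms lin_sum[OF assms[THEN cocycle_lin]] lin_module[OF cocycle_lin[OF assms(1)]]
  by (auto simp: cocycle_def mod_simps mod_closed)

lemma coboundary_cocycle:
  assumes P: "proj_complex R P d" and f: "coboundary R P d N i f" and N: "module R N" shows "cocycle R P d N i f"
proof (cases i)
  case 0
  have "lin R (P 0) N f" by (rule lin_cong[OF lin_const_zero[OF proj_complex_simps(2)[OF P] N]]) (use f 0 in \<open>auto simp: coboundary_0\<close>)
  then show ?thesis using f lin_closed[OF proj_complex_simps(3)[OF P]] unfolding 0 by (auto simp: cocycle_def coboundary_0)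
next
  case (Suc j)
  then obtain \<chi> where c: "lin R (P j) N \<chi>" "\<forall>x \<in> carrier (P (Suc j)). f x = \<chi> (d j x)"
    using f by (auto simp: coboundary_Suc)
  have "lin R (P (Suc j)) N f" by (rule lin_cong[OF lin_compose[OF proj_complex_simps(3)[OF P] c(1)]]) (use c in auto)
  then show ?thesis using c lin_closed[OF proj_complex_simps(3)[OF P]] proj_complex_simps(4)[OF P] unfolding Suc
    by (auto simp: cocycle_def lin_zero)
qed

lemma cocycle_pullback:
  assumes F: "chain_map R P d T \<delta> F" and P: "proj_complex R P d" and c: "cocycle R T \<delta> N i \<phi>"
  shows "cocycle R P d N i (\<lambda>x. \<phi> (F i x))"
  unfolding cocycle_def
  using lin_compose[OF chain_map_simps(1)[OF F] cocycle_lin[OF c]] cocycle_zero[OF c] lin_closed[OF chain_map_simps(1)[OF F]]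
  by (auto simp flip: chain_map_simps(2)[OF F])

lemma coboundary_pullback:
  assumes F: "chain_map R P d T \<delta> F" and P: "proj_complex R P d" and c: "coboundary R T \<delta> N i f"
  shows "coboundary R P d N i (\<lambda>x. f (F i x))"
proof (cases i)
  case 0 then show ?thesis using c lin_closed[OF chain_map_simps(1)[OF F]] by (auto simp: coboundary_0)
next
  case (Suc j)
  then obtain \<chi> where "lin R (T j) N \<chi>" "\<forall>x \<in> carrier (T (Suc j)). f x = \<chi> (\<delta> j x)"
    using c by (auto simp: coboundary_Suc)
  then show ?thesis unfolding Suc coboundary_Suc
    using lin_compose[OF chain_map_simps(1)[OF F]] lin_closed[OF chain_map_simps(1)[OF F]]
    by (intro exI[of _ "\<lambda>x. \<chi> (F j x)"]) (auto simp: chain_map_simps(2)[OF F])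
qed

lemma chain_map_compose:
  assumes F: "chain_map R P d T \<delta> F" and G: "chain_map R T \<delta> V \<epsilon> G"
  shows "chain_map R P d V \<epsilon> (\<lambda>i x. G i (F i x))"
  unfolding chain_map_def
  using lin_compose[OF chain_map_simps(1)[OF F] chain_map_simps(1)[OF G]] lin_closed[OF chain_map_simps(1)[OF F]]
    chain_map_simps(2)[OF F] chain_map_simps(2)[OF G] by auto

section \<open>Resolutions and the comparison theorem\<close>

text \<open>A projective resolution of \<open>M / W\<close>, with the augmentation lifted to a map into \<open>M\<close>. All
  resolutions that occur are of this kind, and all maps between them that occur are induced by the
  identity of \<open>M\<close>; this makes it unnecessary to speak about quotients of \<open>M\<close>.\<close>

definition resolves where
  "resolves R M W P d e \<longleftrightarrow> submodule W R M \<and> proj_complex R P d \<and> exact_from P d 0 \<and> lin R (P 0) M e \<and>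
     (\<forall>x \<in> carrier (P 0). e x \<in> W \<longleftrightarrow> x \<in> d 0 ` carrier (P (Suc 0))) \<and>
     (\<forall>m \<in> carrier M. \<exists>x \<in> carrier (P 0). \<exists>w \<in> W. m = e x \<oplus>\<^bsub>M\<^esub> w)"

definition lifts_id where
  "lifts_id M W P e e' F \<longleftrightarrow> (\<forall>x \<in> carrier (P (0::nat)). \<exists>w \<in> W. e x = e' (F (0::nat) x) \<oplus>\<^bsub>M\<^esub> w)"

lemma resolves_simps:
  assumes "resolves R M W P d e"
  shows "submodule W R M" "proj_complex R P d" "exact_from P d 0" "lin R (P 0) M e" "module R M"
    "x \<in> carrier (P 0) \<Longrightarrow> e x \<in> W \<longleftrightarrow> x \<in> d 0 ` carrier (P (Suc 0))"
    "m \<in> carrier M \<Longrightarrow> \<exists>x \<in> carrier (P 0). \<exists>w \<in> W. m = e x \<oplus>\<^bsub>M\<^esub> w"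
proof -
  show "submodule W R M" "proj_complex R P d" "exact_from P d 0" "lin R (P 0) M e"
    "x \<in> carrier (P 0) \<Longrightarrow> e x \<in> W \<longleftrightarrow> x \<in> d 0 ` carrier (P (Suc 0))"
    "m \<in> carrier M \<Longrightarrow> \<exists>x \<in> carrier (P 0). \<exists>w \<in> W. m = e x \<oplus>\<^bsub>M\<^esub> w"
    using assms unfolding resolves_def by simp_all
  then show "module R M" using lin_module(2) by blast
qed

lemma lifts_id_trans:
  assumes F: "lifts_id M W P e e' F" and G: "lifts_id M W' T e' e'' G" and W: "W \<subseteq> W'" "submodule W' R M"
    and lin: "lin R V M e''" "lin R (P 0) (T 0) (F 0)" "lin R (T 0) V (G 0)"
  shows "lifts_id M W' P e e'' (\<lambda>i x. G i (F i x))"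
  unfolding lifts_id_def
proof
  fix x assume x: "x \<in> carrier (P 0)"
  have m: "module R M" by (rule lin_module(2)[OF lin(1)])
  obtain w where w: "w \<in> W" "e x = e' (F 0 x) \<oplus>\<^bsub>M\<^esub> w" using F x unfolding lifts_id_def by auto
  obtain v where v: "v \<in> W'" "e' (F 0 x) = e'' (G 0 (F 0 x)) \<oplus>\<^bsub>M\<^esub> v"
    using G lin_closed[OF lin(2) x] unfolding lifts_id_def by auto
  have "e x = e'' (G 0 (F 0 x)) \<oplus>\<^bsub>M\<^esub> (v \<oplus>\<^bsub>M\<^esub> w)"
    using w v W submodule_simps(2)[OF m W(2)] x lin by (auto simp: mod_ac[OF m] mod_closed[OF m] lin_closed)
  then show "\<exists>w \<in> W'. e x = e'' (G 0 (F 0 x)) \<oplus>\<^bsub>M\<^esub> w" using submodule_simps(4)[OF m W(2) v(1)] w(1) W(1) by blast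
qed

lemma lifts_id_compose:
  assumes "lifts_id M W P e e' F" "lifts_id M W' T e' e'' G" "W \<subseteq> W'" "submodule W' R M"
    and "lin R (V 0) M e''" and "chain_map R P d T \<delta> F" "chain_map R T \<delta> V \<epsilon> G"
  shows "lifts_id M W' P e e'' (\<lambda>i x. G i (F i x))"
  by (rule lifts_id_trans[OF assms(1-5) chain_map_simps(1)[OF assms(6)] chain_map_simps(1)[OF assms(7)]])

context noeth_universe
begin

text \<open>A map in degree zero extends to a chain map as soon as it sends boundaries to boundaries: the
  components are lifted one after the other, and exactness of the target makes the next lift
  possible.\<close>

lemma extend_chain_map_0:
  fixes P T :: "nat \<Rightarrow> ('r, 'u) module"
  assumes P: "proj_complex R P d" and T: "\<And>i. lin R (T (Suc i)) (T i) (\<delta> i)" and ex: "exact_from T \<delta> 0"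
    and g: "lin R (P 0) (T 0) g" "\<And>x. x \<in> carrier (P (Suc 0)) \<Longrightarrow> g (d 0 x) \<in> \<delta> 0 ` carrier (T (Suc 0))"
  shows "\<exists>G. G 0 = g \<and> chain_map R P d T \<delta> G"
proof -
  define Pr where "Pr i f \<longleftrightarrow> lin R (P i) (T i) f \<and> (\<forall>x \<in> carrier (P (Suc i)). f (d i x) \<in> \<delta> i ` carrier (T (Suc i))) \<and> (i = 0 \<longrightarrow> f = g)" for i f
  have "\<exists>G. \<forall>n. Pr n (G n) \<and> (\<forall>x \<in> carrier (P (Suc n)). \<delta> n (G (Suc n) x) = G n (d n x))"
  proof (rule dependent_nat_choice)
    show "\<exists>x. Pr 0 x" using g unfolding Pr_def by auto
    fix f n assume f: "Pr n f"
    then have fl: "lin R (P n) (T n) f" by (auto simp: Pr_def)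
    have im: "f (d n x) \<in> \<delta> n ` carrier (T (Suc n))" if "x \<in> carrier (P (Suc n))" for x using f that by (auto simp: Pr_def)
    obtain h where h: "lin R (P (Suc n)) (T (Suc n)) h" "\<And>x. x \<in> carrier (P (Suc n)) \<Longrightarrow> \<delta> n (h x) = f (d n x)"
      using projective_lift[OF proj_complex_simps(1)[OF P] T lin_compose[OF proj_complex_simps(3)[OF P] fl] im] by blast
    have "h (d (Suc n) x) \<in> \<delta> (Suc n) ` carrier (T (Suc (Suc n)))" if x: "x \<in> carrier (P (Suc (Suc n)))" for x
    proof -
      have dx: "d (Suc n) x \<in> carrier (P (Suc n))" using lin_closed[OF proj_complex_simps(3)[OF P] x] .
      have "\<delta> n (h (d (Suc n) x)) = \<zero>\<^bsub>T n\<^esub>" using h(2)[OF dx] proj_complex_simps(4)[OF P x] lin_zero[OF fl] by simp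
      then show ?thesis using ex lin_closed[OF h(1) dx] unfolding exact_from_def by auto
    qed
    then show "\<exists>y. Pr (Suc n) y \<and> (\<forall>x \<in> carrier (P (Suc n)). \<delta> n (y x) = f (d n x))"
      using h unfolding Pr_def by auto
  qed
  then obtain G where G: "\<And>n. Pr n (G n)" "\<And>n x. x \<in> carrier (P (Suc n)) \<Longrightarrow> \<delta> n (G (Suc n) x) = G n (d n x)" by blast
  then show ?thesis unfolding Pr_def chain_map_def by (intro exI[of _ G]) auto
qed

lemma proj_complex_shift: "proj_complex R P d \<Longrightarrow> proj_complex R (\<lambda>i. P (Suc i)) (\<lambda>i. d (Suc i))"
  by (auto simp: proj_complex_def)

text \<open>The recursion for \<open>s\<close> stores the equation with \<open>\<delta>\<close> applied to \<open>s i (d i x)\<close>, which is what the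
  next lift requires.\<close>

lemma homotopy:
  fixes P T :: "nat \<Rightarrow> ('r, 'u) module"
  assumes P: "proj_complex R P d" and T: "\<And>i. lin R (T (Suc i)) (T i) (\<delta> i)" and ex: "exact_from T \<delta> 0"
    and h: "chain_map R P d T \<delta> h" and h0: "\<And>x. x \<in> carrier (P 0) \<Longrightarrow> h 0 x \<in> \<delta> 0 ` carrier (T (Suc 0))"
  obtains s where "\<And>i. lin R (P i) (T (Suc i)) (s i)" "\<And>x. x \<in> carrier (P 0) \<Longrightarrow> h 0 x = \<delta> 0 (s 0 x)"
    "\<And>i x. x \<in> carrier (P (Suc i)) \<Longrightarrow> \<delta> (Suc i) (s (Suc i) x) = h (Suc i) x \<oplus>\<^bsub>T (Suc i)\<^esub> \<ominus>\<^bsub>T (Suc i)\<^esub> s i (d i x)"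
proof -
  note d = proj_complex_simps(3)[OF P] and hl = chain_map_simps(1)[OF h]
  have mT: "module R (T i)" for i using T lin_module by blast
  define Pr where "Pr i s \<longleftrightarrow> lin R (P i) (T (Suc i)) s \<and> (\<forall>x \<in> carrier (P (Suc i)). \<delta> i (s (d i x)) = h i (d i x)) \<and>
    (i = 0 \<longrightarrow> (\<forall>x \<in> carrier (P 0). \<delta> 0 (s x) = h 0 x))" for i s
  have "\<exists>s. \<forall>n. Pr n (s n) \<and> (\<forall>x \<in> carrier (P (Suc n)). \<delta> (Suc n) (s (Suc n) x) = h (Suc n) x \<oplus>\<^bsub>T (Suc n)\<^esub> \<ominus>\<^bsub>T (Suc n)\<^esub> s n (d n x))"
  proof (rule dependent_nat_choice)
    obtain s where "lin R (P 0) (T (Suc 0)) s" "\<And>x. x \<in> carrier (P 0) \<Longrightarrow> \<delta> 0 (s x) = h 0 x"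
      using projective_lift[OF proj_complex_simps(1)[OF P] T hl h0] by blast
    then show "\<exists>s. Pr 0 s" unfolding Pr_def using lin_closed[OF d] by (intro exI[of _ s]) auto
  next
    fix s n assume s: "Pr n s"
    then have sl: "lin R (P n) (T (Suc n)) s" and sd: "\<And>x. x \<in> carrier (P (Suc n)) \<Longrightarrow> \<delta> n (s (d n x)) = h n (d n x)"
      by (auto simp: Pr_def)
    let ?f = "\<lambda>x. h (Suc n) x \<oplus>\<^bsub>T (Suc n)\<^esub> \<ominus>\<^bsub>T (Suc n)\<^esub> s (d n x)"
    have f: "lin R (P (Suc n)) (T (Suc n)) ?f" by (rule lin_sum[OF hl lin_uminus[OF lin_compose[OF d sl]]])
    have im: "?f x \<in> \<delta> (Suc n) ` carrier (T (Suc (Suc n)))" if x: "x \<in> carrier (P (Suc n))" for x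
    proof -
      have c: "h (Suc n) x \<in> carrier (T (Suc n))" "s (d n x) \<in> carrier (T (Suc n))" "h n (d n x) \<in> carrier (T n)"
        using lin_closed[OF hl] lin_closed[OF sl] lin_closed[OF d] x by auto
      have "\<delta> n (?f x) = \<zero>\<^bsub>T n\<^esub>"
        using c x sd[OF x] chain_map_simps(2)[OF h x] by (simp add: lin_simps[OF T] mod_closed[OF mT] mod_simps[OF mT])
      then show ?thesis using ex lin_closed[OF f x] unfolding exact_from_def by auto
    qed
    obtain t where t: "lin R (P (Suc n)) (T (Suc (Suc n))) t" "\<And>x. x \<in> carrier (P (Suc n)) \<Longrightarrow> \<delta> (Suc n) (t x) = ?f x"
      using projective_lift[OF proj_complex_simps(1)[OF P] T f im] by blast
    have "\<delta> (Suc n) (t (d (Suc n) x)) = h (Suc n) (d (Suc n) x)" if x: "x \<in> carrier (P (Suc (Suc n)))" for x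
    proof -
      have dx: "d (Suc n) x \<in> carrier (P (Suc n))" using lin_closed[OF d x] .
      show ?thesis using t(2)[OF dx] proj_complex_simps(4)[OF P x] lin_zero[OF sl] lin_closed[OF hl dx]
        by (simp add: mod_simps[OF mT])
    qed
    then show "\<exists>y. Pr (Suc n) y \<and> (\<forall>x \<in> carrier (P (Suc n)). \<delta> (Suc n) (y x) = ?f x)" using t unfolding Pr_def by auto
  qed
  then obtain s where s: "\<And>n. Pr n (s n)" "\<And>n x. x \<in> carrier (P (Suc n)) \<Longrightarrow>
      \<delta> (Suc n) (s (Suc n) x) = h (Suc n) x \<oplus>\<^bsub>T (Suc n)\<^esub> \<ominus>\<^bsub>T (Suc n)\<^esub> s n (d n x)" by blast
  show thesis by (rule that[of s]) (use s in \<open>auto simp: Pr_def\<close>)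
qed

lemma null_homotopic_coboundary:
  fixes P T :: "nat \<Rightarrow> ('r, 'u) module"
  assumes P: "proj_complex R P d" and T: "\<And>i. lin R (T (Suc i)) (T i) (\<delta> i)" and ex: "exact_from T \<delta> 0"
    and h: "chain_map R P d T \<delta> h" and h0: "\<And>x. x \<in> carrier (P 0) \<Longrightarrow> h 0 x \<in> \<delta> 0 ` carrier (T (Suc 0))"
    and c: "cocycle R T \<delta> N i \<phi>"
  shows "coboundary R P d N i (\<lambda>x. \<phi> (h i x))"
proof -
  note d = proj_complex_simps(3)[OF P] and hl = chain_map_simps(1)[OF h] and cl = cocycle_lin[OF c]
  have mT: "module R (T i)" for i using T lin_module by blast
  have mN: "module R N" by (rule lin_module(2)[OF cl])
  obtain s where s: "\<And>i. lin R (P i) (T (Suc i)) (s i)" "\<And>x. x \<in> carrier (P 0) \<Longrightarrow> h 0 x = \<delta> 0 (s 0 x)"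
    "\<And>i x. x \<in> carrier (P (Suc i)) \<Longrightarrow> \<delta> (Suc i) (s (Suc i) x) = h (Suc i) x \<oplus>\<^bsub>T (Suc i)\<^esub> \<ominus>\<^bsub>T (Suc i)\<^esub> s i (d i x)"
    using homotopy[OF P T ex h h0] by metis
  show ?thesis
  proof (cases i)
    case 0
    then show ?thesis unfolding 0 coboundary_0 using s(2) cocycle_zero[OF c[unfolded 0]] lin_closed[OF s(1)] by auto
  next
    case (Suc j)
    have "\<phi> (h (Suc j) x) = \<phi> (s j (d j x))" if x: "x \<in> carrier (P (Suc j))" for x
    proof -
      have cc: "h (Suc j) x \<in> carrier (T (Suc j))" "s j (d j x) \<in> carrier (T (Suc j))" 
        using lin_closed[OF hl] lin_closed[OF s(1)] lin_closed[OF d] x by auto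
      have "\<zero>\<^bsub>N\<^esub> = \<phi> (\<delta> (Suc j) (s (Suc j) x))" using cocycle_zero[OF c] lin_closed[OF s(1) x] Suc by auto
      also have "\<dots> = \<phi> (h (Suc j) x) \<oplus>\<^bsub>N\<^esub> \<ominus>\<^bsub>N\<^esub> \<phi> (s j (d j x))"
        using s(3)[OF x] cc cl Suc by (simp add: lin_simps mod_closed[OF mT])
      finally show ?thesis using mod_diff_zero[OF mN] lin_closed[OF cl] cc Suc by metis
    qed
    then show ?thesis unfolding Suc coboundary_Suc using lin_compose[OF s(1), of _ N \<phi>] cl Suc by blast
  qed
qed

text \<open>The lift is taken along \<open>T 0 \<rightarrow> M / W\<close>, which is surjective although \<open>e'\<close> need not be.\<close>

lemma lift_augmentation:
  fixes Q :: "('r, 'u) module" and T :: "nat \<Rightarrow> ('r, 'u) module" and M :: "('r, 'b) module"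
  assumes Q: "projective_module R Q" and e: "lin R Q M e" and T: "resolves R M W T \<delta> e'"
  obtains g where "lin R Q (T 0) g" "\<And>x. x \<in> carrier Q \<Longrightarrow> \<exists>v \<in> W. e x = e' (g x) \<oplus>\<^bsub>M\<^esub> v"
proof -
  note W = resolves_simps(1)[OF T] and mM = resolves_simps(5)[OF T] and e' = resolves_simps(4)[OF T]
  note w = submodule_simps[OF mM W]
  let ?q = "quot_rep M W" and ?Q = "quot_copy M W"
  note q = quot_rep_lin[OF mM W] and qz = quot_rep_zero[OF mM W]
  have mQ: "module R ?Q" by (rule lin_module(2)[OF q])
  have qw: "?q (a \<oplus>\<^bsub>M\<^esub> v) = ?q a" if "a \<in> carrier M" "v \<in> W" for a v
  proof -
    have "?q v = \<zero>\<^bsub>?Q\<^esub>" using qz[of v] w that by simp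
    then show ?thesis using w that lin_closed[OF q that(1)] by (simp add: lin_add[OF q] mod_simps[OF mQ])
  qed
  have im: "?q (e x) \<in> (\<lambda>y. ?q (e' y)) ` carrier (T 0)" if x: "x \<in> carrier Q" for x
  proof -
    obtain y v where y: "y \<in> carrier (T 0)" "v \<in> W" "e x = e' y \<oplus>\<^bsub>M\<^esub> v" using resolves_simps(7)[OF T lin_closed[OF e x]] by auto
    then show ?thesis using qw lin_closed[OF e'] by auto
  qed
  obtain g where g: "lin R Q (T 0) g" "\<And>x. x \<in> carrier Q \<Longrightarrow> ?q (e' (g x)) = ?q (e x)"
    using projective_lift[OF Q lin_compose[OF e' q] lin_compose[OF e q] im] by blast
  have gw: "\<exists>v \<in> W. e x = e' (g x) \<oplus>\<^bsub>M\<^esub> v" if x: "x \<in> carrier Q" for x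
  proof -
    have c: "e x \<in> carrier M" "e' (g x) \<in> carrier M" using lin_closed[OF e x] lin_closed[OF e'] lin_closed[OF g(1) x] by auto
    then have "?q (\<ominus>\<^bsub>M\<^esub> e' (g x) \<oplus>\<^bsub>M\<^esub> e x) = \<zero>\<^bsub>?Q\<^esub>" using g(2)[OF x] by (simp add: lin_simps[OF q] mod_closed[OF mM] mod_simps[OF mQ])
    then have "\<ominus>\<^bsub>M\<^esub> e' (g x) \<oplus>\<^bsub>M\<^esub> e x \<in> W" using qz c by (simp add: mod_closed[OF mM])
    moreover have "e x = e' (g x) \<oplus>\<^bsub>M\<^esub> (\<ominus>\<^bsub>M\<^esub> e' (g x) \<oplus>\<^bsub>M\<^esub> e x)" using c by (simp add: mod_closed[OF mM] mod_simps[OF mM])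
    ultimately show ?thesis by blast
  qed
  show thesis by (rule that[OF g(1) gw])
qed

lemma lift_exists:
  fixes P T :: "nat \<Rightarrow> ('r, 'u) module" and M :: "('r, 'b) module"
  assumes P: "proj_complex R P d" and e: "lin R (P 0) M e" "\<And>x. x \<in> carrier (P (Suc 0)) \<Longrightarrow> e (d 0 x) \<in> W"
    and T: "resolves R M W T \<delta> e'"
  obtains F where "chain_map R P d T \<delta> F" "lifts_id M W P e e' F"
proof -
  note W = resolves_simps(1)[OF T] and mM = resolves_simps(5)[OF T] and Tc = resolves_simps(2)[OF T] and e' = resolves_simps(4)[OF T]
  obtain g where g: "lin R (P 0) (T 0) g" and gw: "\<And>x. x \<in> carrier (P 0) \<Longrightarrow> \<exists>v \<in> W. e x = e' (g x) \<oplus>\<^bsub>M\<^esub> v"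
    using lift_augmentation[OF proj_complex_simps(1)[OF P] e(1) T] by blast
  have gd: "g (d 0 x) \<in> \<delta> 0 ` carrier (T (Suc 0))" if x: "x \<in> carrier (P (Suc 0))" for x
  proof -
    have dx: "d 0 x \<in> carrier (P 0)" using lin_closed[OF proj_complex_simps(3)[OF P] x] .
    obtain v where v: "v \<in> W" "e (d 0 x) = e' (g (d 0 x)) \<oplus>\<^bsub>M\<^esub> v" using gw[OF dx] by auto
    then have "e' (g (d 0 x)) \<in> W" using submodule_add_iff[OF mM W lin_closed[OF e' lin_closed[OF g dx]] v(1)] e(2)[OF x] by simp
    then show ?thesis using resolves_simps(6)[OF T lin_closed[OF g dx]] by simp
  qed
  obtain G where "G 0 = g" "chain_map R P d T \<delta> G"
    using extend_chain_map_0[OF P proj_complex_simps(3)[OF Tc] resolves_simps(3)[OF T] g gd] by blast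
  then show thesis using gw that unfolding lifts_id_def by blast
qed

text \<open>The difference of two lifts of the identity sends degree zero into the boundaries, so it is
  null-homotopic, and a cocycle composed with a null-homotopic map is a coboundary.\<close>

lemma lift_unique:
  fixes P T :: "nat \<Rightarrow> ('r, 'u) module" and M :: "('r, 'b) module"
  assumes P: "proj_complex R P d" and T: "resolves R M W T \<delta> e'"
    and F: "chain_map R P d T \<delta> F" "lifts_id M W P e e' F"
    and G: "chain_map R P d T \<delta> G" "lifts_id M W P e e' G"
    and c: "cocycle R T \<delta> N i \<phi>"
  shows "coboundary R P d N i (\<lambda>x. \<phi> (F i x) \<oplus>\<^bsub>N\<^esub> \<ominus>\<^bsub>N\<^esub> \<phi> (G i x))"
proof -
  note W = resolves_simps(1)[OF T] and mM = resolves_simps(5)[OF T] and Tc = resolves_simps(2)[OF T] and e' = resolves_simps(4)[OF T]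
  note w = submodule_simps[OF mM W]
  note Fl = chain_map_simps(1)[OF F(1)] and Gl = chain_map_simps(1)[OF G(1)] and d = proj_complex_simps(3)[OF P] and \<delta> = proj_complex_simps(3)[OF Tc]
  have mT: "module R (T i)" for i using proj_complex_simps(2)[OF Tc] .
  let ?h = "\<lambda>i x. F i x \<oplus>\<^bsub>T i\<^esub> \<ominus>\<^bsub>T i\<^esub> G i x"
  have h: "chain_map R P d T \<delta> ?h"
    unfolding chain_map_def
  proof (intro conjI allI ballI)
    fix i show "lin R (P i) (T i) (?h i)" by (rule lin_sum[OF Fl lin_uminus[OF Gl]])
    fix x assume x: "x \<in> carrier (P (Suc i))"
    show "\<delta> i (?h (Suc i) x) = ?h i (d i x)"
      using x chain_map_simps(2)[OF F(1) x] chain_map_simps(2)[OF G(1) x] lin_closed[OF Fl x] lin_closed[OF Gl x]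
      by (simp add: lin_simps[OF \<delta>] mod_closed[OF mT])
  qed
  have h0: "?h 0 x \<in> \<delta> 0 ` carrier (T (Suc 0))" if x: "x \<in> carrier (P 0)" for x
  proof -
    obtain u v where uv: "u \<in> W" "e x = e' (F 0 x) \<oplus>\<^bsub>M\<^esub> u" "v \<in> W" "e x = e' (G 0 x) \<oplus>\<^bsub>M\<^esub> v"
      using F(2) G(2) x unfolding lifts_id_def by blast
    have cl: "F 0 x \<in> carrier (T 0)" "G 0 x \<in> carrier (T 0)" using lin_closed[OF Fl x] lin_closed[OF Gl x] by auto
    then have cl': "e' (F 0 x) \<in> carrier M" "e' (G 0 x) \<in> carrier M" "u \<in> carrier M" "v \<in> carrier M" using lin_closed[OF e'] uv w by auto
    have "e' (F 0 x) = (e' (F 0 x) \<oplus>\<^bsub>M\<^esub> u) \<oplus>\<^bsub>M\<^esub> \<ominus>\<^bsub>M\<^esub> u" using cl' by (simp add: mod_ac[OF mM] mod_closed[OF mM] mod_simps[OF mM])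
    also have "\<dots> = (e' (G 0 x) \<oplus>\<^bsub>M\<^esub> v) \<oplus>\<^bsub>M\<^esub> \<ominus>\<^bsub>M\<^esub> u" using uv by simp
    finally have "e' (?h 0 x) = v \<oplus>\<^bsub>M\<^esub> \<ominus>\<^bsub>M\<^esub> u" using cl cl' 
      by (simp add: lin_simps[OF e'] mod_ac[OF mM] mod_closed[OF mM] mod_closed[OF mT] mod_simps[OF mM])
    then have "e' (?h 0 x) \<in> W" using uv w by simp
    then show ?thesis using resolves_simps(6)[OF T] cl by (simp add: mod_closed[OF mT])
  qed
  have "coboundary R P d N i (\<lambda>x. \<phi> (?h i x))"
    by (rule null_homotopic_coboundary[OF P \<delta> resolves_simps(3)[OF T] h h0 c])
  then show ?thesis
    by (rule coboundary_cong) (simp add: lin_simps[OF cocycle_lin[OF c]] lin_closed[OF Fl] lin_closed[OF Gl] mod_closed[OF mT])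
qed

text \<open>Cover by a finitely generated projective module, take the kernel, and repeat; kernels stay
  finitely generated.\<close>

lemma resolution_exists:
  fixes M :: "('r, 'u) module"
  assumes M: "fin_gen R M" and W: "submodule W R M"
  obtains P :: "nat \<Rightarrow> ('r, 'u) module" and d e where "resolves R M W P d e"
proof -
  have mM: "module R M" using M by (rule fin_gen_module)
  \<comment> \<open>A state consists of a module, a submodule of it that has yet to be covered, and the map to the
    module before.\<close>
  define Pr where "Pr s \<longleftrightarrow> (case s of (P :: ('r, 'u) module, H, f :: 'u \<Rightarrow> 'u) \<Rightarrow> projective_module R P \<and> fin_gen R P \<and> submodule H R P)" for s
  define Q where "Q s t \<longleftrightarrow> (case s of (P, H, f) \<Rightarrow> case t of (P', H', f') \<Rightarrow> lin R P' P f' \<and> f' ` carrier P' = H \<and>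
      H' = {x \<in> carrier P'. f' x = \<zero>\<^bsub>P\<^esub>})" for s t :: "('r, 'u) module \<times> 'u set \<times> ('u \<Rightarrow> 'u)"
  obtain P0 :: "('r, 'u) module" and e where P0: "projective_module R P0" "fin_gen R P0" "lin R P0 M e" "e ` carrier P0 = carrier M"
    using projective_cover[OF M] by blast
  have "\<exists>s. \<forall>n::nat. (Pr (s n) \<and> (n = 0 \<longrightarrow> s n = (P0, {x \<in> carrier P0. e x \<in> W}, undefined))) \<and> Q (s n) (s (Suc n))"
  proof (rule dependent_nat_choice)
    show "\<exists>s. Pr s \<and> (0 = (0::nat) \<longrightarrow> s = (P0, {x \<in> carrier P0. e x \<in> W}, undefined))"
      unfolding Pr_def using P0 submodule_vimage[OF P0(3) W] by auto
    fix s and n :: nat assume "Pr s \<and> (n = 0 \<longrightarrow> s = (P0, {x \<in> carrier P0. e x \<in> W}, undefined))"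
    then obtain P H f where s: "s = (P, H, f)" "projective_module R P" "fin_gen R P" "submodule H R P" unfolding Pr_def by (cases s) auto
    have mP: "module R P" using s(3) by (rule fin_gen_module)
    obtain P' :: "('r, 'u) module" and g where P': "projective_module R P'" "fin_gen R P'" "lin R P' (sub P H) g" "g ` carrier P' = carrier (sub P H)"
      using projective_cover[OF fin_gen_submodule(2)[OF s(3,4)]] by blast
    have g: "lin R P' P g" by (rule sub_lin_map[OF P'(3) s(4) mP])
    then have "Q s (P', {x \<in> carrier P'. g x = \<zero>\<^bsub>P\<^esub>}, g)" unfolding Q_def s(1) using P' by auto
    moreover have "Pr (P', {x \<in> carrier P'. g x = \<zero>\<^bsub>P\<^esub>}, g)" unfolding Pr_def using P' submodule_ker[OF g] by auto
    ultimately show "\<exists>t. (Pr t \<and> (Suc n = 0 \<longrightarrow> t = (P0, {x \<in> carrier P0. e x \<in> W}, undefined))) \<and> Q s t" by blast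
  qed
  then obtain s where s: "\<And>n. Pr (s n)" "s 0 = (P0, {x \<in> carrier P0. e x \<in> W}, undefined)" "\<And>n. Q (s n) (s (Suc n))" by blast
  let ?P = "\<lambda>n. fst (s n)" and ?d = "\<lambda>n. snd (snd (s (Suc n)))"
  have Q: "lin R (?P (Suc n)) (?P n) (?d n)" "?d n ` carrier (?P (Suc n)) = fst (snd (s n))"
      "fst (snd (s (Suc n))) = {x \<in> carrier (?P (Suc n)). ?d n x = \<zero>\<^bsub>?P n\<^esub>}" for n
    using s(3)[of n] unfolding Q_def by (auto split: prod.splits)
  have im: "?d (Suc n) ` carrier (?P (Suc (Suc n))) = {x \<in> carrier (?P (Suc n)). ?d n x = \<zero>\<^bsub>?P n\<^esub>}" for n
    using Q(2)[of "Suc n"] Q(3)[of n] by simp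
  have "resolves R M W ?P ?d e"
    unfolding resolves_def
  proof (intro conjI)
    show "proj_complex R ?P ?d" unfolding proj_complex_def
    proof (intro conjI allI ballI)
      show "projective_module R (?P i)" for i using s(1)[of i] unfolding Pr_def by (auto split: prod.splits)
      show "lin R (?P (Suc i)) (?P i) (?d i)" for i by (rule Q)
      show "?d i (?d (Suc i) x) = \<zero>\<^bsub>?P i\<^esub>" if "x \<in> carrier (?P (Suc (Suc i)))" for i x using im[of i] that by blast
    qed
    show "exact_from ?P ?d 0" unfolding exact_from_def using im by simp
    show "lin R (?P 0) M e" using P0 s(2) by simp
    show "\<forall>x \<in> carrier (?P 0). e x \<in> W \<longleftrightarrow> x \<in> ?d 0 ` carrier (?P (Suc 0))" using Q(2)[of 0] s(2) by simp
    show "\<forall>m \<in> carrier M. \<exists>x \<in> carrier (?P 0). \<exists>w \<in> W. m = e x \<oplus>\<^bsub>M\<^esub> w"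
    proof
      fix m assume m: "m \<in> carrier M"
      then obtain x where "x \<in> carrier P0" "m = e x" using P0(4) by auto
      then show "\<exists>x \<in> carrier (?P 0). \<exists>w \<in> W. m = e x \<oplus>\<^bsub>M\<^esub> w"
        using s(2) submodule_simps(3)[OF mM W] m mod_simps(2)[OF mM m]
        by (rule_tac bexI[of _ x], rule_tac bexI[of _ "\<zero>\<^bsub>M\<^esub>"]) auto
    qed
  qed (rule W)
  then show thesis by (rule that)
qed

end

section \<open>The cone of multiplication by a ring element\<close>

text \<open>A chain map with this property induces the zero map on the cohomology with values in \<open>N\<close> in
  degree \<open>i\<close>.\<close>

definition null_at where
  "null_at R N i P d T \<delta> F \<longleftrightarrow> (\<forall>\<phi>. cocycle R T \<delta> N i \<phi> \<longrightarrow> coboundary R P d N i (\<lambda>x. \<phi> (F i x)))"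

context noeth_universe
begin

text \<open>The cone of \<open>r\<close> on \<open>P\<close>, in degree \<open>i + 1\<close> the sum of \<open>P (i + 1)\<close> and \<open>P i\<close>. A chain map \<open>F\<close> between two
  complexes extends to the cones of \<open>r s\<close> and \<open>r\<close> if it is multiplied by \<open>s\<close> on the shifted summand.\<close>

definition cone where
  "cone P i = (case i of 0 \<Rightarrow> P 0 | Suc j \<Rightarrow> dsum (P (Suc j)) (P j))"

definition cone_diff where
  "cone_diff P d r i z = (case i of 0 \<Rightarrow> d 0 (dfst z) \<oplus>\<^bsub>P 0\<^esub> r \<odot>\<^bsub>P 0\<^esub> dsnd z
     | Suc j \<Rightarrow> dpair (d (Suc j) (dfst z) \<oplus>\<^bsub>P (Suc j)\<^esub> r \<odot>\<^bsub>P (Suc j)\<^esub> dsnd z, \<ominus>\<^bsub>P j\<^esub> d j (dsnd z)))"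

definition cone_map where
  "cone_map P s F i z = (case i of 0 \<Rightarrow> F 0 z | Suc j \<Rightarrow> dpair (F (Suc j) (dfst z), s \<odot>\<^bsub>P j\<^esub> F j (dsnd z)))"

lemma cone_simps [simp]:
  "cone P 0 = P 0" "cone P (Suc j) = dsum (P (Suc j)) (P j)"
  "cone_diff P d r 0 z = d 0 (dfst z) \<oplus>\<^bsub>P 0\<^esub> r \<odot>\<^bsub>P 0\<^esub> dsnd z"
  "cone_diff P d r (Suc j) z = dpair (d (Suc j) (dfst z) \<oplus>\<^bsub>P (Suc j)\<^esub> r \<odot>\<^bsub>P (Suc j)\<^esub> dsnd z, \<ominus>\<^bsub>P j\<^esub> d j (dsnd z))"
  "cone_map P s F 0 z = F 0 z"
  "cone_map P s F (Suc j) z = dpair (F (Suc j) (dfst z), s \<odot>\<^bsub>P j\<^esub> F j (dsnd z))"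
  by (simp_all add: cone_def cone_diff_def cone_map_def)

lemma dsumE:
  assumes "z \<in> carrier (dsum A B)"
  obtains a b where "a \<in> carrier A" "b \<in> carrier B" "z = dpair (a, b)"
  using assms unfolding dsum_carrier by auto

lemma dpair_mem [simp]: "dpair (a, b) \<in> carrier (dsum A B) \<longleftrightarrow> a \<in> carrier A \<and> b \<in> carrier B"
  unfolding dsum_carrier using inj_dpair by (auto dest: injD)

lemma dpair_eq [simp]: "dpair (a, b) = dpair (c, d) \<longleftrightarrow> a = c \<and> b = d"
  using inj_dpair by (auto dest: injD)

lemma dsum_zero: "\<zero>\<^bsub>dsum A B\<^esub> = dpair (\<zero>\<^bsub>A\<^esub>, \<zero>\<^bsub>B\<^esub>)"
  by (simp add: dsum_def transport_def Let_def)

lemma lin_dsum_split: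
  assumes m: "module R A" "module R B" and f: "lin R (dsum A B) N f" and ab: "a \<in> carrier A" "b \<in> carrier B"
  shows "f (dpair (a, b)) = f (dpair (a, \<zero>\<^bsub>B\<^esub>)) \<oplus>\<^bsub>N\<^esub> f (dpair (\<zero>\<^bsub>A\<^esub>, b))"
proof -
  have "inj_on dpair (carrier (prod_module A B))" using inj_dpair by (rule inj_on_subset) auto
  note T = transport_to[OF prod_module_module[OF m] this]
  have "dpair (a, b) = dpair (a, \<zero>\<^bsub>B\<^esub>) \<oplus>\<^bsub>dsum A B\<^esub> dpair (\<zero>\<^bsub>A\<^esub>, b)"
    using lin_add[OF T, of "(a, \<zero>\<^bsub>B\<^esub>)" "(\<zero>\<^bsub>A\<^esub>, b)"] ab unfolding dsum_def
    by (simp add: mod_closed[OF m(1)] mod_closed[OF m(2)] mod_simps[OF m(1)] mod_simps[OF m(2)])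
  then show ?thesis using lin_add[OF f] ab mod_closed(2)[OF m(1)] mod_closed(2)[OF m(2)] by simp
qed

lemma cone_diff_lin:
  assumes P: "proj_complex R P d" and r: "r \<in> carrier R"
  shows "lin R (cone P (Suc i)) (cone P i) (cone_diff P d r i)"
proof -
  note d = proj_complex_simps(3)[OF P] and m = proj_complex_simps(2)[OF P]
  note p = dfst_lin[OF m m] and p' = dsnd_lin[OF m m]
  show ?thesis
  proof (cases i)
    case 0
    show ?thesis unfolding 0 cone_simps(1,2) cone_simps(3)[abs_def]
      by (rule lin_sum[OF lin_compose[OF p d] lin_scale[OF p' r]])
  next
    case (Suc j)
    have "lin R (dsum (P (Suc (Suc j))) (P (Suc j))) (dsum (P (Suc j)) (P j))
       (\<lambda>z. dpair (d (Suc j) (dfst z) \<oplus>\<^bsub>P (Suc j)\<^esub> r \<odot>\<^bsub>P (Suc j)\<^esub> dsnd z, \<ominus>\<^bsub>P j\<^esub> d j (dsnd z)))"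
      by (rule dsum_pair_lin[OF m m lin_sum[OF lin_compose[OF p d] lin_scale[OF p' r]] lin_uminus[OF lin_compose[OF p' d]]])
    then show ?thesis unfolding Suc cone_simps(2) by (rule lin_cong) simp
  qed
qed

lemma cone_proj_complex:
  assumes P: "proj_complex R P d" and r: "r \<in> carrier R"
  shows "proj_complex R (cone P) (cone_diff P d r)"
proof -
  note d = proj_complex_simps(3)[OF P] and m = proj_complex_simps(2)[OF P] and dd = proj_complex_simps(4)[OF P]
  show ?thesis
    unfolding proj_complex_def
  proof (intro conjI allI ballI)
    show "projective_module R (cone P i)" for i
      by (cases i) (auto intro: projective_dsum proj_complex_simps(1)[OF P])
    show "lin R (cone P (Suc i)) (cone P i) (cone_diff P d r i)" for i by (rule cone_diff_lin[OF P r])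
    show "cone_diff P d r i (cone_diff P d r (Suc i) z) = \<zero>\<^bsub>cone P i\<^esub>" if "z \<in> carrier (cone P (Suc (Suc i)))" for i z
    proof -
      obtain p p' where z: "p \<in> carrier (P (Suc (Suc i)))" "p' \<in> carrier (P (Suc i))" "z = dpair (p, p')"
        using \<open>z \<in> carrier (cone P (Suc (Suc i)))\<close> by (auto elim: dsumE)
      have c: "d (Suc i) p \<in> carrier (P (Suc i))" "d i p' \<in> carrier (P i)" using lin_closed[OF d] z by auto
      have e: "d i (d (Suc i) p \<oplus>\<^bsub>P (Suc i)\<^esub> r \<odot>\<^bsub>P (Suc i)\<^esub> p') \<oplus>\<^bsub>P i\<^esub> r \<odot>\<^bsub>P i\<^esub> (\<ominus>\<^bsub>P i\<^esub> d i p') = \<zero>\<^bsub>P i\<^esub>"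
        using c z r dd by (simp add: lin_simps[OF d] mod_closed[OF m] mod_simps[OF m])
      show ?thesis
      proof (cases i)
        case 0 then show ?thesis using e z by simp
      next
        case (Suc j)
        have "d j (\<ominus>\<^bsub>P (Suc j)\<^esub> d (Suc j) p') = \<zero>\<^bsub>P j\<^esub>"
          using c z Suc dd by (simp add: lin_simps[OF d] mod_simps[OF m])
        then show ?thesis using e z Suc by (simp add: dsum_zero mod_simps[OF m])
      qed
    qed
  qed
qed

text \<open>The cone of multiplication by \<open>r\<close> on a resolution of \<open>A\<close> has homology \<open>A / rA\<close> in degree \<open>0\<close> and
  \<open>{a. r a = 0}\<close> in degree \<open>1\<close>; it is exact in all higher degrees.\<close>

lemma cone_exact:
  assumes P: "proj_complex R P d" and ex: "exact_from P d 0" and r: "r \<in> carrier R"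
  shows "exact_from (cone P) (cone_diff P d r) 1"
  unfolding exact_from_def
proof (intro allI ballI impI)
  note d = proj_complex_simps(3)[OF P] and m = proj_complex_simps(2)[OF P] and dd = proj_complex_simps(4)[OF P]
  fix i z assume i: "1 \<le> i" and z: "z \<in> carrier (cone P (Suc i))" and z0: "cone_diff P d r i z = \<zero>\<^bsub>cone P i\<^esub>"
  obtain j where j: "i = Suc j" using i by (cases i) auto
  obtain p p' where p: "p \<in> carrier (P (Suc (Suc j)))" "p' \<in> carrier (P (Suc j))" "z = dpair (p, p')"
    using z j by (auto elim: dsumE)
  have c: "d (Suc j) p \<in> carrier (P (Suc j))" "d j p' \<in> carrier (P j)" using lin_closed[OF d] p by auto
  have e: "d (Suc j) p \<oplus>\<^bsub>P (Suc j)\<^esub> r \<odot>\<^bsub>P (Suc j)\<^esub> p' = \<zero>\<^bsub>P (Suc j)\<^esub>" "\<ominus>\<^bsub>P j\<^esub> d j p' = \<zero>\<^bsub>P j\<^esub>"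
    using z0 p j by (auto simp: dsum_zero)
  have "d j p' = \<zero>\<^bsub>P j\<^esub>" using e(2) c(2) mod_simps(8,9)[OF m] by metis
  then obtain q' where q': "q' \<in> carrier (P (Suc (Suc j)))" "p' = d (Suc j) q'"
    using exact_fromD[OF ex _ p(2)] by auto
  let ?v = "p \<oplus>\<^bsub>P (Suc (Suc j))\<^esub> r \<odot>\<^bsub>P (Suc (Suc j))\<^esub> q'"
  have v: "?v \<in> carrier (P (Suc (Suc j)))" using p q' r by (simp add: mod_closed[OF m])
  have "d (Suc j) ?v = \<zero>\<^bsub>P (Suc j)\<^esub>" using e p q' r by (simp add: lin_simps[OF d] mod_closed[OF m])
  then obtain q where q: "q \<in> carrier (P (Suc (Suc (Suc j))))" "?v = d (Suc (Suc j)) q"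
    using exact_fromD[OF ex _ v] by auto
  have "z = cone_diff P d r (Suc i) (dpair (q, \<ominus>\<^bsub>P (Suc (Suc j))\<^esub> q'))"
    using j p q q' r q(2)[symmetric] by (simp add: lin_simps[OF d] mod_simps[OF m] mod_closed[OF m] mod_ac[OF m])
  then show "z \<in> cone_diff P d r (Suc i) ` carrier (cone P (Suc (Suc i)))"
    by (rule image_eqI) (use j q q' in \<open>simp add: mod_closed[OF m]\<close>)
qed

lemma cone_map_chain:
  assumes F: "chain_map R P d T \<delta> F" and P: "proj_complex R P d" and T: "proj_complex R T \<delta>"
    and r: "r \<in> carrier R" "s \<in> carrier R"
  shows "chain_map R (cone P) (cone_diff P d (r \<otimes> s)) (cone T) (cone_diff T \<delta> r) (cone_map T s F)"
proof -
  note d = proj_complex_simps(3)[OF P] and m = proj_complex_simps(2)[OF P]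
  note \<delta> = proj_complex_simps(3)[OF T] and mT = proj_complex_simps(2)[OF T]
  note Fl = chain_map_simps(1)[OF F] and Fc = chain_map_simps(2)[OF F]
  note p = dfst_lin[OF m m] and p' = dsnd_lin[OF m m]
  show ?thesis
    unfolding chain_map_def
  proof (intro conjI allI ballI)
    show "lin R (cone P i) (cone T i) (cone_map T s F i)" for i
    proof (cases i)
      case 0 then show ?thesis using lin_cong[OF Fl[of 0]] by simp
    next
      case (Suc j)
      have "lin R (dsum (P (Suc j)) (P j)) (dsum (T (Suc j)) (T j)) (\<lambda>z. dpair (F (Suc j) (dfst z), s \<odot>\<^bsub>T j\<^esub> F j (dsnd z)))"
        by (rule dsum_pair_lin[OF mT mT lin_compose[OF p Fl] lin_scale[OF lin_compose[OF p' Fl] r(2)]])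
      then show ?thesis unfolding Suc cone_simps(2) by (rule lin_cong) simp
    qed
    fix i z assume "z \<in> carrier (cone P (Suc i))"
    then obtain a b where z: "a \<in> carrier (P (Suc i))" "b \<in> carrier (P i)" "z = dpair (a, b)" by (auto elim: dsumE)
    have c: "F (Suc i) a \<in> carrier (T (Suc i))" "F i b \<in> carrier (T i)" "d i a \<in> carrier (P i)"
      using lin_closed[OF Fl] lin_closed[OF d] z by auto
    have e: "\<delta> i (F (Suc i) a) \<oplus>\<^bsub>T i\<^esub> r \<odot>\<^bsub>T i\<^esub> (s \<odot>\<^bsub>T i\<^esub> F i b) = F i (d i a \<oplus>\<^bsub>P i\<^esub> (r \<otimes> s) \<odot>\<^bsub>P i\<^esub> b)"
      using c z r Fc[OF z(1)] by (simp add: lin_simps[OF Fl] mod_closed[OF m] mod_smult_assoc[OF mT])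
    show "cone_diff T \<delta> r i (cone_map T s F (Suc i) z) = cone_map T s F i (cone_diff P d (r \<otimes> s) i z)"
    proof (cases i)
      case 0 then show ?thesis using e z by simp
    next
      case (Suc j)
      have "\<ominus>\<^bsub>T j\<^esub> \<delta> j (s \<odot>\<^bsub>T (Suc j)\<^esub> F (Suc j) b) = s \<odot>\<^bsub>T j\<^esub> F j (\<ominus>\<^bsub>P j\<^esub> d j b)"
        using c(2) z r Fc[of b j] Suc lin_closed[OF d, of b j] lin_closed[OF Fl, of _ j]
        by (simp add: lin_simps[OF \<delta>] lin_simps[OF Fl] mod_closed[OF m] mod_closed[OF mT] mod_simps[OF mT])
      then show ?thesis using e z Suc by simp
    qed
  qed
qed

text \<open>Let \<open>\<phi>\<close> and \<open>\<psi>\<close> be the two components of a cocycle \<open>\<theta>\<close> on the cone. The first component is a cocycle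
  on \<open>P\<close> and becomes a coboundary after pulling back along \<open>F\<close>. Subtracting the corresponding coboundary
  of the cone changes the second component into a cocycle in one degree less, which becomes a
  coboundary after pulling back along \<open>G\<close>. So two transition maps are needed for the cone, and the
  degree in which they vanish grows by one.\<close>

lemma cone_null:
  assumes P: "proj_complex R P d" and P': "proj_complex R P' d'" and P'': "proj_complex R P'' d''"
    and F: "chain_map R P' d' P d F" and G: "chain_map R P'' d'' P' d' G"
    and nF: "null_at R N (Suc (Suc j)) P' d' P d F" and nG: "null_at R N (Suc j) P'' d'' P' d' G"
    and r: "r \<in> carrier R" "s \<in> carrier R" "t \<in> carrier R"
    and c: "cocycle R (cone P) (cone_diff P d r) N (Suc (Suc j)) \<theta>"
  shows "coboundary R (cone P'') (cone_diff P'' d'' (r \<otimes> s \<otimes> t)) N (Suc (Suc j))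
    (\<lambda>z. \<theta> (cone_map P s F (Suc (Suc j)) (cone_map P' t G (Suc (Suc j)) z)))"
proof -
  note d = proj_complex_simps(3)[OF P] and m = proj_complex_simps(2)[OF P]
  note d' = proj_complex_simps(3)[OF P'] and m' = proj_complex_simps(2)[OF P']
  note d'' = proj_complex_simps(3)[OF P''] and m'' = proj_complex_simps(2)[OF P'']
  note Fl = chain_map_simps(1)[OF F] and Fc = chain_map_simps(2)[OF F]
  note Gl = chain_map_simps(1)[OF G] and Gc = chain_map_simps(2)[OF G]
  have \<theta>: "lin R (dsum (P (Suc (Suc j))) (P (Suc j))) N \<theta>" using cocycle_lin[OF c] by simp
  have mN: "module R N" by (rule lin_module(2)[OF \<theta>])
  define \<phi> where "\<phi> p = \<theta> (dpair (p, \<zero>\<^bsub>P (Suc j)\<^esub>))" for p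
  define \<psi> where "\<psi> p = \<theta> (dpair (\<zero>\<^bsub>P (Suc (Suc j))\<^esub>, p))" for p
  have \<phi>: "lin R (P (Suc (Suc j))) N \<phi>" unfolding \<phi>_def[abs_def]
    by (rule lin_compose[OF dsum_pair_lin[OF m m lin_ident[OF m] lin_const_zero[OF m m]] \<theta>])
  have \<psi>: "lin R (P (Suc j)) N \<psi>" unfolding \<psi>_def[abs_def]
    by (rule lin_compose[OF dsum_pair_lin[OF m m lin_const_zero[OF m m] lin_ident[OF m]] \<theta>])
  have split: "\<theta> (dpair (a, b)) = \<phi> a \<oplus>\<^bsub>N\<^esub> \<psi> b" if "a \<in> carrier (P (Suc (Suc j)))" "b \<in> carrier (P (Suc j))" for a b
    unfolding \<phi>_def \<psi>_def by (rule lin_dsum_split[OF m m \<theta> that])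
  have z: "\<phi> (d (Suc (Suc j)) a \<oplus>\<^bsub>P (Suc (Suc j))\<^esub> r \<odot>\<^bsub>P (Suc (Suc j))\<^esub> b) \<oplus>\<^bsub>N\<^esub> \<psi> (\<ominus>\<^bsub>P (Suc j)\<^esub> d (Suc j) b) = \<zero>\<^bsub>N\<^esub>"
    if "a \<in> carrier (P (Suc (Suc (Suc j))))" "b \<in> carrier (P (Suc (Suc j)))" for a b
    using cocycle_zero[OF c, of "dpair (a, b)"] that r lin_closed[OF d]
    by (simp add: split mod_closed[OF m])
  have \<phi>0: "\<phi> (d (Suc (Suc j)) a) = \<zero>\<^bsub>N\<^esub>" if a: "a \<in> carrier (P (Suc (Suc (Suc j))))" for a
    using z[OF a mod_closed(2)[OF m]] r lin_closed[OF d a] lin_closed[OF \<phi>] 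
    by (simp add: lin_simps(4)[OF d] lin_simps(4)[OF \<psi>] mod_simps[OF m] mod_simps[OF mN])
  have \<psi>d: "\<psi> (d (Suc j) b) = r \<odot>\<^bsub>N\<^esub> \<phi> b" if b: "b \<in> carrier (P (Suc (Suc j)))" for b
  proof -
    have "r \<odot>\<^bsub>N\<^esub> \<phi> b \<oplus>\<^bsub>N\<^esub> \<ominus>\<^bsub>N\<^esub> \<psi> (d (Suc j) b) = \<zero>\<^bsub>N\<^esub>"
      using z[OF mod_closed(2)[OF m] b] b r lin_closed[OF d b]
      by (simp add: lin_simps(4)[OF d] lin_simps(2-5)[OF \<psi>] lin_simps(2-5)[OF \<phi>] mod_simps[OF m] mod_closed[OF m])
    then show ?thesis using mod_diff_zero[OF mN] lin_closed[OF \<phi> b] lin_closed[OF \<psi> lin_closed[OF d b]] r mod_closed(4)[OF mN] by metis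
  qed
  have "cocycle R P d N (Suc (Suc j)) \<phi>" using \<phi> \<phi>0 by (simp add: cocycle_def)
  then obtain \<chi> where \<chi>: "lin R (P' (Suc j)) N \<chi>" "\<And>x. x \<in> carrier (P' (Suc (Suc j))) \<Longrightarrow> \<phi> (F (Suc (Suc j)) x) = \<chi> (d' (Suc j) x)"
    using nF unfolding null_at_def coboundary_Suc by blast
  \<comment> \<open>The second component of what remains of \<open>\<theta>\<close> after subtracting the coboundary of \<open>(\<chi>, 0)\<close>.\<close>
  let ?p = "\<lambda>x. s \<odot>\<^bsub>N\<^esub> \<psi> (F (Suc j) x) \<oplus>\<^bsub>N\<^esub> \<ominus>\<^bsub>N\<^esub> ((r \<otimes> s) \<odot>\<^bsub>N\<^esub> \<chi> x)"
  have rs: "r \<otimes> s \<in> carrier R" "r \<otimes> s \<otimes> t \<in> carrier R" using r by auto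
  have pl: "lin R (P' (Suc j)) N ?p"
    by (rule lin_sum[OF lin_scale[OF lin_compose[OF Fl \<psi>] r(2)] lin_uminus[OF lin_scale[OF \<chi>(1) rs(1)]]])
  have "cocycle R P' d' N (Suc j) ?p"
    unfolding cocycle_def
  proof (intro conjI ballI pl)
    fix x assume x: "x \<in> carrier (P' (Suc (Suc j)))"
    have Fx: "F (Suc (Suc j)) x \<in> carrier (P (Suc (Suc j)))" using lin_closed[OF Fl x] .
    have "s \<odot>\<^bsub>N\<^esub> \<psi> (F (Suc j) (d' (Suc j) x)) = s \<odot>\<^bsub>N\<^esub> (r \<odot>\<^bsub>N\<^esub> \<phi> (F (Suc (Suc j)) x))"
      using \<psi>d[OF Fx] Fc[OF x] by simp
    also have "\<dots> = (r \<otimes> s) \<odot>\<^bsub>N\<^esub> \<chi> (d' (Suc j) x)"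
      using r \<chi>(2)[OF x] lin_closed[OF \<phi> Fx] by (simp add: mod_smult_assoc[OF mN] mod_smult_comm[OF mN, of s])
    finally show "?p (d' (Suc j) x) = \<zero>\<^bsub>N\<^esub>"
      using lin_closed[OF \<chi>(1) lin_closed[OF d' x]] rs by (simp add: mod_simps[OF mN] mod_closed[OF mN])
  qed
  then obtain \<xi> where \<xi>: "lin R (P'' j) N \<xi>" "\<And>x. x \<in> carrier (P'' (Suc j)) \<Longrightarrow> ?p (G (Suc j) x) = \<xi> (d'' j x)"
    using nG unfolding null_at_def coboundary_Suc by blast
  note p = dfst_lin[OF m'' m''] and p' = dsnd_lin[OF m'' m'']
  \<comment> \<open>Minus, because the differential of the cone acts on the shifted summand by \<open>- d\<close>.\<close>
  let ?X = "\<lambda>z. \<chi> (G (Suc j) (dfst z)) \<oplus>\<^bsub>N\<^esub> \<ominus>\<^bsub>N\<^esub> (t \<odot>\<^bsub>N\<^esub> \<xi> (dsnd z))"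
  have X: "lin R (cone P'' (Suc j)) N ?X" unfolding cone_simps
    by (rule lin_sum[OF lin_compose[OF lin_compose[OF p Gl] \<chi>(1)] lin_uminus[OF lin_scale[OF lin_compose[OF p' \<xi>(1)] r(3)]]])
  have "\<theta> (cone_map P s F (Suc (Suc j)) (cone_map P' t G (Suc (Suc j)) z)) = ?X (cone_diff P'' d'' (r \<otimes> s \<otimes> t) (Suc j) z)"
    if "z \<in> carrier (cone P'' (Suc (Suc j)))" for z
  proof -
    obtain a b where z: "a \<in> carrier (P'' (Suc (Suc j)))" "b \<in> carrier (P'' (Suc j))" "z = dpair (a, b)"
      using \<open>z \<in> carrier (cone P'' (Suc (Suc j)))\<close> by (auto elim: dsumE)
    let ?a = "G (Suc (Suc j)) a" and ?b = "G (Suc j) b"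
    have c: "?a \<in> carrier (P' (Suc (Suc j)))" "?b \<in> carrier (P' (Suc j))" using lin_closed[OF Gl] z by auto
    have Fc': "F (Suc (Suc j)) ?a \<in> carrier (P (Suc (Suc j)))" "F (Suc j) ?b \<in> carrier (P (Suc j))" using lin_closed[OF Fl] c by auto
    have da: "d'' (Suc j) a \<in> carrier (P'' (Suc j))" "d'' j b \<in> carrier (P'' j)" using lin_closed[OF d''] z by auto
    have N: "\<psi> (F (Suc j) ?b) \<in> carrier N" "\<chi> ?b \<in> carrier N" "\<xi> (d'' j b) \<in> carrier N" "\<chi> (G (Suc j) (d'' (Suc j) a)) \<in> carrier N"
      using lin_closed[OF \<psi>] lin_closed[OF \<chi>(1)] lin_closed[OF \<xi>(1)] lin_closed[OF Gl] c Fc' da by auto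
    have "\<theta> (cone_map P s F (Suc (Suc j)) (cone_map P' t G (Suc (Suc j)) z))
        = \<phi> (F (Suc (Suc j)) ?a) \<oplus>\<^bsub>N\<^esub> t \<odot>\<^bsub>N\<^esub> (s \<odot>\<^bsub>N\<^esub> \<psi> (F (Suc j) ?b))"
      using z c Fc' r N by (simp add: split mod_closed[OF m] lin_smult[OF Fl] lin_smult[OF \<psi>] mod_smult_comm[OF mN, of s t] mod_closed[OF mN])
    also have "s \<odot>\<^bsub>N\<^esub> \<psi> (F (Suc j) ?b) = \<xi> (d'' j b) \<oplus>\<^bsub>N\<^esub> (r \<otimes> s) \<odot>\<^bsub>N\<^esub> \<chi> ?b"
      using \<xi>(2)[OF z(2)] N rs r mod_eq_diff[OF mN, of "s \<odot>\<^bsub>N\<^esub> \<psi> (F (Suc j) ?b)" "(r \<otimes> s) \<odot>\<^bsub>N\<^esub> \<chi> ?b" "\<xi> (d'' j b)"]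
      by (simp add: mod_closed[OF mN])
    also have "\<phi> (F (Suc (Suc j)) ?a) = \<chi> (G (Suc j) (d'' (Suc j) a))" using \<chi>(2)[OF c(1)] Gc[OF z(1)] by simp
    also have "\<chi> (G (Suc j) (d'' (Suc j) a)) \<oplus>\<^bsub>N\<^esub> t \<odot>\<^bsub>N\<^esub> (\<xi> (d'' j b) \<oplus>\<^bsub>N\<^esub> (r \<otimes> s) \<odot>\<^bsub>N\<^esub> \<chi> ?b)
      = \<chi> (G (Suc j) (d'' (Suc j) a \<oplus>\<^bsub>P'' (Suc j)\<^esub> (r \<otimes> s \<otimes> t) \<odot>\<^bsub>P'' (Suc j)\<^esub> b)) \<oplus>\<^bsub>N\<^esub> \<ominus>\<^bsub>N\<^esub> (t \<odot>\<^bsub>N\<^esub> \<xi> (\<ominus>\<^bsub>P'' j\<^esub> d'' j b))"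
      using z c r rs da N lin_closed[OF Gl da(1)]
      by (simp add: lin_simps[OF Gl] lin_simps[OF \<chi>(1)] lin_simps[OF \<xi>(1)] mod_closed[OF m''] mod_closed[OF m'] mod_closed[OF mN] mod_simps[OF mN]
        mod_smult_assoc[OF mN, of "r \<otimes> s" t] mod_smult_comm[OF mN, of t "r \<otimes> s"] mod_ac[OF mN])
    finally show ?thesis using z by simp
  qed
  then show ?thesis unfolding coboundary_Suc using X by blast
qed


section \<open>Systems of quotients with vanishing Ext\<close>

text \<open>The projection \<open>M / W' \<rightarrow> M / W\<close> induces zero on \<open>Ext\<^sup>i(-, N)\<close>. By the next lemma, which is a
  consequence of the comparison theorem, the choice of resolutions and of the lift is immaterial, and
  the property survives shrinking \<open>W'\<close> and enlarging \<open>W\<close>.\<close>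

definition null_transition where
  "null_transition N i M W' W \<longleftrightarrow> (\<exists>(P :: nat \<Rightarrow> ('r, 'u) module) d e (T :: nat \<Rightarrow> ('r, 'u) module) \<delta> e' F.
     resolves R M W' P d e \<and> resolves R M W T \<delta> e' \<and> chain_map R P d T \<delta> F \<and> lifts_id M W P e e' F \<and> null_at R N i P d T \<delta> F)"

lemma null_transition_transfer:
  fixes Q Q' :: "nat \<Rightarrow> ('r, 'u) module" and M :: "('r, 'u) module"
  assumes n: "null_transition N i M W' W" and Q: "resolves R M V' Q d e" and Q': "resolves R M V Q' d' e'"
    and sub: "V' \<subseteq> W'" "W \<subseteq> V" "W' \<subseteq> W"
    and G: "chain_map R Q d Q' d' G" "lifts_id M V Q e e' G"
  shows "null_at R N i Q d Q' d' G"
  unfolding null_at_def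
proof (intro allI impI)
  fix \<phi> assume \<phi>: "cocycle R Q' d' N i \<phi>"
  obtain P :: "nat \<Rightarrow> ('r, 'u) module" and dP eP and T :: "nat \<Rightarrow> ('r, 'u) module" and dT eT F where
    P: "resolves R M W' P dP eP" and T: "resolves R M W T dT eT" and F: "chain_map R P dP T dT F" "lifts_id M W P eP eT F"
    and nF: "null_at R N i P dP T dT F" using n unfolding null_transition_def by blast
  note Qc = resolves_simps(2)[OF Q] and Tc = resolves_simps(2)[OF T]
  have "e (d 0 x) \<in> W'" if "x \<in> carrier (Q (Suc 0))" for x
    using resolves_simps(6)[OF Q, of "d 0 x"] that sub lin_closed[OF proj_complex_simps(3)[OF Qc]] by auto
  then obtain a where a: "chain_map R Q d P dP a" "lifts_id M W' Q e eP a"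
    using lift_exists[OF Qc resolves_simps(4)[OF Q] _ P] by blast
  have "eT (dT 0 x) \<in> V" if "x \<in> carrier (T (Suc 0))" for x
    using resolves_simps(6)[OF T, of "dT 0 x"] that sub lin_closed[OF proj_complex_simps(3)[OF Tc]] by auto
  then obtain b where b: "chain_map R T dT Q' d' b" "lifts_id M V T eT e' b"
    using lift_exists[OF Tc resolves_simps(4)[OF T] _ Q'] by blast
  let ?a = "\<lambda>i x. F i (a i x)"
  have a': "chain_map R Q d T dT ?a" by (rule chain_map_compose[OF a(1) F(1)])
  have "lifts_id M W Q e eT ?a"
    by (rule lifts_id_compose[OF a(2) F(2) sub(3) resolves_simps(1,4)[OF T] a(1) F(1)])
  then have l: "lifts_id M V Q e e' (\<lambda>i x. b i (?a i x))"
    by (rule lifts_id_compose[OF _ b(2) sub(2) resolves_simps(1,4)[OF Q'] a' b(1)])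
  have ch: "chain_map R Q d Q' d' (\<lambda>i x. b i (?a i x))" by (rule chain_map_compose[OF a' b(1)])
  have \<phi>l: "lin R (Q' i) N \<phi>" by (rule cocycle_lin[OF \<phi>])
  have mN: "module R N" by (rule lin_module(2)[OF \<phi>l])
  have diff: "coboundary R Q d N i (\<lambda>x. \<phi> (G i x) \<oplus>\<^bsub>N\<^esub> \<ominus>\<^bsub>N\<^esub> \<phi> (b i (?a i x)))"
    by (rule lift_unique[OF Qc Q' G ch l \<phi>])
  have "coboundary R P dP N i (\<lambda>x. \<phi> (b i (F i x)))"
    using nF cocycle_pullback[OF b(1) Tc \<phi>] unfolding null_at_def by blast
  then have nul: "coboundary R Q d N i (\<lambda>x. \<phi> (b i (?a i x)))" by (rule coboundary_pullback[OF a(1) Qc])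
  show "coboundary R Q d N i (\<lambda>x. \<phi> (G i x))"
  proof (rule coboundary_cong[OF coboundary_sum[OF diff nul mN]])
    fix x assume x: "x \<in> carrier (Q i)"
    have "\<phi> (G i x) \<in> carrier N" "\<phi> (b i (?a i x)) \<in> carrier N"
      using lin_closed[OF \<phi>l] lin_closed[OF chain_map_simps(1)[OF G(1)] x] lin_closed[OF chain_map_simps(1)[OF ch] x] by auto
    then show "\<phi> (G i x) \<oplus>\<^bsub>N\<^esub> \<ominus>\<^bsub>N\<^esub> \<phi> (b i (?a i x)) \<oplus>\<^bsub>N\<^esub> \<phi> (b i (?a i x)) = \<phi> (G i x)"
      by (simp add: mod_ac[OF mN] mod_closed[OF mN] mod_simps[OF mN])
  qed
qed

text \<open>For such a system \<open>M / W\<^sub>k\<close> the direct limit of the modules \<open>Ext\<^sup>i(M / W\<^sub>k, N)\<close> vanishes for all \<open>i > q\<close>.\<close>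

definition eventually_null where
  "eventually_null N q M W \<longleftrightarrow> (\<forall>i > q. \<forall>k::nat. \<exists>l \<ge> k. null_transition N i M (W l) (W k))"

lemma torsion_stable:
  assumes M: "fin_gen R M" and W: "submodule W R M" and x: "x \<in> carrier R"
  obtains j where "\<And>l z. z \<in> carrier M \<Longrightarrow> l \<ge> j \<Longrightarrow> (x [^] (l::nat)) \<odot>\<^bsub>M\<^esub> z \<in> W \<Longrightarrow> (x [^] j) \<odot>\<^bsub>M\<^esub> z \<in> W"
proof -
  have m: "module R M" using M by (rule fin_gen_module)
  define V where "V j = {z \<in> carrier M. (x [^] (j::nat)) \<odot>\<^bsub>M\<^esub> z \<in> W}" for j
  have sV: "submodule (V j) R M" for j unfolding V_def by (rule submodule_vimage[OF lin_act[OF m] W]) (use x in simp)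
  have mono: "V j \<subseteq> V l" if "j \<le> l" for j l
  proof
    fix z assume z: "z \<in> V j"
    have "x [^] l = x [^] (l - j) \<otimes> x [^] j" using x that by (simp add: nat_pow_mult)
    then have "(x [^] l) \<odot>\<^bsub>M\<^esub> z = (x [^] (l - j)) \<odot>\<^bsub>M\<^esub> ((x [^] j) \<odot>\<^bsub>M\<^esub> z)"
      using z x by (simp add: V_def mod_smult_assoc[OF m])
    then show "z \<in> V l" using z x submodule_simps(5)[OF m W] unfolding V_def by simp
  qed
  obtain j where "\<And>l. V j \<subseteq> V l \<Longrightarrow> V l = V j"
  proof -
    have "\<exists>H \<in> range V. \<forall>K \<in> range V. H \<subseteq> K \<longrightarrow> K = H"
      by (rule maximal_submodule[OF M]) (use sV in auto)
    then obtain j where "\<forall>l. V j \<subseteq> V l \<longrightarrow> V l = V j" by (auto simp del: subset_iff)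
    then show thesis using that[of j] by blast
  qed
  then have eq: "V l = V j" if "l \<ge> j" for l using mono[OF that] by simp
  show thesis
  proof (rule that[of j])
    fix l z assume "z \<in> carrier M" "l \<ge> j" "(x [^] (l::nat)) \<odot>\<^bsub>M\<^esub> z \<in> W"
    then have "z \<in> V l" by (simp add: V_def)
    then have "z \<in> V j" using eq[OF \<open>l \<ge> j\<close>] by simp
    then show "(x [^] j) \<odot>\<^bsub>M\<^esub> z \<in> W" by (simp add: V_def)
  qed
qed

text \<open>The projection \<open>M / W'\<^sub>l \<rightarrow> M / W'\<^sub>k\<close> with \<open>W'\<^sub>k = W\<^sub>k + x\<^sup>k M\<close> is factored, up to homotopy, through cones on
  resolutions of \<open>M / W\<^sub>l\<close> with \<open>l \<ge> m\<^sub>2 \<ge> m\<^sub>1 \<ge> k\<close>, where the steps from \<open>m\<^sub>2\<close> to \<open>m\<^sub>1\<close> and from \<open>m\<^sub>1\<close> to \<open>k\<close> are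
  those of \<open>cone_null\<close>. The map from the cone at \<open>k\<close> to the resolution of \<open>M / W'\<^sub>k\<close> comes from the comparison
  theorem. In the other direction, a map from the resolution of \<open>M / W'\<^sub>l\<close> to the cone at \<open>l\<close> can be
  constructed in degrees \<open>0\<close> and \<open>1\<close>; in degree \<open>2\<close> it is obstructed by the homology of the cone in degree
  \<open>1\<close>, and this obstruction disappears on passing to the cone at \<open>m\<^sub>2\<close>.\<close>

lemma eventually_null_step:
  fixes M :: "('r, 'u) module"
  assumes M: "fin_gen R M" and W: "\<And>k. submodule (W k) R M" and anti: "\<And>k l. k \<le> l \<Longrightarrow> W l \<subseteq> W k"
    and x: "x \<in> carrier R" and pn: "eventually_null N q M W"
  shows "eventually_null N (Suc q) M (\<lambda>k. sub_sum M (W k) ((\<lambda>m. (x [^] k) \<odot>\<^bsub>M\<^esub> m) ` carrier M))"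
  unfolding eventually_null_def
proof (intro allI impI)
  fix i k assume i: "Suc q < i"
  then obtain j where j: "i = Suc (Suc j)" by (metis Suc_lessE less_SucE not0_implies_Suc Suc_less_eq2)
  have m: "module R M" using M by (rule fin_gen_module)
  define W' where "W' k = sub_sum M (W k) ((\<lambda>m. (x [^] (k::nat)) \<odot>\<^bsub>M\<^esub> m) ` carrier M)" for k
  have xk: "x [^] (n::nat) \<in> carrier R" for n using x by simp
  have sx: "submodule ((\<lambda>m. (x [^] (k::nat)) \<odot>\<^bsub>M\<^esub> m) ` carrier M) R M" for k by (rule submodule_scaled[OF m xk])
  have sW': "submodule (W' k) R M" for k unfolding W'_def by (rule submodule_sub_sum[OF m W sx])
  have WW': "W k \<subseteq> W' k" for k unfolding W'_def by (rule sub_sum_upper[OF m W sx])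
  have xW': "(x [^] k) \<odot>\<^bsub>M\<^esub> z \<in> W' k" if "z \<in> carrier M" for k z
    using that sub_sum_upper(2)[OF m W sx] unfolding W'_def by blast
  have "\<forall>k. \<exists>P. \<exists>d e. resolves R M (W k) (P :: nat \<Rightarrow> ('r, 'u) module) d e" using resolution_exists[OF M W] by metis
  then obtain P :: "nat \<Rightarrow> nat \<Rightarrow> ('r, 'u) module" and d e where P: "\<And>k. resolves R M (W k) (P k) (d k) (e k)" by metis
  note Pc = resolves_simps(2)[OF P] and Pe = resolves_simps(4)[OF P]
  note Pd = proj_complex_simps(3)[OF Pc] and mP = proj_complex_simps(2)[OF Pc]
  have ed: "e l (d l 0 y) \<in> W l" if "y \<in> carrier (P l (Suc 0))" for l y
    using resolves_simps(6)[OF P, of "d l 0 y"] lin_closed[OF Pd that] that by auto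
  have exF: "\<exists>F. chain_map R (P l) (d l) (P k) (d k) F \<and> lifts_id M (W k) (P l) (e l) (e k) F" if "k \<le> l" for k l
  proof -
    have "e l (d l 0 y) \<in> W k" if "y \<in> carrier (P l (Suc 0))" for y using ed[OF that] anti[OF \<open>k \<le> l\<close>] by auto
    then show ?thesis using lift_exists[OF Pc[of l] Pe[of l] _ P[of k]] by metis
  qed
  obtain F where F: "\<And>k l. k \<le> l \<Longrightarrow> chain_map R (P l) (d l) (P k) (d k) (F l k)"
      "\<And>k l. k \<le> l \<Longrightarrow> lifts_id M (W k) (P l) (e l) (e k) (F l k)"
  proof -
    assume *: "\<And>F. (\<And>k l. k \<le> l \<Longrightarrow> chain_map R (P l) (d l) (P k) (d k) (F l k)) \<Longrightarrow>
      (\<And>k l. k \<le> l \<Longrightarrow> lifts_id M (W k) (P l) (e l) (e k) (F l k)) \<Longrightarrow> thesis"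
    define F where "F l k = (SOME F. chain_map R (P l) (d l) (P k) (d k) F \<and> lifts_id M (W k) (P l) (e l) (e k) F)" for l k
    show thesis
      by (rule *[of F]; unfold F_def; drule exF; drule someI_ex; blast)
  qed
  have nullF: "\<exists>l \<ge> k. null_at R N i (P l) (d l) (P k) (d k) (F l k)" if "i > q" for i k
  proof -
    obtain l where l: "l \<ge> k" "null_transition N i M (W l) (W k)" using pn \<open>i > q\<close> unfolding eventually_null_def by blast
    show ?thesis using null_transition_transfer[OF l(2) P P order_refl order_refl anti[OF l(1)] F(1,2)[OF l(1)]] l(1) by blast
  qed
  obtain m1 where m1: "m1 \<ge> k" "null_at R N (Suc (Suc j)) (P m1) (d m1) (P k) (d k) (F m1 k)" using nullF[of "Suc (Suc j)" k] i j by auto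
  obtain m2 where m2: "m2 \<ge> m1" "null_at R N (Suc j) (P m2) (d m2) (P m1) (d m1) (F m2 m1)" using nullF[of "Suc j" m1] i j by auto
  obtain j0 where j0: "\<And>l z. z \<in> carrier M \<Longrightarrow> l \<ge> j0 \<Longrightarrow> (x [^] (l::nat)) \<odot>\<^bsub>M\<^esub> z \<in> W m2 \<Longrightarrow> (x [^] j0) \<odot>\<^bsub>M\<^esub> z \<in> W m2"
    using torsion_stable[OF M W x] by blast
  \<comment> \<open>With this \<open>l\<close>, multiplication by \<open>x\<^sup>l\<^sup>-\<^sup>m\<^sup>2\<close> sends the \<open>x\<^sup>l\<close>-torsion of \<open>M / W\<^sub>l\<close> to zero in \<open>M / W\<^sub>m\<^sub>2\<close>.\<close>
  define l where "l = m2 + j0"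
  have l: "l \<ge> m2" "l \<ge> k" "l - m2 = j0" using m1 m2 by (auto simp: l_def)
  obtain Q :: "nat \<Rightarrow> ('r, 'u) module" and dQ eQ where Q: "resolves R M (W' l) Q dQ eQ" using resolution_exists[OF M sW'] by metis
  obtain Q' :: "nat \<Rightarrow> ('r, 'u) module" and dQ' eQ' where Q': "resolves R M (W' k) Q' dQ' eQ'" using resolution_exists[OF M sW'] by metis
  note Qc = resolves_simps(2)[OF Q] and Qe = resolves_simps(4)[OF Q]
  note Qd = proj_complex_simps(3)[OF Qc] and mQ = proj_complex_simps(2)[OF Qc]
  have pw: "x [^] b = x [^] a \<otimes> x [^] (b - a)" if "a \<le> b" for a b :: nat using x that by (simp add: nat_pow_mult)
  let ?C = "\<lambda>l. cone (P l)" and ?D = "\<lambda>l. cone_diff (P l) (d l) (x [^] l)"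
  have C: "proj_complex R (?C l) (?D l)" for l by (rule cone_proj_complex[OF Pc xk])
  let ?\<tau> = "\<lambda>l k. cone_map (P k) (x [^] (l - k)) (F l k)"
  have \<tau>: "chain_map R (?C l) (?D l) (?C k) (?D k) (?\<tau> l k)" if "k \<le> l" for k l
    using cone_map_chain[OF F(1)[OF that] Pc Pc xk xk[of "l - k"], of k] pw[OF that] by simp
  have \<tau>l: "lifts_id M (W k) (?C l) (e l) (e k) (?\<tau> l k)" if "k \<le> l" for k l
    using F(2)[OF that] by (simp add: lifts_id_def)
  \<comment> \<open>From the cone to the resolution of the smaller quotient.\<close>
  have "e k (?D k 0 z) \<in> W' k" if "z \<in> carrier (?C k (Suc 0))" for z
  proof -
    obtain p p' where z: "p \<in> carrier (P k (Suc 0))" "p' \<in> carrier (P k 0)" "z = dpair (p, p')"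
      using \<open>z \<in> carrier (?C k (Suc 0))\<close> by (auto elim: dsumE)
    have "e k (?D k 0 z) = e k (d k 0 p) \<oplus>\<^bsub>M\<^esub> (x [^] k) \<odot>\<^bsub>M\<^esub> e k p'"
      using z lin_closed[OF Pd] xk by (simp add: lin_simps[OF Pe] mod_closed[OF mP])
    then show ?thesis
      using submodule_simps(4)[OF m sW' subsetD[OF WW' ed[OF z(1)]] xW'[OF lin_closed[OF Pe z(2)], of k]] by (simp del: cone_simps)
  qed
  then obtain c where c: "chain_map R (?C k) (?D k) Q' dQ' c" "lifts_id M (W' k) (?C k) (e k) eQ' c"
    using lift_exists[OF C _ _ Q', of k "e k"] Pe[of k] by auto
  \<comment> \<open>Degrees \<open>0\<close> and \<open>1\<close> of the map in the other direction.\<close>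
  obtain u0 where u0: "lin R (Q 0) (P l 0) u0" "\<And>y. y \<in> carrier (Q 0) \<Longrightarrow> \<exists>v \<in> W l. eQ y = e l (u0 y) \<oplus>\<^bsub>M\<^esub> v"
    using lift_augmentation[OF proj_complex_simps(1)[OF Qc] Qe P] by metis
  have im1: "u0 (dQ 0 y) \<in> ?D l 0 ` carrier (?C l (Suc 0))" if y: "y \<in> carrier (Q (Suc 0))" for y
  proof -
    let ?a = "u0 (dQ 0 y)"
    have dy: "dQ 0 y \<in> carrier (Q 0)" using lin_closed[OF Qd y] .
    have a: "?a \<in> carrier (P l 0)" using lin_closed[OF u0(1) dy] .
    have "eQ (dQ 0 y) \<in> W' l" using resolves_simps(6)[OF Q dy] y by auto
    moreover obtain v where v: "v \<in> W l" "eQ (dQ 0 y) = e l ?a \<oplus>\<^bsub>M\<^esub> v" using u0(2)[OF dy] by auto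
    ultimately have "e l ?a \<in> W' l" using submodule_add_iff[OF m sW' lin_closed[OF Pe a], of v] WW' by auto
    then obtain w z where wz: "w \<in> W l" "z \<in> carrier M" "e l ?a = w \<oplus>\<^bsub>M\<^esub> (x [^] l) \<odot>\<^bsub>M\<^esub> z" unfolding W'_def sub_sum_def by blast
    obtain p w' where p: "p \<in> carrier (P l 0)" "w' \<in> W l" "z = e l p \<oplus>\<^bsub>M\<^esub> w'" using resolves_simps(7)[OF P wz(2)] by blast
    have wM: "w \<in> carrier M" "w' \<in> carrier M" "e l p \<in> carrier M" using wz p submodule_simps(2)[OF m W] lin_closed[OF Pe] by auto
    let ?b = "?a \<oplus>\<^bsub>P l 0\<^esub> \<ominus>\<^bsub>P l 0\<^esub> ((x [^] l) \<odot>\<^bsub>P l 0\<^esub> p)"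
    have b: "?b \<in> carrier (P l 0)" using a p xk by (simp add: mod_closed[OF mP])
    have "e l ?b = w \<oplus>\<^bsub>M\<^esub> (x [^] l) \<odot>\<^bsub>M\<^esub> w'"
      using a p(1) wM xk by (simp add: wz(3) p(3) lin_simps[OF Pe] mod_closed[OF mP] mod_closed[OF m] mod_simps[OF m] mod_ac[OF m])
    then have "e l ?b \<in> W l" using wz p submodule_simps(4,5)[OF m W] xk by simp
    then obtain p1 where p1: "p1 \<in> carrier (P l (Suc 0))" "?b = d l 0 p1" using resolves_simps(6)[OF P b] by auto
    have "?a = ?b \<oplus>\<^bsub>P l 0\<^esub> (x [^] l) \<odot>\<^bsub>P l 0\<^esub> p" using a p(1) xk by (simp add: mod_closed[OF mP] mod_simps[OF mP] mod_ac[OF mP])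
    then have "?a = ?D l 0 (dpair (p1, p))" using p1 by simp
    then show ?thesis by (rule image_eqI) (use p1 p in simp)
  qed
  have D0: "lin R (?C l (Suc 0)) (P l 0) (?D l 0)" using proj_complex_simps(3)[OF C, of l 0] by simp
  obtain u1 where u1: "lin R (Q (Suc 0)) (?C l (Suc 0)) u1" "\<And>y. y \<in> carrier (Q (Suc 0)) \<Longrightarrow> ?D l 0 (u1 y) = u0 (dQ 0 y)"
    using projective_lift[OF proj_complex_simps(1)[OF Qc] D0 lin_compose[OF Qd u0(1)] im1] by metis
  let ?t = "?\<tau> l m2"
  note t = \<tau>[OF l(1)] and tl = chain_map_simps(1)[OF \<tau>[OF l(1)]] and tc = chain_map_simps(2)[OF \<tau>[OF l(1)]]
  let ?v0 = "\<lambda>y. ?t 0 (u0 y)" and ?v1 = "\<lambda>y. ?t (Suc 0) (u1 y)"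
  have u0': "lin R (Q 0) (?C l 0) u0" using u0(1) by simp
  have v0: "lin R (Q 0) (?C m2 0) ?v0" by (rule lin_compose[OF u0' tl])
  have v1: "lin R (Q (Suc 0)) (?C m2 (Suc 0)) ?v1" by (rule lin_compose[OF u1(1) tl])
  \<comment> \<open>The obstruction in degree \<open>2\<close>: the torsion element \<open>p'\<close> dies in the cone at \<open>m\<^sub>2\<close>.\<close>
  have v1d: "?v1 (dQ (Suc 0) y) \<in> ?D m2 (Suc 0) ` carrier (?C m2 (Suc (Suc 0)))" if y: "y \<in> carrier (Q (Suc (Suc 0)))" for y
  proof -
    have dy: "dQ (Suc 0) y \<in> carrier (Q (Suc 0))" using lin_closed[OF Qd y] .
    obtain p p' where p: "p \<in> carrier (P l (Suc 0))" "p' \<in> carrier (P l 0)" "u1 (dQ (Suc 0) y) = dpair (p, p')"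
      using lin_closed[OF u1(1) dy] by (auto elim: dsumE)
    have z: "d l 0 p \<oplus>\<^bsub>P l 0\<^esub> (x [^] l) \<odot>\<^bsub>P l 0\<^esub> p' = \<zero>\<^bsub>P l 0\<^esub>"
      using u1(2)[OF dy] p(3) proj_complex_simps(4)[OF Qc y] lin_zero[OF u0(1)] by simp
    have "\<zero>\<^bsub>M\<^esub> = e l (d l 0 p) \<oplus>\<^bsub>M\<^esub> (x [^] l) \<odot>\<^bsub>M\<^esub> e l p'"
      using arg_cong[OF z, of "e l"] lin_zero[OF Pe] p lin_closed[OF Pd p(1)] xk by (simp add: lin_simps[OF Pe] mod_closed[OF mP])
    then have "(x [^] l) \<odot>\<^bsub>M\<^esub> e l p' \<in> W l"
      using submodule_add_iff[OF m W[of l] _ ed[OF p(1)], of "(x [^] l) \<odot>\<^bsub>M\<^esub> e l p'"] submodule_simps(2,3)[OF m W] ed[OF p(1)]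
        lin_closed[OF Pe p(2)] xk by (simp add: mod_closed[OF m] mod_ac[OF m])
    then have "(x [^] l) \<odot>\<^bsub>M\<^esub> e l p' \<in> W m2" using anti[OF l(1)] by auto
    then have s1: "(x [^] j0) \<odot>\<^bsub>M\<^esub> e l p' \<in> W m2" using j0[OF lin_closed[OF Pe p(2)], of l] by (simp add: l_def)
    note Fl = chain_map_simps(1)[OF F(1)[OF l(1)]] and Fc = chain_map_simps(2)[OF F(1)[OF l(1)]]
    let ?b = "(x [^] j0) \<odot>\<^bsub>P m2 0\<^esub> F l m2 0 p'"
    have Fp: "F l m2 0 p' \<in> carrier (P m2 0)" "F l m2 (Suc 0) p \<in> carrier (P m2 (Suc 0))" using lin_closed[OF Fl] p by auto
    have b: "?b \<in> carrier (P m2 0)" using Fp xk by (simp add: mod_closed[OF mP])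
    obtain w where w: "w \<in> W m2" "e l p' = e m2 (F l m2 0 p') \<oplus>\<^bsub>M\<^esub> w" using F(2)[OF l(1)] p(2) unfolding lifts_id_def by blast
    have "(x [^] j0) \<odot>\<^bsub>M\<^esub> e l p' = e m2 ?b \<oplus>\<^bsub>M\<^esub> (x [^] j0) \<odot>\<^bsub>M\<^esub> w"
      using w Fp xk lin_closed[OF Pe] submodule_simps(2)[OF m W] by (simp add: lin_simps[OF Pe] mod_simps[OF m])
    then have "e m2 ?b \<in> W m2"
      using s1 submodule_add_iff[OF m W lin_closed[OF Pe b], of "(x [^] j0) \<odot>\<^bsub>M\<^esub> w"] submodule_simps(5)[OF m W xk w(1)] by simp
    then obtain q where q: "q \<in> carrier (P m2 (Suc 0))" "?b = d m2 0 q" using resolves_simps(6)[OF P b] by auto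
    let ?f = "F l m2 (Suc 0) p \<oplus>\<^bsub>P m2 (Suc 0)\<^esub> (x [^] m2) \<odot>\<^bsub>P m2 (Suc 0)\<^esub> q"
    have f: "?f \<in> carrier (P m2 (Suc 0))" using Fp q xk by (simp add: mod_closed[OF mP])
    have "d m2 0 ?f = F l m2 0 (d l 0 p \<oplus>\<^bsub>P l 0\<^esub> (x [^] l) \<odot>\<^bsub>P l 0\<^esub> p')"
      using Fp q(1) xk p Fc[OF p(1)] lin_closed[OF Pd p(1)] pw[OF l(1)] l(3)
      by (simp add: lin_simps[OF Pd] lin_simps[OF Fl] mod_closed[OF mP] q(2)[symmetric] mod_smult_assoc[OF mP])
    then have "d m2 0 ?f = \<zero>\<^bsub>P m2 0\<^esub>" using z lin_zero[OF Fl] by simp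
    then obtain q1 where q1: "q1 \<in> carrier (P m2 (Suc (Suc 0)))" "?f = d m2 (Suc 0) q1"
      using exact_fromD[OF resolves_simps(3)[OF P] _ f] by auto
    have "?v1 (dQ (Suc 0) y) = ?D m2 (Suc 0) (dpair (q1, \<ominus>\<^bsub>P m2 (Suc 0)\<^esub> q))"
      using q1(1) q Fp xk p(3) l(3)
      by (simp add: q1(2)[symmetric] q(2)[symmetric] lin_simps[OF Pd] mod_closed[OF mP] mod_simps[OF mP] mod_ac[OF mP])
    then show ?thesis by (rule image_eqI) (use q1 q in \<open>simp add: mod_closed[OF mP]\<close>)
  qed
  have ex1: "exact_from (\<lambda>i. ?C m2 (Suc i)) (\<lambda>i. ?D m2 (Suc i)) 0"
    using cone_exact[OF Pc resolves_simps(3)[OF P] xk, of m2 m2] unfolding exact_from_def by (simp add: Suc_le_eq del: cone_simps)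
  obtain G where G: "G 0 = ?v1" "chain_map R (\<lambda>i. Q (Suc i)) (\<lambda>i. dQ (Suc i)) (\<lambda>i. ?C m2 (Suc i)) (\<lambda>i. ?D m2 (Suc i)) G"
    using extend_chain_map_0[OF proj_complex_shift[OF Qc] proj_complex_simps(3)[OF C] ex1 v1 v1d] by blast
  define u where "u i = (case i of 0 \<Rightarrow> ?v0 | Suc i' \<Rightarrow> G i')" for i
  have u: "chain_map R Q dQ (?C m2) (?D m2) u"
    unfolding chain_map_def
  proof (intro conjI allI ballI)
    show "lin R (Q i) (?C m2 i) (u i)" for i
      using v0 chain_map_simps(1)[OF G(2)] by (cases i) (simp_all add: u_def)
    fix i y assume y: "y \<in> carrier (Q (Suc i))"
    show "?D m2 i (u (Suc i) y) = u i (dQ i y)"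
    proof (cases i)
      case 0
      have "?D m2 0 (?v1 y) = ?t 0 (?D l 0 (u1 y))" by (rule tc) (use lin_closed[OF u1(1)] y 0 in simp)
      then show ?thesis using u1(2) y 0 G(1) by (simp add: u_def del: cone_simps)
    next
      case (Suc i')
      then show ?thesis using chain_map_simps(2)[OF G(2), of y i'] y by (simp add: u_def del: cone_simps)
    qed
  qed
  have "lifts_id M (W l) Q eQ (e l) (\<lambda>_. u0)" using u0(2) unfolding lifts_id_def by auto
  then have ul: "lifts_id M (W m2) Q eQ (e m2) u"
    using lifts_id_trans[where F = "\<lambda>_. u0" and V = "?C m2 0" and P = Q and T = "?C l" and G = ?t, OF _ \<tau>l[OF l(1)] anti[OF l(1)] W _ u0' tl[of 0], of eQ] Pe[of m2]
    unfolding lifts_id_def u_def by simp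
  \<comment> \<open>The factorisation, which lifts the identity of \<open>M\<close> like any comparison map.\<close>
  let ?H = "\<lambda>i y. c i (?\<tau> m1 k i (?\<tau> m2 m1 i (u i y)))"
  have u': "chain_map R Q dQ (?C m1) (?D m1) (\<lambda>i y. ?\<tau> m2 m1 i (u i y))" by (rule chain_map_compose[OF u \<tau>[OF m2(1)]])
  have u'': "chain_map R Q dQ (?C k) (?D k) (\<lambda>i y. ?\<tau> m1 k i (?\<tau> m2 m1 i (u i y)))" by (rule chain_map_compose[OF u' \<tau>[OF m1(1)]])
  have H: "chain_map R Q dQ Q' dQ' ?H" by (rule chain_map_compose[OF u'' c(1)])
  have Ce: "lin R (?C l 0) M (e l)" for l using Pe by simp
  have "lifts_id M (W m1) Q eQ (e m1) (\<lambda>i y. ?\<tau> m2 m1 i (u i y))"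
    by (rule lifts_id_compose[OF ul \<tau>l[OF m2(1)] anti[OF m2(1)] W Ce u \<tau>[OF m2(1)]])
  then have "lifts_id M (W k) Q eQ (e k) (\<lambda>i y. ?\<tau> m1 k i (?\<tau> m2 m1 i (u i y)))"
    by (rule lifts_id_compose[OF _ \<tau>l[OF m1(1)] anti[OF m1(1)] W Ce u' \<tau>[OF m1(1)]])
  then have Hl: "lifts_id M (W' k) Q eQ eQ' ?H"
    by (rule lifts_id_compose[OF _ c(2) WW' sW' resolves_simps(4)[OF Q'] u'' c(1)])
  have "null_at R N (Suc (Suc j)) Q dQ Q' dQ' ?H"
    unfolding null_at_def
  proof (intro allI impI)
    fix \<theta> assume "cocycle R Q' dQ' N (Suc (Suc j)) \<theta>"
    then have \<theta>: "cocycle R (?C k) (?D k) N (Suc (Suc j)) (\<lambda>z. \<theta> (c (Suc (Suc j)) z))" by (rule cocycle_pullback[OF c(1) C])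
    have e: "x [^] k \<otimes> x [^] (m1 - k) \<otimes> x [^] (m2 - m1) = x [^] m2" using pw m1(1) m2(1) by simp
    have "coboundary R (?C m2) (?D m2) N (Suc (Suc j)) (\<lambda>z. \<theta> (c (Suc (Suc j)) (?\<tau> m1 k (Suc (Suc j)) (?\<tau> m2 m1 (Suc (Suc j)) z))))"
      using cone_null[OF Pc Pc Pc F(1)[OF m1(1)] F(1)[OF m2(1)] m1(2) m2(2) xk xk xk \<theta>, of "m1 - k" "m2 - m1"] unfolding e .
    then show "coboundary R Q dQ N (Suc (Suc j)) (\<lambda>y. \<theta> (?H (Suc (Suc j)) y))" by (rule coboundary_pullback[OF u Qc])
  qed
  then have "null_transition N i M (W' l) (W' k)" unfolding null_transition_def j using Q Q' H Hl by blast
  then show "\<exists>l \<ge> k. null_transition N i M (sub_sum M (W l) ((\<lambda>m. (x [^] l) \<odot>\<^bsub>M\<^esub> m) ` carrier M))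
      (sub_sum M (W k) ((\<lambda>m. (x [^] k) \<odot>\<^bsub>M\<^esub> m) ` carrier M))" using l(2) unfolding W'_def by blast
qed

end

section \<open>Powers of an ideal\<close>

lemma ideal_pow:
  "I [^]\<^bsub>ideals_set R\<^esub> (0::nat) = carrier R" "I [^]\<^bsub>ideals_set R\<^esub> (Suc k) = ideal_prod R (I [^]\<^bsub>ideals_set R\<^esub> k) I"
  by (simp_all add: nat_pow_def ideals_set_def)

lemma submodule_span_submodule:
  assumes "module R M" "A \<subseteq> carrier M" shows "submodule (submodule_span R M A) R M"
  unfolding submodule_span_def
  by (rule submoduleI'[OF assms(1)])
    (use assms submodule_carrier[OF assms(1)] submodule_simps(3-5)[OF assms(1)] in auto)

lemma submodule_span_least: "submodule H R M \<Longrightarrow> A \<subseteq> H \<Longrightarrow> submodule_span R M A \<subseteq> H"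
  unfolding submodule_span_def by blast

lemma submodule_span_mem: "A \<subseteq> submodule_span R M A"
  unfolding submodule_span_def by blast

lemma ideal_smult_submodule:
  assumes "module R M" "I \<subseteq> carrier R" shows "submodule (ideal_smult R I M) R M"
  unfolding ideal_smult_def
proof (rule submodule_span_submodule[OF assms(1)], clarify)
  fix a x assume "a \<in> I" "x \<in> carrier M"
  then show "a \<odot>\<^bsub>M\<^esub> x \<in> carrier M" using assms(2) mod_closed(4)[OF assms(1)] by blast
qed

lemma ideal_smult_mem: "a \<in> I \<Longrightarrow> x \<in> carrier M \<Longrightarrow> a \<odot>\<^bsub>M\<^esub> x \<in> ideal_smult R I M"
  unfolding ideal_smult_def by (rule subsetD[OF submodule_span_mem], rule CollectI, intro exI conjI, rule refl)

lemma ideal_smult_least: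
  "submodule H R M \<Longrightarrow> (\<And>a x. a \<in> I \<Longrightarrow> x \<in> carrier M \<Longrightarrow> a \<odot>\<^bsub>M\<^esub> x \<in> H) \<Longrightarrow> ideal_smult R I M \<subseteq> H"
  unfolding ideal_smult_def by (rule submodule_span_least, assumption, clarify)

lemma ideal_smult_mono:
  assumes "module R M" "I \<subseteq> J" "J \<subseteq> carrier R" shows "ideal_smult R I M \<subseteq> ideal_smult R J M"
proof (rule ideal_smult_least[OF ideal_smult_submodule[OF assms(1,3)]])
  fix a x assume "a \<in> I" "x \<in> carrier M"
  then show "a \<odot>\<^bsub>M\<^esub> x \<in> ideal_smult R J M" using assms(2) by (intro ideal_smult_mem) auto
qed

context cring
begin

lemma ideal_pow_ideal: "ideal I R \<Longrightarrow> ideal (I [^]\<^bsub>ideals_set R\<^esub> (k::nat)) R"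
  by (induction k) (simp_all only: ideal_pow oneideal ideal_prod_is_ideal)

lemma ideal_pow_carrier: "ideal I R \<Longrightarrow> I [^]\<^bsub>ideals_set R\<^esub> (k::nat) \<subseteq> carrier R"
  using ideal.Icarr[OF ideal_pow_ideal[of I k]] by auto

lemma ideal_pow_antimono: "ideal I R \<Longrightarrow> k \<le> l \<Longrightarrow> I [^]\<^bsub>ideals_set R\<^esub> (l::nat) \<subseteq> I [^]\<^bsub>ideals_set R\<^esub> k"
proof (induction l)
  case (Suc l)
  have "I [^]\<^bsub>ideals_set R\<^esub> Suc l \<subseteq> I [^]\<^bsub>ideals_set R\<^esub> l"
    unfolding ideal_pow using ideal_prod_inter[OF ideal_pow_ideal[OF Suc.prems(1)] Suc.prems(1)] by blast
  then show ?case using Suc by (cases "k = Suc l") auto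
qed auto

lemma elem_pow_mem: "ideal I R \<Longrightarrow> x \<in> I \<Longrightarrow> x [^] (k::nat) \<in> I [^]\<^bsub>ideals_set R\<^esub> k"
proof (induction k)
  case 0 then show ?case unfolding ideal_pow by simp
next
  case (Suc k) then show ?case unfolding ideal_pow nat_pow_Suc by (intro ideal_prod.prod) simp_all
qed

lemma ideal_submodule_regular: assumes "ideal I R" shows "submodule I R (regular_module R)"
proof -
  interpret ideal I R by fact
  show ?thesis by (rule submoduleI'[OF regular_module[OF is_cring]]) (auto simp: I_l_closed a_subset)
qed

lemma colon_ideal: assumes "ideal I R" "x \<in> carrier R" shows "ideal {r \<in> carrier R. r \<otimes> x \<in> I} R"
  using conductor_ideal[OF regular_module[OF is_cring] ideal_submodule_regular[OF assms(1)]] assms(2) by simp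

definition lprod where "lprod ys = foldr (\<otimes>) ys \<one>"

lemma lprod_simps [simp]: "lprod [] = \<one>" "lprod (y # ys) = y \<otimes> lprod ys"
  by (simp_all add: lprod_def)

lemma lprod_closed: "set ys \<subseteq> carrier R \<Longrightarrow> lprod ys \<in> carrier R"
  by (induction ys) auto

text \<open>An ideal power is tested on products of generators. The induction has to range over all \<open>I\<close>, as the
  step passes to the colon ideals of the generators.\<close>

lemma ideal_pow_subset:
  assumes "X \<subseteq> carrier R" "ideal I R" "\<And>ys. length ys = m \<Longrightarrow> set ys \<subseteq> X \<Longrightarrow> lprod ys \<in> I"
  shows "(Idl X) [^]\<^bsub>ideals_set R\<^esub> m \<subseteq> I"
  using assms(2,3)
proof (induction m arbitrary: I)
  case 0
  then have "\<one> \<in> I" by (metis empty_subsetI length_0_conv list.set(1) lprod_simps(1))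
  then show ?case using ideal.one_imp_carrier[OF 0(1)] unfolding ideal_pow by simp
next
  case (Suc m)
  interpret I: ideal I R by fact
  have a: "ideal (Idl X) R" by (rule genideal_ideal[OF assms(1)])
  have uv: "u \<otimes> v \<in> I" if u: "u \<in> (Idl X) [^]\<^bsub>ideals_set R\<^esub> m" and v: "v \<in> Idl X" for u v
  proof -
    have uR: "u \<in> carrier R" using u ideal_pow_carrier[OF a] by blast
    have "X \<subseteq> {v \<in> carrier R. v \<otimes> u \<in> I}"
    proof
      fix y assume y: "y \<in> X"
      then have yR: "y \<in> carrier R" using assms(1) by blast
      have "(Idl X) [^]\<^bsub>ideals_set R\<^esub> m \<subseteq> {r \<in> carrier R. r \<otimes> y \<in> I}"
      proof (rule Suc.IH[OF colon_ideal[OF Suc.prems(1) yR]])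
        fix ys assume ys: "length ys = m" "set ys \<subseteq> X"
        then have c: "lprod ys \<in> carrier R" using lprod_closed assms(1) by blast
        have "lprod (y # ys) \<in> I" by (rule Suc.prems(2)) (use ys y in auto)
        then show "lprod ys \<in> {r \<in> carrier R. r \<otimes> y \<in> I}" using c yR by (simp add: m_comm)
      qed
      then have "u \<otimes> y \<in> I" using u by blast
      then show "y \<in> {v \<in> carrier R. v \<otimes> u \<in> I}" using yR uR by (simp add: m_comm)
    qed
    then have "Idl X \<subseteq> {v \<in> carrier R. v \<otimes> u \<in> I}" by (rule genideal_minimal[OF colon_ideal[OF Suc.prems(1) uR]])
    then show ?thesis using v uR by (auto simp: m_comm)
  qed
  show ?case
  proof
    fix s assume "s \<in> (Idl X) [^]\<^bsub>ideals_set R\<^esub> Suc m"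
    then show "s \<in> I" unfolding ideal_pow by (induction rule: ideal_prod.induct) (auto intro: uv)
  qed
qed

lemma lprod_count:
  assumes "set ys \<subseteq> carrier R" "y \<in> carrier R"
  shows "\<exists>r \<in> carrier R. lprod ys = y [^] count_list ys y \<otimes> r"
  using assms(1)
proof (induction ys)
  case (Cons z ys)
  then obtain r where r: "r \<in> carrier R" "lprod ys = y [^] count_list ys y \<otimes> r" by auto
  have z: "z \<in> carrier R" using Cons.prems by auto
  show ?case
  proof (cases "z = y")
    case True
    then have "lprod (z # ys) = y [^] count_list (z # ys) y \<otimes> r"
      using r assms(2) by (simp add: m_assoc m_comm m_lcomm)
    then show ?thesis using r(1) by blast
  next
    case False
    then have "lprod (z # ys) = y [^] count_list (z # ys) y \<otimes> (z \<otimes> r)"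
      using r z assms(2) by (simp add: m_lcomm)
    then show ?thesis using r(1) z by blast
  qed
qed (use assms in \<open>auto intro!: bexI[of _ \<one>]\<close>)

text \<open>A product of more than \<open>k \<cdot> card X\<close> factors from \<open>X\<close> contains a \<open>k\<close>-th power.\<close>

lemma ideal_pow_in_ideal_of_powers:
  assumes X: "X \<subseteq> carrier R" "finite X" and I: "ideal I R" and pw: "\<And>y. y \<in> X \<Longrightarrow> y [^] (k::nat) \<in> I"
  shows "(Idl X) [^]\<^bsub>ideals_set R\<^esub> Suc (card X * k) \<subseteq> I"
proof (rule ideal_pow_subset[OF X(1) I])
  interpret I: ideal I R by fact
  fix ys assume ys: "length ys = Suc (card X * k)" "set ys \<subseteq> X"
  have "\<exists>y \<in> X. k < count_list ys y"
  proof (rule ccontr)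
    assume "\<not> (\<exists>y \<in> X. k < count_list ys y)"
    then have "sum (count_list ys) X \<le> card X * k" by (intro sum_bounded_above[where K = k, simplified]) auto
    then show False using sum_count_set[OF ys(2) X(2)] ys(1) by simp
  qed
  then obtain y where y: "y \<in> X" "k < count_list ys y" by auto
  have yR: "y \<in> carrier R" and ysR: "set ys \<subseteq> carrier R" using y ys X by auto
  obtain r where r: "r \<in> carrier R" "lprod ys = y [^] count_list ys y \<otimes> r" using lprod_count[OF ysR yR] by auto
  have "y [^] count_list ys y = y [^] k \<otimes> y [^] (count_list ys y - k)" using y(2) yR by (simp add: nat_pow_mult)
  then show "lprod ys \<in> I" using r pw[OF y(1)] yR by (simp add: I.I_r_closed)
qed

end

section \<open>Vanishing for a module of finite projective dimension\<close>

context noeth_universe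
begin

text \<open>The submodules \<open>x\<^sub>1\<^sup>k M + \<dots> + x\<^sub>r\<^sup>k M\<close>. Unlike the powers of the ideal, they allow adding one generator at
  a time.\<close>

fun powers_sum where
  "powers_sum M [] k = {\<zero>\<^bsub>M\<^esub>}"
| "powers_sum M (x # xs) k = sub_sum M (powers_sum M xs k) ((\<lambda>m. (x [^] (k::nat)) \<odot>\<^bsub>M\<^esub> m) ` carrier M)"

lemma powers_sum_submodule:
  assumes "module R M" "set xs \<subseteq> carrier R" shows "submodule (powers_sum M xs k) R M"
  using assms(2) by (induction xs) (auto intro: submodule_zero submodule_sub_sum submodule_scaled assms(1))

lemma sub_sum_mono: "H \<subseteq> H' \<Longrightarrow> K \<subseteq> K' \<Longrightarrow> sub_sum A H K \<subseteq> sub_sum A H' K'"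
  unfolding sub_sum_def by blast

lemma powers_sum_antimono:
  assumes m: "module R M" and "set xs \<subseteq> carrier R" "k \<le> l" shows "powers_sum M xs l \<subseteq> powers_sum M xs k"
  using assms(2)
proof (induction xs)
  case (Cons x xs)
  have "(x [^] l) \<odot>\<^bsub>M\<^esub> z \<in> (\<lambda>m. (x [^] k) \<odot>\<^bsub>M\<^esub> m) ` carrier M" if z: "z \<in> carrier M" for z
  proof -
    have "x [^] l = x [^] k \<otimes> x [^] (l - k)" using Cons.prems assms(3) by (simp add: nat_pow_mult)
    then have "(x [^] l) \<odot>\<^bsub>M\<^esub> z = (x [^] k) \<odot>\<^bsub>M\<^esub> ((x [^] (l - k)) \<odot>\<^bsub>M\<^esub> z)"
      using Cons.prems z by (simp add: mod_smult_assoc[OF m])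
    then show ?thesis using Cons.prems z by (auto simp: mod_closed[OF m])
  qed
  then have "sub_sum M (powers_sum M xs l) ((\<lambda>m. (x [^] l) \<odot>\<^bsub>M\<^esub> m) ` carrier M)
      \<subseteq> sub_sum M (powers_sum M xs k) ((\<lambda>m. (x [^] k) \<odot>\<^bsub>M\<^esub> m) ` carrier M)"
    using Cons by (intro sub_sum_mono) auto
  then show ?case by simp
qed auto

lemma pro_nullI:
  fixes P T :: "nat \<Rightarrow> ('r, 'u) module"
  assumes "resolves R M W' P d e" "resolves R M W T \<delta> e'" "chain_map R P d T \<delta> F" "lifts_id M W P e e' F"
    "null_at R N i P d T \<delta> F"
  shows "null_transition N i M W' W"
  unfolding null_transition_def by (intro exI conjI; fact)

lemma eventually_null_zero:
  fixes M :: "('r, 'u) module"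
  assumes P: "resolves R M {\<zero>\<^bsub>M\<^esub>} (P :: nat \<Rightarrow> ('r, 'u) module) d e" and fin: "\<And>i. i > p \<Longrightarrow> carrier (P i) = {\<zero>\<^bsub>P i\<^esub>}"
    and N: "module R N"
  shows "eventually_null N p M (\<lambda>_. {\<zero>\<^bsub>M\<^esub>})"
  unfolding eventually_null_def
proof (intro allI impI)
  fix i k :: nat assume "p < i"
  then obtain j where j: "i = Suc j" by (cases i) auto
  note Pc = resolves_simps(2)[OF P] and m = resolves_simps(5)[OF P] and e = resolves_simps(4)[OF P]
  note d = proj_complex_simps(3)[OF Pc] and mP = proj_complex_simps(2)[OF Pc]
  have F: "chain_map R P d P d (\<lambda>i x. x)" unfolding chain_map_def using lin_ident[OF mP] by auto
  have L: "lifts_id M {\<zero>\<^bsub>M\<^esub>} P e e (\<lambda>i x. x)" unfolding lifts_id_def using lin_closed[OF e] by (auto simp: mod_simps[OF m])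
  have n: "null_at R N i P d P d (\<lambda>i x. x)"
    unfolding null_at_def j coboundary_Suc
  proof (intro allI impI exI[of _ "\<lambda>x. \<zero>\<^bsub>N\<^esub>"] conjI ballI)
    fix \<phi> assume \<phi>: "cocycle R P d N (Suc j) \<phi>"
    fix x assume "x \<in> carrier (P (Suc j))"
    then have "x = \<zero>\<^bsub>P (Suc j)\<^esub>" using fin[of i] \<open>p < i\<close> j by simp
    then show "\<phi> x = \<zero>\<^bsub>N\<^esub>" using lin_zero[OF cocycle_lin[OF \<phi>]] by simp
  qed (rule lin_const_zero[OF mP N])
  have "null_transition N i M {\<zero>\<^bsub>M\<^esub>} {\<zero>\<^bsub>M\<^esub>}" by (rule pro_nullI[OF P P F L n])
  then show "\<exists>l \<ge> k. null_transition N i M {\<zero>\<^bsub>M\<^esub>} {\<zero>\<^bsub>M\<^esub>}" by (intro exI[of _ k] conjI order_refl)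
qed

lemma eventually_null_powers_sum:
  fixes M :: "('r, 'u) module"
  assumes M: "fin_gen R M" and z: "eventually_null N p M (\<lambda>_. {\<zero>\<^bsub>M\<^esub>})" and xs: "set xs \<subseteq> carrier R"
  shows "eventually_null N (p + length xs) M (powers_sum M xs)"
  using xs
proof (induction xs)
  case Nil
  have "powers_sum M [] = (\<lambda>_. {\<zero>\<^bsub>M\<^esub>})" by auto
  then show ?case using z by simp
next
  case (Cons x xs)
  have m: "module R M" using M by (rule fin_gen_module)
  have "powers_sum M (x # xs) = (\<lambda>k. sub_sum M (powers_sum M xs k) ((\<lambda>m. (x [^] (k::nat)) \<odot>\<^bsub>M\<^esub> m) ` carrier M))" by auto
  moreover have xs: "set xs \<subseteq> carrier R" "x \<in> carrier R" using Cons.prems by auto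
  note eventually_null_step[where W = "powers_sum M xs", OF M powers_sum_submodule[OF m xs(1)] powers_sum_antimono[OF m xs(1)] xs(2) Cons.IH[OF xs(1)]]
  ultimately show ?case by simp
qed

text \<open>The two systems of submodules are cofinal in each other, and vanishing transition maps are
  inherited by cofinal systems.\<close>

lemma eventually_null_ideal_powers:
  fixes M :: "('r, 'u) module"
  assumes M: "fin_gen R M" and z: "eventually_null N p M (\<lambda>_. {\<zero>\<^bsub>M\<^esub>})" and xs: "set xs \<subseteq> carrier R"
  shows "eventually_null N (p + length xs) M (\<lambda>k. ideal_smult R ((Idl (set xs)) [^]\<^bsub>ideals_set R\<^esub> k) M)"
  unfolding eventually_null_def
proof (intro allI impI)
  fix i k assume i: "p + length xs < i"
  let ?a = "\<lambda>k. (Idl (set xs)) [^]\<^bsub>ideals_set R\<^esub> (k::nat)" and ?W = "powers_sum M xs"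
  let ?V = "\<lambda>k. ideal_smult R (?a k) M"
  have m: "module R M" using M by (rule fin_gen_module)
  have a: "ideal (Idl (set xs)) R" by (rule genideal_ideal[OF xs])
  have sV: "submodule (?V k) R M" for k by (rule ideal_smult_submodule[OF m ideal_pow_carrier[OF a]])
  have sW: "submodule (?W k) R M" for k by (rule powers_sum_submodule[OF m xs])
  have WV: "?W k \<subseteq> ?V k" for k
  proof -
    have "powers_sum M ys k \<subseteq> ?V k" if "set ys \<subseteq> set xs" for ys
      using that
    proof (induction ys)
      case Nil then show ?case using submodule_simps(3)[OF m sV] by simp
    next
      case (Cons y ys)
      have "y \<in> Idl (set xs)" using genideal_self[OF xs] Cons.prems by auto
      then have "(y [^] k) \<odot>\<^bsub>M\<^esub> z \<in> ?V k" if "z \<in> carrier M" for z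
        by (intro ideal_smult_mem elem_pow_mem[OF a] that)
      then show ?case using Cons submodule_simps(4)[OF m sV] by (auto simp: sub_sum_def)
    qed
    then show ?thesis by simp
  qed
  obtain l where l: "l \<ge> k" "null_transition N i M (?W l) (?W k)"
    using eventually_null_powers_sum[OF M z xs] i unfolding eventually_null_def by blast
  let ?I = "\<Inter>z \<in> carrier M. {r \<in> carrier R. r \<odot>\<^bsub>M\<^esub> z \<in> ?W l}"
  have "ideal ?I R"
    by (rule i_Intersect[of "(\<lambda>z. {r \<in> carrier R. r \<odot>\<^bsub>M\<^esub> z \<in> ?W l}) ` carrier M"])
      (use conductor_ideal[OF m sW] mod_closed(2)[OF m] in auto)
  moreover have "y [^] l \<in> ?I" if "y \<in> set xs" for y
  proof -
    have "(y [^] l) \<odot>\<^bsub>M\<^esub> z \<in> powers_sum M ys l" if "z \<in> carrier M" "y \<in> set ys" "set ys \<subseteq> carrier R" for z ys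
      using that(2,3)
    proof (induction ys)
      case (Cons v ys)
      have sv: "submodule ((\<lambda>m. (v [^] l) \<odot>\<^bsub>M\<^esub> m) ` carrier M) R M" by (rule submodule_scaled[OF m]) (use Cons.prems in simp)
      have sW': "submodule (powers_sum M ys l) R M" by (rule powers_sum_submodule[OF m]) (use Cons.prems in simp)
      show ?case
      proof (cases "y = v")
        case True
        then show ?thesis using subsetD[OF sub_sum_upper(2)[OF m sW' sv] imageI[OF \<open>z \<in> carrier M\<close>]] by simp
      next
        case False
        then show ?thesis using subsetD[OF sub_sum_upper(1)[OF m sW' sv]] Cons by simp
      qed
    qed simp
    then show ?thesis using that xs by auto
  qed
  ultimately have "?a (Suc (card (set xs) * l)) \<subseteq> ?I" by (intro ideal_pow_in_ideal_of_powers[OF xs]) auto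
  then have VW: "?V (Suc (card (set xs) * l)) \<subseteq> ?W l" by (intro ideal_smult_least[OF sW]) auto
  define n where "n = max l (Suc (card (set xs) * l))"
  have n: "n \<ge> k" "n \<ge> Suc (card (set xs) * l)" using l by (auto simp: n_def)
  have mono: "?V s \<subseteq> ?V t" if "t \<le> s" for s t
    by (rule ideal_smult_mono[OF m ideal_pow_antimono[OF a that] ideal_pow_carrier[OF a]])
  have nW: "?V n \<subseteq> ?W l" using mono[OF n(2)] VW by blast
  obtain P :: "nat \<Rightarrow> ('r, 'u) module" and d e where P: "resolves R M (?V n) P d e" using resolution_exists[OF M sV] by metis
  obtain T :: "nat \<Rightarrow> ('r, 'u) module" and \<delta> e' where T: "resolves R M (?V k) T \<delta> e'" using resolution_exists[OF M sV] by metis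
  note Pc = resolves_simps(2)[OF P]
  have "e (d 0 x) \<in> ?V k" if "x \<in> carrier (P (Suc 0))" for x
    using resolves_simps(6)[OF P lin_closed[OF proj_complex_simps(3)[OF Pc] that]] that mono[OF n(1)] by auto
  then obtain F where F: "chain_map R P d T \<delta> F" "lifts_id M (?V k) P e e' F"
    using lift_exists[OF Pc resolves_simps(4)[OF P] _ T] by metis
  have "null_at R N i P d T \<delta> F"
    by (rule null_transition_transfer[OF l(2) P T nW WV powers_sum_antimono[OF m xs l(1)] F])
  then have "null_transition N i M (?V n) (?V k)" by (rule pro_nullI[OF P T F])
  then show "\<exists>n \<ge> k. null_transition N i M (?V n) (?V k)" using n(1) by blast
qed

lemma finite_resolution:
  fixes M :: "('r, 'u) module"
  assumes "module R M" "projective_dimension TYPE('u) R M < \<infinity>"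
  obtains p and P :: "nat \<Rightarrow> ('r, 'u) module" and d e where "resolves R M {\<zero>\<^bsub>M\<^esub>} P d e" "\<And>i. i > p \<Longrightarrow> carrier (P i) = {\<zero>\<^bsub>P i\<^esub>}"
proof -
  let ?A = "{enat n | n. \<exists>(P :: nat \<Rightarrow> ('r, 'u) module) d e.
      projective_resolution R M P d e \<and> (\<forall>i > n. carrier (P i) = {\<zero>\<^bsub>P i\<^esub>})}"
  have "?A \<noteq> {}"
  proof
    assume "?A = {}"
    then have "projective_dimension TYPE('u) R M = \<infinity>" unfolding projective_dimension_def by (simp add: Inf_enat_def)
    then show False using assms(2) by simp
  qed
  then obtain p and P :: "nat \<Rightarrow> ('r, 'u) module" and d e where
    r: "projective_resolution R M P d e" and fin: "\<forall>i > p. carrier (P i) = {\<zero>\<^bsub>P i\<^esub>}" by auto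
  have pr: "projective_module R (P i)" for i using r by (simp add: projective_resolution_def)
  then have mP: "module R (P i)" for i by (simp add: projective_module_def)
  have d: "lin R (P (Suc i)) (P i) (d i)" for i using r module_homs_lin[OF mP mP] by (simp add: projective_resolution_def)
  have e: "lin R (P 0) M e" using r module_homs_lin[OF mP assms(1)] by (simp add: projective_resolution_def)
  have im: "d (Suc i) ` carrier (P (Suc (Suc i))) = {x \<in> carrier (P (Suc i)). d i x = \<zero>\<^bsub>P i\<^esub>}" for i
    using r by (simp add: projective_resolution_def module_kernel_def)
  have "resolves R M {\<zero>\<^bsub>M\<^esub>} P d e"
    unfolding resolves_def
  proof (intro conjI)
    show "proj_complex R P d" unfolding proj_complex_def using pr d im by blast
    show "exact_from P d 0" unfolding exact_from_def using im by auto
    show "\<forall>x \<in> carrier (P 0). e x \<in> {\<zero>\<^bsub>M\<^esub>} \<longleftrightarrow> x \<in> d 0 ` carrier (P (Suc 0))"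
      using r by (simp add: projective_resolution_def module_kernel_def)
    show "\<forall>m \<in> carrier M. \<exists>x \<in> carrier (P 0). \<exists>w \<in> {\<zero>\<^bsub>M\<^esub>}. m = e x \<oplus>\<^bsub>M\<^esub> w"
    proof
      fix m assume m: "m \<in> carrier M"
      then have "m \<in> e ` carrier (P 0)" using r by (simp add: projective_resolution_def)
      then obtain x where x: "x \<in> carrier (P 0)" "m = e x" by auto
      then have "m = e x \<oplus>\<^bsub>M\<^esub> \<zero>\<^bsub>M\<^esub>" using m mod_simps(2)[OF assms(1)] by simp
      with x show "\<exists>x \<in> carrier (P 0). \<exists>w \<in> {\<zero>\<^bsub>M\<^esub>}. m = e x \<oplus>\<^bsub>M\<^esub> w" by blast
    qed
  qed (use submodule_zero[OF assms(1)] e in auto)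
  then show thesis using that fin by blast
qed

end

section \<open>Direct limits\<close>

locale direct_system =
  fixes R :: "('r, 's) ring_scheme" and D :: "nat \<Rightarrow> ('r, 'a) module" and t :: "nat \<Rightarrow> nat \<Rightarrow> 'a \<Rightarrow> 'a"
  assumes t_lin: "\<And>k l. k \<le> l \<Longrightarrow> lin R (D k) (D l) (t k l)"
    and t_trans: "\<And>k l m x. k \<le> l \<Longrightarrow> l \<le> m \<Longrightarrow> x \<in> carrier (D k) \<Longrightarrow> t l m (t k l x) = t k m x"
begin

definition lim_class where "lim_class k x = direct_limit_rel D t `` {(k, x)}"

lemma D_module: "module R (D k)" using t_lin[OF order_refl] lin_module by blast

lemma rel_iff:
  "((k, x), (l, y)) \<in> direct_limit_rel D t \<longleftrightarrow> x \<in> carrier (D k) \<and> y \<in> carrier (D l) \<and> (\<exists>m \<ge> max k l. t k m x = t l m y)"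
  by (auto simp: direct_limit_rel_def)

lemma rel_equiv: "equiv (SIGMA k:UNIV. carrier (D k)) (direct_limit_rel D t)"
proof (rule equivI)
  show "direct_limit_rel D t \<subseteq> (SIGMA k:UNIV. carrier (D k)) \<times> (SIGMA k:UNIV. carrier (D k))"
    by (auto simp: direct_limit_rel_def)
  show "refl_on (SIGMA k:UNIV. carrier (D k)) (direct_limit_rel D t)"
    by (auto simp: refl_on_def rel_iff)
  show "sym (direct_limit_rel D t)"
    by (auto simp: sym_def rel_iff max.commute)
  show "trans (direct_limit_rel D t)"
  proof (rule transI, clarify)
    fix k x l y m z
    assume "((k, x), (l, y)) \<in> direct_limit_rel D t" "((l, y), (m, z)) \<in> direct_limit_rel D t"
    then obtain p q where p: "p \<ge> max k l" "t k p x = t l p y" and q: "q \<ge> max l m" "t l q y = t m q z"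
      and c: "x \<in> carrier (D k)" "y \<in> carrier (D l)" "z \<in> carrier (D m)" by (auto simp: rel_iff)
    let ?n = "max p q"
    have "t k ?n x = t p ?n (t k p x)" by (rule t_trans[symmetric]) (use p c in auto)
    also have "\<dots> = t l ?n y" unfolding p(2) by (rule t_trans) (use p c in auto)
    also have "\<dots> = t q ?n (t l q y)" by (rule t_trans[symmetric]) (use q c in auto)
    also have "\<dots> = t m ?n z" unfolding q(2) by (rule t_trans) (use q c in auto)
    finally show "((k, x), (m, z)) \<in> direct_limit_rel D t" using p q c by (auto simp: rel_iff intro!: exI[of _ ?n])
  qed
qed

lemma lim_class_eq:
  assumes "x \<in> carrier (D k)" "y \<in> carrier (D l)"
  shows "lim_class k x = lim_class l y \<longleftrightarrow> (\<exists>m \<ge> max k l. t k m x = t l m y)"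
  unfolding lim_class_def using eq_equiv_class_iff[OF rel_equiv, of "(k, x)" "(l, y)"] assms by (simp add: rel_iff)

lemma lim_class_shift:
  assumes "x \<in> carrier (D k)" "k \<le> l" shows "lim_class k x = lim_class l (t k l x)"
  using lim_class_eq[OF assms(1) lin_closed[OF t_lin[OF assms(2)] assms(1)]] assms
  by (auto simp: t_trans intro!: exI[of _ l])

lemma lim_carrier: "carrier (direct_limit D t) = {lim_class k x | k x. x \<in> carrier (D k)}"
  unfolding direct_limit_def lim_class_def by (auto simp: quotient_def)

lemma lim_class_mem: "(l, y) \<in> lim_class k x \<Longrightarrow> x \<in> carrier (D k) \<Longrightarrow> y \<in> carrier (D l) \<and> lim_class l y = lim_class k x"
  unfolding lim_class_def using equiv_class_eq[OF rel_equiv, of "(k, x)" "(l, y)"] by (auto simp: rel_iff)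

lemma lim_class_self: "x \<in> carrier (D k) \<Longrightarrow> (k, x) \<in> lim_class k x"
  unfolding lim_class_def using rel_equiv by (auto simp: rel_iff)

lemma lim_smult:
  assumes "x \<in> carrier (D k)" "r \<in> carrier R"
  shows "r \<odot>\<^bsub>direct_limit D t\<^esub> lim_class k x = lim_class k (r \<odot>\<^bsub>D k\<^esub> x)"
proof -
  have eq: "lim_class l (r \<odot>\<^bsub>D l\<^esub> y) = lim_class k (r \<odot>\<^bsub>D k\<^esub> x)" if "(l, y) \<in> lim_class k x" for l y
  proof -
    have y: "y \<in> carrier (D l)" "lim_class l y = lim_class k x" using lim_class_mem[OF that assms(1)] by auto
    then obtain m where m: "m \<ge> max l k" "t l m y = t k m x" using lim_class_eq[OF y(1) assms(1)] by auto
    have "t l m (r \<odot>\<^bsub>D l\<^esub> y) = t k m (r \<odot>\<^bsub>D k\<^esub> x)"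
      using m y assms lin_smult[OF t_lin, of l m r y] lin_smult[OF t_lin, of k m r x] by simp
    then show ?thesis using lim_class_eq[OF mod_closed(4)[OF D_module assms(2) y(1)] mod_closed(4)[OF D_module assms(2,1)]] m(1) by blast
  qed
  have "r \<odot>\<^bsub>direct_limit D t\<^esub> lim_class k x = (\<Union>z \<in> lim_class k x. case z of (l, y) \<Rightarrow> lim_class l (r \<odot>\<^bsub>D l\<^esub> y))"
    by (simp add: direct_limit_def lim_class_def)
  also have "\<dots> = lim_class k (r \<odot>\<^bsub>D k\<^esub> x)"
  proof (rule SUP_eq_const)
    show "lim_class k x \<noteq> {}" using lim_class_self[OF assms(1)] by blast
    fix z assume "z \<in> lim_class k x"
    then show "(case z of (l, y) \<Rightarrow> lim_class l (r \<odot>\<^bsub>D l\<^esub> y)) = lim_class k (r \<odot>\<^bsub>D k\<^esub> x)"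
      using eq[of "fst z" "snd z"] by (simp add: case_prod_beta)
  qed
  finally show ?thesis .
qed

lemma lim_add:
  assumes "x \<in> carrier (D k)" "y \<in> carrier (D k)"
  shows "lim_class k x \<oplus>\<^bsub>direct_limit D t\<^esub> lim_class k y = lim_class k (x \<oplus>\<^bsub>D k\<^esub> y)"
proof -
  let ?s = "\<lambda>p q. lim_class (max (fst p) (fst q)) (t (fst p) (max (fst p) (fst q)) (snd p) \<oplus>\<^bsub>D (max (fst p) (fst q))\<^esub> t (fst q) (max (fst p) (fst q)) (snd q))"
  have eq: "?s (l, a) (m, b) = lim_class k (x \<oplus>\<^bsub>D k\<^esub> y)" if "(l, a) \<in> lim_class k x" "(m, b) \<in> lim_class k y" for l a m b
  proof -
    have a: "a \<in> carrier (D l)" "lim_class l a = lim_class k x" using lim_class_mem[OF that(1) assms(1)] by auto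
    have b: "b \<in> carrier (D m)" "lim_class m b = lim_class k y" using lim_class_mem[OF that(2) assms(2)] by auto
    obtain p where p: "p \<ge> max l k" "t l p a = t k p x" using lim_class_eq[OF a(1) assms(1)] a(2) by auto
    obtain q where q: "q \<ge> max m k" "t m q b = t k q y" using lim_class_eq[OF b(1) assms(2)] b(2) by auto
    let ?n = "max p q" and ?j = "max l m"
    have la: "l \<le> ?j" "m \<le> ?j" "?j \<le> ?n" "k \<le> ?n" using p q by auto
    have c: "t l ?j a \<in> carrier (D ?j)" "t m ?j b \<in> carrier (D ?j)" using lin_closed[OF t_lin] a b la by auto
    have "t ?j ?n (t l ?j a \<oplus>\<^bsub>D ?j\<^esub> t m ?j b) = t l ?n a \<oplus>\<^bsub>D ?n\<^esub> t m ?n b"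
      using c la a b by (simp add: lin_add[OF t_lin[OF la(3)]] t_trans)
    also have "t l ?n a = t p ?n (t l p a)" by (rule t_trans[symmetric]) (use p a in auto)
    also have "\<dots> = t k ?n x" unfolding p(2) by (rule t_trans) (use p assms in auto)
    also have "t m ?n b = t q ?n (t m q b)" by (rule t_trans[symmetric]) (use q b in auto)
    also have "\<dots> = t k ?n y" unfolding q(2) by (rule t_trans) (use q assms in auto)
    also have "t k ?n x \<oplus>\<^bsub>D ?n\<^esub> t k ?n y = t k ?n (x \<oplus>\<^bsub>D k\<^esub> y)" using assms by (simp add: lin_add[OF t_lin[OF la(4)]])
    finally show ?thesis
      using lim_class_eq[OF mod_closed(1)[OF D_module c] mod_closed(1)[OF D_module assms]] la
      by (simp, intro exI[of _ ?n]) simp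
  qed
  have "lim_class k x \<oplus>\<^bsub>direct_limit D t\<^esub> lim_class k y = (\<Union>p \<in> lim_class k x. \<Union>q \<in> lim_class k y. ?s p q)"
    by (simp add: direct_limit_def lim_class_def case_prod_unfold)
  also have "\<dots> = lim_class k (x \<oplus>\<^bsub>D k\<^esub> y)"
  proof (intro SUP_eq_const)
    show "lim_class k x \<noteq> {}" "lim_class k y \<noteq> {}" using lim_class_self assms by blast+
    fix p q assume "p \<in> lim_class k x" "q \<in> lim_class k y"
    then show "?s p q = lim_class k (x \<oplus>\<^bsub>D k\<^esub> y)" using eq[of "fst p" "snd p" "fst q" "snd q"] by simp
  qed
  finally show ?thesis .
qed

lemma lim_zero: "\<zero>\<^bsub>direct_limit D t\<^esub> = lim_class k \<zero>\<^bsub>D k\<^esub>"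
proof -
  have "\<zero>\<^bsub>direct_limit D t\<^esub> = lim_class 0 \<zero>\<^bsub>D 0\<^esub>" by (simp add: direct_limit_def lim_class_def)
  also have "\<dots> = lim_class k \<zero>\<^bsub>D k\<^esub>"
    using lim_class_shift[OF mod_closed(2)[OF D_module], of 0 k] lin_zero[OF t_lin, of 0 k] by simp
  finally show ?thesis .
qed

lemma lim_class_zero:
  assumes "x \<in> carrier (D k)" shows "lim_class k x = \<zero>\<^bsub>direct_limit D t\<^esub> \<longleftrightarrow> (\<exists>l \<ge> k. t k l x = \<zero>\<^bsub>D l\<^esub>)"
  using lim_class_eq[OF assms mod_closed(2)[OF D_module], of k] lim_zero[of k] lin_zero[OF t_lin] by auto

lemma lim_common:
  assumes "X \<in> carrier (direct_limit D t)" "Y \<in> carrier (direct_limit D t)"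
  obtains k x y where "x \<in> carrier (D k)" "y \<in> carrier (D k)" "X = lim_class k x" "Y = lim_class k y"
proof -
  obtain k x l y where *: "x \<in> carrier (D k)" "y \<in> carrier (D l)" "X = lim_class k x" "Y = lim_class l y"
    using assms unfolding lim_carrier by auto
  show thesis
    by (rule that[of "t k (max k l) x" "max k l" "t l (max k l) y"])
      (use * lin_closed[OF t_lin] lim_class_shift in auto)
qed

lemma lim_module: "module R (direct_limit D t)"
proof (rule moduleI)
  let ?L = "direct_limit D t"
  note m = D_module
  show "cring R" using mod_cring[OF D_module] .
  have mem: "lim_class k x \<in> carrier ?L" if "x \<in> carrier (D k)" for k x using that unfolding lim_carrier by auto
  show "abelian_group ?L"
  proof (rule abelian_groupI)
    show "\<zero>\<^bsub>?L\<^esub> \<in> carrier ?L" unfolding lim_zero[of 0] by (rule mem[OF mod_closed(2)[OF m]])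
  next
    fix X Y assume "X \<in> carrier ?L" "Y \<in> carrier ?L"
    then obtain k x y where "x \<in> carrier (D k)" "y \<in> carrier (D k)" "X = lim_class k x" "Y = lim_class k y" by (rule lim_common)
    then show "X \<oplus>\<^bsub>?L\<^esub> Y \<in> carrier ?L" "X \<oplus>\<^bsub>?L\<^esub> Y = Y \<oplus>\<^bsub>?L\<^esub> X"
      by (auto simp: lim_add mod_closed[OF m] mod_ac(1)[OF m, of x k y] intro!: mem)
  next
    fix X Y Z assume "X \<in> carrier ?L" "Y \<in> carrier ?L" and Z: "Z \<in> carrier ?L"
    then obtain k x y where 1: "x \<in> carrier (D k)" "y \<in> carrier (D k)" "X = lim_class k x" "Y = lim_class k y" by (metis lim_common)
    obtain l z where 2: "z \<in> carrier (D l)" "Z = lim_class l z" using Z unfolding lim_carrier by auto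
    let ?n = "max k l"
    have "t k ?n x \<in> carrier (D ?n)" "t k ?n y \<in> carrier (D ?n)" "t l ?n z \<in> carrier (D ?n)"
      "X = lim_class ?n (t k ?n x)" "Y = lim_class ?n (t k ?n y)" "Z = lim_class ?n (t l ?n z)"
      using 1 2 lin_closed[OF t_lin] lim_class_shift by auto
    then show "X \<oplus>\<^bsub>?L\<^esub> Y \<oplus>\<^bsub>?L\<^esub> Z = X \<oplus>\<^bsub>?L\<^esub> (Y \<oplus>\<^bsub>?L\<^esub> Z)"
      by (simp add: lim_add mod_closed[OF m] mod_ac(2)[OF m])
  next
    fix X assume "X \<in> carrier ?L"
    then obtain k x where x: "x \<in> carrier (D k)" "X = lim_class k x" unfolding lim_carrier by auto
    then show "\<zero>\<^bsub>?L\<^esub> \<oplus>\<^bsub>?L\<^esub> X = X" by (simp add: lim_zero[of k] lim_add mod_closed[OF m] mod_simps[OF m])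
    show "\<exists>Y \<in> carrier ?L. Y \<oplus>\<^bsub>?L\<^esub> X = \<zero>\<^bsub>?L\<^esub>"
      by (rule bexI[of _ "lim_class k (\<ominus>\<^bsub>D k\<^esub> x)"])
        (use x in \<open>auto simp: lim_zero[of k] lim_add mod_closed[OF m] mod_simps[OF m] intro!: mem\<close>)
  qed
  fix r X assume r: "r \<in> carrier R" and X: "X \<in> carrier ?L"
  obtain k x where x: "x \<in> carrier (D k)" "X = lim_class k x" using X unfolding lim_carrier by auto
  show "r \<odot>\<^bsub>?L\<^esub> X \<in> carrier ?L" using x r by (auto simp: lim_smult mod_closed[OF m] intro!: mem)
  fix s assume s: "s \<in> carrier R"
  show "(r \<oplus>\<^bsub>R\<^esub> s) \<odot>\<^bsub>?L\<^esub> X = r \<odot>\<^bsub>?L\<^esub> X \<oplus>\<^bsub>?L\<^esub> s \<odot>\<^bsub>?L\<^esub> X"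
    using r s x cring.axioms(1)[OF mod_cring[OF m]] by (simp add: lim_smult lim_add mod_closed[OF m] mod_smult_l_distr[OF m] ring.ring_simprules)
  show "(r \<otimes>\<^bsub>R\<^esub> s) \<odot>\<^bsub>?L\<^esub> X = r \<odot>\<^bsub>?L\<^esub> (s \<odot>\<^bsub>?L\<^esub> X)"
    using r s x cring.axioms(1)[OF mod_cring[OF m]] by (simp add: lim_smult mod_closed[OF m] mod_smult_assoc[OF m] ring.ring_simprules)
next
  let ?L = "direct_limit D t"
  fix r X Y assume r: "r \<in> carrier R" "X \<in> carrier ?L" "Y \<in> carrier ?L"
  then obtain k x y where "x \<in> carrier (D k)" "y \<in> carrier (D k)" "X = lim_class k x" "Y = lim_class k y" by (metis lim_common)
  then show "r \<odot>\<^bsub>?L\<^esub> (X \<oplus>\<^bsub>?L\<^esub> Y) = r \<odot>\<^bsub>?L\<^esub> X \<oplus>\<^bsub>?L\<^esub> r \<odot>\<^bsub>?L\<^esub> Y"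
    using r by (simp add: lim_smult lim_add mod_closed[OF D_module] mod_simps(12)[OF D_module])
next
  fix X assume "X \<in> carrier (direct_limit D t)"
  then obtain k x where "x \<in> carrier (D k)" "X = lim_class k x" unfolding lim_carrier by auto
  then show "\<one>\<^bsub>R\<^esub> \<odot>\<^bsub>direct_limit D t\<^esub> X = X"
    using cring.axioms(1)[OF mod_cring[OF D_module]] by (simp add: lim_smult mod_simps[OF D_module] ring.ring_simprules)
qed

end

section \<open>Ext through cocycles\<close>

lemma hom_module_module:
  assumes A: "module R A" and N: "module R N" shows "module R (hom_module R A N)"
proof -
  have mem: "f \<in> module_homs R A N \<longleftrightarrow> lin R A N f \<and> f \<in> extensional (carrier A)" for f
    using A N by (auto simp: module_homs_def lin_def PiE_def)
  let ?H = "hom_module R A N"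
  have s: "carrier ?H = {f. lin R A N f \<and> f \<in> extensional (carrier A)}" "\<zero>\<^bsub>?H\<^esub> = (\<lambda>x \<in> carrier A. \<zero>\<^bsub>N\<^esub>)"
    "f \<oplus>\<^bsub>?H\<^esub> g = (\<lambda>x \<in> carrier A. f x \<oplus>\<^bsub>N\<^esub> g x)" "r \<odot>\<^bsub>?H\<^esub> f = (\<lambda>x \<in> carrier A. r \<odot>\<^bsub>N\<^esub> f x)" for f g r
    using mem by (auto simp: hom_module_def)
  have rl: "lin R A N f \<Longrightarrow> lin R A N (restrict f (carrier A))" for f by (rule lin_cong) auto
  show ?thesis
  proof (rule moduleI)
    show "cring R" by (rule mod_cring[OF A])
    show "abelian_group ?H"
    proof (rule abelian_groupI, goal_cases)
      case (1 f g) then show ?case unfolding s by (simp add: rl[OF lin_sum])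
    next
      case 2 show ?case unfolding s by (simp add: rl[OF lin_const_zero[OF A N]])
    next
      case (3 f g h) then show ?case unfolding s by (auto simp: fun_eq_iff lin_closed mod_ac[OF N])
    next
      case (4 f g)
      then have fg: "lin R A N f" "lin R A N g" unfolding s by auto
      have "f x \<oplus>\<^bsub>N\<^esub> g x = g x \<oplus>\<^bsub>N\<^esub> f x" if "x \<in> carrier A" for x
        by (rule mod_ac(1)[OF N lin_closed[OF fg(1) that] lin_closed[OF fg(2) that]])
      then show ?case unfolding s by (intro restrict_ext)
    next
      case (5 f)
      then have f: "lin R A N f" "f \<in> extensional (carrier A)" unfolding s by auto
      show ?case unfolding s
        by (rule extensionalityI[of _ "carrier A"]) (use f(2) mod_simps(1)[OF N lin_closed[OF f(1)]] in simp_all)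
    next
      case (6 f)
      then have f: "lin R A N f" unfolding s by auto
      show ?case unfolding s
      proof (rule bexI[of _ "\<lambda>x \<in> carrier A. \<ominus>\<^bsub>N\<^esub> f x"])
        show "(\<lambda>x \<in> carrier A. (\<lambda>x \<in> carrier A. \<ominus>\<^bsub>N\<^esub> f x) x \<oplus>\<^bsub>N\<^esub> f x) = (\<lambda>x \<in> carrier A. \<zero>\<^bsub>N\<^esub>)"
          by (rule restrict_ext) (simp add: mod_simps(3)[OF N lin_closed[OF f]])
      qed (simp add: rl[OF lin_uminus[OF f]])
    qed
    show "r \<odot>\<^bsub>?H\<^esub> f \<in> carrier ?H" if "r \<in> carrier R" "f \<in> carrier ?H" for r f
      using that unfolding s by (simp add: rl[OF lin_scale])
    show "(a \<oplus>\<^bsub>R\<^esub> b) \<odot>\<^bsub>?H\<^esub> f = a \<odot>\<^bsub>?H\<^esub> f \<oplus>\<^bsub>?H\<^esub> b \<odot>\<^bsub>?H\<^esub> f" if "a \<in> carrier R" "b \<in> carrier R" "f \<in> carrier ?H" for a b f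
      using that unfolding s by (auto simp: fun_eq_iff lin_closed mod_smult_l_distr[OF N])
    show "a \<odot>\<^bsub>?H\<^esub> (f \<oplus>\<^bsub>?H\<^esub> g) = a \<odot>\<^bsub>?H\<^esub> f \<oplus>\<^bsub>?H\<^esub> a \<odot>\<^bsub>?H\<^esub> g" if "a \<in> carrier R" "f \<in> carrier ?H" "g \<in> carrier ?H" for a f g
      using that unfolding s by (auto simp: fun_eq_iff lin_closed mod_simps(12)[OF N])
    show "(a \<otimes>\<^bsub>R\<^esub> b) \<odot>\<^bsub>?H\<^esub> f = a \<odot>\<^bsub>?H\<^esub> (b \<odot>\<^bsub>?H\<^esub> f)" if "a \<in> carrier R" "b \<in> carrier R" "f \<in> carrier ?H" for a b f
      using that unfolding s by (auto simp: fun_eq_iff lin_closed mod_smult_assoc[OF N])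
    show "\<one>\<^bsub>R\<^esub> \<odot>\<^bsub>?H\<^esub> f = f" if "f \<in> carrier ?H" for f
    proof -
      have f: "lin R A N f" "f \<in> extensional (carrier A)" using that unfolding s by auto
      show ?thesis unfolding s
        by (rule extensionalityI[of _ "carrier A"]) (use f(2) mod_simps(15)[OF N lin_closed[OF f(1)]] in simp_all)
    qed
  qed
qed

context noeth_universe
begin

abbreviation "Pr L \<equiv> res_module TYPE('u) R L"
abbreviation "dr L \<equiv> res_diff TYPE('u) R L"

definition ext_class where
  "ext_class i L N \<phi> = ext_coboundaries TYPE('u) R i L N +>\<^bsub>ext_cocycles TYPE('u) R i L N\<^esub> restrict \<phi> (carrier (Pr L i))"

text \<open>The module \<open>Ext\<close> is a quotient of a module of extensional functions; the following lemmas replace it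
  by classes of arbitrary cocycles.\<close>

context
  fixes L :: "('r, 'a) module" and N :: "('r, 'b) module" and i :: nat
  assumes P: "proj_complex R (Pr L) (dr L)" and N: "module R N"
begin

abbreviation "Cocycles \<equiv> ext_cocycles TYPE('u) R i L N"
abbreviation "Coboundaries \<equiv> ext_coboundaries TYPE('u) R i L N"

lemma homs_iff: "f \<in> module_homs R (Pr L j) N \<longleftrightarrow> lin R (Pr L j) N f \<and> f \<in> extensional (carrier (Pr L j))"
  using proj_complex_simps(2)[OF P] N by (auto simp: module_homs_def lin_def PiE_def)

lemma Cocycles_carrier: "\<phi> \<in> carrier Cocycles \<longleftrightarrow> cocycle R (Pr L) (dr L) N i \<phi> \<and> \<phi> \<in> extensional (carrier (Pr L i))"
  by (auto simp: ext_cocycles_def homs_iff cocycle_def)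

lemma restrict_cocycle: "cocycle R (Pr L) (dr L) N i \<phi> \<Longrightarrow> restrict \<phi> (carrier (Pr L i)) \<in> carrier Cocycles"
  unfolding Cocycles_carrier using cocycle_cong[OF _ P, of N i \<phi> "restrict \<phi> (carrier (Pr L i))"] by auto

lemma Cocycles_ops:
  "\<zero>\<^bsub>Cocycles\<^esub> = (\<lambda>x \<in> carrier (Pr L i). \<zero>\<^bsub>N\<^esub>)"
  "\<phi> \<oplus>\<^bsub>Cocycles\<^esub> \<psi> = (\<lambda>x \<in> carrier (Pr L i). \<phi> x \<oplus>\<^bsub>N\<^esub> \<psi> x)" "r \<odot>\<^bsub>Cocycles\<^esub> \<phi> = (\<lambda>x \<in> carrier (Pr L i). r \<odot>\<^bsub>N\<^esub> \<phi> x)"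
  by (simp_all add: ext_cocycles_def hom_module_def)

lemma coboundary_zero: "coboundary R (Pr L) (dr L) N i (\<lambda>x. \<zero>\<^bsub>N\<^esub>)"
  using lin_const_zero[OF proj_complex_simps(2)[OF P] N] by (cases i) (auto simp: coboundary_0 coboundary_Suc)

lemma coboundary_scale: "coboundary R (Pr L) (dr L) N i f \<Longrightarrow> r \<in> carrier R \<Longrightarrow> coboundary R (Pr L) (dr L) N i (\<lambda>x. r \<odot>\<^bsub>N\<^esub> f x)"
  by (rule coboundary_post[OF _ lin_act[OF N]])

lemma Cocycles_module: "module R Cocycles"
proof -
  have m: "module R (hom_module R (Pr L i) N)" by (rule hom_module_module[OF proj_complex_simps(2)[OF P] N])
  have "submodule {\<phi> \<in> module_homs R (Pr L i) N. \<forall>x \<in> carrier (Pr L (Suc i)). \<phi> (dr L i x) = \<zero>\<^bsub>N\<^esub>} R (hom_module R (Pr L i) N)"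
  proof (rule submoduleI'[OF m])
    show "{\<phi> \<in> module_homs R (Pr L i) N. \<forall>x \<in> carrier (Pr L (Suc i)). \<phi> (dr L i x) = \<zero>\<^bsub>N\<^esub>} \<subseteq> carrier (hom_module R (Pr L i) N)"
      by (auto simp: hom_module_def)
  qed (use mod_closed[OF m] lin_closed[OF proj_complex_simps(3)[OF P]] in
      \<open>auto simp: hom_module_def mod_simps[OF N] mod_closed[OF N]\<close>)
  then show ?thesis unfolding ext_cocycles_def by (rule sub_module[OF m])
qed

lemma Coboundaries_iff: "\<phi> \<in> Coboundaries \<longleftrightarrow> coboundary R (Pr L) (dr L) N i \<phi> \<and> \<phi> \<in> extensional (carrier (Pr L i))"
proof (cases i)
  case 0
  have "\<phi> = (\<lambda>x \<in> carrier (Pr L 0). \<zero>\<^bsub>N\<^esub>) \<longleftrightarrow> (\<forall>x \<in> carrier (Pr L 0). \<phi> x = \<zero>\<^bsub>N\<^esub>) \<and> \<phi> \<in> extensional (carrier (Pr L 0))"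
    by (auto intro: extensionalityI[of _ "carrier (Pr L 0)"])
  then show ?thesis unfolding 0 coboundary_0 by simp
next
  case (Suc j)
  note d = lin_closed[OF proj_complex_simps(3)[OF P], of _ j]
  show ?thesis
  proof
    assume "\<phi> \<in> Coboundaries"
    then show "coboundary R (Pr L) (dr L) N i \<phi> \<and> \<phi> \<in> extensional (carrier (Pr L i))"
      unfolding Suc coboundary_Suc by (auto simp: homs_iff compose_def)
  next
    assume "coboundary R (Pr L) (dr L) N i \<phi> \<and> \<phi> \<in> extensional (carrier (Pr L i))"
    then obtain \<chi> where \<chi>: "lin R (Pr L j) N \<chi>" "\<And>x. x \<in> carrier (Pr L (Suc j)) \<Longrightarrow> \<phi> x = \<chi> (dr L j x)" "\<phi> \<in> extensional (carrier (Pr L (Suc j)))"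
      unfolding Suc coboundary_Suc by auto
    have "\<phi> = compose (carrier (Pr L (Suc j))) (restrict \<chi> (carrier (Pr L j))) (dr L j)"
      by (rule extensionalityI[OF \<chi>(3)]) (simp_all add: compose_def \<chi>(2) d)
    then show "\<phi> \<in> Coboundaries" unfolding Suc using lin_module_homs[OF \<chi>(1)] by auto
  qed
qed

lemma Coboundaries_submodule: "submodule Coboundaries R Cocycles"
proof (rule submoduleI'[OF Cocycles_module])
  show "Coboundaries \<subseteq> carrier Cocycles" using coboundary_cocycle[OF P _ N] by (auto simp: Coboundaries_iff Cocycles_carrier)
  show "\<zero>\<^bsub>Cocycles\<^esub> \<in> Coboundaries" unfolding Coboundaries_iff Cocycles_ops using coboundary_cong[OF coboundary_zero] by auto
  fix f g assume "f \<in> Coboundaries" "g \<in> Coboundaries"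
  then show "f \<oplus>\<^bsub>Cocycles\<^esub> g \<in> Coboundaries" unfolding Coboundaries_iff Cocycles_ops by (auto intro: coboundary_cong[OF coboundary_sum[OF _ _ N]])
next
  fix r f assume "r \<in> carrier R" "f \<in> Coboundaries"
  then show "r \<odot>\<^bsub>Cocycles\<^esub> f \<in> Coboundaries" unfolding Coboundaries_iff Cocycles_ops by (auto intro: coboundary_cong[OF coboundary_scale])
qed

lemmas quot_lin_Ext = quot_lin[OF Cocycles_module Coboundaries_submodule, folded Ext_def]

lemma Ext_module: "module R (Ext TYPE('u) R i L N)"
  by (rule lin_module(2)[OF quot_lin_Ext])

lemma Ext_carrier: "carrier (Ext TYPE('u) R i L N) = {ext_class i L N \<phi> | \<phi>. cocycle R (Pr L) (dr L) N i \<phi>}"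
proof -
  have "carrier Cocycles = (\<lambda>\<phi>. restrict \<phi> (carrier (Pr L i))) ` {\<phi>. cocycle R (Pr L) (dr L) N i \<phi>}"
  proof
    show "carrier Cocycles \<subseteq> (\<lambda>\<phi>. restrict \<phi> (carrier (Pr L i))) ` {\<phi>. cocycle R (Pr L) (dr L) N i \<phi>}"
      by (rule subsetI) (auto simp: Cocycles_carrier extensional_restrict intro!: image_eqI)
  qed (use restrict_cocycle in blast)
  then show ?thesis
    unfolding Ext_def quot_carrier[OF Cocycles_module Coboundaries_submodule] ext_class_def by auto
qed

lemma ext_class_zero:
  assumes "cocycle R (Pr L) (dr L) N i \<phi>"
  shows "ext_class i L N \<phi> = \<zero>\<^bsub>Ext TYPE('u) R i L N\<^esub> \<longleftrightarrow> coboundary R (Pr L) (dr L) N i \<phi>"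
proof -
  have "restrict \<phi> (carrier (Pr L i)) \<in> Coboundaries \<longleftrightarrow> coboundary R (Pr L) (dr L) N i \<phi>"
    unfolding Coboundaries_iff using coboundary_cong[of R "Pr L" "dr L" N i] by (auto intro: coboundary_cong)
  then show ?thesis unfolding Ext_def ext_class_def using quot_zero[OF Cocycles_module Coboundaries_submodule restrict_cocycle[OF assms]] by simp
qed

lemma ext_class_add:
  assumes "cocycle R (Pr L) (dr L) N i \<phi>" "cocycle R (Pr L) (dr L) N i \<psi>"
  shows "ext_class i L N \<phi> \<oplus>\<^bsub>Ext TYPE('u) R i L N\<^esub> ext_class i L N \<psi> = ext_class i L N (\<lambda>x. \<phi> x \<oplus>\<^bsub>N\<^esub> \<psi> x)"
proof -
  have "restrict \<phi> (carrier (Pr L i)) \<oplus>\<^bsub>Cocycles\<^esub> restrict \<psi> (carrier (Pr L i)) = restrict (\<lambda>x. \<phi> x \<oplus>\<^bsub>N\<^esub> \<psi> x) (carrier (Pr L i))"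
    unfolding Cocycles_ops by auto
  then show ?thesis unfolding ext_class_def using lin_add[OF quot_lin_Ext restrict_cocycle[OF assms(1)] restrict_cocycle[OF assms(2)]] by simp
qed

lemma ext_class_smult:
  assumes "cocycle R (Pr L) (dr L) N i \<phi>" "r \<in> carrier R"
  shows "r \<odot>\<^bsub>Ext TYPE('u) R i L N\<^esub> ext_class i L N \<phi> = ext_class i L N (\<lambda>x. r \<odot>\<^bsub>N\<^esub> \<phi> x)"
proof -
  have "r \<odot>\<^bsub>Cocycles\<^esub> restrict \<phi> (carrier (Pr L i)) = restrict (\<lambda>x. r \<odot>\<^bsub>N\<^esub> \<phi> x) (carrier (Pr L i))"
    unfolding Cocycles_ops by auto
  then show ?thesis unfolding ext_class_def using lin_smult[OF quot_lin_Ext assms(2) restrict_cocycle[OF assms(1)]] by simp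
qed

lemma ext_class_eq:
  assumes "cocycle R (Pr L) (dr L) N i \<phi>" "cocycle R (Pr L) (dr L) N i \<psi>"
    "coboundary R (Pr L) (dr L) N i (\<lambda>x. \<phi> x \<oplus>\<^bsub>N\<^esub> \<ominus>\<^bsub>N\<^esub> \<psi> x)"
  shows "ext_class i L N \<phi> = ext_class i L N \<psi>"
proof -
  let ?E = "Ext TYPE('u) R i L N" and ?d = "\<lambda>x. \<phi> x \<oplus>\<^bsub>N\<^esub> \<ominus>\<^bsub>N\<^esub> \<psi> x"
  have c: "cocycle R (Pr L) (dr L) N i ?d" by (rule coboundary_cocycle[OF P assms(3) N])
  have "ext_class i L N \<phi> = ext_class i L N (\<lambda>x. ?d x \<oplus>\<^bsub>N\<^esub> \<psi> x)"
    unfolding ext_class_def using lin_closed[OF cocycle_lin[OF assms(1)]] lin_closed[OF cocycle_lin[OF assms(2)]]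
    by (auto simp: mod_ac[OF N] mod_closed[OF N] mod_simps[OF N] intro!: arg_cong[where f = "\<lambda>f. _ +>\<^bsub>_\<^esub> f"])
  also have "\<dots> = ext_class i L N ?d \<oplus>\<^bsub>?E\<^esub> ext_class i L N \<psi>" by (rule ext_class_add[OF c assms(2), symmetric])
  also have "\<dots> = ext_class i L N \<psi>"
  proof -
    have "ext_class i L N \<psi> \<in> carrier ?E" unfolding Ext_carrier using assms(2) by blast
    then show ?thesis using ext_class_zero[OF c] assms(3) by (simp add: mod_simps[OF Ext_module])
  qed
  finally show ?thesis .
qed

lemma ext_class_mem:
  assumes "cocycle R (Pr L) (dr L) N i \<phi>" "\<psi> \<in> ext_class i L N \<phi>"
  shows "cocycle R (Pr L) (dr L) N i \<psi>" "coboundary R (Pr L) (dr L) N i (\<lambda>x. \<psi> x \<oplus>\<^bsub>N\<^esub> \<ominus>\<^bsub>N\<^esub> \<phi> x)"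
proof -
  obtain b where b: "b \<in> Coboundaries" "\<psi> = b \<oplus>\<^bsub>Cocycles\<^esub> restrict \<phi> (carrier (Pr L i))"
    using assms a_coset_mem[OF Cocycles_module Coboundaries_submodule restrict_cocycle] unfolding ext_class_def by blast
  have bZ: "b \<in> carrier Cocycles" using b(1) submodule_simps(2)[OF Cocycles_module Coboundaries_submodule] by blast
  then show "cocycle R (Pr L) (dr L) N i \<psi>" using mod_closed(1)[OF Cocycles_module] restrict_cocycle[OF assms(1)] b(2) by (auto simp flip: Cocycles_carrier) (metis Cocycles_carrier)
  have cb: "coboundary R (Pr L) (dr L) N i b" using b(1) by (simp add: Coboundaries_iff)
  have bl: "lin R (Pr L i) N b" using bZ by (auto simp: Cocycles_carrier intro: cocycle_lin)
  show "coboundary R (Pr L) (dr L) N i (\<lambda>x. \<psi> x \<oplus>\<^bsub>N\<^esub> \<ominus>\<^bsub>N\<^esub> \<phi> x)"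
    by (rule coboundary_cong[OF cb])
      (use b(2) lin_closed[OF bl] lin_closed[OF cocycle_lin[OF assms(1)]] in \<open>simp add: Cocycles_ops mod_ac[OF N] mod_closed[OF N] mod_simps[OF N]\<close>)
qed

lemma ext_class_self: "cocycle R (Pr L) (dr L) N i \<phi> \<Longrightarrow> restrict \<phi> (carrier (Pr L i)) \<in> ext_class i L N \<phi>"
  unfolding ext_class_def using a_coset_mem[OF Cocycles_module Coboundaries_submodule restrict_cocycle] submodule_simps(3)[OF Cocycles_module Coboundaries_submodule]
    mod_simps(1)[OF Cocycles_module restrict_cocycle] by force

end

text \<open>Although \<open>Ext_map\<close> is defined by a union over all representatives, each of them contributes the same
  coset.\<close>

lemma Ext_map_class:
  assumes P: "proj_complex R (Pr L) (dr L)" and P': "proj_complex R (Pr L') (dr L')" and N: "module R N"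
    and F: "F = (SOME F. resolution_lift TYPE('u) R L L' f F)" "chain_map R (Pr L) (dr L) (Pr L') (dr L') F"
    and c: "cocycle R (Pr L') (dr L') N i \<phi>"
  shows "Ext_map TYPE('u) R i L L' N f (ext_class i L' N \<phi>) = ext_class i L N (\<lambda>x. \<phi> (F i x))"
proof -
  have eq: "ext_coboundaries TYPE('u) R i L N +>\<^bsub>ext_cocycles TYPE('u) R i L N\<^esub> compose (carrier (Pr L i)) \<psi> (F i) = ext_class i L N (\<lambda>x. \<phi> (F i x))"
    if \<psi>: "\<psi> \<in> ext_class i L' N \<phi>" for \<psi>
  proof -
    note m = ext_class_mem[OF P' N c \<psi>]
    have "ext_coboundaries TYPE('u) R i L N +>\<^bsub>ext_cocycles TYPE('u) R i L N\<^esub> compose (carrier (Pr L i)) \<psi> (F i) = ext_class i L N (\<lambda>x. \<psi> (F i x))"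
      unfolding ext_class_def compose_def by simp
    also have "\<dots> = ext_class i L N (\<lambda>x. \<phi> (F i x))"
      by (rule ext_class_eq[OF P N cocycle_pullback[OF F(2) P m(1)] cocycle_pullback[OF F(2) P c] coboundary_pullback[OF F(2) P m(2)]])
    finally show ?thesis .
  qed
  have mem: "ext_class i L' N \<phi> \<in> carrier (Ext TYPE('u) R i L' N)" using Ext_carrier[OF P' N] c by auto
  have "Ext_map TYPE('u) R i L L' N f (ext_class i L' N \<phi>) = (\<Union>\<psi> \<in> ext_class i L' N \<phi>.
      ext_coboundaries TYPE('u) R i L N +>\<^bsub>ext_cocycles TYPE('u) R i L N\<^esub> compose (carrier (Pr L i)) \<psi> (F i))"
    unfolding Ext_map_def Let_def F(1)[symmetric] using mem by simp
  also have "\<dots> = ext_class i L N (\<lambda>x. \<phi> (F i x))"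
    by (rule SUP_eq_const[OF _ eq]) (use ext_class_self[OF P' N c] in blast)
  finally show ?thesis .
qed

end

section \<open>Generalized local cohomology through cocycles\<close>

context noeth_universe
begin

lemma resolves_imp_projective_resolution:
  fixes P :: "nat \<Rightarrow> ('r, 'u) module" and M :: "('r, 'u) module"
  assumes r: "resolves R M W P d e"
  shows "projective_resolution R (quot_module M W) P (\<lambda>i. restrict (d i) (carrier (P (Suc i))))
    (restrict (\<lambda>x. W +>\<^bsub>M\<^esub> e x) (carrier (P 0)))"
proof -
  note W = resolves_simps(1)[OF r] and P = resolves_simps(2)[OF r] and m = resolves_simps(5)[OF r] and e = resolves_simps(4)[OF r]
  note d = proj_complex_simps(3)[OF P]
  note q = quot_lin[OF m W] and qz = quot_zero[OF m W] and qc = quot_carrier[OF m W]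
  have eq: "W +>\<^bsub>M\<^esub> z = W +>\<^bsub>M\<^esub> e x" if "z = e x \<oplus>\<^bsub>M\<^esub> w" "x \<in> carrier (P 0)" "w \<in> W" for z x w
  proof -
    have "e x \<in> carrier M" "w \<in> carrier M" using lin_closed[OF e] that submodule_simps(2)[OF m W] by auto
    then show ?thesis using coset_eq_iff[OF m W, of z "e x"] that mod_ac(1)[OF m] mod_closed(1)[OF m] by metis
  qed
  have im: "restrict (d i) (carrier (P (Suc i))) ` carrier (P (Suc i)) = d i ` carrier (P (Suc i))" for i by simp
  show ?thesis
    unfolding projective_resolution_def
  proof (intro conjI allI)
    show "projective_module R (P i)" for i by (rule proj_complex_simps(1)[OF P])
    show "restrict (d i) (carrier (P (Suc i))) \<in> module_homs R (P (Suc i)) (P i)" for i by (rule lin_module_homs[OF d])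
    show "restrict (\<lambda>x. W +>\<^bsub>M\<^esub> e x) (carrier (P 0)) \<in> module_homs R (P 0) (quot_module M W)"
      by (rule lin_module_homs[OF lin_compose[OF e q]])
    show "restrict (\<lambda>x. W +>\<^bsub>M\<^esub> e x) (carrier (P 0)) ` carrier (P 0) = carrier (quot_module M W)"
    proof -
      have "W +>\<^bsub>M\<^esub> z \<in> (\<lambda>x. W +>\<^bsub>M\<^esub> e x) ` carrier (P 0)" if "z \<in> carrier M" for z
        using resolves_simps(7)[OF r that] eq by blast
      then show ?thesis unfolding qc using lin_closed[OF e] by (auto simp: image_restrict_eq)
    qed
    show "restrict (d 0) (carrier (P (Suc 0))) ` carrier (P (Suc 0)) = module_kernel (P 0) (quot_module M W) (restrict (\<lambda>x. W +>\<^bsub>M\<^esub> e x) (carrier (P 0)))"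
      unfolding im module_kernel_def using resolves_simps(6)[OF r] lin_closed[OF d] qz lin_closed[OF e] by auto
    show "restrict (d (Suc i)) (carrier (P (Suc (Suc i)))) ` carrier (P (Suc (Suc i))) = module_kernel (P (Suc i)) (P i) (restrict (d i) (carrier (P (Suc i))))" for i
    proof -
      have "x \<in> d (Suc i) ` carrier (P (Suc (Suc i)))" if "x \<in> carrier (P (Suc i))" "d i x = \<zero>\<^bsub>P i\<^esub>" for x
        using resolves_simps(3)[OF r] that by (simp add: exact_from_def)
      then show ?thesis unfolding im module_kernel_def using lin_closed[OF d] proj_complex_simps(4)[OF P] by auto
    qed
  qed
qed

lemma projective_resolution_resolves:
  fixes P :: "nat \<Rightarrow> ('r, 'u) module" and M :: "('r, 'u) module"
  assumes r: "projective_resolution R (quot_module M W) P d \<epsilon>" and m: "module R M" and W: "submodule W R M"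
  shows "\<exists>e. resolves R M W P d e \<and> (\<forall>x \<in> carrier (P 0). \<epsilon> x = W +>\<^bsub>M\<^esub> e x)"
proof -
  note q = quot_lin[OF m W] and qz = quot_zero[OF m W] and qc = quot_carrier[OF m W]
  have mQ: "module R (quot_module M W)" by (rule lin_module(2)[OF q])
  have pr: "projective_module R (P i)" for i using r by (simp add: projective_resolution_def)
  then have mP: "module R (P i)" for i by (simp add: projective_module_def)
  have d: "lin R (P (Suc i)) (P i) (d i)" for i using r module_homs_lin[OF mP mP] by (simp add: projective_resolution_def)
  have \<epsilon>: "lin R (P 0) (quot_module M W) \<epsilon>" using r module_homs_lin[OF mP mQ] by (simp add: projective_resolution_def)
  have im: "d (Suc i) ` carrier (P (Suc (Suc i))) = {x \<in> carrier (P (Suc i)). d i x = \<zero>\<^bsub>P i\<^esub>}" for i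
    using r by (simp add: projective_resolution_def module_kernel_def)
  have im0: "d 0 ` carrier (P (Suc 0)) = {x \<in> carrier (P 0). \<epsilon> x = \<zero>\<^bsub>quot_module M W\<^esub>}"
    using r by (simp add: projective_resolution_def module_kernel_def)
  have surj: "\<epsilon> ` carrier (P 0) = carrier (quot_module M W)" using r by (simp add: projective_resolution_def)
  obtain e where e: "lin R (P 0) M e" "\<And>x. x \<in> carrier (P 0) \<Longrightarrow> W +>\<^bsub>M\<^esub> e x = \<epsilon> x"
    using projective_lift[OF pr q \<epsilon>] lin_closed[OF \<epsilon>] unfolding qc by metis
  have "resolves R M W P d e"
    unfolding resolves_def
  proof (intro conjI)
    show "proj_complex R P d" unfolding proj_complex_def using pr d im by blast
    show "exact_from P d 0" unfolding exact_from_def using im by auto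
    show "\<forall>x \<in> carrier (P 0). e x \<in> W \<longleftrightarrow> x \<in> d 0 ` carrier (P (Suc 0))"
    proof
      fix x assume x: "x \<in> carrier (P 0)"
      have "e x \<in> W \<longleftrightarrow> \<epsilon> x = \<zero>\<^bsub>quot_module M W\<^esub>" using qz[OF lin_closed[OF e(1) x]] e(2)[OF x] by simp
      also have "\<dots> \<longleftrightarrow> x \<in> d 0 ` carrier (P (Suc 0))" unfolding im0 using x by simp
      finally show "e x \<in> W \<longleftrightarrow> x \<in> d 0 ` carrier (P (Suc 0))" .
    qed
    show "\<forall>m \<in> carrier M. \<exists>x \<in> carrier (P 0). \<exists>w \<in> W. m = e x \<oplus>\<^bsub>M\<^esub> w"
    proof
      fix z assume z: "z \<in> carrier M"
      then have "W +>\<^bsub>M\<^esub> z \<in> \<epsilon> ` carrier (P 0)" unfolding surj qc by blast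
      then obtain x where x: "x \<in> carrier (P 0)" "W +>\<^bsub>M\<^esub> z = W +>\<^bsub>M\<^esub> e x" using e(2) by auto
      then obtain w where w: "w \<in> W" "z = w \<oplus>\<^bsub>M\<^esub> e x" using coset_eq_iff[OF m W z lin_closed[OF e(1)]] by auto
      then have "z = e x \<oplus>\<^bsub>M\<^esub> w" using mod_ac(1)[OF m] submodule_simps(2)[OF m W] lin_closed[OF e(1) x(1)] by metis
      then show "\<exists>x \<in> carrier (P 0). \<exists>w \<in> W. z = e x \<oplus>\<^bsub>M\<^esub> w" using x w by blast
    qed
  qed (use W e in auto)
  then show ?thesis using e(2) by auto
qed

end

locale cohomology = noeth_universe R U for R :: "('r, 's) ring_scheme" (structure) and U :: "'u itself" +
  fixes M :: "('r, 'u) module" and \<aa> :: "'r set"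
  assumes M_fg: "fin_gen R M" and ideal_a: "ideal \<aa> R"
begin

definition "W k = ideal_smult R (\<aa> [^]\<^bsub>ideals_set R\<^esub> (k::nat)) M"
definition "L k = quot_by_power R \<aa> M k"
abbreviation "H i N \<equiv> gen_local_cohomology TYPE('u) R \<aa> i M N"
abbreviation "PL k \<equiv> Pr (L k)"
abbreviation "dL k \<equiv> dr (L k)"

lemma M_module: "module R M" using M_fg by (rule fin_gen_module)

lemma W_submodule: "submodule (W k) R M"
  unfolding W_def by (rule ideal_smult_submodule[OF M_module ideal_pow_carrier[OF ideal_a]])

lemma W_antimono: "k \<le> l \<Longrightarrow> W l \<subseteq> W k"
  unfolding W_def by (rule ideal_smult_mono[OF M_module ideal_pow_antimono[OF ideal_a] ideal_pow_carrier[OF ideal_a]])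

lemma L_quot: "L k = quot_module M (W k)"
  by (simp add: L_def W_def quot_by_power_def)

lemma chosen_is_resolution: "projective_resolution R (L k) (PL k) (dL k) (res_augmentation TYPE('u) R (L k))"
proof -
  obtain P :: "nat \<Rightarrow> ('r, 'u) module" and d e where "resolves R M (W k) P d e" using resolution_exists[OF M_fg W_submodule] by metis
  then have "projective_resolution R (L k) P (\<lambda>i. restrict (d i) (carrier (P (Suc i)))) (restrict (\<lambda>x. W k +>\<^bsub>M\<^esub> e x) (carrier (P 0)))"
    unfolding L_quot by (rule resolves_imp_projective_resolution)
  then have "\<exists>c :: (nat \<Rightarrow> ('r, 'u) module) \<times> _ \<times> _. case c of (P, d, e) \<Rightarrow> projective_resolution R (L k) P d e" by auto
  from someI_ex[OF this] show ?thesis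
    unfolding res_module_def res_diff_def res_augmentation_def chosen_resolution_def by (simp add: case_prod_unfold)
qed

text \<open>The chosen resolution of \<open>M / \<aa>\<^sup>k M\<close> maps to a module of cosets; \<open>aug k\<close> lifts this augmentation to \<open>M\<close>,
  which brings the chosen resolutions into the form of \<open>resolves\<close>.\<close>

definition "aug k = (SOME e. resolves R M (W k) (PL k) (dL k) e \<and>
   (\<forall>x \<in> carrier (PL k 0). res_augmentation TYPE('u) R (L k) x = W k +>\<^bsub>M\<^esub> e x))"

lemma aug:
  "resolves R M (W k) (PL k) (dL k) (aug k)"
  "x \<in> carrier (PL k 0) \<Longrightarrow> res_augmentation TYPE('u) R (L k) x = W k +>\<^bsub>M\<^esub> aug k x"
  using someI_ex[OF projective_resolution_resolves[OF chosen_is_resolution[unfolded L_quot] M_module W_submodule], folded L_quot]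
  unfolding aug_def by blast+

lemmas PLc = resolves_simps(2)[OF aug(1)]

definition "F l k = (SOME F. resolution_lift TYPE('u) R (L l) (L k) (power_projection R \<aa> M l k) F)"

lemma power_projection_coset:
  assumes "k \<le> l" "x \<in> carrier M" shows "power_projection R \<aa> M l k (W l +>\<^bsub>M\<^esub> x) = W k +>\<^bsub>M\<^esub> x"
proof -
  note m = M_module
  have mem: "W l +>\<^bsub>M\<^esub> x \<in> carrier (quot_by_power R \<aa> M l)"
    using L_quot[of l] quot_carrier[OF m W_submodule] assms by (auto simp: L_def)
  have eq: "W k +>\<^bsub>M\<^esub> y = W k +>\<^bsub>M\<^esub> x" if "y \<in> W l +>\<^bsub>M\<^esub> x" for y
  proof -
    obtain h where h: "h \<in> W l" "y = h \<oplus>\<^bsub>M\<^esub> x" using \<open>y \<in> W l +>\<^bsub>M\<^esub> x\<close> a_coset_mem[OF m W_submodule assms(2)] by auto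
    then have "h \<in> W k" "y \<in> carrier M" using W_antimono[OF assms(1)] submodule_simps(2)[OF m W_submodule] assms(2) mod_closed(1)[OF m] by auto
    then show ?thesis using coset_eq_iff[OF m W_submodule _ assms(2)] h(2) by blast
  qed
  have "x \<in> W l +>\<^bsub>M\<^esub> x" using a_coset_mem[OF m W_submodule assms(2)] submodule_simps(3)[OF m W_submodule] mod_simps(1)[OF m assms(2)] by metis
  then have "(\<Union>y \<in> W l +>\<^bsub>M\<^esub> x. W k +>\<^bsub>M\<^esub> y) = W k +>\<^bsub>M\<^esub> x" by (intro SUP_eq_const[OF _ eq]) blast
  then show ?thesis unfolding power_projection_def W_def[symmetric] using mem by simp
qed

lemma resolution_lift_iff:
  assumes kl: "k \<le> l"
  shows "resolution_lift TYPE('u) R (L l) (L k) (power_projection R \<aa> M l k) G \<longleftrightarrow>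
    (\<forall>i. G i \<in> module_homs R (PL l i) (PL k i)) \<and> chain_map R (PL l) (dL l) (PL k) (dL k) G \<and>
    lifts_id M (W k) (PL l) (aug l) (aug k) G"
proof -
  note m = M_module
  have aux: "(W k +>\<^bsub>M\<^esub> a = W k +>\<^bsub>M\<^esub> b) \<longleftrightarrow> (\<exists>w \<in> W k. b = a \<oplus>\<^bsub>M\<^esub> w)" if "a \<in> carrier M" "b \<in> carrier M" for a b
    using coset_eq_iff[OF m W_submodule that(2,1)] mod_ac(1)[OF m that(1)] submodule_simps(2)[OF m W_submodule] by metis
  have "(\<forall>x \<in> carrier (PL l 0). res_augmentation TYPE('u) R (L k) (G 0 x) = power_projection R \<aa> M l k (res_augmentation TYPE('u) R (L l) x))
     \<longleftrightarrow> lifts_id M (W k) (PL l) (aug l) (aug k) G" if "\<And>x. x \<in> carrier (PL l 0) \<Longrightarrow> G 0 x \<in> carrier (PL k 0)"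
    unfolding lifts_id_def
    using that by (intro ball_cong refl)
      (simp add: aug(2) power_projection_coset[OF kl] lin_closed[OF resolves_simps(4)[OF aug(1)]] aux)
  moreover have "G i \<in> module_homs R (PL l i) (PL k i) \<Longrightarrow> lin R (PL l i) (PL k i) (G i)" for i
    by (rule module_homs_lin[OF proj_complex_simps(2)[OF PLc] proj_complex_simps(2)[OF PLc]])
  moreover have "lin R (PL l 0) (PL k 0) (G 0) \<Longrightarrow> x \<in> carrier (PL l 0) \<Longrightarrow> G 0 x \<in> carrier (PL k 0)" for x
    by (rule lin_closed)
  ultimately show ?thesis unfolding resolution_lift_def chain_map_def by (safe; metis)
qed

lemma F_props:
  assumes kl: "k \<le> l"
  shows "chain_map R (PL l) (dL l) (PL k) (dL k) (F l k)" "lifts_id M (W k) (PL l) (aug l) (aug k) (F l k)"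
proof -
  have "aug l (dL l 0 x) \<in> W k" if "x \<in> carrier (PL l (Suc 0))" for x
    using resolves_simps(6)[OF aug(1), of "dL l 0 x" l] that lin_closed[OF proj_complex_simps(3)[OF PLc] that] W_antimono[OF kl] by auto
  then obtain G where G: "chain_map R (PL l) (dL l) (PL k) (dL k) G" "lifts_id M (W k) (PL l) (aug l) (aug k) G"
    using lift_exists[OF PLc resolves_simps(4)[OF aug(1)] _ aug(1)] by metis
  let ?G = "\<lambda>i. restrict (G i) (carrier (PL l i))"
  note Gl = chain_map_simps(1)[OF G(1)]
  have "lin R (PL l i) (PL k i) (?G i)" for i by (rule lin_cong[OF Gl]) simp
  then have "chain_map R (PL l) (dL l) (PL k) (dL k) ?G"
    unfolding chain_map_def using lin_closed[OF proj_complex_simps(3)[OF PLc]] chain_map_simps(2)[OF G(1)] by auto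
  moreover have "lifts_id M (W k) (PL l) (aug l) (aug k) ?G" using G(2) by (simp add: lifts_id_def)
  ultimately have "resolution_lift TYPE('u) R (L l) (L k) (power_projection R \<aa> M l k) ?G"
    unfolding resolution_lift_iff[OF kl] using lin_module_homs[OF Gl] by blast
  then have "resolution_lift TYPE('u) R (L l) (L k) (power_projection R \<aa> M l k) (F l k)"
    unfolding F_def using someI[of "resolution_lift TYPE('u) R (L l) (L k) (power_projection R \<aa> M l k)" ?G] by simp
  then show "chain_map R (PL l) (dL l) (PL k) (dL k) (F l k)" "lifts_id M (W k) (PL l) (aug l) (aug k) (F l k)"
    unfolding resolution_lift_iff[OF kl] by auto
qed

abbreviation "Ext_sys i N \<equiv> \<lambda>k. Ext TYPE('u) R i (quot_by_power R \<aa> M k) N"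
abbreviation "Ext_trans i N \<equiv> \<lambda>k l. Ext_map TYPE('u) R i (quot_by_power R \<aa> M l) (quot_by_power R \<aa> M k) N (power_projection R \<aa> M l k)"

lemma Ext_trans_class:
  assumes "module R N" "k \<le> l" "cocycle R (PL k) (dL k) N i \<phi>"
  shows "Ext_trans i N k l (ext_class i (L k) N \<phi>) = ext_class i (L l) N (\<lambda>x. \<phi> (F l k i x))"
  using Ext_map_class[OF PLc PLc assms(1) F_def F_props(1)[OF assms(2)] assms(3)] by (simp add: L_def)

lemma cocycle_F: "k \<le> l \<Longrightarrow> cocycle R (PL k) (dL k) N i \<phi> \<Longrightarrow> cocycle R (PL l) (dL l) N i (\<lambda>x. \<phi> (F l k i x))"
  by (rule cocycle_pullback[OF F_props(1) PLc])

text \<open>Functoriality holds because a composite of comparison maps is again a lift of the identity, and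
  lifts are unique up to homotopy.\<close>

lemma cohomology_system:
  assumes N: "module R N" shows "direct_system R (Ext_sys i N) (Ext_trans i N)"
proof
  have C: "carrier (Ext_sys i N k) = {ext_class i (L k) N \<phi> | \<phi>. cocycle R (PL k) (dL k) N i \<phi>}" for k
    using Ext_carrier[OF PLc N] by (simp add: L_def)
  have m: "module R (Ext_sys i N k)" for k using Ext_module[OF PLc N] by (simp add: L_def)
  show "lin R (Ext_sys i N k) (Ext_sys i N l) (Ext_trans i N k l)" if kl: "k \<le> l" for k l
  proof (rule linI[OF m m])
    show "Ext_trans i N k l x \<in> carrier (Ext_sys i N l)" if x: "x \<in> carrier (Ext_sys i N k)" for x
    proof -
      obtain \<phi> where \<phi>: "cocycle R (PL k) (dL k) N i \<phi>" "x = ext_class i (L k) N \<phi>" using x unfolding C by blast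
      show ?thesis unfolding \<phi>(2) Ext_trans_class[OF N kl \<phi>(1)] C using cocycle_F[OF kl \<phi>(1)] by blast
    qed
    show "Ext_trans i N k l (x \<oplus>\<^bsub>Ext_sys i N k\<^esub> y) = Ext_trans i N k l x \<oplus>\<^bsub>Ext_sys i N l\<^esub> Ext_trans i N k l y" if xy: "x \<in> carrier (Ext_sys i N k)" "y \<in> carrier (Ext_sys i N k)" for x y
    proof -
      obtain \<phi> where \<phi>: "cocycle R (PL k) (dL k) N i \<phi>" "x = ext_class i (L k) N \<phi>" using xy unfolding C by blast
      obtain \<psi> where \<psi>: "cocycle R (PL k) (dL k) N i \<psi>" "y = ext_class i (L k) N \<psi>" using xy unfolding C by blast
      have "x \<oplus>\<^bsub>Ext_sys i N k\<^esub> y = ext_class i (L k) N (\<lambda>x. \<phi> x \<oplus>\<^bsub>N\<^esub> \<psi> x)"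
        unfolding \<phi>(2) \<psi>(2) ext_class_add[OF PLc N \<phi>(1) \<psi>(1), symmetric] by (simp add: L_def)
      then have "Ext_trans i N k l (x \<oplus>\<^bsub>Ext_sys i N k\<^esub> y) = ext_class i (L l) N (\<lambda>x. \<phi> (F l k i x) \<oplus>\<^bsub>N\<^esub> \<psi> (F l k i x))"
        using Ext_trans_class[OF N kl cocycle_sum[OF \<phi>(1) \<psi>(1)]] by simp
      also have "\<dots> = Ext_trans i N k l x \<oplus>\<^bsub>Ext_sys i N l\<^esub> Ext_trans i N k l y"
        unfolding \<phi>(2) \<psi>(2) Ext_trans_class[OF N kl \<phi>(1)] Ext_trans_class[OF N kl \<psi>(1)]
        using ext_class_add[OF PLc N cocycle_F[OF kl \<phi>(1)] cocycle_F[OF kl \<psi>(1)]] by (simp add: L_def)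
      finally show ?thesis .
    qed
    show "Ext_trans i N k l (r \<odot>\<^bsub>Ext_sys i N k\<^esub> x) = r \<odot>\<^bsub>Ext_sys i N l\<^esub> Ext_trans i N k l x" if x: "r \<in> carrier R" "x \<in> carrier (Ext_sys i N k)" for r x
    proof -
      obtain \<phi> where \<phi>: "cocycle R (PL k) (dL k) N i \<phi>" "x = ext_class i (L k) N \<phi>" using x unfolding C by blast
      have "r \<odot>\<^bsub>Ext_sys i N k\<^esub> x = ext_class i (L k) N (\<lambda>x. r \<odot>\<^bsub>N\<^esub> \<phi> x)"
        unfolding \<phi>(2) ext_class_smult[OF PLc N \<phi>(1) x(1), symmetric] by (simp add: L_def)
      then have "Ext_trans i N k l (r \<odot>\<^bsub>Ext_sys i N k\<^esub> x) = ext_class i (L l) N (\<lambda>x. r \<odot>\<^bsub>N\<^esub> \<phi> (F l k i x))"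
        using Ext_trans_class[OF N kl cocycle_post[OF \<phi>(1) lin_act[OF N x(1)]]] by simp
      also have "\<dots> = r \<odot>\<^bsub>Ext_sys i N l\<^esub> Ext_trans i N k l x"
        unfolding \<phi>(2) Ext_trans_class[OF N kl \<phi>(1)] using ext_class_smult[OF PLc N cocycle_F[OF kl \<phi>(1)] x(1)] by (simp add: L_def)
      finally show ?thesis .
    qed
  qed
  show "Ext_trans i N l n (Ext_trans i N k l x) = Ext_trans i N k n x" if le: "k \<le> l" "l \<le> n" and x: "x \<in> carrier (Ext_sys i N k)" for k l n x
  proof -
    obtain \<phi> where \<phi>: "cocycle R (PL k) (dL k) N i \<phi>" "x = ext_class i (L k) N \<phi>" using x unfolding C by blast
    have kn: "k \<le> n" using le by simp
    let ?G = "\<lambda>i x. F l k i (F n l i x)"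
    have G: "chain_map R (PL n) (dL n) (PL k) (dL k) ?G" by (rule chain_map_compose[OF F_props(1)[OF le(2)] F_props(1)[OF le(1)]])
    have Gl: "lifts_id M (W k) (PL n) (aug n) (aug k) ?G"
      by (rule lifts_id_compose[OF F_props(2)[OF le(2)] F_props(2)[OF le(1)] W_antimono[OF le(1)] W_submodule
        resolves_simps(4)[OF aug(1)] F_props(1)[OF le(2)] F_props(1)[OF le(1)]])
    have "ext_class i (L n) N (\<lambda>x. \<phi> (?G i x)) = ext_class i (L n) N (\<lambda>x. \<phi> (F n k i x))"
      by (rule ext_class_eq[OF PLc N cocycle_pullback[OF G PLc \<phi>(1)] cocycle_F[OF kn \<phi>(1)]
        lift_unique[OF PLc aug(1) G Gl F_props(1)[OF kn] F_props(2)[OF kn] \<phi>(1)]])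
    then show ?thesis unfolding \<phi>(2) Ext_trans_class[OF N le(1) \<phi>(1)] Ext_trans_class[OF N le(2) cocycle_F[OF le(1) \<phi>(1)]] Ext_trans_class[OF N kn \<phi>(1)] .
  qed
qed

text \<open>The class of a cocycle on the chosen resolution of \<open>M / \<aa>\<^sup>k M\<close>. The lemmas below describe the module \<open>H i N\<close>
  completely in terms of these classes, and nothing else about it is used later.\<close>

definition coh_class where
  "coh_class i N k \<phi> = direct_limit_rel (Ext_sys i N) (Ext_trans i N) `` {(k, ext_class i (L k) N \<phi>)}"

lemma ext_class_mem_Ext_sys: "module R N \<Longrightarrow> cocycle R (PL k) (dL k) N i \<phi> \<Longrightarrow> ext_class i (L k) N \<phi> \<in> carrier (Ext_sys i N k)"
  using Ext_carrier[OF PLc[of k], of N i] unfolding L_def by blast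

lemma Ext_sys_E:
  assumes "module R N" "x \<in> carrier (Ext_sys i N k)" obtains \<phi> where "cocycle R (PL k) (dL k) N i \<phi>" "x = ext_class i (L k) N \<phi>"
  using Ext_carrier[OF PLc[of k] assms(1), of i] assms(2) by (auto simp: L_def)

context
  fixes N :: "('r, 'b) module" assumes N: "module R N"
begin

interpretation D: direct_system R "Ext_sys i N" "Ext_trans i N" for i by (rule cohomology_system[OF N])

lemma coh_class_D: "coh_class i N k \<phi> = D.lim_class i k (ext_class i (L k) N \<phi>)"
  by (simp add: coh_class_def D.lim_class_def)

lemma H_module: "module R (H i N)"
  unfolding gen_local_cohomology_def by (rule D.lim_module)

lemma coh_class_mem: "cocycle R (PL k) (dL k) N i \<phi> \<Longrightarrow> coh_class i N k \<phi> \<in> carrier (H i N)"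
  unfolding gen_local_cohomology_def D.lim_carrier coh_class_D
  by (rule CollectI, intro exI conjI, rule refl, rule ext_class_mem_Ext_sys[OF N])

lemma H_cases:
  assumes "h \<in> carrier (H i N)" obtains k \<phi> where "cocycle R (PL k) (dL k) N i \<phi>" "h = coh_class i N k \<phi>"
proof -
  obtain k x where x: "x \<in> carrier (Ext_sys i N k)" "h = D.lim_class i k x"
    using assms unfolding gen_local_cohomology_def D.lim_carrier by auto
  from x(1) obtain \<phi> where "cocycle R (PL k) (dL k) N i \<phi>" "x = ext_class i (L k) N \<phi>" by (rule Ext_sys_E[OF N])
  then show thesis using that x(2) unfolding coh_class_D by blast
qed

lemma coh_class_add:
  assumes "cocycle R (PL k) (dL k) N i \<phi>" "cocycle R (PL k) (dL k) N i \<psi>"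
  shows "coh_class i N k \<phi> \<oplus>\<^bsub>H i N\<^esub> coh_class i N k \<psi> = coh_class i N k (\<lambda>x. \<phi> x \<oplus>\<^bsub>N\<^esub> \<psi> x)"
  using D.lim_add[OF ext_class_mem_Ext_sys[OF N assms(1)] ext_class_mem_Ext_sys[OF N assms(2)]] ext_class_add[OF PLc N assms]
  by (simp add: gen_local_cohomology_def coh_class_D L_def)

lemma coh_class_smult:
  assumes "cocycle R (PL k) (dL k) N i \<phi>" "r \<in> carrier R"
  shows "r \<odot>\<^bsub>H i N\<^esub> coh_class i N k \<phi> = coh_class i N k (\<lambda>x. r \<odot>\<^bsub>N\<^esub> \<phi> x)"
  using D.lim_smult[OF ext_class_mem_Ext_sys[OF N assms(1)] assms(2)] ext_class_smult[OF PLc N assms]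
  by (simp add: gen_local_cohomology_def coh_class_D L_def)

lemma coh_class_shift:
  assumes "cocycle R (PL k) (dL k) N i \<phi>" "k \<le> l"
  shows "coh_class i N k \<phi> = coh_class i N l (\<lambda>x. \<phi> (F l k i x))"
  using D.lim_class_shift[OF ext_class_mem_Ext_sys[OF N assms(1)] assms(2)] Ext_trans_class[OF N assms(2,1)]
  by (simp add: coh_class_D L_def)

lemma coh_class_zero:
  assumes c: "cocycle R (PL k) (dL k) N i \<phi>"
  shows "coh_class i N k \<phi> = \<zero>\<^bsub>H i N\<^esub> \<longleftrightarrow> (\<exists>l \<ge> k. coboundary R (PL l) (dL l) N i (\<lambda>x. \<phi> (F l k i x)))"
proof -
  have "Ext_trans i N k l (ext_class i (L k) N \<phi>) = \<zero>\<^bsub>Ext_sys i N l\<^esub> \<longleftrightarrow> coboundary R (PL l) (dL l) N i (\<lambda>x. \<phi> (F l k i x))" if "k \<le> l" for l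
    using Ext_trans_class[OF N that c] ext_class_zero[OF PLc N cocycle_F[OF that c]] by (simp add: L_def)
  then show ?thesis using D.lim_class_zero[OF ext_class_mem_Ext_sys[OF N c]] by (auto simp: gen_local_cohomology_def coh_class_D)
qed

end

end

section \<open>Membership in a Serre subcategory\<close>

locale serre_universe = noeth_universe R U for R :: "('r, 's) ring_scheme" (structure) and U :: "'u itself" +
  fixes S :: "('r, 'u) module set"
  assumes serre: "serre_subcategory R S"
begin

abbreviation "in_S X \<equiv> belongs_to R X S"

lemmas serre_parts = serre[unfolded serre_subcategory_def]

lemma S_module: "X \<in> S \<Longrightarrow> module R X"
  by (rule serre_parts[THEN conjunct2, THEN conjunct1, rule_format])

lemma S_sub:
  assumes "X \<in> S" "lin R Y X f" "inj_on f (carrier Y)" shows "Y \<in> S"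
proof -
  have "\<forall>X Y f. X \<in> S \<and> module R Y \<and> f \<in> module_homs R Y X \<and> inj_on f (carrier Y) \<longrightarrow> Y \<in> S"
    by (rule serre_parts[THEN conjunct2, THEN conjunct2, THEN conjunct1])
  moreover have "inj_on (restrict f (carrier Y)) (carrier Y)" using assms(3) by (simp add: inj_on_def)
  ultimately show ?thesis using assms(1) lin_module(1)[OF assms(2)] lin_module_homs[OF assms(2)] by blast
qed

lemma S_quot:
  assumes "X \<in> S" "lin R X Y f" "f ` carrier X = carrier Y" shows "Y \<in> S"
proof -
  have "\<forall>X Y f. X \<in> S \<and> module R Y \<and> f \<in> module_homs R X Y \<and> f ` carrier X = carrier Y \<longrightarrow> Y \<in> S"
    by (rule serre_parts[THEN conjunct2, THEN conjunct2, THEN conjunct2, THEN conjunct1])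
  moreover have "restrict f (carrier X) ` carrier X = carrier Y" using assms(3) by simp
  ultimately show ?thesis using assms(1) lin_module(2)[OF assms(2)] lin_module_homs[OF assms(2)] by blast
qed

lemma S_ext:
  assumes "X \<in> S" "Z \<in> S" "lin R X Y f" "inj_on f (carrier X)" "lin R Y Z g" "g ` carrier Y = carrier Z"
    "f ` carrier X = {y \<in> carrier Y. g y = \<zero>\<^bsub>Z\<^esub>}"
  shows "Y \<in> S"
proof -
  have *: "\<forall>X Y Z f g. X \<in> S \<and> Z \<in> S \<and> module R Y \<and>
       f \<in> module_homs R X Y \<and> inj_on f (carrier X) \<and>
       g \<in> module_homs R Y Z \<and> g ` carrier Y = carrier Z \<and>
       f ` carrier X = module_kernel Y Z g \<longrightarrow> Y \<in> S"
    by (rule serre_parts[THEN conjunct2, THEN conjunct2, THEN conjunct2, THEN conjunct2])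
  show ?thesis
  proof (rule *[rule_format, of X Z Y "restrict f (carrier X)" "restrict g (carrier Y)"], intro conjI)
    show "inj_on (restrict f (carrier X)) (carrier X)" using assms(4) by (simp add: inj_on_def)
    show "restrict f (carrier X) ` carrier X = module_kernel Y Z (restrict g (carrier Y))"
      using assms(7) by (auto simp: module_kernel_def image_restrict_eq)
    show "restrict g (carrier Y) ` carrier Y = carrier Z" using assms(6) by simp
  qed (use assms lin_module(1)[OF assms(5)] lin_module_homs[OF assms(3)] lin_module_homs[OF assms(5)] in auto)
qed

lemma belE:
  assumes "in_S X" "module R X"
  obtains X0 v j where "X0 \<in> S" "lin R X0 X v" "lin R X X0 j" "\<And>x. x \<in> carrier X \<Longrightarrow> v (j x) = x" "\<And>x. x \<in> carrier X0 \<Longrightarrow> j (v x) = x"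
proof -
  obtain X0 v where X0: "X0 \<in> S" "v \<in> module_homs R X0 X" "bij_betw v (carrier X0) (carrier X)"
    using assms(1) unfolding belongs_to_def by blast
  have v: "lin R X0 X v" by (rule module_homs_lin[OF S_module[OF X0(1)] assms(2) X0(2)])
  note m0 = S_module[OF X0(1)]
  let ?j = "inv_into (carrier X0) v"
  have j: "?j x \<in> carrier X0" "v (?j x) = x" if "x \<in> carrier X" for x
    using that X0(3) by (auto simp: bij_betw_def inv_into_into f_inv_into_f)
  have jv: "?j (v x) = x" if "x \<in> carrier X0" for x using that X0(3) by (auto simp: bij_betw_def)
  have inj: "x = y" if "x \<in> carrier X0" "y \<in> carrier X0" "v x = v y" for x y using that X0(3) by (auto simp: bij_betw_def inj_on_def)
  have "lin R X X0 ?j"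
  proof (rule linI[OF assms(2) m0 j(1)])
    fix x y assume xy: "x \<in> carrier X" "y \<in> carrier X"
    show "?j (x \<oplus>\<^bsub>X\<^esub> y) = ?j x \<oplus>\<^bsub>X0\<^esub> ?j y"
      by (rule inj) (use xy j in \<open>simp_all add: lin_add[OF v] mod_closed[OF m0] mod_closed[OF assms(2)]\<close>)
  next
    fix r x assume xy: "r \<in> carrier R" "x \<in> carrier X"
    show "?j (r \<odot>\<^bsub>X\<^esub> x) = r \<odot>\<^bsub>X0\<^esub> ?j x"
      by (rule inj) (use xy j in \<open>simp_all add: lin_smult[OF v] mod_closed[OF m0] mod_closed[OF assms(2)]\<close>)
  qed
  then show thesis using that X0(1) v j(2) jv by blast
qed

lemma belI:
  assumes "X0 \<in> S" "lin R X0 X v" "bij_betw v (carrier X0) (carrier X)" shows "in_S X"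
  unfolding belongs_to_def
  using assms lin_module_homs[OF assms(2)] by (intro bexI[of _ X0] bexI[of _ "restrict v (carrier X0)"]) (auto simp: bij_betw_def inj_on_def)

lemma lepoll_product_universe:
  assumes "A \<lesssim> (UNIV :: 'u set)" "B \<lesssim> (UNIV :: 'u set)" shows "A \<times> B \<lesssim> (UNIV :: 'u set)"
  using lepoll_trans[OF times_lepoll_mono[OF assms]] universe_times by simp

text \<open>Closure under submodules, quotients and extensions in one statement: only exactness in the
  middle is required.\<close>

lemma in_S_exact:
  assumes W: "in_S W" and X: "in_S X" and f: "lin R W Y f" and g: "lin R Y X g"
    and ex: "\<And>y. y \<in> carrier Y \<Longrightarrow> g y = \<zero>\<^bsub>X\<^esub> \<Longrightarrow> y \<in> f ` carrier W"
  shows "in_S Y"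
proof -
  note mW = lin_module(1)[OF f] and mY = lin_module(2)[OF f] and mX = lin_module(2)[OF g]
  obtain W0 vW jW where W0: "W0 \<in> S" "lin R W0 W vW" "lin R W W0 jW"
    "\<And>x. x \<in> carrier W \<Longrightarrow> vW (jW x) = x" "\<And>x. x \<in> carrier W0 \<Longrightarrow> jW (vW x) = x" using belE[OF W mW] by metis
  obtain X0 vX jX where X0: "X0 \<in> S" "lin R X0 X vX" "lin R X X0 jX"
    "\<And>x. x \<in> carrier X \<Longrightarrow> vX (jX x) = x" "\<And>x. x \<in> carrier X0 \<Longrightarrow> jX (vX x) = x" using belE[OF X mX] by metis
  have "inj_on jW (carrier W)" "inj_on jX (carrier X)" using W0(4) X0(4) by (metis inj_onI)+
  then have cW: "carrier W \<lesssim> (UNIV :: 'u set)" and cX: "carrier X \<lesssim> (UNIV :: 'u set)" by (auto simp: lepoll_def)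
  define s where "s c = (SOME y. y \<in> carrier Y \<and> g y = c)" for c
  have s: "s (g y) \<in> carrier Y" "g (s (g y)) = g y" if "y \<in> carrier Y" for y
    using someI[of "\<lambda>z. z \<in> carrier Y \<and> g z = g y" y] that unfolding s_def by auto
  define w where "w y = (SOME w. w \<in> carrier W \<and> f w = y \<oplus>\<^bsub>Y\<^esub> \<ominus>\<^bsub>Y\<^esub> s (g y))" for y
  have w: "w y \<in> carrier W" "f (w y) = y \<oplus>\<^bsub>Y\<^esub> \<ominus>\<^bsub>Y\<^esub> s (g y)" if y: "y \<in> carrier Y" for y
  proof -
    have "g (y \<oplus>\<^bsub>Y\<^esub> \<ominus>\<^bsub>Y\<^esub> s (g y)) = \<zero>\<^bsub>X\<^esub>"
      using s[OF y] y lin_closed[OF g y] by (simp add: lin_simps[OF g] mod_closed[OF mY] mod_simps[OF mX])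
    then have "\<exists>w. w \<in> carrier W \<and> f w = y \<oplus>\<^bsub>Y\<^esub> \<ominus>\<^bsub>Y\<^esub> s (g y)"
      using ex[of "y \<oplus>\<^bsub>Y\<^esub> \<ominus>\<^bsub>Y\<^esub> s (g y)"] s(1)[OF y] y mod_closed[OF mY] by (metis imageE)
    from someI_ex[OF this] show "w y \<in> carrier W" "f (w y) = y \<oplus>\<^bsub>Y\<^esub> \<ominus>\<^bsub>Y\<^esub> s (g y)" unfolding w_def by auto
  qed
  have "inj_on (\<lambda>y. (w y, g y)) (carrier Y)"
  proof (rule inj_onI)
    fix y z assume yz: "y \<in> carrier Y" "z \<in> carrier Y" "(w y, g y) = (w z, g z)"
    then have "y \<oplus>\<^bsub>Y\<^esub> \<ominus>\<^bsub>Y\<^esub> s (g y) = z \<oplus>\<^bsub>Y\<^esub> \<ominus>\<^bsub>Y\<^esub> s (g y)" using w(2)[of y] w(2)[of z] by simp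
    then have "(y \<oplus>\<^bsub>Y\<^esub> \<ominus>\<^bsub>Y\<^esub> s (g y)) \<oplus>\<^bsub>Y\<^esub> s (g y) = (z \<oplus>\<^bsub>Y\<^esub> \<ominus>\<^bsub>Y\<^esub> s (g y)) \<oplus>\<^bsub>Y\<^esub> s (g y)" by simp
    then show "y = z" using yz s(1)[OF yz(1)] by (simp add: mod_ac(2)[OF mY] mod_closed[OF mY] mod_simps[OF mY])
  qed
  moreover have "(\<lambda>y. (w y, g y)) ` carrier Y \<subseteq> carrier W \<times> carrier X" using w lin_closed[OF g] by auto
  ultimately have "carrier Y \<lesssim> carrier W \<times> carrier X" unfolding lepoll_def by blast
  then have "carrier Y \<lesssim> (UNIV :: 'u set)" using lepoll_trans lepoll_product_universe[OF cW cX] by blast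
  then obtain Y0 :: "('r, 'u) module" and j v where Y0: "lin R Y Y0 j" "lin R Y0 Y v" "j ` carrier Y = carrier Y0"
    "\<And>x. x \<in> carrier Y \<Longrightarrow> v (j x) = x" "\<And>y. y \<in> carrier Y0 \<Longrightarrow> j (v y) = y"
    using lepoll_copy[OF mY] by metis
  let ?f = "\<lambda>x. j (f (vW x))" and ?g = "\<lambda>y. jX (g (v y))"
  have f': "lin R W0 Y0 ?f" by (rule lin_compose[OF lin_compose[OF W0(2) f] Y0(1)])
  have g': "lin R Y0 X0 ?g" by (rule lin_compose[OF lin_compose[OF Y0(2) g] X0(3)])
  note mW0 = lin_module(1)[OF f'] and mY0 = lin_module(2)[OF f'] and mX0 = lin_module(2)[OF g']
  have I: "submodule (?f ` carrier W0) R Y0" by (rule submodule_image[OF f' submodule_carrier[OF mW0]])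
  let ?K = "{y \<in> carrier Y0. ?g y = \<zero>\<^bsub>X0\<^esub>}"
  have K: "submodule ?K R Y0" by (rule submodule_ker[OF g'])
  have J: "submodule (?g ` carrier Y0) R X0" by (rule submodule_image[OF g' submodule_carrier[OF mY0]])
  have "sub Y0 (?f ` carrier W0) \<in> S" by (rule S_quot[OF W0(1) lin_into_sub[OF f' I]]) auto
  moreover have "?K \<subseteq> ?f ` carrier W0"
  proof
    fix y assume y: "y \<in> ?K"
    then have c: "v y \<in> carrier Y" using lin_closed[OF Y0(2)] by auto
    have "g (v y) = vX (jX (g (v y)))" using X0(4)[OF lin_closed[OF g c]] by simp
    also have "\<dots> = \<zero>\<^bsub>X\<^esub>" using y lin_zero[OF X0(2)] by simp
    finally obtain z where z: "z \<in> carrier W" "v y = f z" using ex[OF c] by auto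
    then have "y = ?f (jW z)" using W0(4) Y0(5)[of y] y by simp
    then show "y \<in> ?f ` carrier W0" using lin_closed[OF W0(3) z(1)] by blast
  qed
  ultimately have KS: "sub Y0 ?K \<in> S"
    by (rule_tac S_sub[of "sub Y0 (?f ` carrier W0)" _ "\<lambda>x. x"])
      (auto intro!: lin_into_sub[of _ _ Y0, simplified] lin_sub_incl mY0 K I)
  have JS: "sub X0 (?g ` carrier Y0) \<in> S" by (rule S_sub[OF X0(1) lin_sub_incl[OF mX0 J]]) (auto simp: inj_on_def)
  have "Y0 \<in> S"
    by (rule S_ext[OF KS JS lin_sub_incl[OF mY0 K] _ lin_into_sub[OF g' J]]) (auto simp: inj_on_def)
  moreover have "bij_betw v (carrier Y0) (carrier Y)"
    by (rule bij_betw_byWitness[where f' = j]) (use Y0 lin_closed[OF Y0(1)] lin_closed[OF Y0(2)] in auto)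
  ultimately show ?thesis by (rule belI[OF _ Y0(2)])
qed

lemma in_S_inj: assumes X: "in_S X" and g: "lin R Y X g" and "\<And>y. y \<in> carrier Y \<Longrightarrow> g y = \<zero>\<^bsub>X\<^esub> \<Longrightarrow> y = \<zero>\<^bsub>Y\<^esub>" shows "in_S Y"
proof (rule in_S_exact[OF X X lin_const_zero[OF lin_module(2,1)[OF g]] g])
  show "y \<in> (\<lambda>x. \<zero>\<^bsub>Y\<^esub>) ` carrier X" if "y \<in> carrier Y" "g y = \<zero>\<^bsub>X\<^esub>" for y
    using assms(3)[OF that] mod_closed(2)[OF lin_module(2)[OF g]] by blast
qed

lemma in_S_surj: assumes X: "in_S X" and f: "lin R X Y f" "f ` carrier X = carrier Y" shows "in_S Y"
  by (rule in_S_exact[OF X X f(1) lin_const_zero[OF lin_module(2,1)[OF f(1)]]]) (use f(2) in auto)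

lemma in_S_zero: assumes "module R Y" "carrier Y = {\<zero>\<^bsub>Y\<^esub>}" shows "in_S Y"
proof -
  obtain X where X: "X \<in> S" using serre_parts[THEN conjunct1] by blast
  have "in_S X" by (rule belI[OF X lin_ident[OF S_module[OF X]]]) (auto simp: bij_betw_def)
  then show ?thesis by (rule in_S_inj[OF _ lin_const_zero[OF assms(1) S_module[OF X]]]) (use assms(2) in auto)
qed

text \<open>Exactness of \<open>W \<rightarrow> Y \<rightarrow> X\<close> for linear relations in place of maps: \<open>\<sigma>\<close> is single-valued but perhaps not
  everywhere defined, \<open>\<rho>\<close> is everywhere defined but perhaps not single-valued. With relations, neither the
  connecting map nor the map induced by a homomorphism has to be shown independent of representatives.
  The proof applies \<open>in_S_exact\<close> to the graph \<open>\<rho>\<close>, which maps onto \<open>Y\<close>, and to the part of \<open>\<sigma>\<close> over the kernel,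
  which embeds into \<open>W\<close>.\<close>

lemma in_S_rel:
  assumes W: "in_S W" "module R W" and X: "in_S X" "module R X" and Y: "module R Y"
    and \<sigma>: "submodule \<sigma> R (prod_module W Y)" "\<And>y. (\<zero>\<^bsub>W\<^esub>, y) \<in> \<sigma> \<Longrightarrow> y = \<zero>\<^bsub>Y\<^esub>"
    and \<rho>: "submodule \<rho> R (prod_module Y X)" "\<And>y. y \<in> carrier Y \<Longrightarrow> \<exists>x. (y, x) \<in> \<rho>"
    and ex: "\<And>y. (y, \<zero>\<^bsub>X\<^esub>) \<in> \<rho> \<Longrightarrow> \<exists>w. (w, y) \<in> \<sigma>"
  shows "in_S Y"
proof -
  note mWY = prod_module_module[OF W(2) Y] and mYX = prod_module_module[OF Y X(2)]
  note s = submodule_simps[OF mWY \<sigma>(1)] and r = submodule_simps[OF mYX \<rho>(1)]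
  have emb: "lin R Y (prod_module Y X) (\<lambda>y. (y, \<zero>\<^bsub>X\<^esub>))"
    by (rule linI) (use Y mYX in \<open>auto simp: mod_closed[OF X(2)] mod_simps[OF X(2)]\<close>)
  have snd_WY: "lin R (prod_module W Y) (prod_module Y X) (\<lambda>z. (snd z, \<zero>\<^bsub>X\<^esub>))"
    using lin_compose[OF _ emb, of "prod_module W Y" snd] linI[OF mWY Y, of snd] by auto
  let ?\<sigma> = "{z \<in> \<sigma>. (snd z, \<zero>\<^bsub>X\<^esub>) \<in> \<rho>}"
  have \<sigma>': "submodule ?\<sigma> R (prod_module W Y)"
  proof -
    have "submodule {z \<in> carrier (prod_module W Y). (snd z, \<zero>\<^bsub>X\<^esub>) \<in> \<rho>} R (prod_module W Y)"
      by (rule submodule_vimage[OF snd_WY \<rho>(1)])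
    note v = submodule_simps[OF mWY this]
    show ?thesis
    proof (rule submoduleI'[OF mWY])
      show "?\<sigma> \<subseteq> carrier (prod_module W Y)" using s(1) by (rule subset_trans[rotated]) simp
      have e: "z \<in> ?\<sigma> \<longleftrightarrow> z \<in> \<sigma> \<and> z \<in> {z \<in> carrier (prod_module W Y). (snd z, \<zero>\<^bsub>X\<^esub>) \<in> \<rho>}" for z
        using s(2)[of z] by (auto simp del: prod_module_simps)
      show "\<zero>\<^bsub>prod_module W Y\<^esub> \<in> ?\<sigma>" unfolding e using s(3) v(3) by (rule conjI)
      show "x \<oplus>\<^bsub>prod_module W Y\<^esub> y \<in> ?\<sigma>" if "x \<in> ?\<sigma>" "y \<in> ?\<sigma>" for x y
        using that unfolding e by (elim conjE) (intro conjI s(4) v(4))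
      show "r \<odot>\<^bsub>prod_module W Y\<^esub> x \<in> ?\<sigma>" if "r \<in> carrier R" "x \<in> ?\<sigma>" for r x
        using that unfolding e by (elim conjE) (intro conjI s(5) v(5))
    qed
  qed
  have "lin R (prod_module W Y) W fst" by (rule linI[OF mWY W(2)]) auto
  then have b1: "in_S (sub (prod_module W Y) ?\<sigma>)"
    by (rule in_S_inj[OF W(1) lin_from_sub[OF _ \<sigma>']]) (use \<sigma>(2) in auto)
  have sn: "lin R (prod_module Y X) X snd" by (rule linI[OF mYX X(2)]) auto
  have b2: "in_S (sub (prod_module Y X) \<rho>)"
  proof (rule in_S_exact[OF b1 X(1) lin_into_sub[OF lin_from_sub[OF snd_WY \<sigma>'] \<rho>(1)] lin_from_sub[OF sn \<rho>(1)]])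
    fix z assume z: "z \<in> carrier (sub (prod_module Y X) \<rho>)" "snd z = \<zero>\<^bsub>X\<^esub>"
    then have "(fst z, \<zero>\<^bsub>X\<^esub>) \<in> \<rho>" by (metis partial_object.simps(1) partial_object.surjective partial_object.update_convs(1) prod.collapse)
    then obtain w where "(w, fst z) \<in> \<sigma>" using ex by blast
    then show "z \<in> (\<lambda>z. (snd z, \<zero>\<^bsub>X\<^esub>)) ` carrier (sub (prod_module W Y) ?\<sigma>)"
      using z \<open>(fst z, \<zero>\<^bsub>X\<^esub>) \<in> \<rho>\<close> by (intro image_eqI[of _ _ "(w, fst z)"]) (auto simp: prod_eq_iff)
  qed auto
  have "lin R (prod_module Y X) Y fst" by (rule linI[OF mYX Y]) auto
  note l = lin_from_sub[OF this \<rho>(1)]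
  have "fst ` \<rho> = carrier Y"
  proof
    show "fst ` \<rho> \<subseteq> carrier Y" using r(1) by auto
    show "carrier Y \<subseteq> fst ` \<rho>" using \<rho>(2) image_iff by fastforce
  qed
  then show ?thesis by (intro in_S_surj[OF b2 l]) simp
qed

end

section \<open>Long exact sequences\<close>

context cohomology
begin

lemma coh_class_eq:
  assumes N: "module R N" and c: "cocycle R (PL k) (dL k) N i \<phi>" "cocycle R (PL k) (dL k) N i \<psi>"
    "coboundary R (PL k) (dL k) N i (\<lambda>x. \<phi> x \<oplus>\<^bsub>N\<^esub> \<ominus>\<^bsub>N\<^esub> \<psi> x)"
  shows "coh_class i N k \<phi> = coh_class i N k \<psi>"
  unfolding coh_class_def ext_class_eq[OF PLc N c] ..

lemma coh_class_cong:
  assumes N: "module R N" and c: "cocycle R (PL k) (dL k) N i \<phi>" and e: "\<And>x. x \<in> carrier (PL k i) \<Longrightarrow> \<phi> x = \<psi> x"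
  shows "coh_class i N k \<phi> = coh_class i N k \<psi>"
proof -
  have "restrict \<phi> (carrier (PL k i)) = restrict \<psi> (carrier (PL k i))" using e by (rule restrict_ext)
  then show ?thesis unfolding coh_class_def ext_class_def by simp
qed

lemma cocycle_const_zero: "module R N \<Longrightarrow> cocycle R (PL k) (dL k) N i (\<lambda>x. \<zero>\<^bsub>N\<^esub>)"
  by (simp add: cocycle_def lin_const_zero[OF proj_complex_simps(2)[OF PLc]])

lemma coh_class_const_zero: assumes N: "module R N" shows "coh_class i N k (\<lambda>x. \<zero>\<^bsub>N\<^esub>) = \<zero>\<^bsub>H i N\<^esub>"
  unfolding coh_class_zero[OF N cocycle_const_zero[OF N]] using coboundary_zero[OF PLc N] by blast

text \<open>A relation between classes that is given on representatives is a submodule if the relation on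
  representatives is linear at each stage and compatible with the comparison maps.\<close>

lemma coh_class_relation:
  assumes N: "module R N" and N': "module R N'"
    and Q: "\<And>k \<phi> \<psi>. Q k \<phi> \<psi> \<Longrightarrow> cocycle R (PL k) (dL k) N i \<phi> \<and> cocycle R (PL k) (dL k) N' i' \<psi>"
    and zero: "Q 0 (\<lambda>x. \<zero>\<^bsub>N\<^esub>) (\<lambda>x. \<zero>\<^bsub>N'\<^esub>)"
    and shift: "\<And>k l \<phi> \<psi>. Q k \<phi> \<psi> \<Longrightarrow> k \<le> l \<Longrightarrow> Q l (\<lambda>x. \<phi> (F l k i x)) (\<lambda>x. \<psi> (F l k i' x))"
    and add: "\<And>k \<phi> \<psi> \<phi>' \<psi>'. Q k \<phi> \<psi> \<Longrightarrow> Q k \<phi>' \<psi>' \<Longrightarrow> Q k (\<lambda>x. \<phi> x \<oplus>\<^bsub>N\<^esub> \<phi>' x) (\<lambda>x. \<psi> x \<oplus>\<^bsub>N'\<^esub> \<psi>' x)"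
    and scale: "\<And>k \<phi> \<psi> r. Q k \<phi> \<psi> \<Longrightarrow> r \<in> carrier R \<Longrightarrow> Q k (\<lambda>x. r \<odot>\<^bsub>N\<^esub> \<phi> x) (\<lambda>x. r \<odot>\<^bsub>N'\<^esub> \<psi> x)"
  shows "submodule {(coh_class i N k \<phi>, coh_class i' N' k \<psi>) | k \<phi> \<psi>. Q k \<phi> \<psi>} R (prod_module (H i N) (H i' N'))" (is "submodule ?T R ?P")
proof (rule submoduleI'[OF prod_module_module[OF H_module[OF N] H_module[OF N']]])
  show "?T \<subseteq> carrier ?P" using Q coh_class_mem[OF N] coh_class_mem[OF N'] by fastforce
  show "\<zero>\<^bsub>?P\<^esub> \<in> ?T" using zero coh_class_const_zero[OF N, of i 0] coh_class_const_zero[OF N', of i' 0] by force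
next
  fix x y assume "x \<in> ?T" "y \<in> ?T"
  then obtain k \<phi> \<psi> l \<phi>' \<psi>' where 1: "Q k \<phi> \<psi>" "x = (coh_class i N k \<phi>, coh_class i' N' k \<psi>)" "Q l \<phi>' \<psi>'" "y = (coh_class i N l \<phi>', coh_class i' N' l \<psi>')" by blast
  let ?n = "max k l"
  let ?a = "\<lambda>x. \<phi> (F ?n k i x)" and ?b = "\<lambda>x. \<psi> (F ?n k i' x)" and ?c = "\<lambda>x. \<phi>' (F ?n l i x)" and ?d = "\<lambda>x. \<psi>' (F ?n l i' x)"
  have q: "Q ?n ?a ?b" "Q ?n ?c ?d" using shift 1 by auto
  have "x = (coh_class i N ?n ?a, coh_class i' N' ?n ?b)" "y = (coh_class i N ?n ?c, coh_class i' N' ?n ?d)"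
    using 1 Q coh_class_shift[OF N] coh_class_shift[OF N'] by auto
  then have "x \<oplus>\<^bsub>?P\<^esub> y = (coh_class i N ?n (\<lambda>x. ?a x \<oplus>\<^bsub>N\<^esub> ?c x), coh_class i' N' ?n (\<lambda>x. ?b x \<oplus>\<^bsub>N'\<^esub> ?d x))"
    using Q[OF q(1)] Q[OF q(2)] coh_class_add[OF N] coh_class_add[OF N'] by simp
  then show "x \<oplus>\<^bsub>?P\<^esub> y \<in> ?T" using add[OF q] by blast
next
  fix r x assume r: "r \<in> carrier R" and "x \<in> ?T"
  then obtain k \<phi> \<psi> where 1: "Q k \<phi> \<psi>" "x = (coh_class i N k \<phi>, coh_class i' N' k \<psi>)" by blast
  then have "r \<odot>\<^bsub>?P\<^esub> x = (coh_class i N k (\<lambda>x. r \<odot>\<^bsub>N\<^esub> \<phi> x), coh_class i' N' k (\<lambda>x. r \<odot>\<^bsub>N'\<^esub> \<psi> x))"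
    using Q[OF 1(1)] r coh_class_smult[OF N] coh_class_smult[OF N'] by simp
  then show "r \<odot>\<^bsub>?P\<^esub> x \<in> ?T" using scale[OF 1(1) r] by blast
qed

text \<open>The graph of the map \<open>H\<^sup>i(N) \<rightarrow> H\<^sup>i(N')\<close> that is induced by \<open>v\<close>.\<close>

definition post_rel where
  "post_rel i N N' v = {(coh_class i N k \<phi>, coh_class i N' k \<psi>) | k \<phi> \<psi>. cocycle R (PL k) (dL k) N i \<phi> \<and> cocycle R (PL k) (dL k) N' i \<psi> \<and>
     (\<forall>x \<in> carrier (PL k i). \<psi> x = v (\<phi> x))}"

lemma post_rel_submodule:
  assumes v: "lin R N N' v" shows "submodule (post_rel i N N' v) R (prod_module (H i N) (H i N'))"
  unfolding post_rel_def
proof (rule coh_class_relation[OF lin_module[OF v]], goal_cases)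
  case 2 show ?case using cocycle_const_zero[OF lin_module(1)[OF v]] cocycle_const_zero[OF lin_module(2)[OF v]] lin_zero[OF v] by simp
next
  case (3 k l \<phi> \<psi>)
  then show ?case
    using cocycle_F[OF 3(2), of N i \<phi>] cocycle_F[OF 3(2), of N' i \<psi>] lin_closed[OF chain_map_simps(1)[OF F_props(1)[OF 3(2)]]] by simp
next
  case (4 k \<phi> \<psi> \<phi>' \<psi>')
  then have c: "cocycle R (PL k) (dL k) N i \<phi>" "cocycle R (PL k) (dL k) N i \<phi>'" by auto
  from 4 show ?case
    using cocycle_sum[OF c] cocycle_sum[of R "PL k" "dL k" N' i \<psi> \<psi>'] lin_closed[OF cocycle_lin[OF c(1)]] lin_closed[OF cocycle_lin[OF c(2)]]
    by (simp add: lin_add[OF v])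
next
  case (5 k \<phi> \<psi> r)
  then have c: "cocycle R (PL k) (dL k) N i \<phi>" "cocycle R (PL k) (dL k) N' i \<psi>" by auto
  from 5 show ?case
    using cocycle_post[OF c(1) lin_act[OF lin_module(1)[OF v] 5(2)]] cocycle_post[OF c(2) lin_act[OF lin_module(2)[OF v] 5(2)]]
      lin_closed[OF cocycle_lin[OF c(1)]] by (simp add: lin_smult[OF v])
qed blast

lemma post_relI: "cocycle R (PL k) (dL k) N i \<phi> \<Longrightarrow> lin R N N' v \<Longrightarrow> (coh_class i N k \<phi>, coh_class i N' k (\<lambda>x. v (\<phi> x))) \<in> post_rel i N N' v"
  unfolding post_rel_def using cocycle_post by blast

lemma post_rel_zero:
  assumes v: "lin R N N' v" and z: "(\<zero>\<^bsub>H i N\<^esub>, y) \<in> post_rel i N N' v" shows "y = \<zero>\<^bsub>H i N'\<^esub>"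
proof -
  note N = lin_module(1)[OF v] and N' = lin_module(2)[OF v]
  obtain k \<phi> \<psi> where 1: "cocycle R (PL k) (dL k) N i \<phi>" "cocycle R (PL k) (dL k) N' i \<psi>" "\<And>x. x \<in> carrier (PL k i) \<Longrightarrow> \<psi> x = v (\<phi> x)"
    "coh_class i N k \<phi> = \<zero>\<^bsub>H i N\<^esub>" "y = coh_class i N' k \<psi>" using z unfolding post_rel_def by auto
  then obtain l where l: "l \<ge> k" "coboundary R (PL l) (dL l) N i (\<lambda>x. \<phi> (F l k i x))" using coh_class_zero[OF N 1(1)] by auto
  have "coboundary R (PL l) (dL l) N' i (\<lambda>x. \<psi> (F l k i x))"
    by (rule coboundary_cong[OF coboundary_post[OF l(2) v]]) (use 1(3) lin_closed[OF chain_map_simps(1)[OF F_props(1)[OF l(1)]]] in simp)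
  then show ?thesis using coh_class_zero[OF N' 1(2)] l(1) 1(5) by blast
qed

text \<open>The connecting relation from \<open>H\<^sup>i(N)\<close> to \<open>H\<^sup>i\<^sup>+\<^sup>1(K)\<close>, where \<open>v : A \<rightarrow> N\<close> has kernel \<open>K\<close>: a lift \<open>\<alpha>\<close> of a cocycle along
  \<open>v\<close> fails to be a cocycle by \<open>\<omega> = \<alpha> d\<close>. As \<open>v\<close> need not be surjective, the relation need not be defined
  everywhere.\<close>

definition delta_rel where
  "delta_rel i A K N v = {(coh_class i N k \<psi>, coh_class (Suc i) (sub A K) k \<omega>) | k \<psi> \<omega>.
     (cocycle R (PL k) (dL k) N i \<psi> \<and> cocycle R (PL k) (dL k) (sub A K) (Suc i) \<omega>) \<and>
     (\<exists>\<alpha>. lin R (PL k i) A \<alpha> \<and> (\<forall>x \<in> carrier (PL k i). \<psi> x = v (\<alpha> x)) \<and> (\<forall>x \<in> carrier (PL k (Suc i)). \<omega> x = \<alpha> (dL k i x)))}"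

lemma delta_rel_submodule:
  assumes v: "lin R A N v" and K: "submodule K R A"
  shows "submodule (delta_rel i A K N v) R (prod_module (H i N) (H (Suc i) (sub A K)))"
proof -
  note A = lin_module(1)[OF v] and N = lin_module(2)[OF v]
  have mK: "module R (sub A K)" by (rule sub_module[OF A K])
  note mP = proj_complex_simps(2)[OF PLc] and d = proj_complex_simps(3)[OF PLc]
  show ?thesis
    unfolding delta_rel_def
  proof (rule coh_class_relation[OF N mK], goal_cases)
    case 2
    have "lin R (PL 0 i) A (\<lambda>x. \<zero>\<^bsub>A\<^esub>)" by (rule lin_const_zero[OF mP A])
    moreover have "cocycle R (PL 0) (dL 0) (sub A K) (Suc i) (\<lambda>x. \<zero>\<^bsub>sub A K\<^esub>)" by (rule cocycle_const_zero[OF mK])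
    moreover have "\<zero>\<^bsub>sub A K\<^esub> = \<zero>\<^bsub>A\<^esub>" by simp
    ultimately show ?case using cocycle_const_zero[OF N] lin_zero[OF v] by metis
  next
    case (3 k l \<psi> \<omega>)
    then obtain \<alpha> where \<alpha>: "lin R (PL k i) A \<alpha>" "\<forall>x \<in> carrier (PL k i). \<psi> x = v (\<alpha> x)" "\<forall>x \<in> carrier (PL k (Suc i)). \<omega> x = \<alpha> (dL k i x)" by blast
    note Fc = F_props(1)[OF 3(2)] and Fl = chain_map_simps(1)[OF F_props(1)[OF 3(2)]]
    have "cocycle R (PL l) (dL l) N i (\<lambda>x. \<psi> (F l k i x))" "cocycle R (PL l) (dL l) (sub A K) (Suc i) (\<lambda>x. \<omega> (F l k (Suc i) x))"
      using 3(1) cocycle_F[OF 3(2), of N i \<psi>] cocycle_F[OF 3(2), of "sub A K" "Suc i" \<omega>] by blast+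
    moreover have "\<forall>x \<in> carrier (PL l i). \<psi> (F l k i x) = v (\<alpha> (F l k i x))" using \<alpha>(2) lin_closed[OF Fl] by blast
    moreover have "\<forall>x \<in> carrier (PL l (Suc i)). \<omega> (F l k (Suc i) x) = \<alpha> (F l k i (dL l i x))"
      using \<alpha>(3) lin_closed[OF Fl] chain_map_simps(2)[OF Fc] by simp
    ultimately show ?case using lin_compose[OF Fl \<alpha>(1)] by blast
  next
    case (4 k \<psi> \<omega> \<psi>' \<omega>')
    then obtain \<alpha> \<alpha>' where \<alpha>: "lin R (PL k i) A \<alpha>" "\<forall>x \<in> carrier (PL k i). \<psi> x = v (\<alpha> x)" "\<forall>x \<in> carrier (PL k (Suc i)). \<omega> x = \<alpha> (dL k i x)"
       "lin R (PL k i) A \<alpha>'" "\<forall>x \<in> carrier (PL k i). \<psi>' x = v (\<alpha>' x)" "\<forall>x \<in> carrier (PL k (Suc i)). \<omega>' x = \<alpha>' (dL k i x)" by blast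
    have "cocycle R (PL k) (dL k) (sub A K) (Suc i) (\<lambda>x. \<omega> x \<oplus>\<^bsub>sub A K\<^esub> \<omega>' x)" by (rule cocycle_sum) (use 4 in auto)
    moreover have "cocycle R (PL k) (dL k) N i (\<lambda>x. \<psi> x \<oplus>\<^bsub>N\<^esub> \<psi>' x)" by (rule cocycle_sum) (use 4 in auto)
    moreover have "\<forall>x \<in> carrier (PL k i). \<psi> x \<oplus>\<^bsub>N\<^esub> \<psi>' x = v (\<alpha> x \<oplus>\<^bsub>A\<^esub> \<alpha>' x)"
      using \<alpha>(2,5) by (simp add: lin_add[OF v] lin_closed[OF \<alpha>(1)] lin_closed[OF \<alpha>(4)])
    moreover have "\<forall>x \<in> carrier (PL k (Suc i)). \<omega> x \<oplus>\<^bsub>sub A K\<^esub> \<omega>' x = \<alpha> (dL k i x) \<oplus>\<^bsub>A\<^esub> \<alpha>' (dL k i x)"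
      using \<alpha>(3,6) by simp
    ultimately show ?case using lin_sum[OF \<alpha>(1,4)] by blast
  next
    case (5 k \<psi> \<omega> r)
    then obtain \<alpha> where \<alpha>: "lin R (PL k i) A \<alpha>" "\<forall>x \<in> carrier (PL k i). \<psi> x = v (\<alpha> x)" "\<forall>x \<in> carrier (PL k (Suc i)). \<omega> x = \<alpha> (dL k i x)" by blast
    have "cocycle R (PL k) (dL k) (sub A K) (Suc i) (\<lambda>x. r \<odot>\<^bsub>sub A K\<^esub> \<omega> x)" by (rule cocycle_post[OF _ lin_act[OF mK]]) (use 5 in auto)
    moreover have "cocycle R (PL k) (dL k) N i (\<lambda>x. r \<odot>\<^bsub>N\<^esub> \<psi> x)" by (rule cocycle_post[OF _ lin_act[OF N]]) (use 5 in auto)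
    moreover have "\<forall>x \<in> carrier (PL k i). r \<odot>\<^bsub>N\<^esub> \<psi> x = v (r \<odot>\<^bsub>A\<^esub> \<alpha> x)"
      using \<alpha>(2) 5(2) by (simp add: lin_smult[OF v] lin_closed[OF \<alpha>(1)])
    moreover have "\<forall>x \<in> carrier (PL k (Suc i)). r \<odot>\<^bsub>sub A K\<^esub> \<omega> x = r \<odot>\<^bsub>A\<^esub> \<alpha> (dL k i x)"
      using \<alpha>(3) by simp
    ultimately show ?case using lin_scale[OF \<alpha>(1) 5(2)] by blast
  qed auto
qed

lemma delta_relI:
  assumes v: "lin R A N v" and K: "K = {a \<in> carrier A. v a = \<zero>\<^bsub>N\<^esub>}" and \<psi>: "cocycle R (PL k) (dL k) N i \<psi>"
    and \<alpha>: "lin R (PL k i) A \<alpha>" "\<And>x. x \<in> carrier (PL k i) \<Longrightarrow> \<psi> x = v (\<alpha> x)"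
  shows "\<exists>z. (coh_class i N k \<psi>, z) \<in> delta_rel i A K N v"
proof -
  note A = lin_module(1)[OF v] and d = proj_complex_simps(3)[OF PLc]
  have sK: "submodule K R A" unfolding K by (rule submodule_ker[OF v])
  have "lin R (PL k (Suc i)) (sub A K) (\<lambda>x. \<alpha> (dL k i x))"
    by (rule lin_into_sub[OF lin_compose[OF d \<alpha>(1)] sK])
      (use cocycle_zero[OF \<psi>] \<alpha>(2) lin_closed[OF d] lin_closed[OF \<alpha>(1)] in \<open>simp add: K\<close>)
  then have "cocycle R (PL k) (dL k) (sub A K) (Suc i) (\<lambda>x. \<alpha> (dL k i x))"
    using proj_complex_simps(4)[OF PLc] lin_zero[OF \<alpha>(1)] by (simp add: cocycle_def)
  then show ?thesis unfolding delta_rel_def using \<psi> \<alpha> by blast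
qed

text \<open>If \<open>\<omega>\<close> is the coboundary of \<open>\<chi>\<close> at some later stage, then \<open>\<alpha> - \<chi>\<close> is a cocycle, and it is still a lift
  because \<open>\<chi>\<close> has values in the kernel.\<close>

lemma delta_rel_zero:
  assumes v: "lin R A N v" and K: "K = {a \<in> carrier A. v a = \<zero>\<^bsub>N\<^esub>}" and z: "(y, \<zero>\<^bsub>H (Suc i) (sub A K)\<^esub>) \<in> delta_rel i A K N v"
  obtains k \<theta> where "cocycle R (PL k) (dL k) A i \<theta>" "y = coh_class i N k (\<lambda>x. v (\<theta> x))"
proof -
  note A = lin_module(1)[OF v] and N = lin_module(2)[OF v] and d = proj_complex_simps(3)[OF PLc]
  have sK: "submodule K R A" unfolding K by (rule submodule_ker[OF v])
  have mK: "module R (sub A K)" by (rule sub_module[OF A sK])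
  obtain k \<psi> \<omega> \<alpha> where 1: "cocycle R (PL k) (dL k) N i \<psi>" "cocycle R (PL k) (dL k) (sub A K) (Suc i) \<omega>" "lin R (PL k i) A \<alpha>"
    "\<And>x. x \<in> carrier (PL k i) \<Longrightarrow> \<psi> x = v (\<alpha> x)" "\<And>x. x \<in> carrier (PL k (Suc i)) \<Longrightarrow> \<omega> x = \<alpha> (dL k i x)"
    "coh_class (Suc i) (sub A K) k \<omega> = \<zero>\<^bsub>H (Suc i) (sub A K)\<^esub>" "y = coh_class i N k \<psi>"
    using z unfolding delta_rel_def by (auto simp del: partial_object.update_convs)
  obtain l where l: "l \<ge> k" "coboundary R (PL l) (dL l) (sub A K) (Suc i) (\<lambda>x. \<omega> (F l k (Suc i) x))" using coh_class_zero[OF mK 1(2)] 1(6) by auto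
  then obtain \<chi> where \<chi>: "lin R (PL l i) (sub A K) \<chi>" "\<And>x. x \<in> carrier (PL l (Suc i)) \<Longrightarrow> \<omega> (F l k (Suc i) x) = \<chi> (dL l i x)"
    unfolding coboundary_Suc by blast
  note Fc = F_props(1)[OF l(1)] and Fl = chain_map_simps(1)[OF F_props(1)[OF l(1)]]
  have \<chi>A: "lin R (PL l i) A \<chi>" by (rule sub_lin_map[OF \<chi>(1) sK A])
  let ?\<theta> = "\<lambda>x. \<alpha> (F l k i x) \<oplus>\<^bsub>A\<^esub> \<ominus>\<^bsub>A\<^esub> \<chi> x"
  have \<theta>l: "lin R (PL l i) A ?\<theta>" by (rule lin_sum[OF lin_compose[OF Fl 1(3)] lin_uminus[OF \<chi>A]])
  have "cocycle R (PL l) (dL l) A i ?\<theta>"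
    unfolding cocycle_def
  proof (intro conjI ballI \<theta>l)
    fix x assume x: "x \<in> carrier (PL l (Suc i))"
    have "\<alpha> (F l k i (dL l i x)) = \<chi> (dL l i x)"
      using 1(5)[OF lin_closed[OF Fl x]] chain_map_simps(2)[OF Fc x] \<chi>(2)[OF x] by simp
    then show "?\<theta> (dL l i x) = \<zero>\<^bsub>A\<^esub>" using lin_closed[OF \<chi>A lin_closed[OF d x]] by (simp add: mod_simps[OF A])
  qed
  moreover have "y = coh_class i N l (\<lambda>x. v (?\<theta> x))"
  proof -
    have "v (?\<theta> x) = \<psi> (F l k i x)" if x: "x \<in> carrier (PL l i)" for x
    proof -
      have "v (\<chi> x) = \<zero>\<^bsub>N\<^esub>" using lin_closed[OF \<chi>(1) x] by (simp add: K)
      then show ?thesis using lin_closed[OF \<chi>A x] lin_closed[OF 1(3) lin_closed[OF Fl x]] 1(4)[OF lin_closed[OF Fl x]]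
        lin_closed[OF v] by (simp add: lin_simps[OF v] mod_closed[OF A] mod_simps[OF N])
    qed
    then have "coh_class i N l (\<lambda>x. \<psi> (F l k i x)) = coh_class i N l (\<lambda>x. v (?\<theta> x))" by (intro coh_class_cong[OF N cocycle_F[OF l(1) 1(1)]]) simp
    then show ?thesis unfolding 1(7) coh_class_shift[OF N 1(1) l(1)] .
  qed
  ultimately show thesis by (rule that)
qed

lemma coboundary_lift:
  fixes A :: "('r, 'u) module"
  assumes v: "lin R A N v" "v ` carrier A = carrier N" and f: "coboundary R (PL k) (dL k) N i f"
  obtains g where "coboundary R (PL k) (dL k) A i g" "\<And>x. x \<in> carrier (PL k i) \<Longrightarrow> v (g x) = f x"
proof (cases i)
  case 0
  then show thesis using that[of "\<lambda>x. \<zero>\<^bsub>A\<^esub>"] f lin_zero[OF v(1)] by (simp add: coboundary_0)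
next
  case (Suc j)
  obtain \<chi> where \<chi>: "lin R (PL k j) N \<chi>" "\<And>x. x \<in> carrier (PL k (Suc j)) \<Longrightarrow> f x = \<chi> (dL k j x)" using f unfolding Suc coboundary_Suc by blast
  obtain h where h: "lin R (PL k j) A h" "\<And>x. x \<in> carrier (PL k j) \<Longrightarrow> v (h x) = \<chi> x"
    using projective_lift[OF proj_complex_simps(1)[OF PLc] v(1) \<chi>(1)] lin_closed[OF \<chi>(1)] v(2) by metis
  show thesis
    by (rule that[of "\<lambda>x. h (dL k j x)"])
      (use h \<chi> lin_closed[OF proj_complex_simps(3)[OF PLc]] in \<open>auto simp: Suc coboundary_Suc\<close>)
qed

text \<open>Exactness in the middle: the coboundary that \<open>v \<phi>\<close> has become is lifted to a coboundary with values
  in \<open>A\<close>, and subtracting it from \<open>\<phi>\<close> leaves values in the kernel.\<close>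

lemma post_rel_kernel:
  fixes A :: "('r, 'u) module"
  assumes v: "lin R A N v" "v ` carrier A = carrier N" and z: "(y, \<zero>\<^bsub>H i N\<^esub>) \<in> post_rel i A N v"
  obtains k \<theta> where "cocycle R (PL k) (dL k) A i \<theta>" "\<And>x. x \<in> carrier (PL k i) \<Longrightarrow> v (\<theta> x) = \<zero>\<^bsub>N\<^esub>" "y = coh_class i A k \<theta>"
proof -
  note A = lin_module(1)[OF v(1)] and N = lin_module(2)[OF v(1)]
  obtain k \<phi> \<psi> where 1: "cocycle R (PL k) (dL k) A i \<phi>" "cocycle R (PL k) (dL k) N i \<psi>" "\<And>x. x \<in> carrier (PL k i) \<Longrightarrow> \<psi> x = v (\<phi> x)"
    "coh_class i N k \<psi> = \<zero>\<^bsub>H i N\<^esub>" "y = coh_class i A k \<phi>" using z unfolding post_rel_def by auto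
  obtain l where l: "l \<ge> k" "coboundary R (PL l) (dL l) N i (\<lambda>x. \<psi> (F l k i x))" using coh_class_zero[OF N 1(2)] 1(4) by auto
  note Fl = chain_map_simps(1)[OF F_props(1)[OF l(1)]]
  obtain g where g: "coboundary R (PL l) (dL l) A i g" "\<And>x. x \<in> carrier (PL l i) \<Longrightarrow> v (g x) = \<psi> (F l k i x)" using coboundary_lift[OF v l(2)] by blast
  have gc: "cocycle R (PL l) (dL l) A i g" by (rule coboundary_cocycle[OF PLc g(1) A])
  have \<phi>c: "cocycle R (PL l) (dL l) A i (\<lambda>x. \<phi> (F l k i x))" by (rule cocycle_F[OF l(1) 1(1)])
  let ?\<theta> = "\<lambda>x. \<phi> (F l k i x) \<oplus>\<^bsub>A\<^esub> \<ominus>\<^bsub>A\<^esub> g x"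
  have ng: "lin R A A (\<lambda>x. \<ominus>\<^bsub>A\<^esub> x)" by (rule lin_uminus[OF lin_ident[OF A]])
  have \<theta>: "cocycle R (PL l) (dL l) A i ?\<theta>" by (rule cocycle_sum[OF \<phi>c cocycle_post[OF gc ng]])
  note cl = lin_closed[OF cocycle_lin[OF \<phi>c]] lin_closed[OF cocycle_lin[OF gc]]
  have "coh_class i A l (\<lambda>x. \<phi> (F l k i x)) = coh_class i A l ?\<theta>"
    by (rule coh_class_eq[OF A \<phi>c \<theta> coboundary_cong[OF g(1)]]) (use cl in \<open>simp add: mod_simps[OF A] mod_closed[OF A]\<close>)
  then have "y = coh_class i A l ?\<theta>" unfolding 1(5) coh_class_shift[OF A 1(1) l(1)] .
  moreover have "v (?\<theta> x) = \<zero>\<^bsub>N\<^esub>" if x: "x \<in> carrier (PL l i)" for x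
    using cl[OF x] g(2)[OF x] 1(3)[OF lin_closed[OF Fl x]] lin_closed[OF v(1)] by (simp add: lin_simps[OF v(1)] mod_closed[OF A] mod_simps[OF N])
  ultimately show thesis using that \<theta> by blast
qed

end

section \<open>Local cohomology of modules killed by the annihilator of N\<close>

locale serre_cohomology = cohomology R U M \<aa> + serre_universe R U S
  for R :: "('r, 's) ring_scheme" (structure) and U :: "'u itself" and M :: "('r, 'u) module" and \<aa> and S
begin

text \<open>From the exact sequence \<open>H\<^sup>i(K) \<rightarrow> H\<^sup>i(A) \<rightarrow> H\<^sup>i(B)\<close>.\<close>

lemma in_S_middle:
  fixes A B :: "('r, 'u) module"
  assumes v: "lin R A B v" "v ` carrier A = carrier B" and K: "K = {a \<in> carrier A. v a = \<zero>\<^bsub>B\<^esub>}"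
    and b: "in_S (H i (sub A K))" "in_S (H i B)"
  shows "in_S (H i A)"
proof -
  note A = lin_module(1)[OF v(1)] and B = lin_module(2)[OF v(1)]
  have sK: "submodule K R A" unfolding K by (rule submodule_ker[OF v(1)])
  have mK: "module R (sub A K)" by (rule sub_module[OF A sK])
  note incl = lin_sub_incl[OF A sK]
  show ?thesis
  proof (rule in_S_rel[OF b(1) H_module[OF mK] b(2) H_module[OF B] H_module[OF A]
      post_rel_submodule[OF incl] post_rel_zero[OF incl] post_rel_submodule[OF v(1)]])
    fix y assume "y \<in> carrier (H i A)"
    then obtain k \<phi> where \<phi>: "cocycle R (PL k) (dL k) A i \<phi>" "y = coh_class i A k \<phi>" by (rule H_cases[OF A])
    show "\<exists>x. (y, x) \<in> post_rel i A B v" unfolding \<phi>(2) using post_relI[OF \<phi>(1) v(1)] by blast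
  next
    fix y assume "(y, \<zero>\<^bsub>H i B\<^esub>) \<in> post_rel i A B v"
    then obtain k \<theta> where \<theta>: "cocycle R (PL k) (dL k) A i \<theta>" "\<And>x. x \<in> carrier (PL k i) \<Longrightarrow> v (\<theta> x) = \<zero>\<^bsub>B\<^esub>" "y = coh_class i A k \<theta>"
      using post_rel_kernel[OF v] by metis
    have "lin R (PL k i) (sub A K) \<theta>"
      by (rule lin_into_sub[OF cocycle_lin[OF \<theta>(1)] sK]) (simp add: K \<theta>(2) lin_closed[OF cocycle_lin[OF \<theta>(1)]])
    then have "cocycle R (PL k) (dL k) (sub A K) i \<theta>" using \<theta>(1) by (simp add: cocycle_def)
    then show "\<exists>w. (w, y) \<in> post_rel i (sub A K) A (\<lambda>x. x)" unfolding \<theta>(3) using post_relI[OF _ incl] by blast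
  qed
qed

text \<open>From the exact sequence \<open>H\<^sup>i(A) \<rightarrow> H\<^sup>i(B) \<rightarrow> H\<^sup>i\<^sup>+\<^sup>1(K)\<close>.\<close>

lemma in_S_right:
  fixes A B :: "('r, 'u) module"
  assumes v: "lin R A B v" "v ` carrier A = carrier B" and K: "K = {a \<in> carrier A. v a = \<zero>\<^bsub>B\<^esub>}"
    and b: "in_S (H i A)" "in_S (H (Suc i) (sub A K))"
  shows "in_S (H i B)"
proof -
  note A = lin_module(1)[OF v(1)] and B = lin_module(2)[OF v(1)]
  have sK: "submodule K R A" unfolding K by (rule submodule_ker[OF v(1)])
  have mK: "module R (sub A K)" by (rule sub_module[OF A sK])
  show ?thesis
  proof (rule in_S_rel[OF b(1) H_module[OF A] b(2) H_module[OF mK] H_module[OF B]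
      post_rel_submodule[OF v(1)] post_rel_zero[OF v(1)] delta_rel_submodule[OF v(1) sK]])
    fix y assume "y \<in> carrier (H i B)"
    then obtain k \<psi> where \<psi>: "cocycle R (PL k) (dL k) B i \<psi>" "y = coh_class i B k \<psi>" by (rule H_cases[OF B])
    obtain \<alpha> where \<alpha>: "lin R (PL k i) A \<alpha>" "\<And>x. x \<in> carrier (PL k i) \<Longrightarrow> v (\<alpha> x) = \<psi> x"
      using projective_lift[OF proj_complex_simps(1)[OF PLc] v(1) cocycle_lin[OF \<psi>(1)]] lin_closed[OF cocycle_lin[OF \<psi>(1)]] v(2) by metis
    show "\<exists>x. (y, x) \<in> delta_rel i A K B v" unfolding \<psi>(2) by (rule delta_relI[OF v(1) K \<psi>(1) \<alpha>(1)]) (simp add: \<alpha>(2))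
  next
    fix y assume z: "(y, \<zero>\<^bsub>H (Suc i) (sub A K)\<^esub>) \<in> delta_rel i A K B v"
    obtain k \<theta> where \<theta>: "cocycle R (PL k) (dL k) A i \<theta>" "y = coh_class i B k (\<lambda>x. v (\<theta> x))" using delta_rel_zero[OF v(1) K z] by metis
    show "\<exists>w. (w, y) \<in> post_rel i A B v" unfolding \<theta>(2) using post_relI[OF \<theta>(1) v(1)] by blast
  qed
qed

end

text \<open>This class of modules replaces the modules with support in the support of \<open>N\<close>: it contains \<open>N\<close> and is
  closed under submodules, quotients and finite direct sums.\<close>

definition ann_kills where
  "ann_kills R N L \<longleftrightarrow> (\<forall>r \<in> carrier R. (\<forall>z \<in> carrier N. r \<odot>\<^bsub>N\<^esub> z = \<zero>\<^bsub>N\<^esub>) \<longrightarrow> (\<forall>z \<in> carrier L. r \<odot>\<^bsub>L\<^esub> z = \<zero>\<^bsub>L\<^esub>))"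

lemma ann_kills_sub: "ann_kills R N A \<Longrightarrow> K \<subseteq> carrier A \<Longrightarrow> ann_kills R N (sub A K)"
  by (auto simp: ann_kills_def)

lemma ann_kills_image: "ann_kills R N A \<Longrightarrow> lin R A B v \<Longrightarrow> v ` carrier A = carrier B \<Longrightarrow> ann_kills R N B"
  unfolding ann_kills_def
proof (intro ballI impI)
  fix r z assume k: "\<forall>r \<in> carrier R. (\<forall>z \<in> carrier N. r \<odot>\<^bsub>N\<^esub> z = \<zero>\<^bsub>N\<^esub>) \<longrightarrow> (\<forall>z \<in> carrier A. r \<odot>\<^bsub>A\<^esub> z = \<zero>\<^bsub>A\<^esub>)"
    and v: "lin R A B v" "v ` carrier A = carrier B"
    and r: "r \<in> carrier R" "\<forall>z \<in> carrier N. r \<odot>\<^bsub>N\<^esub> z = \<zero>\<^bsub>N\<^esub>" and "z \<in> carrier B"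
  then obtain a where a: "a \<in> carrier A" "z = v a" by blast
  have "r \<odot>\<^bsub>A\<^esub> a = \<zero>\<^bsub>A\<^esub>" using k r a(1) by blast
  then show "r \<odot>\<^bsub>B\<^esub> z = \<zero>\<^bsub>B\<^esub>" using lin_smult[OF v(1) r(1) a(1)] lin_zero[OF v(1)] a(2) by simp
qed

text \<open>If every ring element acts on \<open>A\<close> as zero or injectively, then \<open>A\<close> is torsion-free over \<open>R / \<pp>\<close> for the
  prime \<open>\<pp> = Ann A\<close>, and \<open>c g \<noteq> 0\<close> says \<open>c \<notin> \<pp>\<close>. So this is the existence of a nonzero map \<open>N \<rightarrow> R / \<pp>\<close> for a prime in the
  support of \<open>N\<close>, by induction on the generators. Let \<open>T'\<close> be spanned by all generators except \<open>x\<close>. If some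
  \<open>c \<notin> \<pp>\<close> moves everything into \<open>T'\<close>, then a map on \<open>T'\<close> is composed with \<open>c\<close>. Otherwise \<open>r x \<in> T'\<close> implies
  \<open>r \<in> \<pp>\<close>, so that \<open>r x + y \<mapsto> r g\<close> is well defined.\<close>

lemma nonzero_map_exists:
  fixes N A :: "('r, 'u) module"
  assumes N: "module R N" and A: "module R A"
    and dom: "\<And>r a. r \<in> carrier R \<Longrightarrow> a \<in> carrier A \<Longrightarrow> r \<odot>\<^bsub>A\<^esub> a = \<zero>\<^bsub>A\<^esub> \<Longrightarrow> a = \<zero>\<^bsub>A\<^esub> \<or> (\<forall>b \<in> carrier A. r \<odot>\<^bsub>A\<^esub> b = \<zero>\<^bsub>A\<^esub>)"
    and g: "g \<in> carrier A" "g \<noteq> \<zero>\<^bsub>A\<^esub>"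
    and xs: "set xs \<subseteq> carrier N"
    and supp: "\<And>c. c \<in> carrier R \<Longrightarrow> (\<forall>z \<in> lspan R N xs. c \<odot>\<^bsub>N\<^esub> z = \<zero>\<^bsub>N\<^esub>) \<Longrightarrow> c \<odot>\<^bsub>A\<^esub> g = \<zero>\<^bsub>A\<^esub>"
  shows "\<exists>f. lin R (sub N (lspan R N xs)) A f \<and> (\<exists>z \<in> lspan R N xs. f z \<noteq> \<zero>\<^bsub>A\<^esub>)"
  using xs supp
proof (induction xs)
  case Nil
  interpret cring R by (rule mod_cring[OF N])
  have "\<one>\<^bsub>R\<^esub> \<odot>\<^bsub>A\<^esub> g = \<zero>\<^bsub>A\<^esub>" by (rule Nil.prems(2)) (auto simp: mod_simps[OF N])
  then show ?case using g mod_simps[OF A] by simp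
next
  case (Cons x xs)
  interpret cring R by (rule mod_cring[OF N])
  have x: "x \<in> carrier N" "set xs \<subseteq> carrier N" using Cons.prems by auto
  let ?T = "lspan R N (x # xs)" and ?T' = "lspan R N xs"
  have sT: "submodule ?T R N" and sT': "submodule ?T' R N" by (rule lspan_submodule[OF N]; use x in simp)+
  note t = submodule_simps[OF N sT] and t' = submodule_simps[OF N sT']
  have mT: "module R (sub N ?T)" by (rule sub_module[OF N sT])
  show ?case
  proof (cases "\<exists>c \<in> carrier R. c \<odot>\<^bsub>A\<^esub> g \<noteq> \<zero>\<^bsub>A\<^esub> \<and> (\<forall>z \<in> ?T. c \<odot>\<^bsub>N\<^esub> z \<in> ?T')")
    case True
    then obtain c where c: "c \<in> carrier R" "c \<odot>\<^bsub>A\<^esub> g \<noteq> \<zero>\<^bsub>A\<^esub>" "\<And>z. z \<in> ?T \<Longrightarrow> c \<odot>\<^bsub>N\<^esub> z \<in> ?T'" by blast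
    have inj: "a = \<zero>\<^bsub>A\<^esub>" if "a \<in> carrier A" "c \<odot>\<^bsub>A\<^esub> a = \<zero>\<^bsub>A\<^esub>" for a using dom[OF c(1) that] c(2) g(1) by blast
    have "\<exists>f. lin R (sub N ?T') A f \<and> (\<exists>z \<in> ?T'. f z \<noteq> \<zero>\<^bsub>A\<^esub>)"
    proof (rule Cons.IH[OF x(2)])
      fix c' assume c': "c' \<in> carrier R" "\<forall>z \<in> ?T'. c' \<odot>\<^bsub>N\<^esub> z = \<zero>\<^bsub>N\<^esub>"
      have "(c' \<otimes>\<^bsub>R\<^esub> c) \<odot>\<^bsub>A\<^esub> g = \<zero>\<^bsub>A\<^esub>"
        by (rule Cons.prems(2)) (use c c' t(2) in \<open>simp_all only: mod_smult_assoc[OF N] m_closed ball_simps, auto simp: mod_smult_assoc[OF N]\<close>)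
      then have "c' \<odot>\<^bsub>A\<^esub> (c \<odot>\<^bsub>A\<^esub> g) = \<zero>\<^bsub>A\<^esub>" using c c' g by (simp add: mod_smult_assoc[OF A])
      then show "c' \<odot>\<^bsub>A\<^esub> g = \<zero>\<^bsub>A\<^esub>" using dom[OF c'(1) mod_closed(4)[OF A c(1) g(1)]] c(2) g(1) by blast
    qed
    then obtain f z where f: "lin R (sub N ?T') A f" "z \<in> ?T'" "f z \<noteq> \<zero>\<^bsub>A\<^esub>" by blast
    have cl: "lin R (sub N ?T) (sub N ?T') (\<lambda>z. c \<odot>\<^bsub>N\<^esub> z)"
      by (rule lin_into_sub[OF lin_from_sub[OF lin_act[OF N c(1)] sT] sT']) (use c in auto)
    have zT: "z \<in> ?T"
    proof -
      have "?T' \<subseteq> ?T" by (rule lspan_least[OF N sT]) (use lspan_mem[OF N, of "x # xs"] Cons.prems in auto)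
      then show ?thesis using f(2) by blast
    qed
    have "f (c \<odot>\<^bsub>N\<^esub> z) = c \<odot>\<^bsub>A\<^esub> f z" using lin_smult[OF f(1) c(1)] f(2) by simp
    then have "f (c \<odot>\<^bsub>N\<^esub> z) \<noteq> \<zero>\<^bsub>A\<^esub>" using inj f lin_closed[OF f(1)] by auto
    then show ?thesis using lin_compose[OF cl f(1)] zT by blast
  next
    case False
    have wd: "r \<odot>\<^bsub>A\<^esub> g = \<zero>\<^bsub>A\<^esub>" if r: "r \<in> carrier R" "r \<odot>\<^bsub>N\<^esub> x \<in> ?T'" for r
    proof (rule ccontr)
      assume nz: "r \<odot>\<^bsub>A\<^esub> g \<noteq> \<zero>\<^bsub>A\<^esub>"
      have "r \<odot>\<^bsub>N\<^esub> z \<in> ?T'" if z: "z \<in> ?T" for z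
      proof -
        obtain s y where sy: "s \<in> carrier R" "y \<in> ?T'" "z = s \<odot>\<^bsub>N\<^esub> x \<oplus>\<^bsub>N\<^esub> y" using z by auto
        have "r \<odot>\<^bsub>N\<^esub> z = s \<odot>\<^bsub>N\<^esub> (r \<odot>\<^bsub>N\<^esub> x) \<oplus>\<^bsub>N\<^esub> r \<odot>\<^bsub>N\<^esub> y"
          using sy r x t'(2)[OF sy(2)] by (simp add: mod_simps[OF N] mod_closed[OF N] mod_smult_comm[OF N, of r s])
        then show ?thesis using t'(4)[OF t'(5)[OF sy(1) r(2)] t'(5)[OF r(1) sy(2)]] by simp
      qed
      then show False using False r nz by blast
    qed
    define f where "f z = (SOME r. r \<in> carrier R \<and> (\<exists>y \<in> ?T'. z = r \<odot>\<^bsub>N\<^esub> x \<oplus>\<^bsub>N\<^esub> y)) \<odot>\<^bsub>A\<^esub> g" for z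
    have f: "f (r \<odot>\<^bsub>N\<^esub> x \<oplus>\<^bsub>N\<^esub> y) = r \<odot>\<^bsub>A\<^esub> g" if r: "r \<in> carrier R" and y: "y \<in> ?T'" for r y
    proof -
      let ?P = "\<lambda>s. s \<in> carrier R \<and> (\<exists>y' \<in> ?T'. r \<odot>\<^bsub>N\<^esub> x \<oplus>\<^bsub>N\<^esub> y = s \<odot>\<^bsub>N\<^esub> x \<oplus>\<^bsub>N\<^esub> y')"
      have "\<exists>s. ?P s" using r y by blast
      from someI_ex[OF this] obtain s y' where s: "s = (SOME s. ?P s)" "s \<in> carrier R" "y' \<in> ?T'" "r \<odot>\<^bsub>N\<^esub> x \<oplus>\<^bsub>N\<^esub> y = s \<odot>\<^bsub>N\<^esub> x \<oplus>\<^bsub>N\<^esub> y'" by blast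
      have yN: "y \<in> carrier N" "y' \<in> carrier N" using t'(2) y s(3) by auto
      have d: "r \<oplus>\<^bsub>R\<^esub> \<ominus>\<^bsub>R\<^esub> s \<in> carrier R" using r s by simp
      have ns: "(\<ominus>\<^bsub>R\<^esub> s) \<odot>\<^bsub>N\<^esub> x = \<ominus>\<^bsub>N\<^esub> (s \<odot>\<^bsub>N\<^esub> x)" by (rule module.smult_l_minus[OF N s(2) x(1)])
      have "r \<odot>\<^bsub>N\<^esub> x = (r \<odot>\<^bsub>N\<^esub> x \<oplus>\<^bsub>N\<^esub> y) \<oplus>\<^bsub>N\<^esub> \<ominus>\<^bsub>N\<^esub> y" using r x yN by (simp add: mod_ac(2)[OF N] mod_closed[OF N] mod_simps[OF N])
      also have "\<dots> = s \<odot>\<^bsub>N\<^esub> x \<oplus>\<^bsub>N\<^esub> y' \<oplus>\<^bsub>N\<^esub> \<ominus>\<^bsub>N\<^esub> y" by (simp add: s(4))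
      finally have "(r \<oplus>\<^bsub>R\<^esub> \<ominus>\<^bsub>R\<^esub> s) \<odot>\<^bsub>N\<^esub> x = y' \<oplus>\<^bsub>N\<^esub> \<ominus>\<^bsub>N\<^esub> y"
        using r s(2) x yN by (simp add: mod_smult_l_distr[OF N] ns mod_ac[OF N] mod_closed[OF N] mod_simps[OF N])
      then have "(r \<oplus>\<^bsub>R\<^esub> \<ominus>\<^bsub>R\<^esub> s) \<odot>\<^bsub>A\<^esub> g = \<zero>\<^bsub>A\<^esub>" using wd[OF d] t'(4)[OF s(3) t'(6)[OF y]] by simp
      then have "r \<odot>\<^bsub>A\<^esub> g \<oplus>\<^bsub>A\<^esub> \<ominus>\<^bsub>A\<^esub> (s \<odot>\<^bsub>A\<^esub> g) = \<zero>\<^bsub>A\<^esub>"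
        using r s(2) g(1) module.smult_l_minus[OF A s(2) g(1)] by (simp add: mod_smult_l_distr[OF A])
      then have "r \<odot>\<^bsub>A\<^esub> g = s \<odot>\<^bsub>A\<^esub> g" using mod_diff_zero[OF A mod_closed(4)[OF A r g(1)] mod_closed(4)[OF A s(2) g(1)]] by simp
      then show ?thesis unfolding f_def s(1) by simp
    qed
    have fl: "lin R (sub N ?T) A f"
    proof (rule linI[OF mT A])
      fix z assume "z \<in> carrier (sub N ?T)"
      then obtain r y where ry: "r \<in> carrier R" "y \<in> ?T'" "z = r \<odot>\<^bsub>N\<^esub> x \<oplus>\<^bsub>N\<^esub> y" by auto
      then show "f z \<in> carrier A" using f g(1) mod_closed(4)[OF A] by simp
      fix w assume "w \<in> carrier (sub N ?T)"
      then obtain s u where su: "s \<in> carrier R" "u \<in> ?T'" "w = s \<odot>\<^bsub>N\<^esub> x \<oplus>\<^bsub>N\<^esub> u" by auto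
      have "z \<oplus>\<^bsub>N\<^esub> w = (r \<oplus>\<^bsub>R\<^esub> s) \<odot>\<^bsub>N\<^esub> x \<oplus>\<^bsub>N\<^esub> (y \<oplus>\<^bsub>N\<^esub> u)"
        using ry su x t'(2)[OF ry(2)] t'(2)[OF su(2)] by (simp add: mod_smult_l_distr[OF N] mod_ac[OF N] mod_closed[OF N])
      then show "f (z \<oplus>\<^bsub>sub N ?T\<^esub> w) = f z \<oplus>\<^bsub>A\<^esub> f w"
        using f[OF _ t'(4)[OF ry(2) su(2)], of "r \<oplus>\<^bsub>R\<^esub> s"] f ry su g(1) by (simp add: mod_smult_l_distr[OF A])
    next
      fix c z assume c: "c \<in> carrier R" and "z \<in> carrier (sub N ?T)"
      then obtain r y where ry: "r \<in> carrier R" "y \<in> ?T'" "z = r \<odot>\<^bsub>N\<^esub> x \<oplus>\<^bsub>N\<^esub> y" by auto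
      have "c \<odot>\<^bsub>N\<^esub> z = (c \<otimes>\<^bsub>R\<^esub> r) \<odot>\<^bsub>N\<^esub> x \<oplus>\<^bsub>N\<^esub> c \<odot>\<^bsub>N\<^esub> y"
        using ry c x t'(2)[OF ry(2)] by (simp add: mod_smult_assoc[OF N] mod_closed[OF N] mod_simps[OF N])
      then show "f (c \<odot>\<^bsub>sub N ?T\<^esub> z) = c \<odot>\<^bsub>A\<^esub> f z"
        using f[OF _ t'(5)[OF c ry(2)], of "c \<otimes>\<^bsub>R\<^esub> r"] f ry c g(1) by (simp add: mod_smult_assoc[OF A])
    qed
    have "\<one>\<^bsub>R\<^esub> \<odot>\<^bsub>N\<^esub> x \<oplus>\<^bsub>N\<^esub> \<zero>\<^bsub>N\<^esub> \<in> ?T" using t'(3) by auto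
    moreover have "f (\<one>\<^bsub>R\<^esub> \<odot>\<^bsub>N\<^esub> x \<oplus>\<^bsub>N\<^esub> \<zero>\<^bsub>N\<^esub>) \<noteq> \<zero>\<^bsub>A\<^esub>" using f[OF one_closed t'(3)] g mod_simps[OF A] by simp
    ultimately show ?thesis using fl by blast
  qed
qed

context serre_cohomology
begin

definition all_good where
  "all_good N i \<longleftrightarrow> (\<forall>L' :: ('r, 'u) module. fin_gen R L' \<and> ann_kills R N L' \<longrightarrow> in_S (H i L'))"

text \<open>The kernel of \<open>N \<rightarrow> B\<close> is killed by the annihilator of \<open>N\<close>, so the next degree is under control.\<close>

lemma image_good:
  fixes N B :: "('r, 'u) module"
  assumes N: "fin_gen R N" "in_S (H i N)" and up: "all_good N (Suc i)"
    and v: "lin R N B v" "v ` carrier N = carrier B"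
  shows "in_S (H i B)"
proof (rule in_S_right[OF v refl N(2)])
  let ?K = "{a \<in> carrier N. v a = \<zero>\<^bsub>B\<^esub>}"
  have K: "submodule ?K R N" by (rule submodule_ker[OF v(1)])
  have "ann_kills R N (sub N ?K)" by (auto simp: ann_kills_def)
  then show "in_S (H (Suc i) (sub N ?K))" using up fin_gen_submodule(2)[OF N(1) K] unfolding all_good_def by blast
qed

text \<open>A submodule \<open>X\<close> that is maximal among those with a bad quotient yields a bad module \<open>A\<close> whose proper
  quotients are good. A nonzero good submodule of \<open>A\<close> is then a contradiction, as the quotient by it is
  good as well. Such submodules are \<open>r A\<close> if \<open>r\<close> acts neither as zero nor injectively, and the image of
  a nonzero map \<open>N \<rightarrow> A\<close>.\<close>

lemma all_good_step:
  fixes N :: "('r, 'u) module"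
  assumes N: "fin_gen R N" "in_S (H i N)" and up: "all_good N (Suc i)"
  shows "all_good N i"
  unfolding all_good_def
proof (intro allI impI, rule ccontr)
  fix L' :: "('r, 'u) module" assume L': "fin_gen R L' \<and> ann_kills R N L'" and bad: "\<not> in_S (H i L')"
  have mN: "module R N" by (rule fin_gen_module[OF N(1)])
  have mL': "module R L'" using L' fin_gen_module by blast
  define C where "C = {X. submodule X R L' \<and> (\<exists>(B :: ('r, 'u) module) v. lin R L' B v \<and> v ` carrier L' = carrier B \<and>
      X = {a \<in> carrier L'. v a = \<zero>\<^bsub>B\<^esub>} \<and> \<not> in_S (H i B))}"
  have "{\<zero>\<^bsub>L'\<^esub>} \<in> C" unfolding C_def
  proof (rule CollectI, intro conjI exI[of _ L'] exI[of _ "\<lambda>x. x"])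
    show "{\<zero>\<^bsub>L'\<^esub>} = {a \<in> carrier L'. a = \<zero>\<^bsub>L'\<^esub>}" using mod_closed(2)[OF mL'] by blast
  qed (use submodule_zero[OF mL'] lin_ident[OF mL'] bad in simp_all)
  moreover have "submodule K R L'" if "K \<in> C" for K using that unfolding C_def by simp
  ultimately have "\<exists>X \<in> C. \<forall>K \<in> C. X \<subseteq> K \<longrightarrow> K = X" using maximal_submodule[of L' C] L' by blast
  then obtain X where X: "X \<in> C" "\<And>K. K \<in> C \<Longrightarrow> X \<subseteq> K \<Longrightarrow> K = X" by blast
  from X(1)[unfolded C_def] obtain A :: "('r, 'u) module" and v where v: "lin R L' A v" "v ` carrier L' = carrier A"
    "X = {a \<in> carrier L'. v a = \<zero>\<^bsub>A\<^esub>}" and badA: "\<not> in_S (H i A)" by auto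
  have A: "module R A" by (rule lin_module(2)[OF v(1)])
  have kA: "ann_kills R N A" by (rule ann_kills_image[OF _ v(1,2)]) (use L' in blast)
  \<comment> \<open>By maximality of \<open>X\<close>, all proper quotients of \<open>A\<close> are good.\<close>
  have quot: "in_S (H i B)" if w: "lin R A B w" "w ` carrier A = carrier B" and a: "a \<in> carrier A" "a \<noteq> \<zero>\<^bsub>A\<^esub>" "w a = \<zero>\<^bsub>B\<^esub>"
    for B :: "('r, 'u) module" and w a
  proof (rule ccontr)
    assume nb: "\<not> in_S (H i B)"
    let ?K = "{z \<in> carrier L'. w (v z) = \<zero>\<^bsub>B\<^esub>}"
    have l: "lin R L' B (\<lambda>z. w (v z))" by (rule lin_compose[OF v(1) w(1)])
    have "(\<lambda>z. w (v z)) ` carrier L' = carrier B" using v(2) w(2) by (metis image_image)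
    then have "?K \<in> C" unfolding C_def using submodule_ker[OF l] l nb by blast
    moreover have "X \<subseteq> ?K" using v(3) lin_zero[OF w(1)] by auto
    ultimately have "?K = X" by (rule X(2))
    obtain z where "z \<in> carrier L'" "a = v z" using a(1) v(2) by auto
    then have "z \<in> ?K" "z \<notin> X" using a v(3) by auto
    then show False using \<open>?K = X\<close> by blast
  qed
  have ext: "False" if "submodule K R A" "in_S (H i (sub A K))" and z: "z \<in> K" "z \<noteq> \<zero>\<^bsub>A\<^esub>" for K z
  proof -
    note q = quot_rep_lin[OF A that(1)] and qs = quot_rep_surj[OF A that(1)] and qz = quot_rep_zero[OF A that(1)]
    have zA: "z \<in> carrier A" using submodule_simps(2)[OF A that(1) z(1)] .
    have K: "K = {a \<in> carrier A. quot_rep A K a = \<zero>\<^bsub>quot_copy A K\<^esub>}" using qz submodule_simps(2)[OF A that(1)] by auto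
    have "in_S (H i (quot_copy A K))" by (rule quot[OF q qs zA z(2)]) (simp add: qz[OF zA] z(1))
    then have "in_S (H i A)" by (rule in_S_middle[OF q qs K that(2)])
    then show False using badA by blast
  qed
  \<comment> \<open>Hence the annihilator of \<open>A\<close> is a prime ideal over which \<open>A\<close> is torsion-free.\<close>
  have dom: "a = \<zero>\<^bsub>A\<^esub> \<or> (\<forall>b \<in> carrier A. r \<odot>\<^bsub>A\<^esub> b = \<zero>\<^bsub>A\<^esub>)" if r: "r \<in> carrier R" and a: "a \<in> carrier A" "r \<odot>\<^bsub>A\<^esub> a = \<zero>\<^bsub>A\<^esub>" for r a
  proof (rule ccontr)
    assume n: "\<not> (a = \<zero>\<^bsub>A\<^esub> \<or> (\<forall>b \<in> carrier A. r \<odot>\<^bsub>A\<^esub> b = \<zero>\<^bsub>A\<^esub>))"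
    then obtain b where b: "b \<in> carrier A" "r \<odot>\<^bsub>A\<^esub> b \<noteq> \<zero>\<^bsub>A\<^esub>" by blast
    let ?K = "(\<lambda>x. r \<odot>\<^bsub>A\<^esub> x) ` carrier A"
    have K: "submodule ?K R A" by (rule submodule_scaled[OF A r])
    have l: "lin R A (sub A ?K) (\<lambda>x. r \<odot>\<^bsub>A\<^esub> x)" by (rule lin_into_sub[OF lin_act[OF A r] K]) auto
    have "in_S (H i (sub A ?K))" by (rule quot[OF l _ a(1)]) (use n a in auto)
    then show False using ext[OF K _ _ b(2)] b(1) by blast
  qed
  have "carrier A \<noteq> {\<zero>\<^bsub>A\<^esub>}"
  proof
    assume 0: "carrier A = {\<zero>\<^bsub>A\<^esub>}"
    have "lin R N A (\<lambda>x. \<zero>\<^bsub>A\<^esub>)" by (rule lin_const_zero[OF mN A])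
    moreover have "(\<lambda>x. \<zero>\<^bsub>A\<^esub>) ` carrier N = carrier A" unfolding 0 using mod_closed(2)[OF mN] by auto
    ultimately have "in_S (H i A)" by (rule image_good[OF N up])
    then show False using badA by blast
  qed
  then obtain g where g: "g \<in> carrier A" "g \<noteq> \<zero>\<^bsub>A\<^esub>" using mod_closed(2)[OF A] by blast
  obtain xs where xs: "set xs \<subseteq> carrier N" "carrier N = lspan R N xs" using N(1) by (auto simp: fin_gen_def)
  have "\<exists>f. lin R (sub N (lspan R N xs)) A f \<and> (\<exists>z \<in> lspan R N xs. f z \<noteq> \<zero>\<^bsub>A\<^esub>)"
    by (rule nonzero_map_exists[OF mN A dom g xs(1)]) (use kA g(1) in \<open>auto simp: ann_kills_def xs(2)[symmetric]\<close>)
  moreover have "sub N (lspan R N xs) = N" using xs(2) by simp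
  ultimately obtain f z where f: "lin R N A f" "z \<in> carrier N" "f z \<noteq> \<zero>\<^bsub>A\<^esub>" using xs(2) by auto
  have I: "submodule (f ` carrier N) R A" by (rule submodule_image[OF f(1) submodule_carrier[OF mN]])
  have "in_S (H i (sub A (f ` carrier N)))"
    by (rule image_good[OF N up lin_into_sub[OF f(1) I]]) auto
  then show False using ext[OF I _ _ f(3)] f(2) by blast
qed

section \<open>The quotient of the cohomology by an ideal\<close>

lemma ann_kills_dsum:
  assumes "module R A" "module R B" "ann_kills R N A" "ann_kills R N B" shows "ann_kills R N (dsum A B)"
  unfolding ann_kills_def
proof (intro ballI impI)
  fix r z assume r: "r \<in> carrier R" "\<forall>z \<in> carrier N. r \<odot>\<^bsub>N\<^esub> z = \<zero>\<^bsub>N\<^esub>" and z: "z \<in> carrier (dsum A B)"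
  note m = dsum_module[OF assms(1,2)] and p = dfst_lin[OF assms(1,2)] and q = dsnd_lin[OF assms(1,2)]
  have "dfst (r \<odot>\<^bsub>dsum A B\<^esub> z) = \<zero>\<^bsub>A\<^esub>" "dsnd (r \<odot>\<^bsub>dsum A B\<^esub> z) = \<zero>\<^bsub>B\<^esub>"
    using r z assms(3,4) lin_closed[OF p z] lin_closed[OF q z] by (simp_all add: lin_smult[OF p] lin_smult[OF q] ann_kills_def)
  then show "r \<odot>\<^bsub>dsum A B\<^esub> z = \<zero>\<^bsub>dsum A B\<^esub>" using dsum_eq[OF mod_closed(4)[OF m r(1) z]] by (simp add: dsum_zero)
qed

text \<open>The module \<open>Q\<close> is \<open>N\<close> plus one more copy of \<open>N\<close> for each \<open>b\<close> in the list, and \<open>g\<close> multiplies the copy by \<open>b\<close>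
  (and the initial one by \<open>0\<close>). On classes, \<open>g\<close> is then a combination of multiplications by elements of
  \<open>\<bb>\<close>.\<close>

lemma ideal_cover:
  fixes N :: "('r, 'u) module"
  assumes N: "fin_gen R N" and \<bb>: "ideal \<bb> R" and bs: "set bs \<subseteq> \<bb>"
  shows "\<exists>(Q :: ('r, 'u) module) g. fin_gen R Q \<and> ann_kills R N Q \<and> lin R Q N g \<and>
     (\<forall>b \<in> set bs. \<forall>z \<in> carrier N. b \<odot>\<^bsub>N\<^esub> z \<in> g ` carrier Q) \<and> g ` carrier Q \<subseteq> ideal_smult R \<bb> N \<and>
     (\<forall>k \<theta>. cocycle R (PL k) (dL k) Q n \<theta> \<longrightarrow> coh_class n N k (\<lambda>x. g (\<theta> x)) \<in> ideal_smult R \<bb> (H n N))"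
  using bs
proof (induction bs)
  case Nil
  have m: "module R N" by (rule fin_gen_module[OF N])
  have bR: "\<bb> \<subseteq> carrier R" using ideal.Icarr[OF \<bb>] by blast
  have z: "\<zero>\<^bsub>N\<^esub> \<in> ideal_smult R \<bb> N" "\<zero>\<^bsub>H n N\<^esub> \<in> ideal_smult R \<bb> (H n N)"
    using submodule_simps(3)[OF m ideal_smult_submodule[OF m bR]] submodule_simps(3)[OF H_module[OF m] ideal_smult_submodule[OF H_module[OF m] bR]] by auto
  show ?case
    by (rule exI[of _ N], rule exI[of _ "\<lambda>x. \<zero>\<^bsub>N\<^esub>"])
      (use N z lin_const_zero[OF m m] coh_class_const_zero[OF m] in \<open>auto simp: ann_kills_def\<close>)
next
  case (Cons b bs)
  have m: "module R N" by (rule fin_gen_module[OF N])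
  have bR: "\<bb> \<subseteq> carrier R" using ideal.Icarr[OF \<bb>] by blast
  have b: "b \<in> \<bb>" "b \<in> carrier R" using Cons.prems bR by auto
  have sN: "submodule (ideal_smult R \<bb> N) R N" by (rule ideal_smult_submodule[OF m bR])
  have sH: "submodule (ideal_smult R \<bb> (H n N)) R (H n N)" by (rule ideal_smult_submodule[OF H_module[OF m] bR])
  obtain Q :: "('r, 'u) module" and g where Q: "fin_gen R Q" "ann_kills R N Q" "lin R Q N g"
     "\<And>b z. b \<in> set bs \<Longrightarrow> z \<in> carrier N \<Longrightarrow> b \<odot>\<^bsub>N\<^esub> z \<in> g ` carrier Q" "g ` carrier Q \<subseteq> ideal_smult R \<bb> N"
     "\<And>k \<theta>. cocycle R (PL k) (dL k) Q n \<theta> \<Longrightarrow> coh_class n N k (\<lambda>x. g (\<theta> x)) \<in> ideal_smult R \<bb> (H n N)"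
    using Cons.IH Cons.prems by auto
  have mQ: "module R Q" by (rule fin_gen_module[OF Q(1)])
  note p = dfst_lin[OF m mQ] and q = dsnd_lin[OF m mQ]
  let ?g = "\<lambda>z. b \<odot>\<^bsub>N\<^esub> dfst z \<oplus>\<^bsub>N\<^esub> g (dsnd z)"
  have gl: "lin R (dsum N Q) N ?g" by (rule lin_sum[OF lin_scale[OF p b(2)] lin_compose[OF q Q(3)]])
  have 1: "c \<odot>\<^bsub>N\<^esub> z \<in> ?g ` carrier (dsum N Q)" if c: "c \<in> set (b # bs)" "z \<in> carrier N" for c z
  proof (cases "c = b")
    case True
    have "c \<odot>\<^bsub>N\<^esub> z = ?g (dpair (z, \<zero>\<^bsub>Q\<^esub>))" using True b c lin_zero[OF Q(3)] by (simp add: mod_simps[OF m] mod_closed[OF m])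
    then show ?thesis by (rule image_eqI) (use c mod_closed(2)[OF mQ] in simp)
  next
    case False
    then obtain u where u: "u \<in> carrier Q" "c \<odot>\<^bsub>N\<^esub> z = g u" using Q(4)[OF _ c(2)] c(1) by auto
    have "c \<odot>\<^bsub>N\<^esub> z = ?g (dpair (\<zero>\<^bsub>N\<^esub>, u))" using u b lin_closed[OF Q(3)] by (simp add: mod_simps[OF m])
    then show ?thesis by (rule image_eqI) (use u mod_closed(2)[OF m] in simp)
  qed
  have 2: "?g ` carrier (dsum N Q) \<subseteq> ideal_smult R \<bb> N"
  proof (rule image_subsetI)
    fix z assume z: "z \<in> carrier (dsum N Q)"
    have "g (dsnd z) \<in> ideal_smult R \<bb> N" using Q(5) lin_closed[OF q z] by blast
    then show "?g z \<in> ideal_smult R \<bb> N" by (rule submodule_simps(4)[OF m sN ideal_smult_mem[OF b(1) lin_closed[OF p z]]])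
  qed
  have 3: "coh_class n N k (\<lambda>x. ?g (\<theta> x)) \<in> ideal_smult R \<bb> (H n N)" if \<theta>: "cocycle R (PL k) (dL k) (dsum N Q) n \<theta>" for k \<theta>
  proof -
    have c1: "cocycle R (PL k) (dL k) N n (\<lambda>x. dfst (\<theta> x))" and c2: "cocycle R (PL k) (dL k) Q n (\<lambda>x. dsnd (\<theta> x))"
      by (rule cocycle_post[OF \<theta> p], rule cocycle_post[OF \<theta> q])
    have "coh_class n N k (\<lambda>x. ?g (\<theta> x)) = b \<odot>\<^bsub>H n N\<^esub> coh_class n N k (\<lambda>x. dfst (\<theta> x)) \<oplus>\<^bsub>H n N\<^esub> coh_class n N k (\<lambda>x. g (dsnd (\<theta> x)))"
      unfolding coh_class_smult[OF m c1 b(2)] using coh_class_add[OF m cocycle_post[OF c1 lin_act[OF m b(2)]] cocycle_post[OF c2 Q(3)]] by simp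
    then show ?thesis using submodule_simps(4)[OF H_module[OF m] sH ideal_smult_mem[OF b(1) coh_class_mem[OF m c1]] Q(6)[OF c2]] by simp
  qed
  have 0: "fin_gen R (dsum N Q)" "ann_kills R N (dsum N Q)"
    using fin_gen_dsum[OF N Q(1)] ann_kills_dsum[OF m mQ _ Q(2)] by (auto simp: ann_kills_def)
  show ?case by (rule exI[of _ "dsum N Q"], rule exI[of _ ?g]) (use 0 gl 1 2 3 in blast)
qed

text \<open>The quotient \<open>Y = H\<^sup>n(N) / \<bb> H\<^sup>n(N)\<close> is placed between \<open>W = H\<^sup>n\<^sup>+\<^sup>1(K)\<close> and \<open>X = H\<^sup>n(N / \<bb>N)\<close>, where \<open>K\<close> is the kernel of
  \<open>g : Q \<rightarrow> N\<close>. The relation from \<open>W\<close> to \<open>Y\<close> is the inverse of the connecting relation of \<open>g\<close>: it relates zero to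
  zero only, since a class with vanishing obstruction lifts to \<open>H\<^sup>n(Q)\<close> and therefore lies in \<open>\<bb> H\<^sup>n(N)\<close>.\<close>

lemma in_S_quotient:
  fixes N :: "('r, 'u) module"
  assumes N: "fin_gen R N" and up: "all_good N (Suc n)" and \<bb>: "ideal \<bb> R"
    and b: "in_S (H n (quot_by_ideal R N \<bb>))"
  shows "in_S (quot_by_ideal R (H n N) \<bb>)"
proof -
  have m: "module R N" by (rule fin_gen_module[OF N])
  have bR: "\<bb> \<subseteq> carrier R" using ideal.Icarr[OF \<bb>] by blast
  let ?B = "ideal_smult R \<bb> N" and ?bH = "ideal_smult R \<bb> (H n N)"
  have sB: "submodule ?B R N" by (rule ideal_smult_submodule[OF m bR])
  note mH = H_module[OF m, of n]
  have sH: "submodule ?bH R (H n N)" by (rule ideal_smult_submodule[OF mH bR])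
  obtain Bs where Bs: "Bs \<subseteq> carrier R" "finite Bs" "\<bb> = Idl Bs" using noetherian_ring.finetely_gen[OF noetherian \<bb>] by auto
  obtain bs where bs: "set bs = Bs" using finite_list[OF Bs(2)] by blast
  have bsb: "set bs \<subseteq> \<bb>" using genideal_self[OF Bs(1)] Bs(3) bs by simp
  obtain Q :: "('r, 'u) module" and g where Q: "fin_gen R Q" "ann_kills R N Q" "lin R Q N g"
     "\<And>b z. b \<in> set bs \<Longrightarrow> z \<in> carrier N \<Longrightarrow> b \<odot>\<^bsub>N\<^esub> z \<in> g ` carrier Q" "g ` carrier Q \<subseteq> ?B"
     "\<And>k \<theta>. cocycle R (PL k) (dL k) Q n \<theta> \<Longrightarrow> coh_class n N k (\<lambda>x. g (\<theta> x)) \<in> ?bH"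
    using ideal_cover[OF N \<bb> bsb, of n] by metis
  have mQ: "module R Q" by (rule fin_gen_module[OF Q(1)])
  have sg: "submodule (g ` carrier Q) R N" by (rule submodule_image[OF Q(3) submodule_carrier[OF mQ]])
  have "a \<odot>\<^bsub>N\<^esub> z \<in> g ` carrier Q" if az: "a \<in> \<bb>" "z \<in> carrier N" for a z
  proof -
    have "Idl Bs \<subseteq> {r \<in> carrier R. r \<odot>\<^bsub>N\<^esub> z \<in> g ` carrier Q}"
      by (rule genideal_minimal[OF conductor_ideal[OF m sg az(2)]]) (use Q(4) az(2) bs Bs(1) in auto)
    then show ?thesis using az(1) Bs(3) by blast
  qed
  then have Bg: "?B \<subseteq> g ` carrier Q" by (intro ideal_smult_least[OF sg])
  let ?K = "{a \<in> carrier Q. g a = \<zero>\<^bsub>N\<^esub>}"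
  have sK: "submodule ?K R Q" by (rule submodule_ker[OF Q(3)])
  have mK: "module R (sub Q ?K)" by (rule sub_module[OF mQ sK])
  have bK: "in_S (H (Suc n) (sub Q ?K))"
    using up fin_gen_submodule(2)[OF Q(1) sK] ann_kills_sub[OF Q(2), of ?K] unfolding all_good_def by blast
  let ?N' = "quot_by_ideal R N \<bb>" and ?v = "\<lambda>x. ?B +>\<^bsub>N\<^esub> x"
  note v = quot_lin[OF m sB] and vz = quot_zero[OF m sB]
  have vs: "?v ` carrier N = carrier ?N'" using quot_carrier[OF m sB] by simp
  have mN': "module R ?N'" by (rule lin_module(2)[OF v])
  let ?Y = "quot_by_ideal R (H n N) \<bb>" and ?q = "\<lambda>h. ?bH +>\<^bsub>H n N\<^esub> h"
  note q = quot_lin[OF mH sH] and qz = quot_zero[OF mH sH] and qc = quot_carrier[OF mH sH]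
  have mY: "module R ?Y" by (rule lin_module(2)[OF q])
  have 1: "lin R (prod_module (H n N) (H n ?N')) (prod_module ?Y (H n ?N')) (\<lambda>z. (?q (fst z), snd z))"
    by (rule linI) (auto simp: prod_module_module mH mY H_module[OF mN'] lin_simps[OF q])
  have 2: "lin R (prod_module (H n N) (H (Suc n) (sub Q ?K))) (prod_module (H (Suc n) (sub Q ?K)) ?Y) (\<lambda>z. (snd z, ?q (fst z)))"
    by (rule linI) (auto simp: prod_module_module mH mY H_module[OF mK] lin_simps[OF q])
  let ?\<rho> = "(\<lambda>z. (?q (fst z), snd z)) ` post_rel n N ?N' ?v"
  let ?\<sigma> = "(\<lambda>z. (snd z, ?q (fst z))) ` delta_rel n Q ?K N g"
  show ?thesis
  proof (rule in_S_rel[OF bK H_module[OF mK] b H_module[OF mN'] mY])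
    show "submodule ?\<rho> R (prod_module ?Y (H n ?N'))" by (rule submodule_image[OF 1 post_rel_submodule[OF v]])
    show "submodule ?\<sigma> R (prod_module (H (Suc n) (sub Q ?K)) ?Y)" by (rule submodule_image[OF 2 delta_rel_submodule[OF Q(3) sK]])
    fix y
    {
      assume "(\<zero>\<^bsub>H (Suc n) (sub Q ?K)\<^esub>, y) \<in> ?\<sigma>"
      then obtain h where h: "(h, \<zero>\<^bsub>H (Suc n) (sub Q ?K)\<^esub>) \<in> delta_rel n Q ?K N g" "y = ?q h" by force
      obtain k \<theta> where \<theta>: "cocycle R (PL k) (dL k) Q n \<theta>" "h = coh_class n N k (\<lambda>x. g (\<theta> x))"
        using delta_rel_zero[OF Q(3) refl h(1)] by metis
      then have "h \<in> ?bH" using Q(6) by simp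
      then show "y = \<zero>\<^bsub>?Y\<^esub>" using qz h(2) submodule_simps(2)[OF mH sH] by simp
    next
      assume "y \<in> carrier ?Y"
      then obtain h where h: "h \<in> carrier (H n N)" "y = ?q h" unfolding qc by blast
      obtain k \<phi> where \<phi>: "cocycle R (PL k) (dL k) N n \<phi>" "h = coh_class n N k \<phi>" using h(1) by (rule H_cases[OF m])
      then show "\<exists>x. (y, x) \<in> ?\<rho>" using post_relI[OF \<phi>(1) v] h(2) by force
    next
      assume "(y, \<zero>\<^bsub>H n ?N'\<^esub>) \<in> ?\<rho>"
      then obtain h where h: "(h, \<zero>\<^bsub>H n ?N'\<^esub>) \<in> post_rel n N ?N' ?v" "y = ?q h" by force
      obtain k \<theta> where \<theta>: "cocycle R (PL k) (dL k) N n \<theta>" "\<And>x. x \<in> carrier (PL k n) \<Longrightarrow> ?v (\<theta> x) = \<zero>\<^bsub>?N'\<^esub>" "h = coh_class n N k \<theta>"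
        using post_rel_kernel[OF v vs h(1)] by metis
      have "\<theta> x \<in> g ` carrier Q" if "x \<in> carrier (PL k n)" for x
        using \<theta>(2)[OF that] vz[OF lin_closed[OF cocycle_lin[OF \<theta>(1)] that]] Bg by blast
      then obtain \<alpha> where \<alpha>: "lin R (PL k n) Q \<alpha>" "\<And>x. x \<in> carrier (PL k n) \<Longrightarrow> g (\<alpha> x) = \<theta> x"
        using projective_lift[OF proj_complex_simps(1)[OF PLc] Q(3) cocycle_lin[OF \<theta>(1)]] by metis
      then obtain z where "(coh_class n N k \<theta>, z) \<in> delta_rel n Q ?K N g" using delta_relI[OF Q(3) refl \<theta>(1) \<alpha>(1) \<alpha>(2)[symmetric]] by blast
      then show "\<exists>w. (w, y) \<in> ?\<sigma>" unfolding h(2) \<theta>(3) by force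
    }
  qed
qed

lemma vanishing:
  assumes pd: "projective_dimension TYPE('u) R M < \<infinity>"
  shows "\<exists>q. \<forall>i > q. \<forall>N :: ('r, 'u) module. module R N \<longrightarrow> carrier (H i N) = {\<zero>\<^bsub>H i N\<^esub>}"
proof -
  obtain p and P :: "nat \<Rightarrow> ('r, 'u) module" and d e where
    P: "resolves R M {\<zero>\<^bsub>M\<^esub>} P d e" "\<And>i. i > p \<Longrightarrow> carrier (P i) = {\<zero>\<^bsub>P i\<^esub>}" using finite_resolution[OF M_module pd] by metis
  obtain As where As: "As \<subseteq> carrier R" "finite As" "\<aa> = Idl As" using noetherian_ring.finetely_gen[OF noetherian ideal_a] by auto
  obtain xs where xs: "set xs = As" using finite_list[OF As(2)] by blast
  have "carrier (H i N) = {\<zero>\<^bsub>H i N\<^esub>}" if i: "p + length xs < i" and N: "module R N" for i and N :: "('r, 'u) module"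
  proof -
    have pn: "eventually_null N (p + length xs) M W"
      using eventually_null_ideal_powers[where xs = xs, OF M_fg eventually_null_zero[OF P N]] As xs unfolding W_def[abs_def] by simp
    have "h = \<zero>\<^bsub>H i N\<^esub>" if h: "h \<in> carrier (H i N)" for h
    proof -
      obtain k \<phi> where \<phi>: "cocycle R (PL k) (dL k) N i \<phi>" "h = coh_class i N k \<phi>" using h by (rule H_cases[OF N])
      obtain l where l: "l \<ge> k" "null_transition N i M (W l) (W k)" using pn i unfolding eventually_null_def by blast
      have "null_at R N i (PL l) (dL l) (PL k) (dL k) (F l k)"
        by (rule null_transition_transfer[OF l(2) aug(1) aug(1) order_refl order_refl W_antimono[OF l(1)] F_props[OF l(1)]])
      then show ?thesis unfolding \<phi>(2) coh_class_zero[OF N \<phi>(1)] null_at_def using \<phi>(1) l(1) by blast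
    qed
    then show ?thesis using mod_closed(2)[OF H_module[OF N]] by blast
  qed
  then show ?thesis by blast
qed

lemma all_good_above:
  fixes N :: "('r, 'u) module"
  assumes pd: "projective_dimension TYPE('u) R M < \<infinity>" and N: "fin_gen R N" and above: "\<And>i. i > n \<Longrightarrow> in_S (H i N)"
    and i: "i > n"
  shows "all_good N i"
proof -
  obtain q where q: "\<forall>i > q. \<forall>N :: ('r, 'u) module. module R N \<longrightarrow> carrier (H i N) = {\<zero>\<^bsub>H i N\<^esub>}"
    by (rule exE[OF vanishing[OF pd]])
  have "\<forall>i > n. i + m > q \<longrightarrow> all_good N i" for m
  proof (induction m)
    case 0
    show ?case
    proof (intro allI impI)
      fix i assume "n < i" "i + 0 > q"
      then show "all_good N i" unfolding all_good_def
      proof (intro allI impI, elim conjE)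
        fix L' :: "('r, 'u) module" assume "fin_gen R L'"
        then have m: "module R L'" by (rule fin_gen_module)
        have "carrier (H i L') = {\<zero>\<^bsub>H i L'\<^esub>}" using q m \<open>i + 0 > q\<close> by simp
        then show "in_S (H i L')" by (rule in_S_zero[OF H_module[OF m]])
      qed
    qed
  next
    case (Suc m)
    show ?case
    proof (intro allI impI)
      fix i assume i: "n < i" "i + Suc m > q"
      then have "all_good N (Suc i)" using Suc by simp
      then show "all_good N i" by (rule all_good_step[OF N above[OF i(1)]])
    qed
  qed
  from this[of "Suc q"] show ?thesis using i by simp
qed

end

theorem theorem2p6:
  fixes R :: "('r, 's) ring_scheme"
    and S :: "('r, 'u) module set"
    and M N :: "('r, 'u) module"
    and \<aa> \<bb> :: "'r set"
    and n :: nat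
  assumes universe: "infinite (UNIV :: 'u set)" "carrier R \<lesssim> (UNIV :: 'u set)"
    and ring: "cring R" "noetherian_ring R" "\<one>\<^bsub>R\<^esub> \<noteq> \<zero>\<^bsub>R\<^esub>"
    and serre: "serre_subcategory R S"
    and M: "finite_module R M" "projective_dimension TYPE('u) R M < \<infinity>"
    and N: "finite_module R N"
    and ideal_a: "ideal \<aa> R"
    and n: "projective_dimension TYPE('u) R M \<le> enat n"
    and above: "\<And>i. i > n \<Longrightarrow> belongs_to R (gen_local_cohomology TYPE('u) R \<aa> i M N) S"
    and ideal_b: "ideal \<bb> R"
    and at_n: "belongs_to R (gen_local_cohomology TYPE('u) R \<aa> n M (quot_by_ideal R N \<bb>)) S"
  shows "belongs_to R (quot_by_ideal R (gen_local_cohomology TYPE('u) R \<aa> n M N) \<bb>) S"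
proof -
  have nu: "noeth_universe TYPE('u) R"
    by (intro noeth_universe.intro noeth_universe_axioms.intro ring(1,2) universe)
  interpret serre_cohomology R "TYPE('u)" M \<aa> S
    by (intro serre_cohomology.intro cohomology.intro serre_universe.intro nu
      cohomology_axioms.intro serre_universe_axioms.intro finite_module_fin_gen[OF M(1)] ideal_a serre)
  have N': "fin_gen R N" by (rule finite_module_fin_gen[OF N])
  show ?thesis
    by (rule in_S_quotient[OF N' all_good_above[OF M(2) N' above] ideal_b at_n]) auto
qed

end
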